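(* Assume that $a_0,a_1$ are bounded on $V\times V$, that $a_0(v,v)\ge 0$ for all $v\in V$ (no positive lower bound is assumed), that $a_1(v,v)\ge\beta|v|_V^2$ for all $v\in V$ with some $\beta>0$, and that $0<M_0=\nu([0,\infty))<\infty$. Then the operator $\mathcal A$ with domain $D(\mathcal A)$ is densely defined and $m$-dissipative on $\mathcal W$. More precisely, for every $(u,\zeta)\in D(\mathcal A)$, $$\langle \mathcal A(u,\zeta),(u,\zeta)\rangle_{\mathcal W}=-a_0(u,u)-\int_{[0,\infty)}\lambda\,a_1(\zeta(\lambda),\zeta(\lambda))\,d\nu(\lambda)\le 0,$$ and $\operatorname{Ran}(I-\mathcal A)=\mathcal W$. Consequently, $\mathcal A$ generates a $C_0$-semigroup of contractions $(S(t))_{t\ge0}$ on $\mathcal W$. For any $u_0\in H$ and $f\in L^1(0,T;H)$, the abstract Cauchy problem $$X'(t)=\mathcal A X(t)+(f(t),0),\qquad X(0)=(u_0,0),$$ has a unique mild solution $X=(u,\zeta)\in C([0,T];\mathcal W)$, given by $$X(t)=S(t)(u_0,0)+\int_0^t S(t-s)(f(s),0)\,ds,$$ and it satisfies, for all $t\in[0,T]$, $$\|X(t)\|_{\mathcal W}\le\|u_0\|_H+\int_0^t\|f(s)\|_H\,ds .$$ In particular, the solution depends Lipschitz-continuously on the data: the map $(u_0,f)\mapsto X$ from $H\times L^1(0,T;H)$ to $C([0,T];\mathcal W)$ is Lipschitz continuous.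
   Context: Setting. $\Omega\subset\mathbb R^d$, $d\in\{1,2,3\}$, is a bounded Lipschitz domain; $H=L^2(\Omega)$, $V=H^1_0(\Omega)$ (real spaces), $|v|_V=\|\nabla v\|_{L^2(\Omega)}$, $\|v\|_V^2=\|v\|_H^2+|v|_V^2$; $H$ is identified with a subspace of $V'$; $T>0$ is fixed. $A_0,A_1\in L^\infty(\Omega)^{d\times d}$ are symmetric matrix fields, $A_1$ pointwise positive semidefinite a.e., $a_i(w,v)=\int_\Omega A_i\nabla w\cdot\nabla v\,dx$, and $\mathsf A_i:V\to V'$ is given by $\langle\mathsf A_iw,v\rangle=a_i(w,v)$, $i=0,1$. $\nu$ is a non-zero non-negative Borel measure on $[0,\infty)$, the Bernstein representing measure of the completely monotone kernel $k(t)=\int_{[0,\infty)}e^{-\lambda t}\,d\nu(\lambda)$. Spaces. $\mathcal K$ is the Hilbert space of (classes of) strongly $\nu$-measurable $\zeta:[0,\infty)\to V$ with $\|\zeta\|_{\mathcal K}^2=\int_{[0,\infty)}a_1(\zeta(\lambda),\zeta(\lambda))\,d\nu(\lambda)<\infty$. The extended memory state space is $\mathcal W=H\times\mathcal K$ with inner product $\langle(u,\zeta),(v,\chi)\rangle_{\mathcal W}=(u,v)_H+\int_{[0,\infty)}a_1(\zeta(\lambda),\chi(\lambda))\,d\nu(\lambda)$. Operators. $J:\mathcal K\to V$, $J\zeta=\int_{[0,\infty)}\zeta(\lambda)\,d\nu(\lambda)$; $E:V\to\mathcal K$, $(Eu)(\lambda)=u$; $(\Lambda\zeta)(\lambda)=\lambda\zeta(\lambda)$.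 The augmented operator is $\mathcal A(u,\zeta)=(-\mathsf A_0u-\mathsf A_1J\zeta,\;Eu-\Lambda\zeta)$ with domain $D(\mathcal A)=\{(u,\zeta)\in V\times\mathcal K:\ \mathsf A_0u+\mathsf A_1J\zeta\in H,\ Eu-\Lambda\zeta\in\mathcal K\}$. "$m$-dissipative" means: $\langle\mathcal AX,X\rangle_{\mathcal W}\le0$ for all $X\in D(\mathcal A)$ and $\operatorname{Ran}(I-\mathcal A)=\mathcal W$. The mild solution of the Cauchy problem is the function given by the variation-of-constants formula. *)

theory Defs
  imports "HOL-Analysis.Analysis" "HOL-Library.Function_Algebras"
begin

text \<open>
  The spaces below depend on the data (domain, matrix field, measure), so they cannot be types.
  A (semi-)normed space is given by a carrier \<open>C\<close> in a real vector space and a function \<open>N\<close> on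
  it; elements of spaces of classes are represented by functions, and two representatives
  \<open>x\<close>, \<open>y\<close> denote the same class iff \<open>N (x - y) = 0\<close>.
\<close>

instantiation "fun" :: (type, real_vector) real_vector
begin

definition scaleR_fun :: "real \<Rightarrow> ('a \<Rightarrow> 'b) \<Rightarrow> 'a \<Rightarrow> 'b"
  where "scaleR_fun c f = (\<lambda>x. c *\<^sub>R f x)"

instance
  by standard
    (auto simp: scaleR_fun_def fun_eq_iff scaleR_add_right scaleR_add_left)

end

text \<open>Convergence is required at every point: every class of a.e. limits of simple functions has
  such a representative, and real integrands built from \<open>f\<close> are then measurable with respect to
  \<open>M\<close> itself and not merely to its completion.\<close>

definition strongly_measurable_in ::
  "'e set \<Rightarrow> ('e \<Rightarrow> real) \<Rightarrow> 'a measure \<Rightarrow> ('a \<Rightarrow> 'e::real_vector) \<Rightarrow> bool"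
  where "strongly_measurable_in C N M f \<longleftrightarrow>
    (\<forall>x\<in>space M. f x \<in> C) \<and>
    (\<exists>s. (\<forall>i::nat. simple_function M (s i) \<and> s i ` space M \<subseteq> C) \<and>
         (\<forall>x\<in>space M. (\<lambda>i. N (f x - s i x)) \<longlonglongrightarrow> 0))"

definition bochner_integrable_in ::
  "'e set \<Rightarrow> ('e \<Rightarrow> real) \<Rightarrow> 'a measure \<Rightarrow> ('a \<Rightarrow> 'e::real_vector) \<Rightarrow> bool"
  where "bochner_integrable_in C N M f \<longleftrightarrow>
    strongly_measurable_in C N M f \<and> integrable M (\<lambda>x. N (f x))"

text \<open>The library's definition of \<^const>\<open>has_bochner_integral\<close>, with \<open>norm\<close> replaced by \<open>N\<close>;
  the value \<open>I\<close> is determined up to \<open>N\<close>-null elements.\<close>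

definition has_bochner_integral_in ::
  "'e set \<Rightarrow> ('e \<Rightarrow> real) \<Rightarrow> 'a measure \<Rightarrow> ('a \<Rightarrow> 'e::real_vector) \<Rightarrow> 'e \<Rightarrow> bool"
  where "has_bochner_integral_in C N M f I \<longleftrightarrow>
    strongly_measurable_in C N M f \<and> I \<in> C \<and>
    (\<exists>s. (\<forall>i::nat. Bochner_Integration.simple_bochner_integrable M (s i) \<and> s i ` space M \<subseteq> C) \<and>
         (\<lambda>i. \<integral>\<^sup>+x. ennreal (N (f x - s i x)) \<partial>M) \<longlonglongrightarrow> 0 \<and>
         (\<lambda>i. N (Bochner_Integration.simple_bochner_integral M (s i) - I)) \<longlonglongrightarrow> 0)"

definition bochner_integral_in ::
  "'e set \<Rightarrow> ('e \<Rightarrow> real) \<Rightarrow> 'a measure \<Rightarrow> ('a \<Rightarrow> 'e::real_vector) \<Rightarrow> 'e"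
  where "bochner_integral_in C N M f = (SOME I. has_bochner_integral_in C N M f I)"

definition dense_subset_in :: "'e set \<Rightarrow> ('e \<Rightarrow> real) \<Rightarrow> 'e::real_vector set \<Rightarrow> bool"
  where "dense_subset_in C N D \<longleftrightarrow> D \<subseteq> C \<and> (\<forall>x\<in>C. \<forall>e>0. \<exists>y\<in>D. N (x - y) < e)"

text \<open>The set of representatives of the classes in \<open>Ran (I - A)\<close>.\<close>

definition range_I_minus ::
  "'e set \<Rightarrow> ('e \<Rightarrow> real) \<Rightarrow> 'e set \<Rightarrow> ('e \<Rightarrow> 'e) \<Rightarrow> 'e::real_vector set"
  where "range_I_minus C N D A = {y \<in> C. \<exists>x\<in>D. N ((x - A x) - y) = 0}"

definition m_dissipative_in ::
  "'e set \<Rightarrow> ('e \<Rightarrow> 'e \<Rightarrow> real) \<Rightarrow> 'e set \<Rightarrow> ('e \<Rightarrow> 'e::real_vector) \<Rightarrow> bool"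
  where "m_dissipative_in C ip D A \<longleftrightarrow>
    D \<subseteq> C \<and> A ` D \<subseteq> C \<and>
    (\<forall>x\<in>D. ip (A x) x \<le> 0) \<and>
    range_I_minus C (\<lambda>x. sqrt (ip x x)) D A = C"

definition contraction_semigroup_in ::
  "'e set \<Rightarrow> ('e \<Rightarrow> real) \<Rightarrow> (real \<Rightarrow> 'e \<Rightarrow> 'e::real_vector) \<Rightarrow> bool"
  where "contraction_semigroup_in C N S \<longleftrightarrow>
    (\<forall>t\<ge>0. \<forall>x\<in>C. S t x \<in> C) \<and>
    (\<forall>t\<ge>0. \<forall>x\<in>C. \<forall>y\<in>C. \<forall>a b.
        N (S t (a *\<^sub>R x + b *\<^sub>R y) - (a *\<^sub>R S t x + b *\<^sub>R S t y)) = 0) \<and>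
    (\<forall>t\<ge>0. \<forall>x\<in>C. N (S t x) \<le> N x) \<and>
    (\<forall>x\<in>C. N (S 0 x - x) = 0) \<and>
    (\<forall>s\<ge>0. \<forall>t\<ge>0. \<forall>x\<in>C. N (S (s + t) x - S s (S t x)) = 0) \<and>
    (\<forall>x\<in>C. ((\<lambda>t. N (S t x - x)) \<longlongrightarrow> 0) (at_right 0))"

definition generates_in ::
  "'e set \<Rightarrow> ('e \<Rightarrow> real) \<Rightarrow> 'e set \<Rightarrow> ('e \<Rightarrow> 'e) \<Rightarrow> (real \<Rightarrow> 'e \<Rightarrow> 'e::real_vector) \<Rightarrow> bool"
  where "generates_in C N D A S \<longleftrightarrow>
    D = {x \<in> C. \<exists>y\<in>C. ((\<lambda>h. N ((1 / h) *\<^sub>R (S h x - x) - y)) \<longlongrightarrow> 0) (at_right 0)} \<and>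
    (\<forall>x\<in>D. A x \<in> C \<and> ((\<lambda>h. N ((1 / h) *\<^sub>R (S h x - x) - A x)) \<longlongrightarrow> 0) (at_right 0))"

definition continuous_curve_in ::
  "'e set \<Rightarrow> ('e \<Rightarrow> real) \<Rightarrow> real \<Rightarrow> (real \<Rightarrow> 'e::real_vector) \<Rightarrow> bool"
  where "continuous_curve_in C N T X \<longleftrightarrow>
    (\<forall>t\<in>{0..T}. X t \<in> C \<and> ((\<lambda>s. N (X s - X t)) \<longlongrightarrow> 0) (at t within {0..T}))"

text \<open>Mild solution on \<open>[0,T]\<close> of \<open>X' = A X + F\<close>, \<open>X 0 = X0\<close>, where \<open>S\<close> is the semigroup
  generated by \<open>A\<close>; the integrand is required to be Bochner integrable.\<close>

definition mild_solution_in ::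
  "'e set \<Rightarrow> ('e \<Rightarrow> real) \<Rightarrow> (real \<Rightarrow> 'e \<Rightarrow> 'e) \<Rightarrow> real \<Rightarrow> 'e \<Rightarrow> (real \<Rightarrow> 'e) \<Rightarrow>
    (real \<Rightarrow> 'e::real_vector) \<Rightarrow> bool"
  where "mild_solution_in C N S T X0 F X \<longleftrightarrow>
    (\<forall>t\<in>{0..T}. X t \<in> C \<and>
      (\<exists>I. has_bochner_integral_in C N (lebesgue_on {0..t}) (\<lambda>s. S (t - s) (F s)) I \<and>
           N (X t - (S t X0 + I)) = 0))"

text \<open>Near each boundary point, \<open>\<Omega>\<close> is the part of a ball above the graph of a Lipschitz function
  over the hyperplane orthogonal to some unit vector \<open>e\<close>.\<close>

definition lipschitz_domain :: "'a::euclidean_space set \<Rightarrow> bool"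
  where "lipschitz_domain \<Omega> \<longleftrightarrow>
    open \<Omega> \<and> connected \<Omega> \<and> \<Omega> \<noteq> {} \<and>
    (\<forall>x\<in>frontier \<Omega>. \<exists>e r L \<gamma>. norm e = 1 \<and> r > 0 \<and>
       L-lipschitz_on {y. y \<bullet> e = 0} \<gamma> \<and>
       \<Omega> \<inter> ball x r = {y \<in> ball x r. \<gamma> (y - (y \<bullet> e) *\<^sub>R e) < y \<bullet> e})"

definition partial_deriv :: "'n \<Rightarrow> (real^'n \<Rightarrow> real) \<Rightarrow> real^'n \<Rightarrow> real"
  where "partial_deriv i \<phi> x = frechet_derivative \<phi> (at x) (axis i 1)"

primrec smooth_upto :: "nat \<Rightarrow> (real^'n \<Rightarrow> real) \<Rightarrow> bool"
  where
    "smooth_upto 0 \<phi> \<longleftrightarrow> continuous_on UNIV \<phi>"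
  | "smooth_upto (Suc k) \<phi> \<longleftrightarrow>
       (\<forall>x. \<phi> differentiable (at x)) \<and> (\<forall>i. smooth_upto k (partial_deriv i \<phi>))"

definition test_functions :: "(real^'n) set \<Rightarrow> (real^'n \<Rightarrow> real) set"
  where "test_functions \<Omega> =
    {\<phi>. (\<forall>k. smooth_upto k \<phi>) \<and> compact (closure {x. \<phi> x \<noteq> 0}) \<and> closure {x. \<phi> x \<noteq> 0} \<subseteq> \<Omega>}"

definition L2 :: "(real^'n) set \<Rightarrow> (real^'n \<Rightarrow> real) set"
  where "L2 \<Omega> = {u. u \<in> borel_measurable (lebesgue_on \<Omega>) \<and>
                    integrable (lebesgue_on \<Omega>) (\<lambda>x. (u x)\<^sup>2)}"

definition ip_L2 :: "(real^'n) set \<Rightarrow> (real^'n \<Rightarrow> real) \<Rightarrow> (real^'n \<Rightarrow> real) \<Rightarrow> real"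
  where "ip_L2 \<Omega> u v = (LINT x|lebesgue_on \<Omega>. u x * v x)"

definition norm_L2 :: "(real^'n) set \<Rightarrow> (real^'n \<Rightarrow> real) \<Rightarrow> real"
  where "norm_L2 \<Omega> u = sqrt (ip_L2 \<Omega> u u)"

definition weak_gradient :: "(real^'n) set \<Rightarrow> (real^'n \<Rightarrow> real) \<Rightarrow> (real^'n \<Rightarrow> real^'n) \<Rightarrow> bool"
  where "weak_gradient \<Omega> u g \<longleftrightarrow>
    g \<in> borel_measurable (lebesgue_on \<Omega>) \<and>
    integrable (lebesgue_on \<Omega>) (\<lambda>x. (norm (g x))\<^sup>2) \<and>
    (\<forall>\<phi>\<in>test_functions \<Omega>. \<forall>i.
       (LINT x|lebesgue_on \<Omega>. u x * partial_deriv i \<phi> x) = - (LINT x|lebesgue_on \<Omega>. g x $ i * \<phi> x))"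

definition H1 :: "(real^'n) set \<Rightarrow> (real^'n \<Rightarrow> real) set"
  where "H1 \<Omega> = {u \<in> L2 \<Omega>. \<exists>g. weak_gradient \<Omega> u g}"

text \<open>A representative; weak gradients are unique almost everywhere on \<open>\<Omega>\<close>.\<close>

definition grad :: "(real^'n) set \<Rightarrow> (real^'n \<Rightarrow> real) \<Rightarrow> real^'n \<Rightarrow> real^'n"
  where "grad \<Omega> u = (SOME g. weak_gradient \<Omega> u g)"

definition seminorm_H1 :: "(real^'n) set \<Rightarrow> (real^'n \<Rightarrow> real) \<Rightarrow> real"
  where "seminorm_H1 \<Omega> u = sqrt (LINT x|lebesgue_on \<Omega>. (norm (grad \<Omega> u x))\<^sup>2)"

definition norm_H1 :: "(real^'n) set \<Rightarrow> (real^'n \<Rightarrow> real) \<Rightarrow> real"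
  where "norm_H1 \<Omega> u = sqrt ((norm_L2 \<Omega> u)\<^sup>2 + (seminorm_H1 \<Omega> u)\<^sup>2)"

definition H10 :: "(real^'n) set \<Rightarrow> (real^'n \<Rightarrow> real) set"
  where "H10 \<Omega> = {u \<in> H1 \<Omega>. \<exists>\<phi>. (\<forall>k::nat. \<phi> k \<in> test_functions \<Omega>) \<and>
                                 (\<lambda>k. norm_H1 \<Omega> (u - \<phi> k)) \<longlonglongrightarrow> 0}"

definition Linfty_matrix :: "(real^'n) set \<Rightarrow> (real^'n \<Rightarrow> real^'n^'n) \<Rightarrow> bool"
  where "Linfty_matrix \<Omega> A \<longleftrightarrow>
    A \<in> borel_measurable (lebesgue_on \<Omega>) \<and>
    (\<exists>c. AE x in lebesgue_on \<Omega>. \<forall>i j. \<bar>A x $ i $ j\<bar> \<le> c)"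

definition aform ::
  "(real^'n) set \<Rightarrow> (real^'n \<Rightarrow> real^'n^'n) \<Rightarrow> (real^'n \<Rightarrow> real) \<Rightarrow> (real^'n \<Rightarrow> real) \<Rightarrow> real"
  where "aform \<Omega> A w v = (LINT x|lebesgue_on \<Omega>. (A x *v grad \<Omega> w x) \<bullet> grad \<Omega> v x)"

text \<open>Elements of the dual \<open>V'\<close> of \<open>V = H10 \<Omega>\<close> are functionals, of which only the values on \<open>V\<close>
  matter.  \<open>H = L2 \<Omega>\<close> is identified with a subspace of \<open>V'\<close> by \<open>h \<mapsto> (h, \<cdot>)\<^sub>H\<close>; \<open>H_rep\<close> inverts
  this identification.\<close>

definition dual_op ::
  "(real^'n) set \<Rightarrow> (real^'n \<Rightarrow> real^'n^'n) \<Rightarrow> (real^'n \<Rightarrow> real) \<Rightarrow> (real^'n \<Rightarrow> real) \<Rightarrow> real"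
  where "dual_op \<Omega> A w = (\<lambda>v. aform \<Omega> A w v)"

definition represents :: "(real^'n) set \<Rightarrow> (real^'n \<Rightarrow> real) \<Rightarrow> ((real^'n \<Rightarrow> real) \<Rightarrow> real) \<Rightarrow> bool"
  where "represents \<Omega> h l \<longleftrightarrow> h \<in> L2 \<Omega> \<and> (\<forall>v\<in>H10 \<Omega>. l v = ip_L2 \<Omega> h v)"

definition in_H :: "(real^'n) set \<Rightarrow> ((real^'n \<Rightarrow> real) \<Rightarrow> real) \<Rightarrow> bool"
  where "in_H \<Omega> l \<longleftrightarrow> (\<exists>h. represents \<Omega> h l)"

definition H_rep :: "(real^'n) set \<Rightarrow> ((real^'n \<Rightarrow> real) \<Rightarrow> real) \<Rightarrow> real^'n \<Rightarrow> real"
  where "H_rep \<Omega> l = (SOME h. represents \<Omega> h l)"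

text \<open>Elements of \<open>\<K>\<close> are functions on \<open>[0,\<infinity>)\<close>; since HOL functions are total they are
  represented with domain \<^typ>\<open>real\<close>, and \<open>\<nu>\<close> is a measure with space \<open>[0,\<infinity>)\<close>.\<close>

definition K_space ::
  "(real^'n) set \<Rightarrow> (real^'n \<Rightarrow> real^'n^'n) \<Rightarrow> real measure \<Rightarrow> (real \<Rightarrow> real^'n \<Rightarrow> real) set"
  where "K_space \<Omega> A1 \<nu> =
    {\<zeta>. strongly_measurable_in (H10 \<Omega>) (norm_H1 \<Omega>) \<nu> \<zeta> \<and>
        integrable \<nu> (\<lambda>l. aform \<Omega> A1 (\<zeta> l) (\<zeta> l))}"

type_synonym 'n state = "(real^'n \<Rightarrow> real) \<times> (real \<Rightarrow> real^'n \<Rightarrow> real)"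

definition W_space ::
  "(real^'n) set \<Rightarrow> (real^'n \<Rightarrow> real^'n^'n) \<Rightarrow> real measure \<Rightarrow> 'n state set"
  where "W_space \<Omega> A1 \<nu> = L2 \<Omega> \<times> K_space \<Omega> A1 \<nu>"

definition ip_W ::
  "(real^'n) set \<Rightarrow> (real^'n \<Rightarrow> real^'n^'n) \<Rightarrow> real measure \<Rightarrow> 'n state \<Rightarrow> 'n state \<Rightarrow> real"
  where "ip_W \<Omega> A1 \<nu> X Y =
    ip_L2 \<Omega> (fst X) (fst Y) + (LINT l|\<nu>. aform \<Omega> A1 (snd X l) (snd Y l))"

definition norm_W ::
  "(real^'n) set \<Rightarrow> (real^'n \<Rightarrow> real^'n^'n) \<Rightarrow> real measure \<Rightarrow> 'n state \<Rightarrow> real"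
  where "norm_W \<Omega> A1 \<nu> X = sqrt (ip_W \<Omega> A1 \<nu> X X)"

definition J_op :: "(real^'n) set \<Rightarrow> real measure \<Rightarrow> (real \<Rightarrow> real^'n \<Rightarrow> real) \<Rightarrow> real^'n \<Rightarrow> real"
  where "J_op \<Omega> \<nu> \<zeta> = bochner_integral_in (H10 \<Omega>) (norm_H1 \<Omega>) \<nu> \<zeta>"

definition E_op :: "(real^'n \<Rightarrow> real) \<Rightarrow> real \<Rightarrow> real^'n \<Rightarrow> real"
  where "E_op u = (\<lambda>l. u)"

definition Lambda_op :: "(real \<Rightarrow> real^'n \<Rightarrow> real) \<Rightarrow> real \<Rightarrow> real^'n \<Rightarrow> real"
  where "Lambda_op \<zeta> = (\<lambda>l. l *\<^sub>R \<zeta> l)"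

definition aug_domain ::
  "(real^'n) set \<Rightarrow> (real^'n \<Rightarrow> real^'n^'n) \<Rightarrow> (real^'n \<Rightarrow> real^'n^'n) \<Rightarrow> real measure \<Rightarrow> 'n state set"
  where "aug_domain \<Omega> A0 A1 \<nu> =
    {(u, \<zeta>). u \<in> H10 \<Omega> \<and> \<zeta> \<in> K_space \<Omega> A1 \<nu> \<and>
       in_H \<Omega> (dual_op \<Omega> A0 u + dual_op \<Omega> A1 (J_op \<Omega> \<nu> \<zeta>)) \<and>
       E_op u - Lambda_op \<zeta> \<in> K_space \<Omega> A1 \<nu>}"

definition aug_op ::
  "(real^'n) set \<Rightarrow> (real^'n \<Rightarrow> real^'n^'n) \<Rightarrow> (real^'n \<Rightarrow> real^'n^'n) \<Rightarrow> real measure \<Rightarrow> 'n state \<Rightarrow> 'n state"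
  where "aug_op \<Omega> A0 A1 \<nu> = (\<lambda>(u, \<zeta>).
    (H_rep \<Omega> (- dual_op \<Omega> A0 u - dual_op \<Omega> A1 (J_op \<Omega> \<nu> \<zeta>)), E_op u - Lambda_op \<zeta>))"

definition L1_H :: "(real^'n) set \<Rightarrow> real \<Rightarrow> (real \<Rightarrow> real^'n \<Rightarrow> real) set"
  where "L1_H \<Omega> T = {f. bochner_integrable_in (L2 \<Omega>) (norm_L2 \<Omega>) (lebesgue_on {0..T}) f}"

definition mild_sol ::
  "(real^'n) set \<Rightarrow> (real^'n \<Rightarrow> real^'n^'n) \<Rightarrow> real measure \<Rightarrow> real \<Rightarrow>
    (real \<Rightarrow> 'n state \<Rightarrow> 'n state) \<Rightarrow>
    (real^'n \<Rightarrow> real) \<Rightarrow> (real \<Rightarrow> real^'n \<Rightarrow> real) \<Rightarrow>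
    (real \<Rightarrow> 'n state) \<Rightarrow> bool"
  where "mild_sol \<Omega> A1 \<nu> T S u0 f X \<longleftrightarrow>
    mild_solution_in (W_space \<Omega> A1 \<nu>) (norm_W \<Omega> A1 \<nu>) S T (u0, 0) (\<lambda>s. (f s, 0)) X"

end

theory Submission
  imports Defs
begin


text \<open>
  \<^bold>\<open>Dissipativity.\<close>  With respect to the form \<open>a1\<close>, the averaging operator \<open>J\<close> is the adjoint of the
  embedding \<open>E\<close> of constant functions: \<open>a1(J \<zeta>, v) = \<langle>\<zeta>, E v\<rangle>\<close> in \<open>\<K>\<close> (\<open>J_adjoint_E\<close>).  In
  \<open>\<langle>\<A>(u, \<zeta>), (u, \<zeta>)\<rangle>\<close> the two coupling terms therefore cancel, which leaves the energy identity
  (\<open>energy_identity\<close>).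

  \<^bold>\<open>Range.\<close>  For \<open>\<tau> > 0\<close> the equation \<open>X - \<tau> \<A> X = (g, \<xi>)\<close> can be solved for the memory variable
  pointwise, \<open>\<zeta>(\<lambda>) = (\<xi>(\<lambda>) + \<tau> u) / (1 + \<tau> \<lambda>)\<close>.  What remains is a variational problem for \<open>u\<close> with
  the symmetric form \<open>(u, v) + \<tau> a0(u, v) + \<tau>\<^sup>2 \<kappa> a1(u, v)\<close>, where \<open>\<kappa> > 0\<close> because \<open>\<nu>\<close> is finite and not
  zero.  The memory thus supplies the coercivity that \<open>a0\<close> may lack; together with the Poincare
  inequality it makes \<open>V\<close> a Hilbert space for this form, and the Riesz representation theorem gives \<open>u\<close>
  (\<open>range_condition\<close>).

  \<^bold>\<open>Generation.\<close>  A dissipative operator whose range condition holds is densely defined: a vector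
  orthogonal to its domain has the form \<open>z - A z\<close>, and then \<open>z = 0\<close> (\<open>dissipative_range_imp_dense\<close>).  The
  semigroup is the limit of the implicit Euler schemes \<open>(I - (t/n) A)\<^sup>-\<^sup>n\<close>; on the domain of \<open>A\<^sup>2\<close> a
  telescoping sum bounds the difference of two such schemes by a multiple of \<open>1/m + 1/n\<close>
  (\<open>Lumer_Phillips\<close>).

  \<^bold>\<open>Mild solutions.\<close>  They exist because \<open>s \<mapsto> S(t - s) F(s)\<close> is Bochner integrable, and all estimates
  follow from the contractivity of \<open>S\<close>; continuity in time is dominated convergence
  (\<open>mild_solution_continuous\<close>).

  \<^bold>\<open>Foundations.\<close>  The spaces are carriers of representatives with seminorms, so the theory of inner
  products, strong measurability, Bochner integrals and square integrable functions is developed on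
  carriers.  Completeness of \<open>H\<close>, \<open>V\<close> and \<open>\<K>\<close> rests on one Riesz-Fischer theorem
  (\<open>complete_in_Lsq\<close>).  The forms are bilinear because weak gradients are unique almost everywhere, by
  the fundamental lemma of the calculus of variations (\<open>fundamental_lemma\<close>), for which smooth cut-off
  functions are built from \<open>exp(-1/t)\<close>.
\<close>

section \<open>Seminormed and semi-inner product spaces on carriers\<close>

text \<open>The spaces of the problem consist of representatives of classes, so that the basic structure
  is a seminorm on a subspace of a real vector space; nothing is assumed outside the carrier.\<close>

locale seminormed_space =
  fixes C :: "'e::real_vector set" and N :: "'e \<Rightarrow> real"
  assumes subspace_C: "subspace C"
    and N_triangle: "\<lbrakk>x \<in> C; y \<in> C\<rbrakk> \<Longrightarrow> N (x + y) \<le> N x + N y"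
    and N_scale: "x \<in> C \<Longrightarrow> N (c *\<^sub>R x) = \<bar>c\<bar> * N x"
begin

lemma zero_in [simp, intro]: "0 \<in> C"
  using subspace_C by (rule subspace_0)

lemma add_in [simp, intro]: "x \<in> C \<Longrightarrow> y \<in> C \<Longrightarrow> x + y \<in> C"
  using subspace_C by (rule subspace_add)

lemma diff_in [simp, intro]: "x \<in> C \<Longrightarrow> y \<in> C \<Longrightarrow> x - y \<in> C"
  using subspace_C by (rule subspace_diff)

lemma scale_in [simp, intro]: "x \<in> C \<Longrightarrow> c *\<^sub>R x \<in> C"
  using subspace_C by (rule subspace_scale)

lemma minus_in [simp, intro]: "x \<in> C \<Longrightarrow> - x \<in> C"
  using subspace_C by (rule subspace_neg)

lemma sum_in: "(\<And>i. i \<in> I \<Longrightarrow> f i \<in> C) \<Longrightarrow> sum f I \<in> C"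
  using subspace_C by (rule subspace_sum)

lemma N_zero [simp]: "N 0 = 0"
  using N_scale[of 0 0] by simp

lemma N_minus: "x \<in> C \<Longrightarrow> N (- x) = N x"
  using N_scale[of x "-1"] by simp

lemma N_nonneg [simp]: "x \<in> C \<Longrightarrow> 0 \<le> N x"
  using N_triangle[of x "- x"] N_minus[of x] by simp

lemma N_minus_commute: "x \<in> C \<Longrightarrow> y \<in> C \<Longrightarrow> N (x - y) = N (y - x)"
  using N_minus[of "x - y"] by simp

lemma N_diff_le: "x \<in> C \<Longrightarrow> y \<in> C \<Longrightarrow> N (x - y) \<le> N x + N y"
  using N_triangle[of x "- y"] N_minus[of y] by simp

lemma N_diff_triangle: "x \<in> C \<Longrightarrow> y \<in> C \<Longrightarrow> z \<in> C \<Longrightarrow> N (x - z) \<le> N (x - y) + N (y - z)"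
  using N_triangle[of "x - y" "y - z"] by simp

lemma N_reverse_triangle: "x \<in> C \<Longrightarrow> y \<in> C \<Longrightarrow> \<bar>N x - N y\<bar> \<le> N (x - y)"
  using N_triangle[of "x - y" y] N_triangle[of "y - x" x] N_minus_commute[of x y] by simp

lemma N_cong: "x \<in> C \<Longrightarrow> y \<in> C \<Longrightarrow> N (x - y) = 0 \<Longrightarrow> N x = N y"
  using N_reverse_triangle[of x y] by simp

lemma N_sum_le: "finite I \<Longrightarrow> (\<And>i. i \<in> I \<Longrightarrow> f i \<in> C) \<Longrightarrow> N (sum f I) \<le> (\<Sum>i\<in>I. N (f i))"
proof (induction I rule: finite_induct)
  case (insert i I)
  have "N (f i + sum f I) \<le> N (f i) + N (sum f I)"
    using insert by (intro N_triangle) (auto intro: sum_in)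
  then show ?case using insert by auto
qed simp

lemma N_tendsto:
  assumes "\<And>i. X i \<in> C" "x \<in> C" "((\<lambda>i. N (X i - x)) \<longlongrightarrow> 0) F"
  shows "((\<lambda>i. N (X i)) \<longlongrightarrow> N x) F"
proof -
  have "((\<lambda>i. N (X i) - N x) \<longlongrightarrow> 0) F"
    by (rule Lim_null_comparison[OF _ assms(3)]) (use N_reverse_triangle assms in auto)
  then show ?thesis by (simp add: LIM_zero_iff)
qed

lemma N_limit_unique:
  assumes "\<And>i. X i \<in> C" "x \<in> C" "y \<in> C" "F \<noteq> bot"
    and x: "((\<lambda>i. N (X i - x)) \<longlongrightarrow> 0) F" and y: "((\<lambda>i. N (X i - y)) \<longlongrightarrow> 0) F"
  shows "N (x - y) = 0"
proof -
  have "((\<lambda>i. N (X i - x) + N (X i - y)) \<longlongrightarrow> 0 + 0) F" by (intro tendsto_add x y)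
  moreover have "\<forall>i. N (x - y) \<le> N (X i - x) + N (X i - y)"
    using N_diff_triangle[of x _ y] N_minus_commute[of x] assms by metis
  ultimately have "N (x - y) \<le> 0"
    using assms(4) by (intro tendsto_lowerbound[of _ 0 F]) auto
  then show ?thesis using assms N_nonneg[of "x - y"] by (simp add: order_antisym)
qed

end

definition complete_in :: "'e::real_vector set \<Rightarrow> ('e \<Rightarrow> real) \<Rightarrow> bool"
  where "complete_in C N \<longleftrightarrow>
    (\<forall>X. (\<forall>n::nat. X n \<in> C) \<longrightarrow> (\<forall>e>0. \<exists>M. \<forall>m\<ge>M. \<forall>n\<ge>M. N (X m - X n) < e) \<longrightarrow>
         (\<exists>x\<in>C. (\<lambda>n. N (X n - x)) \<longlonglongrightarrow> 0))"

lemma complete_inD: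
  assumes "complete_in C N" "\<And>n::nat. X n \<in> C"
    and "\<And>e. e > 0 \<Longrightarrow> \<exists>M. \<forall>m\<ge>M. \<forall>n\<ge>M. N (X m - X n) < e"
  obtains x where "x \<in> C" "(\<lambda>n. N (X n - x)) \<longlonglongrightarrow> 0"
  using assms unfolding complete_in_def by blast

lemma (in seminormed_space) complete_in_bound:
  assumes "complete_in C N" "\<And>n::nat. X n \<in> C" "b \<longlonglongrightarrow> 0"
    and le: "\<And>m n. N (X m - X n) \<le> b m + b n"
  obtains x where "x \<in> C" "(\<lambda>n. N (X n - x)) \<longlonglongrightarrow> 0"
proof (rule complete_inD[OF assms(1,2)])
  fix e :: real assume "e > 0"
  then have "e / 2 > 0" by simp
  from LIMSEQ_D[OF assms(3) this] obtain M where M: "\<And>n. n \<ge> M \<Longrightarrow> \<bar>b n\<bar> < e / 2" by auto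
  have "N (X m - X n) < e" if "m \<ge> M" "n \<ge> M" for m n
    using le[of m n] M[OF that(1)] M[OF that(2)] by linarith
  then show "\<exists>M. \<forall>m\<ge>M. \<forall>n\<ge>M. N (X m - X n) < e" by blast
qed (use that in auto)

text \<open>Needed because the energy norms of the forms on \<open>V\<close> are not the Sobolev norm itself.\<close>

lemma complete_in_equivalent:
  assumes "complete_in C N" "subspace C"
    and 1: "\<And>x. x \<in> C \<Longrightarrow> N x \<le> c * N' x" and 2: "\<And>x. x \<in> C \<Longrightarrow> N' x \<le> d * N x"
    and nonneg: "\<And>x. x \<in> C \<Longrightarrow> 0 \<le> N' x"
  shows "complete_in C N'"
  unfolding complete_in_def
proof (intro allI impI)
  fix X :: "nat \<Rightarrow> 'a"
  assume X: "\<forall>n. X n \<in> C" and Cauchy: "\<forall>e>0. \<exists>M. \<forall>m\<ge>M. \<forall>n\<ge>M. N' (X m - X n) < e"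
  have diff: "x - y \<in> C" if "x \<in> C" "y \<in> C" for x y using assms(2) that by (rule subspace_diff)
  have "\<exists>M. \<forall>m\<ge>M. \<forall>n\<ge>M. N (X m - X n) < e" if "e > 0" for e
  proof -
    have "e / (\<bar>c\<bar> + 1) > 0" using that by simp
    then obtain M where M: "\<And>m n. m \<ge> M \<Longrightarrow> n \<ge> M \<Longrightarrow> N' (X m - X n) < e / (\<bar>c\<bar> + 1)"
      using Cauchy by blast
    have "N (X m - X n) < e" if "m \<ge> M" "n \<ge> M" for m n
    proof -
      have "N (X m - X n) \<le> c * N' (X m - X n)" using 1 diff X by blast
      also have "\<dots> \<le> (\<bar>c\<bar> + 1) * N' (X m - X n)" using nonneg diff X by (intro mult_right_mono) auto
      also have "\<dots> < (\<bar>c\<bar> + 1) * (e / (\<bar>c\<bar> + 1))"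
        using M[OF that] by (intro mult_strict_left_mono) auto
      also have "\<dots> = e" by (simp add: add_nonneg_eq_0_iff)
      finally show ?thesis .
    qed
    then show ?thesis by blast
  qed
  then obtain x where x: "x \<in> C" "(\<lambda>n. N (X n - x)) \<longlonglongrightarrow> 0"
    using complete_inD[OF assms(1), of X] X by metis
  have "(\<lambda>n. N' (X n - x)) \<longlonglongrightarrow> 0"
  proof (rule Lim_null_comparison)
    show "\<forall>\<^sub>F n in sequentially. norm (N' (X n - x)) \<le> d * N (X n - x)"
      using 2 nonneg diff X x(1) by auto
    show "(\<lambda>n. d * N (X n - x)) \<longlonglongrightarrow> 0" using tendsto_mult_left[OF x(2), of d] by simp
  qed
  with x show "\<exists>x\<in>C. (\<lambda>n. N' (X n - x)) \<longlonglongrightarrow> 0" by blast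
qed

definition ip_norm :: "('e \<Rightarrow> 'e \<Rightarrow> real) \<Rightarrow> 'e \<Rightarrow> real"
  where "ip_norm ip x = sqrt (ip x x)"

locale semi_inner_space =
  fixes C :: "'e::real_vector set" and ip :: "'e \<Rightarrow> 'e \<Rightarrow> real"
  assumes subspace_C: "subspace C"
    and ip_commute: "\<lbrakk>x \<in> C; y \<in> C\<rbrakk> \<Longrightarrow> ip x y = ip y x"
    and ip_add_left: "\<lbrakk>x \<in> C; y \<in> C; z \<in> C\<rbrakk> \<Longrightarrow> ip (x + y) z = ip x z + ip y z"
    and ip_scale_left: "\<lbrakk>x \<in> C; y \<in> C\<rbrakk> \<Longrightarrow> ip (c *\<^sub>R x) y = c * ip x y"
    and ip_nonneg: "x \<in> C \<Longrightarrow> 0 \<le> ip x x"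
begin

abbreviation "Nip \<equiv> ip_norm ip"

lemma C_in:
  "0 \<in> C" "x \<in> C \<Longrightarrow> y \<in> C \<Longrightarrow> x + y \<in> C" "x \<in> C \<Longrightarrow> y \<in> C \<Longrightarrow> x - y \<in> C"
  "x \<in> C \<Longrightarrow> c *\<^sub>R x \<in> C"
  using subspace_C by (auto intro: subspace_0 subspace_add subspace_diff subspace_scale)

lemma ip_add_right: "\<lbrakk>x \<in> C; y \<in> C; z \<in> C\<rbrakk> \<Longrightarrow> ip z (x + y) = ip z x + ip z y"
  using ip_add_left[of x y z] ip_commute C_in by metis

lemma ip_scale_right: "\<lbrakk>x \<in> C; y \<in> C\<rbrakk> \<Longrightarrow> ip y (c *\<^sub>R x) = c * ip y x"
  using ip_scale_left[of x y c] ip_commute C_in by metis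

lemma ip_diff_left: "\<lbrakk>x \<in> C; y \<in> C; z \<in> C\<rbrakk> \<Longrightarrow> ip (x - y) z = ip x z - ip y z"
  using ip_add_left[of "x - y" y z] C_in by simp

lemma ip_diff_right: "\<lbrakk>x \<in> C; y \<in> C; z \<in> C\<rbrakk> \<Longrightarrow> ip z (x - y) = ip z x - ip z y"
  using ip_diff_left[of x y z] ip_commute C_in by metis

lemma ip_zero_left: "y \<in> C \<Longrightarrow> ip 0 y = 0"
  using ip_scale_left[of 0 y 0] C_in by simp

lemmas ip_simps = ip_add_left ip_add_right ip_diff_left ip_diff_right ip_scale_left ip_scale_right C_in

lemma Nip_sq: "x \<in> C \<Longrightarrow> (Nip x)\<^sup>2 = ip x x"
  by (simp add: ip_norm_def ip_nonneg)

lemma ip_add_self: "x \<in> C \<Longrightarrow> y \<in> C \<Longrightarrow> ip (x + y) (x + y) = ip x x + 2 * ip x y + ip y y"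
  using ip_commute[of x y] by (simp add: ip_simps)

lemma ip_diff_self: "x \<in> C \<Longrightarrow> y \<in> C \<Longrightarrow> ip (x - y) (x - y) = ip x x - 2 * ip x y + ip y y"
  using ip_commute[of x y] by (simp add: ip_simps)

end

text \<open>The step from minimality of a squared distance to orthogonality.\<close>

lemma linear_coeff_zero:
  fixes b c :: real
  assumes "\<And>t. 0 \<le> 2 * t * b + t\<^sup>2 * c"
  shows "b = 0"
proof (rule ccontr)
  assume b: "b \<noteq> 0"
  define d where "d = \<bar>c\<bar> + 1"
  have d: "d > 0" "c < 2 * d" unfolding d_def by auto
  have "0 \<le> 2 * (- b / d) * b + (- b / d)\<^sup>2 * c" by (rule assms)
  also have "\<dots> = b\<^sup>2 / d\<^sup>2 * (c - 2 * d)"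
    using d by (simp add: power2_eq_square field_simps)
  also have "\<dots> < 0" using b d by (intro mult_pos_neg) auto
  finally show False by simp
qed

context semi_inner_space begin

text \<open>The discriminant argument; the case of a null vector \<open>y\<close> is separate, since a seminorm does not
  give \<open>y = 0\<close>.\<close>

lemma Cauchy_Schwarz_sq:
  assumes "x \<in> C" "y \<in> C"
  shows "(ip x y)\<^sup>2 \<le> ip x x * ip y y"
proof -
  have q: "0 \<le> ip x x + 2 * t * ip x y + t\<^sup>2 * ip y y" for t
    using ip_nonneg[of "x + t *\<^sub>R y"] assms ip_add_self[of x "t *\<^sub>R y"]
    by (simp add: ip_scale_left ip_scale_right C_in power2_eq_square mult.assoc)
  show ?thesis
  proof (cases "ip y y = 0")
    case True
    have "ip x y = 0"
    proof (rule ccontr)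
      assume "ip x y \<noteq> 0"
      then show False using q[of "- (ip x x + 1) / (2 * ip x y)"] True by (simp add: field_simps)
    qed
    then show ?thesis using True by simp
  next
    case False
    then have "ip y y > 0" using ip_nonneg[OF assms(2)] by simp
    then show ?thesis using q[of "- ip x y / ip y y"]
      by (simp add: field_simps power2_eq_square)
  qed
qed

lemma Cauchy_Schwarz: "\<lbrakk>x \<in> C; y \<in> C\<rbrakk> \<Longrightarrow> \<bar>ip x y\<bar> \<le> Nip x * Nip y"
  using real_sqrt_le_mono[OF Cauchy_Schwarz_sq[of x y]]
  by (simp add: ip_norm_def real_sqrt_mult)

lemma ip_null_left: "\<lbrakk>x \<in> C; y \<in> C; Nip x = 0\<rbrakk> \<Longrightarrow> ip x y = 0"
  using Cauchy_Schwarz[of x y] by simp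

lemma seminormed: "seminormed_space C Nip"
proof
  fix x y assume xy: "x \<in> C" "y \<in> C"
  have "ip (x + y) (x + y) \<le> ip x x + 2 * (Nip x * Nip y) + ip y y"
    using ip_add_self[OF xy] Cauchy_Schwarz[OF xy] by simp
  also have "\<dots> = (Nip x + Nip y)\<^sup>2"
    using xy by (simp add: power2_sum Nip_sq)
  finally show "Nip (x + y) \<le> Nip x + Nip y"
    unfolding ip_norm_def[of _ "x + y"] using xy
    by (intro real_le_lsqrt) (auto simp: ip_norm_def ip_nonneg)
next
  fix x c assume "x \<in> C"
  then show "Nip (c *\<^sub>R x) = \<bar>c\<bar> * Nip x"
    by (simp add: ip_norm_def ip_simps real_sqrt_mult mult.assoc[symmetric] flip: power2_eq_square)
qed (rule subspace_C)

end

sublocale semi_inner_space \<subseteq> seminormed_space C "ip_norm ip"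
  by (rule seminormed)

context semi_inner_space begin

lemma ip_tendsto_left:
  assumes "\<And>i. X i \<in> C" "x \<in> C" "y \<in> C" "((\<lambda>i. Nip (X i - x)) \<longlongrightarrow> 0) F"
  shows "((\<lambda>i. ip (X i) y) \<longlongrightarrow> ip x y) F"
proof -
  have "((\<lambda>i. ip (X i) y - ip x y) \<longlongrightarrow> 0) F"
  proof (rule Lim_null_comparison)
    show "\<forall>\<^sub>F i in F. norm (ip (X i) y - ip x y) \<le> Nip (X i - x) * Nip y"
      using Cauchy_Schwarz[OF diff_in[OF assms(1,2)] assms(3)] assms(1-3)
      by (auto simp: ip_diff_left)
    show "((\<lambda>i. Nip (X i - x) * Nip y) \<longlongrightarrow> 0) F"
      using tendsto_mult_right[OF assms(4), of "Nip y"] by simp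
  qed
  then show ?thesis by (simp add: LIM_zero_iff)
qed

text \<open>The orthogonal projection onto the closure of a subspace: by the parallelogram law a
  minimizing sequence for the distance is Cauchy, and minimality at its limit forces the
  linear term of the quadratic \<open>t \<mapsto> \<parallel>x - m - t y\<parallel>\<^sup>2\<close> to vanish.\<close>

lemma projection_onto_closure:
  assumes complete: "complete_in C Nip" and D: "subspace D" "D \<subseteq> C" and x: "x \<in> C"
  obtains d m where "\<And>n::nat. d n \<in> D" "m \<in> C" "(\<lambda>n. Nip (d n - m)) \<longlonglongrightarrow> 0"
    "\<And>y. y \<in> D \<Longrightarrow> ip (x - m) y = 0"
proof -
  define \<delta> where "\<delta> = Inf ((\<lambda>d. ip (x - d) (x - d)) ` D)"
  have bdd: "bdd_below ((\<lambda>d. ip (x - d) (x - d)) ` D)"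
    using D x by (intro bdd_belowI2[of _ 0] ip_nonneg) auto
  have \<delta>: "\<delta> \<le> ip (x - d) (x - d)" if "d \<in> D" for d
    unfolding \<delta>_def using that bdd by (intro cInf_lower) auto
  have ne: "(\<lambda>d. ip (x - d) (x - d)) ` D \<noteq> {}" using subspace_0[OF D(1)] by blast
  have "\<exists>d\<in>D. ip (x - d) (x - d) < \<delta> + 1 / real (Suc n)" for n
  proof -
    have "Inf ((\<lambda>d. ip (x - d) (x - d)) ` D) < \<delta> + 1 / real (Suc n)" by (simp add: \<delta>_def)
    from cInf_lessD[OF ne this] show ?thesis by blast
  qed
  then obtain d where d: "\<And>n. d n \<in> D" "\<And>n. ip (x - d n) (x - d n) < \<delta> + 1 / real (Suc n)"
    by metis
  have dC: "d n \<in> C" for n using d(1) D(2) by blast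
  \<comment> \<open>The midpoint of \<open>d i\<close> and \<open>d j\<close> lies in \<open>D\<close>, so its distance to \<open>x\<close> is at least the infimum.\<close>
  have par: "ip (d i - d j) (d i - d j) \<le> 2 * (1 / real (Suc i) + 1 / real (Suc j))" for i j
  proof -
    let ?h = "(1/2) *\<^sub>R (d i + d j)"
    have h: "?h \<in> D" using D(1) d(1) by (intro subspace_scale subspace_add)
    have 1: "(x - d i) + (x - d j) = 2 *\<^sub>R (x - ?h)" by (simp add: algebra_simps scaleR_2)
    have 2: "(x - d i) - (x - d j) = d j - d i" by simp
    have "ip ((x - d i) + (x - d j)) ((x - d i) + (x - d j)) + ip ((x - d i) - (x - d j)) ((x - d i) - (x - d j))
        = 2 * ip (x - d i) (x - d i) + 2 * ip (x - d j) (x - d j)"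
      using x dC by (subst ip_add_self ip_diff_self; simp)+
    moreover have "ip (2 *\<^sub>R (x - ?h)) (2 *\<^sub>R (x - ?h)) = 4 * ip (x - ?h) (x - ?h)"
      using x dC by (subst ip_scale_left ip_scale_right; (intro C_in)?; simp)+
    moreover have "ip (d j - d i) (d j - d i) = ip (d i - d j) (d i - d j)"
      using dC by (simp add: ip_diff_left ip_diff_right)
    ultimately have "4 * ip (x - ?h) (x - ?h) + ip (d i - d j) (d i - d j)
        = 2 * ip (x - d i) (x - d i) + 2 * ip (x - d j) (x - d j)"
      unfolding 1 2 by linarith
    then show ?thesis using \<delta>[OF h] d(2)[of i] d(2)[of j] by argo
  qed
  have lim0: "(\<lambda>n. sqrt (2 * (1 / real (Suc n)))) \<longlonglongrightarrow> 0"
    using tendsto_real_sqrt[OF tendsto_mult_left[OF LIMSEQ_inverse_real_of_nat, of 2]]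
    by (simp add: inverse_eq_divide)
  obtain m where m: "m \<in> C" "(\<lambda>n. Nip (d n - m)) \<longlonglongrightarrow> 0"
  proof (rule complete_in_bound[OF complete, of d "\<lambda>n. sqrt (2 * (1 / real (Suc n)))"])
    fix i j
    have "Nip (d i - d j) \<le> sqrt (2 * (1 / real (Suc i)) + 2 * (1 / real (Suc j)))"
      unfolding ip_norm_def using par[of i j] by (simp add: distrib_left)
    also have "\<dots> \<le> sqrt (2 * (1 / real (Suc i))) + sqrt (2 * (1 / real (Suc j)))"
      by (rule sqrt_add_le_add_sqrt) auto
    finally show "Nip (d i - d j) \<le> sqrt (2 * (1 / real (Suc i))) + sqrt (2 * (1 / real (Suc j)))" .
  qed (use dC lim0 in auto)
  have lim: "(\<lambda>n. ip (x - d n - z) (x - d n - z)) \<longlonglongrightarrow> ip (x - m - z) (x - m - z)" if "z \<in> C" for z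
  proof -
    have eq: "x - d n - z - (x - m - z) = - 1 *\<^sub>R (d n - m)" for n by simp
    have "(\<lambda>n. Nip (x - d n - z)) \<longlonglongrightarrow> Nip (x - m - z)"
    proof (rule N_tendsto)
      show "(\<lambda>n. Nip (x - d n - z - (x - m - z))) \<longlonglongrightarrow> 0"
        unfolding eq using m dC by (subst N_scale) auto
    qed (use x dC m that in auto)
    from tendsto_power[OF this, of 2] show ?thesis
      using x dC m that by (simp add: Nip_sq)
  qed
  have upper: "ip (x - m) (x - m) \<le> \<delta>"
  proof -
    have "(\<lambda>n. \<delta> + 1 / real (Suc n)) \<longlonglongrightarrow> \<delta> + 0"
      by (intro tendsto_add tendsto_const) (use LIMSEQ_inverse_real_of_nat in \<open>simp add: inverse_eq_divide\<close>)
    moreover have "(\<lambda>n. ip (x - d n) (x - d n)) \<longlonglongrightarrow> ip (x - m) (x - m)"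
      using lim[of 0] by (simp add: C_in)
    ultimately show ?thesis
      using d(2) by (intro LIMSEQ_le[of _ _ "\<lambda>n. \<delta> + 1 / real (Suc n)"]) (auto intro: less_imp_le)
  qed
  have "ip (x - m) y = 0" if y: "y \<in> D" for y
  proof -
    have yC: "y \<in> C" using y D by blast
    have "0 \<le> 2 * t * (- ip (x - m) y) + t\<^sup>2 * ip y y" for t
    proof -
      have "\<delta> \<le> ip (x - m - t *\<^sub>R y) (x - m - t *\<^sub>R y)"
      proof (rule tendsto_lowerbound[OF lim])
        have "\<delta> \<le> ip (x - d n - t *\<^sub>R y) (x - d n - t *\<^sub>R y)" for n
          using \<delta>[of "d n + t *\<^sub>R y"] subspace_add[OF D(1) d(1) subspace_scale[OF D(1) y]]
          by (simp add: algebra_simps)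
        then show "\<forall>\<^sub>F n in sequentially. \<delta> \<le> ip (x - d n - t *\<^sub>R y) (x - d n - t *\<^sub>R y)" by simp
      qed (use yC in auto)
      also have "\<dots> = ip (x - m) (x - m) - 2 * t * ip (x - m) y + t\<^sup>2 * ip y y"
        using x m yC by (subst ip_diff_self) (auto simp: ip_scale_left ip_scale_right power2_eq_square)
      finally show ?thesis using upper by simp
    qed
    from linear_coeff_zero[OF this] show ?thesis by simp
  qed
  then show ?thesis using that d(1) m by blast
qed

text \<open>Riesz representation: a vector orthogonal to the kernel, suitably scaled, represents the
  functional.\<close>

lemma Riesz_representation:
  assumes complete: "complete_in C Nip"
    and l_add: "\<And>x y. x \<in> C \<Longrightarrow> y \<in> C \<Longrightarrow> l (x + y) = l x + l y"
    and l_scale: "\<And>x a. x \<in> C \<Longrightarrow> l (a *\<^sub>R x) = a * (l x :: real)"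
    and l_bound: "\<And>x. x \<in> C \<Longrightarrow> \<bar>l x\<bar> \<le> c * Nip x"
  obtains u where "u \<in> C" "\<And>v. v \<in> C \<Longrightarrow> ip u v = l v"
proof (cases "\<forall>x\<in>C. l x = 0")
  case True
  then show ?thesis using that[of 0] by (simp add: ip_zero_left)
next
  case False
  then obtain x where x: "x \<in> C" "l x \<noteq> 0" by blast
  have l_zero: "l 0 = 0" using l_scale[of 0 0] by simp
  have l_diff: "l (a - b) = l a - l b" if "a \<in> C" "b \<in> C" for a b
    using l_add[of "a - b" b] that by simp
  define D where "D = {v \<in> C. l v = 0}"
  have D: "subspace D" "D \<subseteq> C"
    unfolding D_def subspace_def by (auto simp: l_zero l_add l_scale)
  obtain d m where d: "\<And>n::nat. d n \<in> D" and m: "m \<in> C" and dm: "(\<lambda>n. Nip (d n - m)) \<longlonglongrightarrow> 0"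
    and orth: "\<And>y. y \<in> D \<Longrightarrow> ip (x - m) y = 0"
    using projection_onto_closure[OF complete D x(1)] by metis
  have "\<bar>l m\<bar> \<le> c * Nip (d n - m)" for n
    using l_bound[of "d n - m"] l_diff[of "d n" m] d[of n] m unfolding D_def by auto
  moreover have "(\<lambda>n. c * Nip (d n - m)) \<longlonglongrightarrow> c * 0" using dm by (rule tendsto_mult_left)
  ultimately have "\<bar>l m\<bar> \<le> c * 0" by (intro LIMSEQ_le_const) auto
  then have lm: "l m = 0" by simp
  define w where "w = x - m"
  have w: "w \<in> C" "l w = l x" using x m lm l_diff unfolding w_def by auto
  have ww: "ip w w \<noteq> 0"
  proof
    assume "ip w w = 0"
    then have "Nip w = 0" by (simp add: ip_norm_def)
    then show False using l_bound[OF w(1)] w x by simp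
  qed
  have "ip ((l w / ip w w) *\<^sub>R w) v = l v" if v: "v \<in> C" for v
  proof -
    have "v - (l v / l w) *\<^sub>R w \<in> D" using v w x unfolding D_def by (auto simp: l_diff l_scale)
    from orth[OF this] have "ip w v = (l v / l w) * ip w w"
      using v w unfolding w_def[symmetric] by (simp add: ip_simps)
    then show ?thesis using v w x ww by (simp add: ip_simps)
  qed
  then show ?thesis using that[of "(l w / ip w w) *\<^sub>R w"] w by blast
qed

text \<open>A residual \<open>w\<close> orthogonal to the domain has the form \<open>z - A z\<close>, and dissipativity gives
  \<open>\<parallel>z\<parallel>\<^sup>2 \<le> \<langle>z - A z, z\<rangle> = \<langle>w, z\<rangle> = 0\<close>.\<close>

lemma dissipative_range_imp_dense:
  assumes complete: "complete_in C Nip" and D: "subspace D" "D \<subseteq> C"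
    and A: "\<And>x. x \<in> D \<Longrightarrow> A x \<in> C"
    and A_null: "\<And>x. x \<in> D \<Longrightarrow> Nip x = 0 \<Longrightarrow> Nip (A x) = 0"
    and dissipative: "\<And>x. x \<in> D \<Longrightarrow> ip (A x) x \<le> 0"
    and range: "\<And>y. y \<in> C \<Longrightarrow> \<exists>x\<in>D. Nip ((x - A x) - y) = 0"
  shows "dense_subset_in C Nip D"
  unfolding dense_subset_in_def
proof (intro conjI ballI allI impI D)
  fix x and e :: real assume x: "x \<in> C" and e: "e > 0"
  obtain d m where d: "\<And>n::nat. d n \<in> D" and m: "m \<in> C" and dm: "(\<lambda>n. Nip (d n - m)) \<longlonglongrightarrow> 0"
    and orth: "\<And>y. y \<in> D \<Longrightarrow> ip (x - m) y = 0"
    using projection_onto_closure[OF complete D x] by metis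
  define w where "w = x - m"
  have w: "w \<in> C" using x m unfolding w_def by auto
  obtain z where z: "z \<in> D" "Nip ((z - A z) - w) = 0" using range[OF w] by blast
  have zC: "z \<in> C" "A z \<in> C" using z D A by auto
  have "ip ((z - A z) - w) z = 0" using z zC w by (intro ip_null_left) auto
  then have "ip z z - ip (A z) z = ip w z" using zC w by (simp add: ip_diff_left)
  also have "\<dots> = 0" using orth[OF z(1)] unfolding w_def .
  finally have "ip z z \<le> 0" using dissipative[OF z(1)] by simp
  then have z0: "Nip z = 0" using ip_nonneg[OF zC(1)] by (simp add: ip_norm_def)
  have "Nip w = Nip (z - A z)" using N_cong[of "z - A z" w] z zC w by auto
  also have "\<dots> \<le> 0" using N_diff_le[OF zC] z0 A_null[OF z(1) z0] by simp
  finally have w0: "Nip w \<le> 0" .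
  obtain n where n: "Nip (d n - m) < e"
    using order_tendstoD(2)[OF dm e] by (auto simp: eventually_sequentially)
  have dC: "d n \<in> C" using d D by blast
  have "Nip (x - d n) \<le> Nip (x - m) + Nip (m - d n)" using N_diff_triangle[OF x m dC] .
  also have "\<dots> < e" using w0 n N_minus_commute[OF m dC] unfolding w_def by simp
  finally show "\<exists>y\<in>D. Nip (x - y) < e" using d by blast
qed

end

lemma semi_inner_space_Times:
  assumes "semi_inner_space C1 ip1" "semi_inner_space C2 ip2"
  shows "semi_inner_space (C1 \<times> C2) (\<lambda>X Y. ip1 (fst X) (fst Y) + ip2 (snd X) (snd Y))"
proof -
  interpret S1: semi_inner_space C1 ip1 by fact
  interpret S2: semi_inner_space C2 ip2 by fact
  show ?thesis
  proof
    show "subspace (C1 \<times> C2)" using S1.subspace_C S2.subspace_C by (rule subspace_Times)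
  next
    fix x y assume "x \<in> C1 \<times> C2" "y \<in> C1 \<times> C2"
    then show "ip1 (fst x) (fst y) + ip2 (snd x) (snd y) = ip1 (fst y) (fst x) + ip2 (snd y) (snd x)"
      using S1.ip_commute[of "fst x" "fst y"] S2.ip_commute[of "snd x" "snd y"] by auto
  qed (auto simp: S1.ip_simps S2.ip_simps S1.ip_nonneg S2.ip_nonneg distrib_left)
qed

lemma complete_in_Times:
  assumes "semi_inner_space C1 ip1" "semi_inner_space C2 ip2"
    and "complete_in C1 (ip_norm ip1)" "complete_in C2 (ip_norm ip2)"
  shows "complete_in (C1 \<times> C2) (ip_norm (\<lambda>X Y. ip1 (fst X) (fst Y) + ip2 (snd X) (snd Y)))"
    (is "complete_in _ ?N")
  unfolding complete_in_def
proof (intro allI impI)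
  interpret S1: semi_inner_space C1 ip1 by fact
  interpret S2: semi_inner_space C2 ip2 by fact
  have N1: "S1.Nip (fst x) \<le> ?N x" and N2: "S2.Nip (snd x) \<le> ?N x"
    and N12: "?N x \<le> S1.Nip (fst x) + S2.Nip (snd x)" if "x \<in> C1 \<times> C2" for x
    using that S1.ip_nonneg[of "fst x"] S2.ip_nonneg[of "snd x"]
      sqrt_add_le_add_sqrt[of "ip1 (fst x) (fst x)" "ip2 (snd x) (snd x)"]
    by (auto simp: ip_norm_def)
  have diff: "x - y \<in> C1 \<times> C2" if "x \<in> C1 \<times> C2" "y \<in> C1 \<times> C2" for x y
    using that by auto
  fix X :: "nat \<Rightarrow> 'a \<times> 'b"
  assume X: "\<forall>n. X n \<in> C1 \<times> C2" and Cauchy: "\<forall>e>0. \<exists>M. \<forall>m\<ge>M. \<forall>n\<ge>M. ?N (X m - X n) < e"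
  have X1: "fst (X n) \<in> C1" and X2: "snd (X n) \<in> C2" for n
    using X[rule_format, of n] by (auto simp: mem_Times_iff)
  have le: "S1.Nip (fst (X m) - fst (X n)) \<le> ?N (X m - X n)"
    "S2.Nip (snd (X m) - snd (X n)) \<le> ?N (X m - X n)" for m n
    using N1[OF diff, of "X m" "X n"] N2[OF diff, of "X m" "X n"] X by simp_all
  obtain x1 where x1: "x1 \<in> C1" "(\<lambda>n. S1.Nip (fst (X n) - x1)) \<longlonglongrightarrow> 0"
  proof (rule complete_inD[OF assms(3), of "\<lambda>n. fst (X n)"])
    fix e :: real assume "e > 0"
    then show "\<exists>M. \<forall>m\<ge>M. \<forall>n\<ge>M. S1.Nip (fst (X m) - fst (X n)) < e"
      using Cauchy le(1) by (meson order_le_less_trans)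
  qed (use X1 in auto)
  obtain x2 where x2: "x2 \<in> C2" "(\<lambda>n. S2.Nip (snd (X n) - x2)) \<longlonglongrightarrow> 0"
  proof (rule complete_inD[OF assms(4), of "\<lambda>n. snd (X n)"])
    fix e :: real assume "e > 0"
    then show "\<exists>M. \<forall>m\<ge>M. \<forall>n\<ge>M. S2.Nip (snd (X m) - snd (X n)) < e"
      using Cauchy le(2) by (meson order_le_less_trans)
  qed (use X2 in auto)
  have x: "(x1, x2) \<in> C1 \<times> C2" using x1 x2 by simp
  have "(\<lambda>n. ?N (X n - (x1, x2))) \<longlonglongrightarrow> 0"
  proof (rule Lim_null_comparison)
    show "\<forall>\<^sub>F n in sequentially. norm (?N (X n - (x1, x2)))
        \<le> S1.Nip (fst (X n) - x1) + S2.Nip (snd (X n) - x2)"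
    proof (intro always_eventually allI)
      fix n
      have d: "X n - (x1, x2) \<in> C1 \<times> C2" using X x diff by blast
      have "0 \<le> ?N (X n - (x1, x2))"
        using N1[OF d] S1.N_nonneg[OF S1.diff_in[OF X1 x1(1)], of n] by simp
      then show "norm (?N (X n - (x1, x2))) \<le> S1.Nip (fst (X n) - x1) + S2.Nip (snd (X n) - x2)"
        using N12[OF d] by simp
    qed
    show "(\<lambda>n. S1.Nip (fst (X n) - x1) + S2.Nip (snd (X n) - x2)) \<longlonglongrightarrow> 0"
      using tendsto_add[OF x1(2) x2(2)] by simp
  qed
  with x show "\<exists>x\<in>C1 \<times> C2. (\<lambda>n. ?N (X n - x)) \<longlonglongrightarrow> 0" by blast
qed


section \<open>Strong measurability and the Bochner integral on carriers\<close>

context seminormed_space begin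

lemma strongly_measurableI:
  assumes "\<And>x. x \<in> space M \<Longrightarrow> f x \<in> C" "\<And>i::nat. simple_function M (s i)"
    and "\<And>i x. x \<in> space M \<Longrightarrow> s i x \<in> C"
    and "\<And>x. x \<in> space M \<Longrightarrow> (\<lambda>i. N (f x - s i x)) \<longlonglongrightarrow> 0"
  shows "strongly_measurable_in C N M f"
  using assms unfolding strongly_measurable_in_def by (intro conjI exI[of _ s]) auto

lemma strongly_measurableE:
  assumes "strongly_measurable_in C N M f"
  obtains s where "\<And>i::nat. simple_function M (s i)" "\<And>i x. x \<in> space M \<Longrightarrow> s i x \<in> C"
    "\<And>x. x \<in> space M \<Longrightarrow> (\<lambda>i. N (f x - s i x)) \<longlonglongrightarrow> 0" "\<And>x. x \<in> space M \<Longrightarrow> f x \<in> C"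
  using assms unfolding strongly_measurable_in_def by (metis image_subset_iff)

lemma strongly_measurable_in_C: "strongly_measurable_in C N M f \<Longrightarrow> x \<in> space M \<Longrightarrow> f x \<in> C"
  unfolding strongly_measurable_in_def by blast

lemma strongly_measurable_cong:
  "(\<And>x. x \<in> space M \<Longrightarrow> f x = g x) \<Longrightarrow> strongly_measurable_in C N M f \<longleftrightarrow> strongly_measurable_in C N M g"
  unfolding strongly_measurable_in_def by simp

lemma strongly_measurable_simple:
  assumes "simple_function M f" "\<And>x. x \<in> space M \<Longrightarrow> f x \<in> C"
  shows "strongly_measurable_in C N M f"
  by (rule strongly_measurableI[where s="\<lambda>_. f"]) (use assms in auto)

lemma strongly_measurable_const: "c \<in> C \<Longrightarrow> strongly_measurable_in C N M (\<lambda>_. c)"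
  by (rule strongly_measurable_simple) auto

text \<open>Real functions built from \<open>f\<close> are measurable as pointwise limits of the same functions
  built from the approximating simple functions.\<close>

lemma strongly_measurable_dist:
  assumes "strongly_measurable_in C N M f" and z: "z \<in> C"
  shows "(\<lambda>x. N (f x - z)) \<in> borel_measurable M"
proof -
  obtain s where s: "\<And>i::nat. simple_function M (s i)" "\<And>i x. x \<in> space M \<Longrightarrow> s i x \<in> C"
    "\<And>x. x \<in> space M \<Longrightarrow> (\<lambda>i. N (f x - s i x)) \<longlonglongrightarrow> 0" "\<And>x. x \<in> space M \<Longrightarrow> f x \<in> C"
    using strongly_measurableE[OF assms(1)] by blast
  show ?thesis
  proof (rule borel_measurable_LIMSEQ_real)
    show "(\<lambda>x. N (s i x - z)) \<in> borel_measurable M" for i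
      using simple_function_compose1[OF s(1), where g="\<lambda>y. N (y - z)"] by (rule borel_measurable_simple_function)
    fix x assume x: "x \<in> space M"
    have "(\<lambda>i. N (s i x - z) - N (f x - z)) \<longlonglongrightarrow> 0"
    proof (rule Lim_null_comparison[OF always_eventually s(3)[OF x]], intro allI)
      fix i
      have "\<bar>N (s i x - z) - N (f x - z)\<bar> \<le> N (s i x - z - (f x - z))"
        using s x z by (intro N_reverse_triangle) auto
      then show "norm (N (s i x - z) - N (f x - z)) \<le> N (f x - s i x)"
        using N_minus_commute[of "s i x" "f x"] s x by simp
    qed
    then show "(\<lambda>i. N (s i x - z)) \<longlonglongrightarrow> N (f x - z)" by (simp add: LIM_zero_iff)
  qed
qed

lemma strongly_measurable_norm:
  "strongly_measurable_in C N M f \<Longrightarrow> (\<lambda>x. N (f x)) \<in> borel_measurable M"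
  using strongly_measurable_dist[of M f 0] by simp

lemma strongly_measurable_compose:
  fixes L :: "'e \<Rightarrow> 'f::real_vector"
  assumes f: "strongly_measurable_in C N M f"
    and L: "\<And>x. x \<in> C \<Longrightarrow> L x \<in> C'" "\<And>x y. x \<in> C \<Longrightarrow> y \<in> C \<Longrightarrow> 0 \<le> N' (L x - L y)"
      "\<And>x y. x \<in> C \<Longrightarrow> y \<in> C \<Longrightarrow> N' (L x - L y) \<le> c * N (x - y)"
  shows "strongly_measurable_in C' N' M (\<lambda>x. L (f x))"
proof -
  obtain s where s: "\<And>i::nat. simple_function M (s i)" "\<And>i x. x \<in> space M \<Longrightarrow> s i x \<in> C"
    "\<And>x. x \<in> space M \<Longrightarrow> (\<lambda>i. N (f x - s i x)) \<longlonglongrightarrow> 0" "\<And>x. x \<in> space M \<Longrightarrow> f x \<in> C"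
    using strongly_measurableE[OF f] by blast
  have "(\<lambda>i. N' (L (f x) - L (s i x))) \<longlonglongrightarrow> 0" if x: "x \<in> space M" for x
  proof (rule Lim_null_comparison[OF always_eventually])
    show "\<forall>i. norm (N' (L (f x) - L (s i x))) \<le> c * N (f x - s i x)" using L s x by auto
    show "(\<lambda>i. c * N (f x - s i x)) \<longlonglongrightarrow> 0" using tendsto_mult_left[OF s(3)[OF x], of c] by simp
  qed
  then show ?thesis unfolding strongly_measurable_in_def
    using s L simple_function_compose1[OF s(1), where g=L]
    by (intro conjI exI[of _ "\<lambda>i x. L (s i x)"]) auto
qed

lemma strongly_measurable_add:
  assumes "strongly_measurable_in C N M f" "strongly_measurable_in C N M g"
  shows "strongly_measurable_in C N M (\<lambda>x. f x + g x)"
proof -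
  obtain s where s: "\<And>i::nat. simple_function M (s i)" "\<And>i x. x \<in> space M \<Longrightarrow> s i x \<in> C"
    "\<And>x. x \<in> space M \<Longrightarrow> (\<lambda>i. N (f x - s i x)) \<longlonglongrightarrow> 0" "\<And>x. x \<in> space M \<Longrightarrow> f x \<in> C"
    using strongly_measurableE[OF assms(1)] by blast
  obtain t where t: "\<And>i::nat. simple_function M (t i)" "\<And>i x. x \<in> space M \<Longrightarrow> t i x \<in> C"
    "\<And>x. x \<in> space M \<Longrightarrow> (\<lambda>i. N (g x - t i x)) \<longlonglongrightarrow> 0" "\<And>x. x \<in> space M \<Longrightarrow> g x \<in> C"
    using strongly_measurableE[OF assms(2)] by blast
  show ?thesis
  proof (rule strongly_measurableI[where s="\<lambda>i x. s i x + t i x"])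
    fix x assume x: "x \<in> space M"
    show "(\<lambda>i. N (f x + g x - (s i x + t i x))) \<longlonglongrightarrow> 0"
    proof (rule Lim_null_comparison[OF always_eventually])
      have "N ((f x - s i x) + (g x - t i x)) \<le> N (f x - s i x) + N (g x - t i x)" for i
        using s t x by (intro N_triangle) auto
      then show "\<forall>i. norm (N (f x + g x - (s i x + t i x))) \<le> N (f x - s i x) + N (g x - t i x)"
        using s t x by (auto simp: algebra_simps)
      show "(\<lambda>i. N (f x - s i x) + N (g x - t i x)) \<longlonglongrightarrow> 0"
        using tendsto_add[OF s(3) t(3)] x by simp
    qed
  qed (use s t in \<open>auto intro: simple_function_compose2[of _ _ _ "(+)"]\<close>)
qed

lemma strongly_measurable_scale_fun:
  fixes h :: "'a \<Rightarrow> real"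
  assumes f: "strongly_measurable_in C N M f" and h: "h \<in> borel_measurable M"
  shows "strongly_measurable_in C N M (\<lambda>x. h x *\<^sub>R f x)"
proof -
  obtain s where s: "\<And>i::nat. simple_function M (s i)" "\<And>i x. x \<in> space M \<Longrightarrow> s i x \<in> C"
    "\<And>x. x \<in> space M \<Longrightarrow> (\<lambda>i. N (f x - s i x)) \<longlonglongrightarrow> 0" "\<And>x. x \<in> space M \<Longrightarrow> f x \<in> C"
    using strongly_measurableE[OF f] by blast
  obtain t where t: "\<And>i::nat. simple_function M (t i)" "\<And>x. x \<in> space M \<Longrightarrow> (\<lambda>i. t i x) \<longlonglongrightarrow> h x"
    using borel_measurable_implies_sequence_metric[OF h, of 0] by blast
  show ?thesis
  proof (rule strongly_measurableI[where s="\<lambda>i x. t i x *\<^sub>R s i x"])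
    fix x assume x: "x \<in> space M"
    show "(\<lambda>i. N (h x *\<^sub>R f x - t i x *\<^sub>R s i x)) \<longlonglongrightarrow> 0"
    proof (rule Lim_null_comparison[OF always_eventually], intro allI)
      fix i
      have "h x *\<^sub>R f x - t i x *\<^sub>R s i x = (h x - t i x) *\<^sub>R f x + t i x *\<^sub>R (f x - s i x)"
        by (simp add: algebra_simps)
      then have "N (h x *\<^sub>R f x - t i x *\<^sub>R s i x) \<le> N ((h x - t i x) *\<^sub>R f x) + N (t i x *\<^sub>R (f x - s i x))"
        using s x N_triangle[of "(h x - t i x) *\<^sub>R f x" "t i x *\<^sub>R (f x - s i x)"] by auto
      then show "norm (N (h x *\<^sub>R f x - t i x *\<^sub>R s i x)) \<le> \<bar>h x - t i x\<bar> * N (f x) + \<bar>t i x\<bar> * N (f x - s i x)"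
        using s x by (auto simp: N_scale)
    next
      have "(\<lambda>i. \<bar>h x - t i x\<bar> * N (f x) + \<bar>t i x\<bar> * N (f x - s i x)) \<longlonglongrightarrow> \<bar>h x - h x\<bar> * N (f x) + \<bar>h x\<bar> * 0"
        by (intro tendsto_intros t s x)
      then show "(\<lambda>i. \<bar>h x - t i x\<bar> * N (f x) + \<bar>t i x\<bar> * N (f x - s i x)) \<longlonglongrightarrow> 0" by simp
    qed
  qed (use s t in \<open>auto intro: simple_function_compose2[of _ _ _ "\<lambda>x y. x *\<^sub>R y"]\<close>)
qed

lemma strongly_measurable_scale:
  "strongly_measurable_in C N M f \<Longrightarrow> strongly_measurable_in C N M (\<lambda>x. c *\<^sub>R f x)"
  by (rule strongly_measurable_scale_fun) auto

lemma strongly_measurable_diff: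
  assumes "strongly_measurable_in C N M f" "strongly_measurable_in C N M g"
  shows "strongly_measurable_in C N M (\<lambda>x. f x - g x)"
  using strongly_measurable_add[OF assms(1) strongly_measurable_scale[OF assms(2), of "-1"]] by simp

text \<open>The values of all approximating simple functions form a countable set \<open>Z\<close> which is dense in
  the range of the limit \<open>f\<close>; the \<open>n\<close>-th simple function picks, among the first \<open>n\<close> points
  of \<open>Z\<close>, the first one that is closest to \<open>f x\<close>.\<close>

lemma strongly_measurable_LIMSEQ:
  assumes f: "\<And>n::nat. strongly_measurable_in C N M (f n)"
    and g: "\<And>x. x \<in> space M \<Longrightarrow> g x \<in> C" "\<And>x. x \<in> space M \<Longrightarrow> (\<lambda>n. N (f n x - g x)) \<longlonglongrightarrow> 0"
  shows "strongly_measurable_in C N M g"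
proof (cases "space M = {}")
  case True
  then show ?thesis by (intro strongly_measurableI[where s="\<lambda>_ _. 0"]) auto
next
  case False
  have "\<exists>s. (\<forall>i::nat. simple_function M (s i)) \<and> (\<forall>i. \<forall>x\<in>space M. s i x \<in> C) \<and>
    (\<forall>x\<in>space M. (\<lambda>i. N (f n x - s i x)) \<longlonglongrightarrow> 0)" for n
    using strongly_measurableE[OF f[of n]] by metis
  then obtain s where s: "\<And>n i::nat. simple_function M (s n i)" "\<And>n i x. x \<in> space M \<Longrightarrow> s n i x \<in> C"
    "\<And>n x. x \<in> space M \<Longrightarrow> (\<lambda>i. N (f n x - s n i x)) \<longlonglongrightarrow> 0" by metis
  have fC: "f n x \<in> C" if "x \<in> space M" for n x using f that by (rule strongly_measurable_in_C)
  define Z where "Z = (\<Union>n i. s n i ` space M)"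
  have "countable Z" unfolding Z_def
    by (intro countable_UN countableI_type countable_finite simple_functionD(1)[OF s(1)])
  moreover have "Z \<noteq> {}" using False unfolding Z_def by auto
  ultimately have rZ: "range (from_nat_into Z) = Z" by (simp add: range_from_nat_into)
  define z where "z = from_nat_into Z"
  have zC: "z j \<in> C" for j
    using rZ s(2) unfolding z_def Z_def by (metis (no_types, lifting) UN_iff image_iff rangeI)
  have dense: "\<exists>j. N (g x - z j) < e" if x: "x \<in> space M" and e: "e > 0" for x e
  proof -
    obtain n where n: "N (f n x - g x) < e / 2"
      using order_tendstoD(2)[OF g(2)[OF x], of "e/2"] e by (auto simp: eventually_sequentially)
    obtain i where i: "N (f n x - s n i x) < e / 2"
      using order_tendstoD(2)[OF s(3)[OF x], of "e/2" n] e by (auto simp: eventually_sequentially)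
    have "s n i x \<in> Z" unfolding Z_def using x by blast
    then obtain j where j: "z j = s n i x" using rZ unfolding z_def by (metis imageE)
    have "N (g x - z j) \<le> N (g x - f n x) + N (f n x - s n i x)"
      unfolding j using g(1) fC s(2) x by (intro N_diff_triangle) auto
    also have "N (g x - f n x) = N (f n x - g x)" using g(1) fC x by (intro N_minus_commute) auto
    finally show ?thesis using n i by (intro exI[of _ j]) simp
  qed
  have meas: "(\<lambda>x. N (g x - z j)) \<in> borel_measurable M" for j
  proof (rule borel_measurable_LIMSEQ_real)
    show "(\<lambda>x. N (f n x - z j)) \<in> borel_measurable M" for n
      using f zC by (rule strongly_measurable_dist)
    fix x assume x: "x \<in> space M"
    show "(\<lambda>n. N (f n x - z j)) \<longlonglongrightarrow> N (g x - z j)"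
      using g x fC zC by (intro N_tendsto) auto
  qed
  define k where "k = (\<lambda>n x. LEAST j. j \<le> n \<and> (\<forall>i\<le>n. N (g x - z j) \<le> N (g x - z i)))"
  have ex: "\<exists>j. j \<le> n \<and> (\<forall>i\<le>n. N (g x - z j) \<le> N (g x - z i))" for n x
  proof -
    have "\<exists>j. j \<in> {..n} \<and> (\<forall>i\<in>{..n}. \<not> N (g x - z i) < N (g x - z j))"
      using ex_min_if_finite[of "(\<lambda>j. N (g x - z j)) ` {..n}"] by auto
    then show ?thesis by (metis atMost_iff not_less)
  qed
  have k: "k n x \<le> n" "i \<le> n \<Longrightarrow> N (g x - z (k n x)) \<le> N (g x - z i)" for n x i
    using LeastI_ex[OF ex[of n x]] unfolding k_def by auto
  have k_simple: "simple_function M (k n)" for n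
    unfolding simple_function_def
  proof (intro conjI ballI)
    show "finite (k n ` space M)" by (rule finite_subset[of _ "{..n}"]) (use k(1) in auto)
    have "Measurable.pred M (\<lambda>x. N (g x - z j) \<le> N (g x - z i))" for i j
      unfolding pred_def by (rule borel_measurable_le[OF meas meas])
    then have "k n \<in> measurable M (count_space UNIV)"
      unfolding k_def by (intro measurable_Least pred_intros_logic pred_intros_countable) auto
    then show "k n -` {j} \<inter> space M \<in> sets M" for j by (rule measurable_sets) auto
  qed
  show ?thesis
  proof (rule strongly_measurableI[where s="\<lambda>n x. z (k n x)"])
    fix x assume x: "x \<in> space M"
    show "(\<lambda>n. N (g x - z (k n x))) \<longlonglongrightarrow> 0"
    proof (rule LIMSEQ_I)
      fix e :: real assume "e > 0"
      then obtain j where j: "N (g x - z j) < e" using dense[OF x] by blast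
      have "norm (N (g x - z (k n x)) - 0) < e" if "n \<ge> j" for n
        using k(2)[OF that, of x] j g(1) x zC by auto
      then show "\<exists>no. \<forall>n\<ge>no. norm (N (g x - z (k n x)) - 0) < e" by blast
    qed
  qed (use g(1) zC k_simple in \<open>auto intro: simple_function_compose1\<close>)
qed

subsection \<open>Integrals of simple functions\<close>

abbreviation "sint \<equiv> Bochner_Integration.simple_bochner_integral"
abbreviation "sintegrable \<equiv> Bochner_Integration.simple_bochner_integrable"

lemma sintegrableD: "sintegrable M s \<Longrightarrow> simple_function M s"
  by (auto elim: simple_bochner_integrable.cases)

lemma sintegrableI_finite: "finite_measure M \<Longrightarrow> simple_function M s \<Longrightarrow> sintegrable M s"
  by (auto intro!: simple_bochner_integrable.intros simp: finite_measure.emeasure_finite)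

lemma sint_in_C: "(\<And>x. x \<in> space M \<Longrightarrow> s x \<in> C) \<Longrightarrow> sint M s \<in> C"
  unfolding simple_bochner_integral_def by (intro sum_in scale_in) auto

text \<open>The triangle inequality for finite sums, rewritten as an integral of the real simple
  function \<open>|N \<circ> s|\<close>; the absolute value matters only outside the space, where \<open>s\<close> may leave the carrier.\<close>

lemma N_sint_le:
  assumes s: "sintegrable M s" "\<And>x. x \<in> space M \<Longrightarrow> s x \<in> C"
  shows "ennreal (N (sint M s)) \<le> (\<integral>\<^sup>+x. ennreal (N (s x)) \<partial>M)"
proof -
  have fin: "finite (s ` space M)" using sintegrableD[OF s(1)] by (simp add: simple_function_def)
  have "N (sint M s) \<le> (\<Sum>y\<in>s ` space M. N (measure M {x \<in> space M. s x = y} *\<^sub>R y))"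
    unfolding simple_bochner_integral_def using fin s by (intro N_sum_le) auto
  also have "\<dots> = (\<Sum>y\<in>s ` space M. measure M {x \<in> space M. s x = y} *\<^sub>R \<bar>N y\<bar>)"
    using s by (intro sum.cong refl) (auto simp: N_scale)
  also have "\<dots> = sint M (\<lambda>x. \<bar>N (s x)\<bar>)"
    using s(1) by (intro simple_bochner_integral_partition[symmetric])
      (auto intro: simple_bochner_integrable_compose2[where p="\<lambda>x y. \<bar>N x\<bar>"] sintegrableD)
  finally have "ennreal (N (sint M s)) \<le> ennreal (sint M (\<lambda>x. \<bar>N (s x)\<bar>))" by (rule ennreal_leI)
  also have "\<dots> = (\<integral>\<^sup>+x. ennreal \<bar>N (s x)\<bar> \<partial>M)"
    using s(1) by (intro simple_bochner_integral_eq_nn_integral)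
      (auto intro: simple_bochner_integrable_compose2[where p="\<lambda>x y. \<bar>N x\<bar>"])
  also have "\<dots> = (\<integral>\<^sup>+x. ennreal (N (s x)) \<partial>M)"
    using s(2) by (intro nn_integral_cong) auto
  finally show ?thesis .
qed

subsection \<open>The integral\<close>

lemma has_bochner_integral_inE:
  assumes "has_bochner_integral_in C N M f I"
  obtains s where "strongly_measurable_in C N M f" "I \<in> C"
    "\<And>i::nat. sintegrable M (s i)" "\<And>i x. x \<in> space M \<Longrightarrow> s i x \<in> C"
    "(\<lambda>i. \<integral>\<^sup>+x. ennreal (N (f x - s i x)) \<partial>M) \<longlonglongrightarrow> 0" "(\<lambda>i. N (sint M (s i) - I)) \<longlonglongrightarrow> 0"
proof -
  from assms obtain s where "strongly_measurable_in C N M f" "I \<in> C"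
    and s: "\<forall>i::nat. sintegrable M (s i) \<and> s i ` space M \<subseteq> C"
    and "(\<lambda>i. \<integral>\<^sup>+x. ennreal (N (f x - s i x)) \<partial>M) \<longlonglongrightarrow> 0" "(\<lambda>i. N (sint M (s i) - I)) \<longlonglongrightarrow> 0"
    unfolding has_bochner_integral_in_def by blast
  then show ?thesis by (intro that[of s]) auto
qed

lemma has_bochner_integral_inI:
  assumes "strongly_measurable_in C N M f" "I \<in> C"
    "\<And>i::nat. sintegrable M (s i)" "\<And>i x. x \<in> space M \<Longrightarrow> s i x \<in> C"
    "(\<lambda>i. \<integral>\<^sup>+x. ennreal (N (f x - s i x)) \<partial>M) \<longlonglongrightarrow> 0" "(\<lambda>i. N (sint M (s i) - I)) \<longlonglongrightarrow> 0"
  shows "has_bochner_integral_in C N M f I"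
  unfolding has_bochner_integral_in_def using assms by (intro conjI exI[of _ s]) auto

lemma ennreal_N_add_le:
  "x \<in> C \<Longrightarrow> y \<in> C \<Longrightarrow> ennreal (N (x + y)) \<le> ennreal (N x) + ennreal (N y)"
  using N_triangle[of x y] by (simp flip: ennreal_plus add: ennreal_leI)

lemma nn_integral_N_add_le:
  assumes "strongly_measurable_in C N M f" "strongly_measurable_in C N M g"
  shows "(\<integral>\<^sup>+x. ennreal (N (f x + g x)) \<partial>M)
    \<le> (\<integral>\<^sup>+x. ennreal (N (f x)) \<partial>M) + (\<integral>\<^sup>+x. ennreal (N (g x)) \<partial>M)"
proof -
  have "(\<integral>\<^sup>+x. ennreal (N (f x + g x)) \<partial>M) \<le> (\<integral>\<^sup>+x. ennreal (N (f x)) + ennreal (N (g x)) \<partial>M)"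
    using assms by (intro nn_integral_mono ennreal_N_add_le) (auto intro: strongly_measurable_in_C)
  also have "\<dots> = (\<integral>\<^sup>+x. ennreal (N (f x)) \<partial>M) + (\<integral>\<^sup>+x. ennreal (N (g x)) \<partial>M)"
    using assms[THEN strongly_measurable_norm] by (intro nn_integral_add) auto
  finally show ?thesis .
qed

lemma has_bochner_integral_in_bound:
  assumes "has_bochner_integral_in C N M f I"
  shows "ennreal (N I) \<le> (\<integral>\<^sup>+x. ennreal (N (f x)) \<partial>M)"
proof -
  obtain s where f: "strongly_measurable_in C N M f" and I: "I \<in> C"
    and s: "\<And>i::nat. sintegrable M (s i)" "\<And>i x. x \<in> space M \<Longrightarrow> s i x \<in> C"
    and lim: "(\<lambda>i. \<integral>\<^sup>+x. ennreal (N (f x - s i x)) \<partial>M) \<longlonglongrightarrow> 0" "(\<lambda>i. N (sint M (s i) - I)) \<longlonglongrightarrow> 0"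
    by (rule has_bochner_integral_inE[OF assms], rule that)
  have fC: "f x \<in> C" if "x \<in> space M" for x using f that by (rule strongly_measurable_in_C)
  have sm_s: "strongly_measurable_in C N M (s i)" for i
    using s by (intro strongly_measurable_simple) (auto intro: sintegrableD)
  have le: "ennreal (N I) \<le> (\<integral>\<^sup>+x. ennreal (N (f x)) \<partial>M) + (\<integral>\<^sup>+x. ennreal (N (f x - s i x)) \<partial>M)
      + ennreal (N (sint M (s i) - I))" for i
  proof -
    have si: "sint M (s i) \<in> C" using s(2) by (rule sint_in_C)
    have "ennreal (N I) \<le> ennreal (N (sint M (s i))) + ennreal (N (I - sint M (s i)))"
      using ennreal_N_add_le[OF si diff_in[OF I si]] by simp
    also have "N (I - sint M (s i)) = N (sint M (s i) - I)" using I si by (rule N_minus_commute)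
    also have "ennreal (N (sint M (s i))) \<le> (\<integral>\<^sup>+x. ennreal (N (s i x)) \<partial>M)"
      by (intro N_sint_le s)
    also have "\<dots> = (\<integral>\<^sup>+x. ennreal (N (f x + (s i x - f x))) \<partial>M)" by simp
    also have "\<dots> \<le> (\<integral>\<^sup>+x. ennreal (N (f x)) \<partial>M) + (\<integral>\<^sup>+x. ennreal (N (s i x - f x)) \<partial>M)"
      by (intro nn_integral_N_add_le strongly_measurable_diff f sm_s)
    also have "(\<integral>\<^sup>+x. ennreal (N (s i x - f x)) \<partial>M) = (\<integral>\<^sup>+x. ennreal (N (f x - s i x)) \<partial>M)"
      using fC s(2) by (intro nn_integral_cong arg_cong[of _ _ ennreal] N_minus_commute) auto
    finally show ?thesis by (simp add: add_right_mono)
  qed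
  have "(\<lambda>i. (\<integral>\<^sup>+x. ennreal (N (f x)) \<partial>M) + (\<integral>\<^sup>+x. ennreal (N (f x - s i x)) \<partial>M)
      + ennreal (N (sint M (s i) - I))) \<longlonglongrightarrow> (\<integral>\<^sup>+x. ennreal (N (f x)) \<partial>M) + 0 + ennreal 0"
    by (intro tendsto_add tendsto_const tendsto_ennrealI lim)
  from LIMSEQ_le_const[OF this] le show ?thesis by auto
qed

lemma has_bochner_integral_in_add:
  assumes "has_bochner_integral_in C N M f I" "has_bochner_integral_in C N M g J"
  shows "has_bochner_integral_in C N M (\<lambda>x. f x + g x) (I + J)"
proof -
  obtain s where f: "strongly_measurable_in C N M f" and I: "I \<in> C"
    and s: "\<And>i::nat. sintegrable M (s i)" "\<And>i x. x \<in> space M \<Longrightarrow> s i x \<in> C"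
    and sl: "(\<lambda>i. \<integral>\<^sup>+x. ennreal (N (f x - s i x)) \<partial>M) \<longlonglongrightarrow> 0" "(\<lambda>i. N (sint M (s i) - I)) \<longlonglongrightarrow> 0"
    by (rule has_bochner_integral_inE[OF assms(1)], rule that)
  obtain t where g: "strongly_measurable_in C N M g" and J: "J \<in> C"
    and t: "\<And>i::nat. sintegrable M (t i)" "\<And>i x. x \<in> space M \<Longrightarrow> t i x \<in> C"
    and tl: "(\<lambda>i. \<integral>\<^sup>+x. ennreal (N (g x - t i x)) \<partial>M) \<longlonglongrightarrow> 0" "(\<lambda>i. N (sint M (t i) - J)) \<longlonglongrightarrow> 0"
    by (rule has_bochner_integral_inE[OF assms(2)], rule that)
  note sm = strongly_measurable_diff[OF f strongly_measurable_simple[OF sintegrableD[OF s(1)]]]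
    strongly_measurable_diff[OF g strongly_measurable_simple[OF sintegrableD[OF t(1)]]]
  show ?thesis
  proof (rule has_bochner_integral_inI[where s="\<lambda>i x. s i x + t i x"])
    show "strongly_measurable_in C N M (\<lambda>x. f x + g x)" using f g by (rule strongly_measurable_add)
    show "sintegrable M (\<lambda>x. s i x + t i x)" for i
      by (rule simple_bochner_integrable_compose2[where p="(+)", OF _ s(1) t(1)]) simp
    show "(\<lambda>i. \<integral>\<^sup>+x. ennreal (N (f x + g x - (s i x + t i x))) \<partial>M) \<longlonglongrightarrow> 0"
    proof (rule tendsto_sandwich[OF _ _ tendsto_const])
      show "\<forall>\<^sub>F i in sequentially. (\<integral>\<^sup>+x. ennreal (N (f x + g x - (s i x + t i x))) \<partial>M)
        \<le> (\<integral>\<^sup>+x. ennreal (N (f x - s i x)) \<partial>M) + (\<integral>\<^sup>+x. ennreal (N (g x - t i x)) \<partial>M)"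
        using nn_integral_N_add_le[OF sm] s(2) t(2) by (auto simp: algebra_simps)
      show "(\<lambda>i. (\<integral>\<^sup>+x. ennreal (N (f x - s i x)) \<partial>M) + (\<integral>\<^sup>+x. ennreal (N (g x - t i x)) \<partial>M)) \<longlonglongrightarrow> 0"
        using tendsto_add[OF sl(1) tl(1)] by simp
    qed auto
    have si: "sint M (s i) \<in> C" "sint M (t i) \<in> C" for i using s(2) t(2) by (auto intro: sint_in_C)
    show "(\<lambda>i. N (sint M (\<lambda>x. s i x + t i x) - (I + J))) \<longlonglongrightarrow> 0"
    proof (rule Lim_null_comparison[OF always_eventually], intro allI)
      fix i
      have eq: "sint M (\<lambda>x. s i x + t i x) - (I + J) = (sint M (s i) - I) + (sint M (t i) - J)"
        using simple_bochner_integral_add[OF s(1)[of i] t(1)[of i]] by simp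
      show "norm (N (sint M (\<lambda>x. s i x + t i x) - (I + J))) \<le> N (sint M (s i) - I) + N (sint M (t i) - J)"
        unfolding eq using si I J N_triangle[of "sint M (s i) - I" "sint M (t i) - J"]
          N_nonneg[of "(sint M (s i) - I) + (sint M (t i) - J)"] by simp
      show "(\<lambda>i. N (sint M (s i) - I) + N (sint M (t i) - J)) \<longlonglongrightarrow> 0"
        using tendsto_add[OF sl(2) tl(2)] by simp
    qed
  qed (use s t I J in auto)
qed

lemma has_bochner_integral_in_scale:
  assumes "has_bochner_integral_in C N M f I"
  shows "has_bochner_integral_in C N M (\<lambda>x. c *\<^sub>R f x) (c *\<^sub>R I)"
proof -
  obtain s where f: "strongly_measurable_in C N M f" and I: "I \<in> C"
    and s: "\<And>i::nat. sintegrable M (s i)" "\<And>i x. x \<in> space M \<Longrightarrow> s i x \<in> C"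
    and sl: "(\<lambda>i. \<integral>\<^sup>+x. ennreal (N (f x - s i x)) \<partial>M) \<longlonglongrightarrow> 0" "(\<lambda>i. N (sint M (s i) - I)) \<longlonglongrightarrow> 0"
    by (rule has_bochner_integral_inE[OF assms(1)], rule that)
  have fC: "f x \<in> C" if "x \<in> space M" for x using f that by (rule strongly_measurable_in_C)
  show ?thesis
  proof (rule has_bochner_integral_inI[where s="\<lambda>i x. c *\<^sub>R s i x"])
    show "strongly_measurable_in C N M (\<lambda>x. c *\<^sub>R f x)" using f by (rule strongly_measurable_scale)
    show "sintegrable M (\<lambda>x. c *\<^sub>R s i x)" for i
      by (rule simple_bochner_integrable_compose2[where p="\<lambda>x y. c *\<^sub>R x", OF _ s(1) s(1)]) simp
    have "(\<integral>\<^sup>+x. ennreal (N (c *\<^sub>R f x - c *\<^sub>R s i x)) \<partial>M) = ennreal \<bar>c\<bar> * (\<integral>\<^sup>+x. ennreal (N (f x - s i x)) \<partial>M)" for i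
    proof -
      have "(\<integral>\<^sup>+x. ennreal (N (c *\<^sub>R f x - c *\<^sub>R s i x)) \<partial>M) = (\<integral>\<^sup>+x. ennreal \<bar>c\<bar> * ennreal (N (f x - s i x)) \<partial>M)"
        using fC s(2) by (intro nn_integral_cong)
          (simp add: N_scale ennreal_mult flip: scaleR_diff_right)
      also have "\<dots> = ennreal \<bar>c\<bar> * (\<integral>\<^sup>+x. ennreal (N (f x - s i x)) \<partial>M)"
        using strongly_measurable_norm[OF strongly_measurable_diff[OF f strongly_measurable_simple[OF sintegrableD[OF s(1)]]]] s(2)
        by (intro nn_integral_cmult) auto
      finally show ?thesis .
    qed
    then show "(\<lambda>i. \<integral>\<^sup>+x. ennreal (N (c *\<^sub>R f x - c *\<^sub>R s i x)) \<partial>M) \<longlonglongrightarrow> 0"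
      using ennreal_tendsto_cmult[OF _ sl(1), of "ennreal \<bar>c\<bar>"] by simp
    have lin: "linear (\<lambda>x. c *\<^sub>R x :: 'e)" by (rule linearI) (auto simp: algebra_simps)
    have "N (sint M (\<lambda>x. c *\<^sub>R s i x) - c *\<^sub>R I) = \<bar>c\<bar> * N (sint M (s i) - I)" for i
    proof -
      have "sint M (s i) - I \<in> C" using sint_in_C[of M "s i"] s(2) I by auto
      then show ?thesis using simple_bochner_integral_linear[OF lin s(1)[of i]] N_scale[of "sint M (s i) - I" c]
        by (simp add: scaleR_diff_right)
    qed
    then show "(\<lambda>i. N (sint M (\<lambda>x. c *\<^sub>R s i x) - c *\<^sub>R I)) \<longlonglongrightarrow> 0"
      using tendsto_mult_left[OF sl(2), of "\<bar>c\<bar>"] by simp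
  qed (use s I in auto)
qed

lemma has_bochner_integral_in_diff:
  assumes "has_bochner_integral_in C N M f I" "has_bochner_integral_in C N M g J"
  shows "has_bochner_integral_in C N M (\<lambda>x. f x - g x) (I - J)"
  using has_bochner_integral_in_add[OF assms(1) has_bochner_integral_in_scale[OF assms(2), of "-1"]] by simp

text \<open>The difference of the integrals is an integral of the difference of the
  integrands, and the norm bound applies to it.\<close>

lemma has_bochner_integral_in_AE_unique:
  assumes "has_bochner_integral_in C N M f I" "has_bochner_integral_in C N M g J"
    and "AE x in M. N (f x - g x) = 0"
  shows "N (I - J) = 0"
proof -
  have "ennreal (N (I - J)) \<le> (\<integral>\<^sup>+x. ennreal (N (f x - g x)) \<partial>M)"
    using assms by (intro has_bochner_integral_in_bound has_bochner_integral_in_diff)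
  also have "\<dots> = (\<integral>\<^sup>+x. 0 \<partial>M)" using assms(3) by (intro nn_integral_cong_AE) auto
  finally have "N (I - J) \<le> 0" by (simp add: ennreal_eq_0_iff)
  moreover have "I \<in> C" "J \<in> C" using assms by (auto simp: has_bochner_integral_in_def)
  ultimately show ?thesis by (simp add: order_antisym)
qed

lemma has_bochner_integral_in_unique:
  assumes "has_bochner_integral_in C N M f I" "has_bochner_integral_in C N M f J"
  shows "N (I - J) = 0"
  using assms by (rule has_bochner_integral_in_AE_unique) simp

lemma has_bochner_integral_in_bound_real:
  assumes "has_bochner_integral_in C N M f I" and "integrable M (\<lambda>x. N (f x))"
  shows "N I \<le> (LINT x|M. N (f x))"
proof -
  have f: "\<And>x. x \<in> space M \<Longrightarrow> f x \<in> C"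
    using assms(1) unfolding has_bochner_integral_in_def by (auto intro: strongly_measurable_in_C)
  have "ennreal (N I) \<le> (\<integral>\<^sup>+x. ennreal (N (f x)) \<partial>M)" using assms(1) by (rule has_bochner_integral_in_bound)
  also have "\<dots> = ennreal (LINT x|M. N (f x))"
    using assms(2) f by (intro nn_integral_eq_integral) auto
  finally show ?thesis
    using f by (subst (asm) ennreal_le_iff) (auto intro: Bochner_Integration.integral_nonneg)
qed

text \<open>Approximating simple functions are cut off where they exceed twice the integrand, so that the
  dominated convergence theorem applies; completeness turns their integrals into a limit.\<close>

lemma has_bochner_integral_in_exists:
  assumes complete: "complete_in C N" and "finite_measure M"
    and f: "bochner_integrable_in C N M f"
  obtains I where "has_bochner_integral_in C N M f I"
proof -
  interpret finite_measure M by fact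
  have sm: "strongly_measurable_in C N M f" and int: "integrable M (\<lambda>x. N (f x))"
    using f unfolding bochner_integrable_in_def by auto
  obtain s where s: "\<And>i::nat. simple_function M (s i)" "\<And>i x. x \<in> space M \<Longrightarrow> s i x \<in> C"
    "\<And>x. x \<in> space M \<Longrightarrow> (\<lambda>i. N (f x - s i x)) \<longlonglongrightarrow> 0" "\<And>x. x \<in> space M \<Longrightarrow> f x \<in> C"
    using strongly_measurableE[OF sm] by blast
  note [measurable] = strongly_measurable_norm[OF sm]
  have [measurable]: "(\<lambda>x. N (s i x)) \<in> borel_measurable M" for i
    using s by (intro strongly_measurable_norm strongly_measurable_simple) auto
  define t where "t = (\<lambda>i x. if N (s i x) \<le> 2 * N (f x) then s i x else 0)"
  have tC: "t i x \<in> C" if "x \<in> space M" for i x using s(2) that unfolding t_def by auto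
  have t_simple: "simple_function M (t i)" for i
    unfolding t_def using s(1) by (intro simple_function_If) auto
  have t_bound: "N (f x - t i x) \<le> 3 * N (f x)" if x: "x \<in> space M" for i x
    using N_diff_le[of "f x" "t i x"] s(4) tC x unfolding t_def by auto
  have t_lim: "(\<lambda>i. N (f x - t i x)) \<longlonglongrightarrow> 0" if x: "x \<in> space M" for x
  proof (cases "N (f x) = 0")
    case True
    have "N (f x - t i x) = 0" for i
    proof -
      have "f x - t i x \<in> C" using s(4) tC x by auto
      then show ?thesis using t_bound[OF x, of i] N_nonneg[of "f x - t i x"] True by (simp add: order_antisym)
    qed
    then show ?thesis by simp
  next
    case False
    then have pos: "N (f x) > 0" using s(4)[OF x] N_nonneg[of "f x"] by linarith
    have "\<forall>\<^sub>F i in sequentially. N (f x - s i x) < N (f x)"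
      using order_tendstoD(2)[OF s(3)[OF x] pos] .
    then have "\<forall>\<^sub>F i in sequentially. N (f x - s i x) = N (f x - t i x)"
    proof eventually_elim
      case (elim i)
      have "N (s i x) \<le> N (f x) + N (f x - s i x)"
        using N_diff_le[of "f x" "f x - s i x"] s(2,4) x by simp
      then show ?case using elim by (simp add: t_def)
    qed
    from Lim_transform_eventually[OF s(3)[OF x] this] show ?thesis .
  qed
  have sm_t: "strongly_measurable_in C N M (t i)" for i
    using t_simple tC by (rule strongly_measurable_simple)
  have t_sm: "strongly_measurable_in C N M (\<lambda>x. f x - t i x)" for i
    using sm sm_t by (rule strongly_measurable_diff)
  have lim: "(\<lambda>i. \<integral>\<^sup>+x. ennreal (N (f x - t i x)) \<partial>M) \<longlonglongrightarrow> (\<integral>\<^sup>+x. 0 \<partial>M)"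
  proof (rule nn_integral_dominated_convergence[where w="\<lambda>x. ennreal (3 * N (f x))"])
    show "(\<lambda>x. ennreal (N (f x - t i x))) \<in> borel_measurable M" for i
      using strongly_measurable_norm[OF t_sm] by simp
    show "AE x in M. ennreal (N (f x - t i x)) \<le> ennreal (3 * N (f x))" for i
      using t_bound by (auto intro!: AE_I2 ennreal_leI)
    show "(\<integral>\<^sup>+x. ennreal (3 * N (f x)) \<partial>M) < \<infinity>"
      using int s(4) by (subst nn_integral_eq_integral) auto
    show "AE x in M. (\<lambda>i. ennreal (N (f x - t i x))) \<longlonglongrightarrow> 0"
      using tendsto_ennrealI[OF t_lim] by (intro AE_I2) auto
  qed auto
  have t_int: "sintegrable M (t i)" for i by (rule sintegrableI_finite[OF assms(2) t_simple])
  have int_t: "integrable M (\<lambda>x. N (f x - t i x))" for i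
  proof (rule Bochner_Integration.integrable_bound[of M "\<lambda>x. 3 * N (f x)"])
    show "AE x in M. norm (N (f x - t i x)) \<le> norm (3 * N (f x))"
      using t_bound s(4) tC by (intro AE_I2) auto
  qed (use int strongly_measurable_norm[OF t_sm] in auto)
  define b where "b = (\<lambda>i. LINT x|M. N (f x - t i x))"
  have b_nn: "ennreal (b i) = (\<integral>\<^sup>+x. ennreal (N (f x - t i x)) \<partial>M)" for i
    unfolding b_def using int_t s(4) tC by (intro nn_integral_eq_integral[symmetric]) auto
  have b0: "b i \<ge> 0" for i
    unfolding b_def using s(4) tC by (intro Bochner_Integration.integral_nonneg) auto
  have "(\<lambda>i. ennreal (b i)) \<longlonglongrightarrow> ennreal 0" using lim by (simp add: b_nn)
  then have b_lim: "b \<longlonglongrightarrow> 0" using b0 by (subst (asm) tendsto_ennreal_iff) auto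
  obtain I where I: "I \<in> C" "(\<lambda>i. N (sint M (t i) - I)) \<longlonglongrightarrow> 0"
  proof (rule complete_in_bound[OF complete _ b_lim, of "\<lambda>i. sint M (t i)"])
    show "sint M (t i) \<in> C" for i using tC by (rule sint_in_C)
    fix m n
    have sm': "strongly_measurable_in C N M (\<lambda>x. t m x - f x)"
      using sm_t sm by (rule strongly_measurable_diff)
    have "ennreal (N (sint M (t m) - sint M (t n))) = ennreal (N (sint M (\<lambda>x. t m x - t n x)))"
      using t_int by (simp add: simple_bochner_integral_diff)
    also have "\<dots> \<le> (\<integral>\<^sup>+x. ennreal (N (t m x - t n x)) \<partial>M)"
      using tC by (intro N_sint_le simple_bochner_integrable_compose2[where p="(-)", OF _ t_int t_int]) auto
    also have "\<dots> = (\<integral>\<^sup>+x. ennreal (N ((t m x - f x) + (f x - t n x))) \<partial>M)" by simp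
    also have "\<dots> \<le> (\<integral>\<^sup>+x. ennreal (N (t m x - f x)) \<partial>M) + (\<integral>\<^sup>+x. ennreal (N (f x - t n x)) \<partial>M)"
      by (intro nn_integral_N_add_le sm' t_sm)
    also have "(\<integral>\<^sup>+x. ennreal (N (t m x - f x)) \<partial>M) = ennreal (b m)"
      unfolding b_nn using s(4) tC by (intro nn_integral_cong arg_cong[of _ _ ennreal] N_minus_commute) auto
    also have "(\<integral>\<^sup>+x. ennreal (N (f x - t n x)) \<partial>M) = ennreal (b n)" by (simp add: b_nn)
    finally show "N (sint M (t m) - sint M (t n)) \<le> b m + b n"
      using b0 by (simp flip: ennreal_plus)
  qed auto
  have "has_bochner_integral_in C N M f I"
    by (rule has_bochner_integral_inI[OF sm I(1) t_int tC _ I(2)]) (use lim in auto)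
  then show ?thesis by (rule that)
qed

text \<open>The functional is moved inside the finite sums that define the integrals of the approximating
  simple functions; its bound controls the error on both sides of the equation.\<close>

lemma has_bochner_integral_in_functional:
  fixes l :: "'e \<Rightarrow> real"
  assumes I: "has_bochner_integral_in C N M f I"
    and l_add: "\<And>x y. x \<in> C \<Longrightarrow> y \<in> C \<Longrightarrow> l (x + y) = l x + l y"
    and l_scale: "\<And>x a. x \<in> C \<Longrightarrow> l (a *\<^sub>R x) = a * l x"
    and l_bound: "\<And>x. x \<in> C \<Longrightarrow> \<bar>l x\<bar> \<le> c * N x"
  shows "has_bochner_integral M (\<lambda>x. l (f x)) (l I)"
proof -
  obtain s where f: "strongly_measurable_in C N M f" and IC: "I \<in> C"
    and s: "\<And>i::nat. sintegrable M (s i)" "\<And>i x. x \<in> space M \<Longrightarrow> s i x \<in> C"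
    and lim: "(\<lambda>i. \<integral>\<^sup>+x. ennreal (N (f x - s i x)) \<partial>M) \<longlonglongrightarrow> 0" "(\<lambda>i. N (sint M (s i) - I)) \<longlonglongrightarrow> 0"
    by (rule has_bochner_integral_inE[OF I], rule that)
  have fC: "f x \<in> C" if "x \<in> space M" for x using f that by (rule strongly_measurable_in_C)
  have l0: "l 0 = 0" using l_scale[of 0 0] by simp
  have l_diff: "l (a - b) = l a - l b" if "a \<in> C" "b \<in> C" for a b
    using l_add[of "a - b" b] that by simp
  have l_sum: "l (sum g A) = (\<Sum>i\<in>A. l (g i))" if "finite A" "\<And>i. i \<in> A \<Longrightarrow> g i \<in> C" for g and A :: "'e set"
    using that by (induction A rule: finite_induct) (auto simp: l0 l_add sum_in)
  have l_bound': "\<bar>l x\<bar> \<le> \<bar>c\<bar> * N x" if "x \<in> C" for x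
    using l_bound[OF that] mult_right_mono[OF abs_ge_self[of c] N_nonneg[OF that]] by linarith
  have "strongly_measurable_in UNIV norm M (\<lambda>x. l (f x))"
    using f l_bound l_diff by (intro strongly_measurable_compose[where c=c and L=l])
      (auto simp: l_diff[symmetric])
  then obtain r where r: "\<And>i::nat. simple_function M (r i)"
      "\<And>x. x \<in> space M \<Longrightarrow> (\<lambda>i. norm (l (f x) - r i x)) \<longlonglongrightarrow> 0"
    unfolding strongly_measurable_in_def by blast
  have meas: "(\<lambda>x. l (f x)) \<in> borel_measurable M"
  proof (rule borel_measurable_LIMSEQ_real)
    show "r i \<in> borel_measurable M" for i using r(1) by (rule borel_measurable_simple_function)
    show "(\<lambda>i. r i x) \<longlonglongrightarrow> l (f x)" if "x \<in> space M" for x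
    proof -
      have "(\<lambda>i. l (f x) - r i x) \<longlonglongrightarrow> 0" using r(2)[OF that] by (rule tendsto_norm_zero_cancel)
      from tendsto_diff[OF tendsto_const[of "l (f x)"] this] show ?thesis by simp
    qed
  qed
  have ls: "sintegrable M (\<lambda>x. l (s i x))" for i
    by (rule simple_bochner_integrable_compose2[where p="\<lambda>x y. l x", OF _ s(1) s(1)]) (rule l0)
  have "(\<lambda>i. \<integral>\<^sup>+x. ennreal (norm (l (f x) - l (s i x))) \<partial>M) \<longlonglongrightarrow> 0"
  proof (rule tendsto_sandwich[OF _ _ tendsto_const])
    show "\<forall>\<^sub>F i in sequentially. (\<integral>\<^sup>+x. ennreal (norm (l (f x) - l (s i x))) \<partial>M)
        \<le> ennreal \<bar>c\<bar> * (\<integral>\<^sup>+x. ennreal (N (f x - s i x)) \<partial>M)"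
    proof (intro always_eventually allI)
      fix i
      have "(\<integral>\<^sup>+x. ennreal (norm (l (f x) - l (s i x))) \<partial>M)
          \<le> (\<integral>\<^sup>+x. ennreal \<bar>c\<bar> * ennreal (N (f x - s i x)) \<partial>M)"
      proof (rule nn_integral_mono)
        fix x assume x: "x \<in> space M"
        have "norm (l (f x) - l (s i x)) \<le> \<bar>c\<bar> * N (f x - s i x)"
          using l_bound'[of "f x - s i x"] fC s(2) x by (simp add: l_diff)
        then show "ennreal (norm (l (f x) - l (s i x))) \<le> ennreal \<bar>c\<bar> * ennreal (N (f x - s i x))"
          using fC s(2) x by (simp add: ennreal_leI flip: ennreal_mult)
      qed
      also have "\<dots> = ennreal \<bar>c\<bar> * (\<integral>\<^sup>+x. ennreal (N (f x - s i x)) \<partial>M)"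
        using strongly_measurable_norm[OF strongly_measurable_diff[OF f strongly_measurable_simple[OF sintegrableD[OF s(1)]]]] s(2)
        by (intro nn_integral_cmult) auto
      finally show "(\<integral>\<^sup>+x. ennreal (norm (l (f x) - l (s i x))) \<partial>M)
        \<le> ennreal \<bar>c\<bar> * (\<integral>\<^sup>+x. ennreal (N (f x - s i x)) \<partial>M)" .
    qed
    show "(\<lambda>i. ennreal \<bar>c\<bar> * (\<integral>\<^sup>+x. ennreal (N (f x - s i x)) \<partial>M)) \<longlonglongrightarrow> 0"
      using ennreal_tendsto_cmult[OF _ lim(1), of "ennreal \<bar>c\<bar>"] by simp
  qed auto
  moreover have "(\<lambda>i. sint M (\<lambda>x. l (s i x))) \<longlonglongrightarrow> l I"
  proof -
    have eq: "sint M (\<lambda>x. l (s i x)) = l (sint M (s i))" for i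
    proof -
      have fin: "finite (s i ` space M)" using sintegrableD[OF s(1)] by (simp add: simple_function_def)
      have "sint M (\<lambda>x. l (s i x)) = (\<Sum>y\<in>s i ` space M. measure M {x \<in> space M. s i x = y} *\<^sub>R l y)"
        by (rule simple_bochner_integral_partition) (auto intro: ls sintegrableD[OF s(1)])
      also have "\<dots> = l (sint M (s i))"
        unfolding simple_bochner_integral_def using fin s(2)
        by (subst l_sum) (auto simp: l_scale intro!: sum.cong)
      finally show ?thesis .
    qed
    have siC: "sint M (s i) \<in> C" for i using s(2) by (rule sint_in_C)
    have "(\<lambda>i. sint M (\<lambda>x. l (s i x)) - l I) \<longlonglongrightarrow> 0"
    proof (rule Lim_null_comparison[OF always_eventually])
      show "\<forall>i. norm (sint M (\<lambda>x. l (s i x)) - l I) \<le> c * N (sint M (s i) - I)"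
        using l_bound[OF diff_in[OF siC IC]] by (simp add: eq l_diff siC IC)
      show "(\<lambda>i. c * N (sint M (s i) - I)) \<longlonglongrightarrow> 0" using tendsto_mult_left[OF lim(2), of c] by simp
    qed
    then show ?thesis by (simp add: LIM_zero_iff)
  qed
  ultimately show ?thesis using meas ls by (intro has_bochner_integral.intros) auto
qed

end


section \<open>Square integrable functions with values in a carrier\<close>

definition square_integrable_in ::
  "'e set \<Rightarrow> ('e \<Rightarrow> real) \<Rightarrow> 'a measure \<Rightarrow> ('a \<Rightarrow> 'e::real_vector) set"
  where "square_integrable_in C N M =
    {f. strongly_measurable_in C N M f \<and> integrable M (\<lambda>x. (N (f x))\<^sup>2)}"

text \<open>This connects the measurability of carrier-valued functions with the Borel measurability
  used for \<open>L2\<close> and for weak gradients.\<close>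

lemma strongly_measurable_in_UNIV_iff:
  fixes f :: "'a \<Rightarrow> 'b::{real_normed_vector, second_countable_topology}"
  shows "strongly_measurable_in UNIV norm M f \<longleftrightarrow> f \<in> borel_measurable M"
proof
  assume "strongly_measurable_in UNIV norm M f"
  then obtain r where r: "\<And>i::nat. simple_function M (r i)"
      "\<And>x. x \<in> space M \<Longrightarrow> (\<lambda>i. norm (f x - r i x)) \<longlonglongrightarrow> 0"
    unfolding strongly_measurable_in_def by blast
  show "f \<in> borel_measurable M"
  proof (rule borel_measurable_LIMSEQ_metric)
    show "r i \<in> borel_measurable M" for i using r(1) by (rule borel_measurable_simple_function)
    show "(\<lambda>i. r i x) \<longlonglongrightarrow> f x" if "x \<in> space M" for x
    proof -
      have "(\<lambda>i. f x - r i x) \<longlonglongrightarrow> 0" using r(2)[OF that] by (rule tendsto_norm_zero_cancel)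
      from tendsto_diff[OF tendsto_const[of "f x"] this] show ?thesis by simp
    qed
  qed
next
  assume f: "f \<in> borel_measurable M"
  obtain r where r: "\<And>i::nat. simple_function M (r i)" "\<And>x. x \<in> space M \<Longrightarrow> (\<lambda>i. r i x) \<longlonglongrightarrow> f x"
    using borel_measurable_implies_sequence_metric[OF f, of 0] by blast
  have "(\<lambda>i. norm (f x - r i x)) \<longlonglongrightarrow> 0" if "x \<in> space M" for x
    using tendsto_norm[OF tendsto_diff[OF tendsto_const[of "f x"] r(2)[OF that]]] by simp
  then show "strongly_measurable_in UNIV norm M f"
    unfolding strongly_measurable_in_def using r(1) by blast
qed

context semi_inner_space begin

abbreviation "Lsq M \<equiv> square_integrable_in C Nip M"

lemma LsqD:
  assumes "f \<in> Lsq M"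
  shows "strongly_measurable_in C Nip M f" "integrable M (\<lambda>x. (Nip (f x))\<^sup>2)" "x \<in> space M \<Longrightarrow> f x \<in> C"
  using assms strongly_measurable_in_C by (auto simp: square_integrable_in_def)

lemma polarization: "x \<in> C \<Longrightarrow> y \<in> C \<Longrightarrow> ip x y = ((Nip (x + y))\<^sup>2 - (Nip (x - y))\<^sup>2) / 4"
  by (simp add: Nip_sq ip_add_self ip_diff_self)

text \<open>Polarization reduces inner products to norms, whose measurability is known.\<close>

lemma borel_measurable_ip:
  assumes "strongly_measurable_in C Nip M f" "strongly_measurable_in C Nip M g"
  shows "(\<lambda>x. ip (f x) (g x)) \<in> borel_measurable M"
proof -
  note [measurable] = strongly_measurable_norm[OF strongly_measurable_add[OF assms]]
    strongly_measurable_norm[OF strongly_measurable_diff[OF assms]]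
  have "(\<lambda>x. ((Nip (f x + g x))\<^sup>2 - (Nip (f x - g x))\<^sup>2) / 4) \<in> borel_measurable M" by measurable
  then show ?thesis
    using assms[THEN strongly_measurable_in_C] by (subst measurable_cong[OF polarization]) auto
qed

lemma integrable_ip:
  assumes f: "f \<in> Lsq M" and g: "g \<in> Lsq M"
  shows "integrable M (\<lambda>x. ip (f x) (g x))"
proof (rule Bochner_Integration.integrable_bound)
  show "integrable M (\<lambda>x. (Nip (f x))\<^sup>2 + (Nip (g x))\<^sup>2)"
    using LsqD(2)[OF f] LsqD(2)[OF g] by simp
  show "(\<lambda>x. ip (f x) (g x)) \<in> borel_measurable M"
    using LsqD(1)[OF f] LsqD(1)[OF g] by (rule borel_measurable_ip)
  have "\<bar>ip (f x) (g x)\<bar> \<le> (Nip (f x))\<^sup>2 + (Nip (g x))\<^sup>2" if "x \<in> space M" for x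
  proof -
    have "\<bar>ip (f x) (g x)\<bar> \<le> Nip (f x) * Nip (g x)"
      using LsqD(3)[OF f that] LsqD(3)[OF g that] by (rule Cauchy_Schwarz)
    also have "\<dots> \<le> (Nip (f x))\<^sup>2 + (Nip (g x))\<^sup>2"
      using sum_squares_bound[of "Nip (f x)" "Nip (g x)"] mult_nonneg_nonneg[of "Nip (f x)" "Nip (g x)"]
        LsqD(3)[OF f that] LsqD(3)[OF g that] by (simp del: mult_nonneg_nonneg)
    finally show ?thesis .
  qed
  then show "AE x in M. norm (ip (f x) (g x)) \<le> norm ((Nip (f x))\<^sup>2 + (Nip (g x))\<^sup>2)" by auto
qed

lemma Lsq_add:
  assumes f: "f \<in> Lsq M" and g: "g \<in> Lsq M"
  shows "f + g \<in> Lsq M"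
  unfolding square_integrable_in_def plus_fun_def
proof (intro CollectI conjI)
  show "strongly_measurable_in C Nip M (\<lambda>x. f x + g x)"
    using LsqD(1)[OF f] LsqD(1)[OF g] by (rule strongly_measurable_add)
  have "integrable M (\<lambda>x. (Nip (f x))\<^sup>2 + 2 * ip (f x) (g x) + (Nip (g x))\<^sup>2)"
    using LsqD(2)[OF f] LsqD(2)[OF g] integrable_ip[OF f g] by simp
  moreover have "integrable M (\<lambda>x. (Nip (f x + g x))\<^sup>2) \<longleftrightarrow>
      integrable M (\<lambda>x. (Nip (f x))\<^sup>2 + 2 * ip (f x) (g x) + (Nip (g x))\<^sup>2)"
    using LsqD(3)[OF f] LsqD(3)[OF g]
    by (intro Bochner_Integration.integrable_cong refl) (auto simp: Nip_sq ip_add_self)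
  ultimately show "integrable M (\<lambda>x. (Nip (f x + g x))\<^sup>2)" by simp
qed

lemma Lsq_scale: "f \<in> Lsq M \<Longrightarrow> c *\<^sub>R f \<in> Lsq M"
proof -
  assume f: "f \<in> Lsq M"
  have "integrable M (\<lambda>x. c\<^sup>2 * (Nip (f x))\<^sup>2)" using LsqD(2)[OF f] by simp
  moreover have "integrable M (\<lambda>x. (Nip (c *\<^sub>R f x))\<^sup>2) \<longleftrightarrow> integrable M (\<lambda>x. c\<^sup>2 * (Nip (f x))\<^sup>2)"
    using LsqD(3)[OF f]
    by (intro Bochner_Integration.integrable_cong refl) (auto simp: N_scale power_mult_distrib)
  ultimately have "integrable M (\<lambda>x. (Nip (c *\<^sub>R f x))\<^sup>2)" by simp
  then show ?thesis using LsqD(1)[OF f]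
    unfolding square_integrable_in_def scaleR_fun_def by (auto intro: strongly_measurable_scale)
qed

lemma Lsq_zero: "0 \<in> Lsq M"
  by (auto simp: square_integrable_in_def zero_fun_def intro: strongly_measurable_const)

lemma Lsq_scale_fun:
  assumes f: "f \<in> Lsq M" and h: "h \<in> borel_measurable M" "\<And>x. x \<in> space M \<Longrightarrow> \<bar>h x\<bar> \<le> c"
  shows "(\<lambda>x. h x *\<^sub>R f x) \<in> Lsq M"
  unfolding square_integrable_in_def
proof (intro CollectI conjI)
  show sm: "strongly_measurable_in C Nip M (\<lambda>x. h x *\<^sub>R f x)"
    using LsqD(1)[OF f] h(1) by (rule strongly_measurable_scale_fun)
  show "integrable M (\<lambda>x. (Nip (h x *\<^sub>R f x))\<^sup>2)"
  proof (rule Bochner_Integration.integrable_bound)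
    show "integrable M (\<lambda>x. c\<^sup>2 * (Nip (f x))\<^sup>2)" using LsqD(2)[OF f] by simp
    have "\<bar>(Nip (h x *\<^sub>R f x))\<^sup>2\<bar> \<le> \<bar>c\<^sup>2 * (Nip (f x))\<^sup>2\<bar>" if x: "x \<in> space M" for x
      using LsqD(3)[OF f x] power_mono[OF h(2)[OF x], of 2]
      by (simp add: N_scale power_mult_distrib abs_mult mult_right_mono)
    then show "AE x in M. norm ((Nip (h x *\<^sub>R f x))\<^sup>2) \<le> norm (c\<^sup>2 * (Nip (f x))\<^sup>2)" by simp
  qed (use strongly_measurable_norm[OF sm] in measurable)
qed

lemma semi_inner_space_Lsq: "semi_inner_space (Lsq M) (\<lambda>f g. LINT x|M. ip (f x) (g x))"
proof
  show "subspace (Lsq M)"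
    unfolding subspace_def using Lsq_add Lsq_scale Lsq_zero by auto
next
  fix f g assume "f \<in> Lsq M" "g \<in> Lsq M"
  then show "(LINT x|M. ip (f x) (g x)) = (LINT x|M. ip (g x) (f x))"
    by (intro Bochner_Integration.integral_cong refl ip_commute) (auto intro: LsqD)
next
  fix f g h assume *: "f \<in> Lsq M" "g \<in> Lsq M" "h \<in> Lsq M"
  have "(LINT x|M. ip ((f + g) x) (h x)) = (LINT x|M. ip (f x) (h x) + ip (g x) (h x))"
    using * by (intro Bochner_Integration.integral_cong refl) (auto simp: ip_add_left LsqD(3))
  then show "(LINT x|M. ip ((f + g) x) (h x)) = (LINT x|M. ip (f x) (h x)) + (LINT x|M. ip (g x) (h x))"
    using * by (simp add: integrable_ip)
next
  fix f g and c :: real assume *: "f \<in> Lsq M" "g \<in> Lsq M"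
  have "(LINT x|M. ip ((c *\<^sub>R f) x) (g x)) = (LINT x|M. c * ip (f x) (g x))"
    using * by (intro Bochner_Integration.integral_cong refl) (auto simp: scaleR_fun_def ip_scale_left LsqD(3))
  then show "(LINT x|M. ip ((c *\<^sub>R f) x) (g x)) = c * (LINT x|M. ip (f x) (g x))" by simp
next
  fix f assume "f \<in> Lsq M"
  then show "0 \<le> (LINT x|M. ip (f x) (f x))"
    by (intro Bochner_Integration.integral_nonneg ip_nonneg LsqD(3))
qed

lemma Lsq_norm_sq:
  assumes "f \<in> Lsq M"
  shows "(LINT x|M. ip (f x) (f x)) = (LINT x|M. (Nip (f x))\<^sup>2)"
    and "ennreal (LINT x|M. ip (f x) (f x)) = (\<integral>\<^sup>+x. ennreal ((Nip (f x))\<^sup>2) \<partial>M)"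
    and "(LINT x|M. ip (f x) (f x)) = 0 \<longleftrightarrow> (AE x in M. Nip (f x) = 0)"
proof -
  show 1: "(LINT x|M. ip (f x) (f x)) = (LINT x|M. (Nip (f x))\<^sup>2)"
    using assms by (intro Bochner_Integration.integral_cong refl) (auto simp: Nip_sq LsqD(3))
  show "ennreal (LINT x|M. ip (f x) (f x)) = (\<integral>\<^sup>+x. ennreal ((Nip (f x))\<^sup>2) \<partial>M)"
    unfolding 1 using LsqD(2)[OF assms] by (intro nn_integral_eq_integral[symmetric]) auto
  show "(LINT x|M. ip (f x) (f x)) = 0 \<longleftrightarrow> (AE x in M. Nip (f x) = 0)"
    unfolding 1 using LsqD(2)[OF assms] by (subst integral_nonneg_eq_0_iff_AE) auto
qed

text \<open>Squared increments below \<open>K 2\<^sup>-\<^sup>k\<close> are increments below \<open>\<surd>K r\<^sup>k\<close> with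
  \<open>r = \<surd>(1/2) < 1\<close>, and geometric increments are summable.\<close>

lemma geometric_increments_limit:
  assumes complete: "complete_in C Nip" and X: "\<And>k::nat. X k \<in> C"
    and inc: "\<And>k. (Nip (X (Suc k) - X k))\<^sup>2 \<le> K * (1/2) ^ k"
  obtains x where "x \<in> C" "(\<lambda>k. Nip (X k - x)) \<longlonglongrightarrow> 0"
proof -
  define r :: real where "r = sqrt (1/2)"
  have r: "0 < r" "r < 1" unfolding r_def by (auto simp: real_sqrt_less_iff)
  have "0 \<le> K" using inc[of 0] order_trans[OF zero_le_power2] by fastforce
  then have inc': "Nip (X (Suc k) - X k) \<le> sqrt K * r ^ k" for k
    using real_sqrt_le_mono[OF inc[of k]] X by (simp add: real_sqrt_mult real_sqrt_power r_def)
  have step: "Nip (X (m + n) - X m) \<le> sqrt K * r ^ m * (\<Sum>i<n. r ^ i)" for m n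
  proof (induction n)
    case (Suc n)
    have "Nip (X (m + Suc n) - X m) \<le> Nip (X (Suc (m + n)) - X (m + n)) + Nip (X (m + n) - X m)"
      using N_diff_triangle[OF X X X] by simp
    also have "\<dots> \<le> sqrt K * r ^ (m + n) + sqrt K * r ^ m * (\<Sum>i<n. r ^ i)"
      using inc' Suc by (intro add_mono)
    also have "\<dots> = sqrt K * r ^ m * (\<Sum>i<Suc n. r ^ i)" by (simp add: algebra_simps power_add)
    finally show ?case .
  qed simp
  define c where "c = sqrt K / (1 - r)"
  have c: "0 \<le> c" unfolding c_def using r \<open>0 \<le> K\<close> by simp
  have step': "Nip (X (m + n) - X m) \<le> c * r ^ m" for m n
  proof -
    have "(\<Sum>i<n. r ^ i) \<le> 1 / (1 - r)"
      using sum_le_suminf[of "\<lambda>i. r ^ i" "{..<n}"] r suminf_geometric[of r] summable_geometric[of r] by auto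
    then have "sqrt K * r ^ m * (\<Sum>i<n. r ^ i) \<le> sqrt K * r ^ m * (1 / (1 - r))"
      using r \<open>0 \<le> K\<close> by (intro mult_left_mono) auto
    then show ?thesis using step[of m n] by (simp add: c_def mult.commute mult.left_commute divide_inverse)
  qed
  have "(\<lambda>m. c * r ^ m) \<longlonglongrightarrow> c * 0" using r by (intro tendsto_mult_left LIMSEQ_power_zero) auto
  then have lim: "(\<lambda>m. c * r ^ m) \<longlonglongrightarrow> 0" by simp
  show ?thesis
  proof (rule complete_in_bound[OF complete X lim])
    fix m n
    have nn: "0 \<le> c * r ^ i" for i using c r by simp
    show "Nip (X m - X n) \<le> c * r ^ m + c * r ^ n"
    proof (cases "m \<le> n")
      case True
      then show ?thesis using step'[of m "n - m"] nn[of n] N_minus_commute[OF X X, of m n] by simp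
    next
      case False
      then show ?thesis using step'[of n "m - n"] nn[of m] by simp
    qed
  qed (rule that)
qed

text \<open>The Riesz-Fischer theorem.  A subsequence with
  \<open>\<parallel>f\<^sub>k\<^sub>+\<^sub>1 - f\<^sub>k\<parallel>\<^sup>2 \<le> 8\<^sup>-\<^sup>k\<close> satisfies \<open>\<integral> \<Sum>\<^sub>k 2\<^sup>k |f\<^sub>k\<^sub>+\<^sub>1 - f\<^sub>k|\<^sup>2 < \<infinity>\<close>, so that almost everywhere
  \<open>|f\<^sub>k\<^sub>+\<^sub>1 - f\<^sub>k|\<close> decays geometrically and the subsequence converges pointwise; on the exceptional
  null set the limit is set to \<open>0\<close>.  The weights \<open>2\<^sup>k\<close> make the argument independent of the total mass
  of the measure, and Fatou's lemma turns pointwise into mean square convergence.\<close>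

lemma complete_in_Lsq:
  fixes M :: "'m measure"
  assumes complete: "complete_in C Nip"
  shows "complete_in (Lsq M) (ip_norm (\<lambda>f g. LINT x|M. ip (f x) (g x)))"
    (is "complete_in _ ?N")
  unfolding complete_in_def
proof (intro allI impI)
  interpret L: semi_inner_space "Lsq M" "\<lambda>f g. LINT x|M. ip (f x) (g x)"
    by (rule semi_inner_space_Lsq)
  have nn: "ennreal ((?N f)\<^sup>2) = (\<integral>\<^sup>+x. ennreal ((Nip (f x))\<^sup>2) \<partial>M)" if "f \<in> Lsq M" for f
    using Lsq_norm_sq(2)[OF that] L.Nip_sq[OF that] by simp
  fix X :: "nat \<Rightarrow> 'm \<Rightarrow> 'e"
  assume X: "\<forall>n. X n \<in> Lsq M" and Cauchy: "\<forall>e>0. \<exists>M. \<forall>m\<ge>M. \<forall>n\<ge>M. ?N (X m - X n) < e"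
  have "\<exists>m. \<forall>i\<ge>m. \<forall>j\<ge>m. ?N (X i - X j) < sqrt ((1/8) ^ k)" for k :: nat
    using Cauchy by simp
  then obtain n0 where n0: "\<And>k i j. i \<ge> n0 k \<Longrightarrow> j \<ge> n0 k \<Longrightarrow> ?N (X i - X j) < sqrt ((1/8) ^ k)"
    by metis
  define n where "n = (\<lambda>k. k + (\<Sum>i\<le>k. n0 i))"
  have n_ge: "n0 k \<le> n k" for k
    unfolding n_def using member_le_sum[of k "{..k}" n0] by simp
  have n_Suc: "n k \<le> n (Suc k)" for k unfolding n_def by simp
  define Y where "Y = (\<lambda>k. X (n k))"
  have Y: "Y k \<in> Lsq M" for k using X unfolding Y_def by simp
  have YC: "Y k x \<in> C" if "x \<in> space M" for k x using LsqD(3)[OF Y that] .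
  have Yd: "Y i - Y j \<in> Lsq M" for i j using Y by auto
  have inc: "(\<integral>\<^sup>+x. ennreal ((Nip ((Y (Suc k) - Y k) x))\<^sup>2) \<partial>M) \<le> ennreal ((1/8) ^ k)" for k
  proof -
    have "?N (Y (Suc k) - Y k) < sqrt ((1/8) ^ k)"
      unfolding Y_def using n_ge[of k] n_Suc[of k] by (intro n0) auto
    then have "(?N (Y (Suc k) - Y k))\<^sup>2 \<le> (sqrt ((1/8) ^ k))\<^sup>2"
      using Yd by (intro power_mono) auto
    then show ?thesis by (subst nn[OF Yd, symmetric]) (simp add: ennreal_leI)
  qed
  define d where "d = (\<lambda>k x. (Nip ((Y (Suc k) - Y k) x))\<^sup>2)"
  have d_meas [measurable]: "d k \<in> borel_measurable M" for k
    unfolding d_def by (intro borel_measurable_power strongly_measurable_norm LsqD(1)[OF Yd])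
  have "(\<integral>\<^sup>+x. (\<Sum>k. ennreal (2 ^ k * d k x)) \<partial>M) = (\<Sum>k. \<integral>\<^sup>+x. ennreal (2 ^ k * d k x) \<partial>M)"
    by (intro nn_integral_suminf) measurable
  also have "\<dots> = (\<Sum>k. ennreal (2 ^ k) * (\<integral>\<^sup>+x. ennreal (d k x) \<partial>M))"
  proof (subst nn_integral_cmult[symmetric])
    have "0 \<le> d k x" for k x unfolding d_def by simp
    then show "(\<Sum>k. \<integral>\<^sup>+x. ennreal (2 ^ k * d k x) \<partial>M) = (\<Sum>k. \<integral>\<^sup>+x. ennreal (2 ^ k) * ennreal (d k x) \<partial>M)"
      by (simp add: ennreal_mult)
  qed measurable
  also have "\<dots> \<le> (\<Sum>k. ennreal ((1/4) ^ k))"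
  proof (intro suminf_le)
    fix k
    have "ennreal (2 ^ k) * (\<integral>\<^sup>+x. ennreal (d k x) \<partial>M) \<le> ennreal (2 ^ k) * ennreal ((1/8) ^ k)"
      using inc[of k] unfolding d_def by (intro mult_left_mono) auto
    also have "\<dots> = ennreal ((1/4) ^ k)"
      by (simp flip: ennreal_mult power_mult_distrib)
    finally show "ennreal (2 ^ k) * (\<integral>\<^sup>+x. ennreal (d k x) \<partial>M) \<le> ennreal ((1/4) ^ k)" .
  qed auto
  also have "\<dots> = ennreal (\<Sum>k. (1/4) ^ k)" by (intro suminf_ennreal2 summable_geometric) auto
  also have "\<dots> < \<infinity>" by simp
  finally have "AE x in M. (\<Sum>k. ennreal (2 ^ k * d k x)) \<noteq> \<infinity>"
    by (intro nn_integral_PInf_AE) auto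
  then obtain Z where Z: "{x \<in> space M. (\<Sum>k. ennreal (2 ^ k * d k x)) = \<infinity>} \<subseteq> Z"
    "emeasure M Z = 0" "Z \<in> sets M" by (auto elim!: AE_E)
  have lim: "\<exists>y\<in>C. (\<lambda>k. Nip (Y k x - y)) \<longlonglongrightarrow> 0" if x: "x \<in> space M" "x \<notin> Z" for x
  proof -
    have fin: "(\<Sum>k. ennreal (2 ^ k * d k x)) \<noteq> \<infinity>" using x Z by blast
    define K where "K = enn2real (\<Sum>k. ennreal (2 ^ k * d k x))"
    have dK: "d k x \<le> K * (1/2) ^ k" for k
    proof -
      have "ennreal (2 ^ k * d k x) \<le> (\<Sum>k. ennreal (2 ^ k * d k x))"
        using sum_le_suminf[of "\<lambda>k. ennreal (2 ^ k * d k x)" "{k}"] by simp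
      also have "\<dots> = ennreal K" unfolding K_def using fin by (simp add: less_top)
      finally have "2 ^ k * d k x \<le> K" unfolding K_def by (subst (asm) ennreal_le_iff) auto
      then show ?thesis by (simp add: field_simps power_divide)
    qed
    obtain y where "y \<in> C" "(\<lambda>k. Nip (Y k x - y)) \<longlonglongrightarrow> 0"
    proof (rule geometric_increments_limit[OF complete, of "\<lambda>k. Y k x" K])
      show "(Nip (Y (Suc k) x - Y k x))\<^sup>2 \<le> K * (1/2) ^ k" for k using dK[of k] by (simp add: d_def)
    qed (use YC[OF x(1)] in auto)
    then show ?thesis by blast
  qed
  define f where "f = (\<lambda>x. if x \<in> space M \<and> x \<notin> Z then SOME y. y \<in> C \<and> (\<lambda>k. Nip (Y k x - y)) \<longlonglongrightarrow> 0 else 0)"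
  have f: "f x \<in> C" "(\<lambda>k. Nip (Y k x - f x)) \<longlonglongrightarrow> 0" if "x \<in> space M" "x \<notin> Z" for x
    using someI_ex[of "\<lambda>y. y \<in> C \<and> (\<lambda>k. Nip (Y k x - y)) \<longlonglongrightarrow> 0"] lim[OF that] that
    unfolding f_def by auto
  have f_0: "f x = 0" if "x \<in> Z" for x using that unfolding f_def by simp
  have fC: "f x \<in> C" if "x \<in> space M" for x using f f_0 that by (cases "x \<in> Z") auto
  have f_sm: "strongly_measurable_in C Nip M f"
  proof (rule strongly_measurable_LIMSEQ)
    show "strongly_measurable_in C Nip M (\<lambda>x. indicator (- Z) x *\<^sub>R Y k x)" for k
      using LsqD(1)[OF Y, of k] Z(3) by (intro strongly_measurable_scale_fun borel_measurable_indicator')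
        (auto simp: Compl_eq_Diff_UNIV Diff_Int_distrib2)
    show "(\<lambda>k. Nip (indicator (- Z) x *\<^sub>R Y k x - f x)) \<longlonglongrightarrow> 0" if "x \<in> space M" for x
      using f(2)[OF that] f_0 by (cases "x \<in> Z") auto
  qed (rule fC)
  have Z_AE: "AE x in M. x \<notin> Z" using Z by (intro AE_I[of _ _ Z]) auto
  have close: "(\<integral>\<^sup>+x. ennreal ((Nip (X m x - f x))\<^sup>2) \<partial>M) \<le> ennreal (e\<^sup>2)"
    if e: "e > 0" and m: "\<And>i. i \<ge> p \<Longrightarrow> ?N (X m - X i) \<le> e" for e m p
  proof -
    have XmC: "X m x \<in> C" if "x \<in> space M" for x using LsqD(3)[OF X[rule_format] that] .
    have dm: "X m - Y k \<in> Lsq M" for k using X[rule_format] Y by (rule L.diff_in)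
    have "(\<integral>\<^sup>+x. ennreal ((Nip (X m x - f x))\<^sup>2) \<partial>M)
        = (\<integral>\<^sup>+x. liminf (\<lambda>k. ennreal ((Nip ((X m - Y k) x))\<^sup>2)) \<partial>M)"
    proof (intro nn_integral_cong_AE)
      show "AE x in M. ennreal ((Nip (X m x - f x))\<^sup>2) = liminf (\<lambda>k. ennreal ((Nip ((X m - Y k) x))\<^sup>2))"
        using Z_AE AE_space
      proof eventually_elim
        case (elim x)
          have "(\<lambda>k. Nip (X m x - Y k x)) \<longlonglongrightarrow> Nip (X m x - f x)"
          proof (rule N_tendsto)
            have "Nip (X m x - Y k x - (X m x - f x)) = Nip (Y k x - f x)" for k
              using N_minus_commute[of "f x" "Y k x"] YC fC elim(2) by simp
            then show "(\<lambda>k. Nip (X m x - Y k x - (X m x - f x))) \<longlonglongrightarrow> 0" using f(2)[OF elim(2,1)] by simp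
          qed (use XmC YC fC elim(2) in auto)
          then have "(\<lambda>k. ennreal ((Nip ((X m - Y k) x))\<^sup>2)) \<longlonglongrightarrow> ennreal ((Nip (X m x - f x))\<^sup>2)"
            by (intro tendsto_intros) auto
          from lim_imp_Liminf[OF _ this] show ?case by simp
      qed
    qed
    also have "\<dots> \<le> liminf (\<lambda>k. \<integral>\<^sup>+x. ennreal ((Nip ((X m - Y k) x))\<^sup>2) \<partial>M)"
      by (intro nn_integral_liminf measurable_compose[OF _ measurable_ennreal]
            borel_measurable_power strongly_measurable_norm LsqD(1)[OF dm])
    also have "\<dots> \<le> liminf (\<lambda>k. ennreal (e\<^sup>2))"
    proof (rule Liminf_mono)
      show "\<forall>\<^sub>F k in sequentially. (\<integral>\<^sup>+x. ennreal ((Nip ((X m - Y k) x))\<^sup>2) \<partial>M) \<le> ennreal (e\<^sup>2)"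
        using eventually_ge_at_top[of p]
      proof eventually_elim
        case (elim k)
        have "k \<le> n k" unfolding n_def by simp
        then have "?N (X m - Y k) \<le> e" using m[of "n k"] elim unfolding Y_def by simp
        then have "(?N (X m - Y k))\<^sup>2 \<le> e\<^sup>2" using dm by (intro power_mono) auto
        then show ?case by (subst nn[OF dm, symmetric]) (rule ennreal_leI)
      qed
    qed
    also have "\<dots> = ennreal (e\<^sup>2)" by (simp add: Liminf_const)
    finally show ?thesis .
  qed
  have in_Lsq: "X m - f \<in> Lsq M" and N_le: "?N (X m - f) \<le> e"
    if e: "e > 0" and m: "\<And>i. i \<ge> p \<Longrightarrow> ?N (X m - X i) \<le> e" for e m p
  proof -
    have sm: "strongly_measurable_in C Nip M (\<lambda>x. X m x - f x)"
      using LsqD(1)[OF X[rule_format]] f_sm by (rule strongly_measurable_diff)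
    have fin: "(\<integral>\<^sup>+x. ennreal ((Nip (X m x - f x))\<^sup>2) \<partial>M) < \<infinity>"
      using close[OF e m] by (rule order_le_less_trans) auto
    have "integrable M (\<lambda>x. (Nip (X m x - f x))\<^sup>2)"
      using fin strongly_measurable_norm[OF sm] by (intro integrableI_nonneg) auto
    then show 1: "X m - f \<in> Lsq M" using sm unfolding square_integrable_in_def by (simp add: fun_diff_def)
    have "ennreal ((?N (X m - f))\<^sup>2) \<le> ennreal (e\<^sup>2)"
      unfolding nn[OF 1] using close[OF e m] by simp
    then have "(?N (X m - f))\<^sup>2 \<le> e\<^sup>2" by (subst (asm) ennreal_le_iff) auto
    then show "?N (X m - f) \<le> e" using e by (simp add: power2_le_iff_abs_le)
  qed
  have ex: "\<exists>p. \<forall>m\<ge>p. \<forall>i\<ge>p. ?N (X m - X i) \<le> e" if "e > 0" for e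
    using Cauchy that less_imp_le by meson
  show "\<exists>f\<in>Lsq M. (\<lambda>n. ?N (X n - f)) \<longlonglongrightarrow> 0"
  proof
    obtain p where p: "\<And>m i. m \<ge> p \<Longrightarrow> i \<ge> p \<Longrightarrow> ?N (X m - X i) \<le> 1" using ex[of 1] by auto
    have "X p - f \<in> Lsq M" using in_Lsq[of 1 p p] p by auto
    then have "X p - (X p - f) \<in> Lsq M" by (rule L.diff_in[OF X[rule_format]])
    then show f_in: "f \<in> Lsq M" by simp
    show "(\<lambda>n. ?N (X n - f)) \<longlonglongrightarrow> 0"
    proof (rule LIMSEQ_I)
      fix e :: real assume e: "e > 0"
      obtain p where p: "\<And>m i. m \<ge> p \<Longrightarrow> i \<ge> p \<Longrightarrow> ?N (X m - X i) \<le> e / 2"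
        using ex[of "e/2"] e by auto
      have "norm (?N (X m - f) - 0) < e" if "m \<ge> p" for m
      proof -
        have "?N (X m - f) \<le> e / 2" using N_le[of "e/2" p m] p that e by auto
        moreover have "0 \<le> ?N (X m - f)" using X f_in by (intro L.N_nonneg) auto
        ultimately show ?thesis using e by simp
      qed
      then show "\<exists>no. \<forall>m\<ge>no. norm (?N (X m - f) - 0) < e" by blast
    qed
  qed
qed

end


section \<open>Test functions and the fundamental lemma of the calculus of variations\<close>

text \<open>The functions \<open>t \<mapsto> p(1/t) exp(-1/t)\<close> on the positive half-line, extended by zero, form a class
  closed under differentiation, which makes their smoothness a plain induction.\<close>

definition flat_exp :: "real poly \<Rightarrow> real \<Rightarrow> real"
  where "flat_exp p t = (if t \<le> 0 then 0 else poly p (1 / t) * exp (- (1 / t)))"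

definition flat_exp_deriv :: "real poly \<Rightarrow> real poly"
  where "flat_exp_deriv p = monom 1 2 * (p - pderiv p)"

text \<open>This limit is the reason why all derivatives of \<open>flat_exp p\<close> vanish at \<open>0\<close>.\<close>

lemma poly_times_exp_minus_at_top: "((\<lambda>s. poly p s * exp (- s)) \<longlongrightarrow> (0::real)) at_top"
proof -
  have "((\<lambda>s. \<Sum>i\<le>degree p. coeff p i * (s ^ i / exp s)) \<longlongrightarrow> (\<Sum>i\<le>degree p. coeff p i * 0)) at_top"
    by (intro tendsto_sum tendsto_mult tendsto_const tendsto_power_div_exp_0)
  then show ?thesis
    by (simp add: poly_altdef sum_distrib_right exp_minus divide_inverse mult.assoc)
qed

lemma has_real_derivative_flat_exp:
  "(flat_exp p has_real_derivative flat_exp (flat_exp_deriv p) t) (at t)"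
proof -
  consider "t < 0" | "t = 0" | "t > 0" by linarith
  then show ?thesis
  proof cases
    case 1
    have "((\<lambda>_. 0) has_real_derivative 0) (at t)" by simp
    then have "(flat_exp p has_real_derivative 0) (at t)"
      by (rule has_field_derivative_transform_within_open[of _ _ _ "{..<0}"]) (use 1 in \<open>auto simp: flat_exp_def\<close>)
    then show ?thesis using 1 by (simp add: flat_exp_def)
  next
    case 2
    have "((\<lambda>h. poly (pCons 0 p) (inverse h) * exp (- inverse h)) \<longlongrightarrow> 0) (at_right 0)"
      by (rule filterlim_compose[OF poly_times_exp_minus_at_top filterlim_inverse_at_top_right])
    then have "((\<lambda>h. (flat_exp p (0 + h) - flat_exp p 0) / h) \<longlongrightarrow> 0) (at_right 0)"
    proof (rule Lim_transform_eventually)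
      show "\<forall>\<^sub>F h in at_right 0. poly (pCons 0 p) (inverse h) * exp (- inverse h)
          = (flat_exp p (0 + h) - flat_exp p 0) / h"
        using eventually_at_right_less[of "0::real"]
        by eventually_elim (simp add: flat_exp_def field_simps)
    qed
    moreover have "((\<lambda>h. (flat_exp p (0 + h) - flat_exp p 0) / h) \<longlongrightarrow> 0) (at_left 0)"
    proof (rule Lim_transform_eventually[OF tendsto_const])
      show "\<forall>\<^sub>F h in at_left 0. 0 = (flat_exp p (0 + h) - flat_exp p 0) / h"
        by (auto simp: flat_exp_def eventually_at_filter)
    qed
    ultimately have "(flat_exp p has_real_derivative 0) (at 0)"
      unfolding DERIV_def by (simp add: filterlim_at_split)
    then show ?thesis using 2 by (simp add: flat_exp_def)
  next
    case 3
    have "((\<lambda>t. poly p (1 / t) * exp (- (1 / t))) has_real_derivative flat_exp (flat_exp_deriv p) t) (at t)"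
    proof -
      have i: "((\<lambda>t. 1 / t) has_real_derivative - (1 / t\<^sup>2)) (at t)"
        using 3 by (auto intro!: derivative_eq_intros simp: power2_eq_square)
      have "((\<lambda>t. poly p (1 / t)) has_real_derivative poly (pderiv p) (1 / t) * - (1 / t\<^sup>2)) (at t)"
        by (rule DERIV_chain2[OF poly_DERIV i])
      then have "((\<lambda>t. poly p (1 / t) * exp (- (1 / t))) has_real_derivative
          (poly (pderiv p) (1 / t) * - (1 / t\<^sup>2)) * exp (- (1 / t))
          + (exp (- (1 / t)) * - (- (1 / t\<^sup>2))) * poly p (1 / t)) (at t)"
        by (intro DERIV_mult DERIV_fun_exp DERIV_minus i)
      moreover have "(poly (pderiv p) (1 / t) * - (1 / t\<^sup>2)) * exp (- (1 / t))
          + (exp (- (1 / t)) * - (- (1 / t\<^sup>2))) * poly p (1 / t) = flat_exp (flat_exp_deriv p) t"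
        using 3 by (simp add: flat_exp_def flat_exp_deriv_def poly_monom algebra_simps power_divide)
      ultimately show ?thesis by simp
    qed
    then show ?thesis
      by (rule has_field_derivative_transform_within_open[of _ _ _ "{0<..}"]) (use 3 in \<open>auto simp: flat_exp_def\<close>)
  qed
qed

lemma flat_exp_one_bounds: "0 \<le> flat_exp 1 t" "flat_exp 1 t \<le> 1" "flat_exp 1 t = 0 \<longleftrightarrow> t \<le> 0"
  by (auto simp: flat_exp_def)

lemma flat_exp_one_tendsto: "(\<lambda>n. flat_exp 1 (real (Suc n) * t)) \<longlonglongrightarrow> (if t > 0 then 1 else 0)"
proof (cases "t > 0")
  case True
  have "(\<lambda>n. exp (- (inverse (real (Suc n)) * (1 / t)))) \<longlonglongrightarrow> exp (- (0 * (1 / t)))"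
    by (intro tendsto_intros LIMSEQ_inverse_real_of_nat)
  moreover have "flat_exp 1 (real (Suc n) * t) = exp (- (inverse (real (Suc n)) * (1 / t)))" for n
  proof -
    have "\<not> real (Suc n) * t \<le> 0" using True by (simp add: mult_le_0_iff)
    then show ?thesis unfolding flat_exp_def using True by (simp add: divide_inverse)
  qed
  ultimately show ?thesis using True by simp
next
  case False
  then have "real (Suc n) * t \<le> 0" for n by (intro mult_nonneg_nonpos) auto
  then show ?thesis using False by (simp add: flat_exp_def)
qed

subsection \<open>Calculus of iterated partial derivatives\<close>

lemma partial_deriv_eq:
  "(f has_derivative f') (at x) \<Longrightarrow> partial_deriv i f x = f' (axis i 1)"
  unfolding partial_deriv_def by (simp add: frechet_derivative_at[symmetric])

lemma differentiable_has_derivative: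
  "f differentiable (at x) \<Longrightarrow> (f has_derivative frechet_derivative f (at x)) (at x)"
  by (simp add: frechet_derivative_works)

lemma partial_deriv_add:
  assumes "f differentiable (at x)" "g differentiable (at x)"
  shows "partial_deriv i (\<lambda>x. f x + g x) x = partial_deriv i f x + partial_deriv i g x"
  using partial_deriv_eq[OF has_derivative_add[OF assms[THEN differentiable_has_derivative]]]
  by (simp add: partial_deriv_def)

lemma partial_deriv_mult:
  assumes "f differentiable (at x)" "g differentiable (at x)"
  shows "partial_deriv i (\<lambda>x. f x * g x) x = f x * partial_deriv i g x + partial_deriv i f x * g x"
  using partial_deriv_eq[OF has_derivative_mult[OF assms[THEN differentiable_has_derivative]]]
  by (simp add: partial_deriv_def)

lemma partial_deriv_const: "partial_deriv i (\<lambda>_. c) x = 0"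
  by (simp add: partial_deriv_def)

lemma smooth_upto_SucD: "smooth_upto (Suc k) f \<Longrightarrow> smooth_upto k f"
proof (induction k arbitrary: f)
  case 0
  then show ?case
    by (auto intro!: continuous_at_imp_continuous_on differentiable_imp_continuous_within)
next
  case (Suc k)
  then show ?case by simp
qed

lemma smooth_upto_const: "smooth_upto k (\<lambda>_. c)"
proof (induction k arbitrary: c)
  case (Suc k)
  have "partial_deriv i (\<lambda>_. c) = (\<lambda>_. 0)" for i :: 'a by (auto simp: partial_deriv_const)
  then show ?case using Suc by simp
qed simp

lemma smooth_upto_add:
  "smooth_upto k f \<Longrightarrow> smooth_upto k g \<Longrightarrow> smooth_upto k (\<lambda>x. f x + g x)"
proof (induction k arbitrary: f g)
  case (Suc k)
  have "partial_deriv i (\<lambda>x. f x + g x) = (\<lambda>x. partial_deriv i f x + partial_deriv i g x)" for i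
    using Suc.prems by (auto simp: partial_deriv_add)
  then show ?case using Suc by simp
qed (auto intro: continuous_on_add)

lemma smooth_upto_mult:
  "smooth_upto k f \<Longrightarrow> smooth_upto k g \<Longrightarrow> smooth_upto k (\<lambda>x. f x * g x)"
proof (induction k arbitrary: f g)
  case (Suc k)
  have "partial_deriv i (\<lambda>x. f x * g x) = (\<lambda>x. f x * partial_deriv i g x + partial_deriv i f x * g x)" for i
    using Suc.prems by (auto simp: partial_deriv_mult)
  moreover have "smooth_upto k (\<lambda>x. f x * partial_deriv i g x + partial_deriv i f x * g x)" for i
    using Suc.prems smooth_upto_SucD[OF Suc.prems(1)] smooth_upto_SucD[OF Suc.prems(2)]
    by (intro smooth_upto_add Suc.IH) auto
  ultimately show ?case using Suc.prems by (auto intro: differentiable_mult)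
qed (auto intro: continuous_on_mult)

lemma smooth_upto_prod:
  "finite I \<Longrightarrow> (\<And>j. j \<in> I \<Longrightarrow> smooth_upto k (f j)) \<Longrightarrow> smooth_upto k (\<lambda>x. \<Prod>j\<in>I. f j x)"
  by (induction I rule: finite_induct) (auto intro: smooth_upto_const smooth_upto_mult)

text \<open>The scalar \<open>r\<close> and the polynomial \<open>p\<close> are generalized in the induction: a partial derivative of
  such a function is again of this form.\<close>

lemma smooth_upto_flat_exp: "smooth_upto k (\<lambda>x. r * flat_exp p (c * x $ j + d))"
proof (induction k arbitrary: r p)
  case 0
  have "continuous_on UNIV (flat_exp p)"
    using has_real_derivative_flat_exp DERIV_isCont by (blast intro: continuous_at_imp_continuous_on)
  then have "continuous_on UNIV (\<lambda>x. flat_exp p (c * x $ j + d))"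
    by (rule continuous_on_compose2) (auto intro!: continuous_intros)
  then show ?case by (auto intro!: continuous_intros)
next
  case (Suc k)
  have "((\<lambda>x. flat_exp p (c * x $ j + d)) has_derivative
      (\<lambda>h. (c * h $ j) * flat_exp (flat_exp_deriv p) (c * x $ j + d))) (at x)" for x
  proof -
    have 1: "((\<lambda>x. c * x $ j + d) has_derivative (\<lambda>h. c * h $ j)) (at x)"
      by (auto intro!: derivative_eq_intros bounded_linear_imp_has_derivative bounded_linear_vec_nth)
    show ?thesis
      using has_derivative_compose[OF 1 has_real_derivative_flat_exp[unfolded has_field_derivative_def]]
      by (simp add: mult.commute mult.left_commute)
  qed
  then have d: "((\<lambda>x. r * flat_exp p (c * x $ j + d)) has_derivative
      (\<lambda>h. r * ((c * h $ j) * flat_exp (flat_exp_deriv p) (c * x $ j + d)))) (at x)" for x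
    by (rule has_derivative_mult_right)
  then have "(\<lambda>x. r * flat_exp p (c * x $ j + d)) differentiable (at x)" for x
    unfolding differentiable_def by blast
  moreover have "partial_deriv i (\<lambda>x. r * flat_exp p (c * x $ j + d))
      = (\<lambda>x. (if i = j then r * c else 0) * flat_exp (flat_exp_deriv p) (c * x $ j + d))" for i
    using partial_deriv_eq[OF d] by (auto simp: fun_eq_iff axis_def)
  ultimately show ?case using Suc.IH by simp
qed

subsection \<open>Test functions\<close>

lemma compact_closure_if_subset:
  fixes S :: "'a::heine_borel set"
  shows "closure S \<subseteq> K \<Longrightarrow> compact K \<Longrightarrow> compact (closure S)"
  by (auto simp: compact_eq_bounded_closed intro: bounded_subset)

lemma integrable_indicator_cball:
  "integrable lborel (\<lambda>x::'a::euclidean_space. c * indicator (cball 0 R) x :: real)"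
  using emeasure_lborel_cball_finite[of "0::'a" R]
  by (intro integrable_mult_right integrable_real_indicator) auto

lemma closure_nonzero_subset:
  "(\<And>x. h x \<noteq> 0 \<Longrightarrow> f x \<noteq> 0 \<or> g x \<noteq> 0) \<Longrightarrow>
   closure {x. h x \<noteq> 0} \<subseteq> closure {x. f x \<noteq> 0} \<union> closure {x. g x \<noteq> 0}"
  by (metis (mono_tags, lifting) Collect_disj_eq Collect_mono closure_Un closure_mono)

lemma test_functions_add:
  assumes "\<phi> \<in> test_functions \<Omega>" "\<psi> \<in> test_functions \<Omega>"
  shows "\<phi> + \<psi> \<in> test_functions \<Omega>"
proof -
  have sub: "closure {x. (\<phi> + \<psi>) x \<noteq> 0} \<subseteq> closure {x. \<phi> x \<noteq> 0} \<union> closure {x. \<psi> x \<noteq> 0}"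
    by (rule closure_nonzero_subset) auto
  moreover have "compact (closure {x. \<phi> x \<noteq> 0} \<union> closure {x. \<psi> x \<noteq> 0})"
    using assms unfolding test_functions_def by auto
  ultimately have "compact (closure {x. (\<phi> + \<psi>) x \<noteq> 0})"
    by (rule compact_closure_if_subset)
  then show ?thesis using assms sub unfolding test_functions_def
    by (auto simp: plus_fun_def intro: smooth_upto_add)
qed

lemma test_functions_scale:
  assumes "\<phi> \<in> test_functions \<Omega>"
  shows "c *\<^sub>R \<phi> \<in> test_functions \<Omega>"
proof -
  have sub: "closure {x. (c *\<^sub>R \<phi>) x \<noteq> 0} \<subseteq> closure {x. \<phi> x \<noteq> 0}"
    by (rule closure_mono) (auto simp: scaleR_fun_def)
  then have "compact (closure {x. (c *\<^sub>R \<phi>) x \<noteq> 0})"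
    using assms compact_closure_if_subset unfolding test_functions_def by blast
  then show ?thesis using assms sub unfolding test_functions_def
    by (auto simp: scaleR_fun_def intro: smooth_upto_mult smooth_upto_const)
qed

lemma test_functions_zero: "0 \<in> test_functions \<Omega>"
  unfolding test_functions_def by (auto simp: zero_fun_def intro: smooth_upto_const)

text \<open>Unlike the test functions of a domain, this class contains the products \<open>x\<^sub>i \<phi>(x)\<close> and
  \<open>\<phi>(x) \<psi>(x)\<close> to which integration by parts is applied.\<close>

definition C1_compact_support :: "(real^'n \<Rightarrow> real) \<Rightarrow> bool"
  where "C1_compact_support f \<longleftrightarrow>
    (\<forall>x. f differentiable (at x)) \<and> (\<forall>i. continuous_on UNIV (partial_deriv i f)) \<and>
    (\<exists>R. \<forall>x. R \<le> norm x \<longrightarrow> f x = 0)"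

lemma C1_compact_support_continuous: "C1_compact_support f \<Longrightarrow> continuous_on UNIV f"
  unfolding C1_compact_support_def
  by (auto intro!: continuous_at_imp_continuous_on differentiable_imp_continuous_within)

lemma partial_deriv_outside_support:
  assumes "\<And>y. y \<in> U \<Longrightarrow> f y = 0" "open U" "x \<in> U"
  shows "partial_deriv i f x = 0"
proof -
  have "((\<lambda>_. 0) has_derivative (\<lambda>_. 0)) (at x)" by simp
  then have "(f has_derivative (\<lambda>_. 0)) (at x)"
    by (rule has_derivative_transform_within_open[OF _ assms(2,3)]) (use assms(1) in auto)
  then show ?thesis by (simp add: partial_deriv_eq)
qed

lemma bounded_if_compact_support:
  fixes f :: "real^'n \<Rightarrow> real"
  assumes "continuous_on UNIV f" "\<And>x. R \<le> norm x \<Longrightarrow> f x = 0"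
  obtains B where "B \<ge> 0" "\<And>x. \<bar>f x\<bar> \<le> B"
proof -
  have "compact (f ` cball 0 R)"
    using assms(1) by (intro compact_continuous_image) (auto intro: continuous_on_subset)
  then obtain B where B: "\<And>x. x \<in> cball 0 R \<Longrightarrow> \<bar>f x\<bar> \<le> B"
    using compact_imp_bounded by (fastforce simp: bounded_iff)
  have "\<bar>f x\<bar> \<le> max B 0" for x
    using B[of x] assms(2)[of x] by (cases "norm x \<le> R") auto
  then show ?thesis using that[of "max B 0"] by auto
qed

lemma integrable_if_compact_support:
  fixes f :: "real^'n \<Rightarrow> real"
  assumes f: "continuous_on UNIV f" "\<And>x. R \<le> norm x \<Longrightarrow> f x = 0"
  shows "integrable lborel f"
proof -
  obtain B where B: "B \<ge> 0" "\<And>x. \<bar>f x\<bar> \<le> B" using bounded_if_compact_support[OF f] by blast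
  have meas: "f \<in> borel_measurable borel" using f(1) by (rule borel_measurable_continuous_onI)
  show ?thesis
  proof (rule Bochner_Integration.integrable_bound)
    show "integrable lborel (\<lambda>x. B * indicator (cball 0 R) x)"
      by (rule integrable_indicator_cball)
    show "AE x in lborel. norm (f x) \<le> norm (B * indicator (cball 0 R) x)"
      using B f(2) by (intro AE_I2) (auto simp: indicator_def)
  qed (use meas in simp)
qed

text \<open>By translation invariance the integral of a difference quotient vanishes, and the difference
  quotients \<open>(f (x + h e) - f x) / h\<close> converge boundedly to the partial derivative.\<close>

lemma integral_partial_deriv_zero:
  fixes f :: "real^'n \<Rightarrow> real"
  assumes f: "C1_compact_support f"
  shows "(LINT x|lborel. partial_deriv i f x) = 0"
proof -
  have diff: "\<And>x. f differentiable (at x)" and cont: "continuous_on UNIV (partial_deriv i f)"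
    using f unfolding C1_compact_support_def by auto
  obtain R where R: "\<And>x. R \<le> norm x \<Longrightarrow> f x = 0" using f unfolding C1_compact_support_def by blast
  have pd0: "partial_deriv i f x = 0" if "R + 1 \<le> norm x" for x
    by (rule partial_deriv_outside_support[of "- cball 0 R"]) (use R that in auto)
  obtain B where B: "B \<ge> 0" "\<And>x. \<bar>partial_deriv i f x\<bar> \<le> B"
    using bounded_if_compact_support[OF cont pd0] by blast
  have fint: "integrable lborel f"
    using C1_compact_support_continuous[OF f] R by (rule integrable_if_compact_support)
  have fmeas [measurable]: "f \<in> borel_measurable borel"
    using C1_compact_support_continuous[OF f] by (rule borel_measurable_continuous_onI)
  define e :: "real^'n" where "e = axis i 1"
  have e: "norm e = 1" by (simp add: e_def norm_axis_1)
  have D: "DERIV (\<lambda>t. f (x + t *\<^sub>R e)) t :> partial_deriv i f (x + t *\<^sub>R e)" for x t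
  proof -
    have 1: "((\<lambda>t. x + t *\<^sub>R e) has_derivative (\<lambda>h. h *\<^sub>R e)) (at t)"
      by (auto intro!: derivative_eq_intros)
    have "((\<lambda>t. f (x + t *\<^sub>R e)) has_derivative (\<lambda>h. frechet_derivative f (at (x + t *\<^sub>R e)) (h *\<^sub>R e))) (at t)"
      using has_derivative_compose[OF 1 differentiable_has_derivative[OF diff]] .
    moreover have "frechet_derivative f (at (x + t *\<^sub>R e)) (h *\<^sub>R e) = h * partial_deriv i f (x + t *\<^sub>R e)" for h
      using linear_cmul[OF linear_frechet_derivative[OF diff]] by (simp add: partial_deriv_def e_def)
    ultimately show ?thesis by (simp add: has_field_derivative_def mult_commute_abs)
  qed
  define h :: "nat \<Rightarrow> real" where "h = (\<lambda>k. 1 / real (Suc k))"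
  have h: "0 < h k" "h k \<le> 1" for k unfolding h_def by auto
  have h_lim: "h \<longlonglongrightarrow> 0" unfolding h_def using LIMSEQ_inverse_real_of_nat by (simp add: inverse_eq_divide)
  define q where "q = (\<lambda>k x. (f (x + h k *\<^sub>R e) - f x) / h k)"
  have "\<exists>z. 0 < z \<and> z < h k \<and> q k x = partial_deriv i f (x + z *\<^sub>R e)" for k x
  proof -
    obtain z where "0 < z" "z < h k" "f (x + h k *\<^sub>R e) - f (x + 0 *\<^sub>R e) = (h k - 0) * partial_deriv i f (x + z *\<^sub>R e)"
      using MVT2[OF h(1)[of k], where f="\<lambda>t. f (x + t *\<^sub>R e)" and f'="\<lambda>t. partial_deriv i f (x + t *\<^sub>R e)"] D by metis
    then show ?thesis using h[of k] unfolding q_def by (intro exI[of _ z]) auto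
  qed
  then obtain z where z: "\<And>k x. 0 < z k x" "\<And>k x. z k x < h k"
      "\<And>k x. q k x = partial_deriv i f (x + z k x *\<^sub>R e)" by metis
  have q_lim: "(\<lambda>k. q k x) \<longlonglongrightarrow> partial_deriv i f x" for x
  proof -
    have "(\<lambda>k. z k x) \<longlonglongrightarrow> 0"
      by (rule tendsto_sandwich[OF _ _ tendsto_const h_lim]) (auto intro!: always_eventually less_imp_le z)
    then have "(\<lambda>k. x + z k x *\<^sub>R e) \<longlonglongrightarrow> x + 0 *\<^sub>R e" by (intro tendsto_intros)
    then show ?thesis
      using cont unfolding z(3) continuous_on_eq_continuous_at[OF open_UNIV]
      by (auto intro: isCont_tendsto_compose)
  qed
  have q_zero: "q k x = 0" if "R + 1 \<le> norm x" for k x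
  proof -
    have "norm x \<le> norm (x + h k *\<^sub>R e) + norm (h k *\<^sub>R e)"
      using norm_triangle_ineq4[of "x + h k *\<^sub>R e" "h k *\<^sub>R e"] by simp
    then have "R \<le> norm (x + h k *\<^sub>R e)" using that h[of k] e by simp
    then show ?thesis using R that unfolding q_def by simp
  qed
  have "(\<lambda>k. LINT x|lborel. q k x) \<longlonglongrightarrow> (LINT x|lborel. partial_deriv i f x)"
  proof (rule integral_dominated_convergence[where w="\<lambda>x. B * indicator (cball 0 (R + 1)) x"])
    show "partial_deriv i f \<in> borel_measurable lborel"
      using borel_measurable_continuous_onI[OF cont] by simp
    show "q k \<in> borel_measurable lborel" for k unfolding q_def by measurable
    show "integrable lborel (\<lambda>x::real^'n. B * indicator (cball 0 (R + 1)) x)"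
      by (rule integrable_indicator_cball)
    show "AE x in lborel. (\<lambda>k. q k x) \<longlonglongrightarrow> partial_deriv i f x" using q_lim by simp
    show "AE x in lborel. norm (q k x) \<le> B * indicator (cball 0 (R + 1)) x" for k
    proof (intro AE_I2)
      fix x :: "real^'n"
      show "norm (q k x) \<le> B * indicator (cball 0 (R + 1)) x"
        using q_zero[of x k] B(2) z(3)[of k x] by (cases "x \<in> cball 0 (R + 1)") auto
    qed
  qed
  moreover have "(LINT x|lborel. q k x) = 0" for k
  proof -
    have "(LINT x|lborel. f x) = (LINT x|distr lborel borel ((+) (h k *\<^sub>R e)). f x)"
      by (simp add: lborel_distr_plus)
    also have "\<dots> = (LINT x|lborel. f (h k *\<^sub>R e + x))" by (rule integral_distr) auto
    finally have eq: "(LINT x|lborel. f (x + h k *\<^sub>R e)) = (LINT x|lborel. f x)" by (simp add: add.commute)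
    have "integrable (distr lborel borel ((+) (h k *\<^sub>R e))) f" using fint by (simp add: lborel_distr_plus)
    then have "integrable lborel (\<lambda>x. f (h k *\<^sub>R e + x))"
      by (subst (asm) integrable_distr_eq) auto
    then show ?thesis unfolding q_def using fint eq by (simp add: add.commute)
  qed
  ultimately show ?thesis by (simp add: LIMSEQ_const_iff)
qed

lemma C1_compact_support_mult:
  assumes f: "\<And>x. f differentiable (at x)" "\<And>i. continuous_on UNIV (partial_deriv i f)"
    and g: "C1_compact_support g"
  shows "C1_compact_support (\<lambda>x. f x * g x)"
proof -
  have d: "\<And>x. g differentiable (at x)"
    using g unfolding C1_compact_support_def by auto
  have c: "continuous_on UNIV f"
    using f(1) by (auto intro!: continuous_at_imp_continuous_on differentiable_imp_continuous_within)
  have "partial_deriv i (\<lambda>x. f x * g x) = (\<lambda>x. f x * partial_deriv i g x + partial_deriv i f x * g x)" for i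
    using f(1) d by (auto simp: partial_deriv_mult)
  then show ?thesis
    using c f g C1_compact_support_continuous[OF g] d unfolding C1_compact_support_def
    by (auto intro!: continuous_intros differentiable_mult)
qed

text \<open>The integral of a partial derivative of the product \<open>f g\<close> vanishes.\<close>

lemma integration_by_parts:
  assumes f: "C1_compact_support f" and g: "C1_compact_support g"
  shows "(LINT x|lborel. f x * partial_deriv i g x) = - (LINT x|lborel. partial_deriv i f x * g x)"
proof -
  have d: "\<And>x. f differentiable (at x)" "\<And>x. g differentiable (at x)"
    using assms unfolding C1_compact_support_def by auto
  note c = assms[THEN C1_compact_support_continuous]
  obtain R where R: "\<And>x. R \<le> norm x \<Longrightarrow> f x = 0" using f unfolding C1_compact_support_def by blast
  obtain S where S: "\<And>x. S \<le> norm x \<Longrightarrow> g x = 0" using g unfolding C1_compact_support_def by blast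
  have i1: "integrable lborel (\<lambda>x. f x * partial_deriv i g x)"
    by (rule integrable_if_compact_support[of _ R])
      (use c g R in \<open>auto simp: C1_compact_support_def intro!: continuous_intros\<close>)
  have i2: "integrable lborel (\<lambda>x. partial_deriv i f x * g x)"
    by (rule integrable_if_compact_support[of _ S])
      (use c f S in \<open>auto simp: C1_compact_support_def intro!: continuous_intros\<close>)
  have "0 = (LINT x|lborel. f x * partial_deriv i g x + partial_deriv i f x * g x)"
    using integral_partial_deriv_zero[OF C1_compact_support_mult[OF d(1) _ g], of i] f d
    by (simp add: partial_deriv_mult C1_compact_support_def)
  then show ?thesis using i1 i2 by simp
qed

lemma test_function_C1:
  assumes "\<phi> \<in> test_functions \<Omega>"
  shows "C1_compact_support \<phi>"
proof -
  have s: "\<And>k. smooth_upto k \<phi>" and K: "compact (closure {x. \<phi> x \<noteq> 0})"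
    using assms unfolding test_functions_def by auto
  obtain R where R: "\<And>x. x \<in> closure {x. \<phi> x \<noteq> 0} \<Longrightarrow> norm x \<le> R"
    using compact_imp_bounded[OF K] by (auto simp: bounded_iff)
  have "\<phi> x = 0" if "R + 1 \<le> norm x" for x
    using R[of x] closure_subset[of "{x. \<phi> x \<noteq> 0}"] that by (cases "\<phi> x = 0") auto
  then show ?thesis using s[of "Suc 0"] unfolding C1_compact_support_def by auto
qed

lemma test_function_outside:
  assumes "\<phi> \<in> test_functions \<Omega>" "x \<notin> \<Omega>"
  shows "\<phi> x = 0" "partial_deriv i \<phi> x = 0"
proof -
  have x: "x \<notin> closure {x. \<phi> x \<noteq> 0}" using assms unfolding test_functions_def by auto
  then show "\<phi> x = 0" using closure_subset[of "{x. \<phi> x \<noteq> 0}"] by auto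
  show "partial_deriv i \<phi> x = 0"
    by (rule partial_deriv_outside_support[of "- closure {x. \<phi> x \<noteq> 0}"])
      (use x closure_subset[of "{x. \<phi> x \<noteq> 0}"] in auto)
qed

text \<open>Since \<open>exp(-1/(n t))\<close> tends to \<open>1\<close> for \<open>t > 0\<close>, rescaling the argument of one flat function
  suffices to approximate the indicator function of an open box by smooth functions.\<close>

definition box_cutoff :: "real^'n \<Rightarrow> real^'n \<Rightarrow> nat \<Rightarrow> real^'n \<Rightarrow> real"
  where "box_cutoff a b n x = (\<Prod>j\<in>UNIV. flat_exp 1 (real (Suc n) * (x $ j - a $ j))
    * flat_exp 1 (real (Suc n) * (b $ j - x $ j)))"

lemma box_cutoff_test_function:
  assumes "cbox a b \<subseteq> \<Omega>"
  shows "box_cutoff a b n \<in> test_functions \<Omega>"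
proof -
  have "smooth_upto k (\<lambda>x. flat_exp 1 (real (Suc n) * (x $ j - a $ j)))" for k j
    using smooth_upto_flat_exp[of k 1 1 "real (Suc n)" j "- real (Suc n) * a $ j"]
    by (simp add: algebra_simps)
  moreover have "smooth_upto k (\<lambda>x. flat_exp 1 (real (Suc n) * (b $ j - x $ j)))" for k j
    using smooth_upto_flat_exp[of k 1 1 "- real (Suc n)" j "real (Suc n) * b $ j"]
    by (simp add: algebra_simps)
  ultimately have "smooth_upto k (box_cutoff a b n)" for k
    unfolding box_cutoff_def[abs_def] by (intro smooth_upto_prod smooth_upto_mult) auto
  moreover have sub: "closure {x. box_cutoff a b n x \<noteq> 0} \<subseteq> cbox a b"
  proof (rule closure_minimal)
    show "{x. box_cutoff a b n x \<noteq> 0} \<subseteq> cbox a b"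
    proof safe
      fix x assume "box_cutoff a b n x \<noteq> 0"
      then have "0 < real (Suc n) * (x $ j - a $ j)" "0 < real (Suc n) * (b $ j - x $ j)" for j
        unfolding box_cutoff_def by (auto simp: flat_exp_one_bounds(3) not_le)
      then show "x \<in> cbox a b" by (auto simp: mem_box_cart zero_less_mult_iff less_imp_le)
    qed
  qed (rule closed_cbox)
  then have "compact (closure {x. box_cutoff a b n x \<noteq> 0})"
    using compact_cbox by (rule compact_closure_if_subset)
  ultimately show ?thesis using assms sub unfolding test_functions_def by auto
qed

lemma box_cutoff_bounds: "\<bar>box_cutoff a b n x\<bar> \<le> 1"
proof -
  have "0 \<le> box_cutoff a b n x" unfolding box_cutoff_def
    by (intro prod_nonneg ballI mult_nonneg_nonneg flat_exp_one_bounds)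
  moreover have "box_cutoff a b n x \<le> 1" unfolding box_cutoff_def
    by (intro prod_le_1) (auto intro!: mult_le_one mult_nonneg_nonneg flat_exp_one_bounds simp del: of_nat_Suc)
  ultimately show ?thesis by simp
qed

lemma box_cutoff_tendsto: "(\<lambda>n. box_cutoff a b n x) \<longlonglongrightarrow> indicator (box a b) x"
proof -
  have "(\<lambda>n. box_cutoff a b n x) \<longlonglongrightarrow>
      (\<Prod>j\<in>UNIV. (if x $ j - a $ j > 0 then 1 else 0) * (if b $ j - x $ j > 0 then 1 else 0))"
    unfolding box_cutoff_def by (intro tendsto_prod tendsto_mult flat_exp_one_tendsto)
  moreover have "(\<Prod>j\<in>UNIV. (if x $ j - a $ j > 0 then 1 else 0) * (if b $ j - x $ j > 0 then 1 else 0))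
      = indicat_real (box a b) x"
  proof (cases "x \<in> box a b")
    case True
    then show ?thesis by (auto simp: mem_box_cart)
  next
    case False
    then obtain j where "\<not> (a $ j < x $ j \<and> x $ j < b $ j)" by (auto simp: mem_box_cart)
    then have "(if x $ j - a $ j > 0 then 1 else 0) * (if b $ j - x $ j > 0 then 1 else 0) = (0::real)"
      by auto
    then have "(\<Prod>j\<in>UNIV. (if x $ j - a $ j > 0 then 1 else 0) * (if b $ j - x $ j > 0 then 1 else 0)) = (0::real)"
      by (intro prod_zero bexI[of _ j]) auto
    then show ?thesis using False by simp
  qed
  ultimately show ?thesis by simp
qed

text \<open>Boxes are stable under intersection and generate the Borel sets; the sets over
  which the integral vanishes are closed under complements, as the total integral is zero, and under
  disjoint unions.\<close>

lemma AE_zero_if_box_integrals_zero: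
  fixes f :: "'a::euclidean_space \<Rightarrow> real"
  assumes f: "integrable lborel f" and f0: "(LINT x|lborel. f x) = 0"
    and box: "\<And>a b. (LINT x:box a b|lborel. f x) = 0"
  shows "AE x in lborel. f x = 0"
proof (rule density_unique_real)
  have si: "set_integrable lborel A f" if "A \<in> sets borel" for A
    unfolding set_integrable_def using that f by (intro integrable_mult_indicator) auto
  fix A :: "'a set" assume "A \<in> sets lborel"
  then have A: "A \<in> sigma_sets UNIV (range (\<lambda>(a, b). box a b))" by (simp add: borel_eq_box)
  have "Int_stable (range (\<lambda>(a, b::'a). box a b))"
    by (auto simp: Int_stable_def box_Int_box)
  moreover have "range (\<lambda>(a, b). box a b) \<subseteq> Pow (UNIV :: 'a set)" by simp
  ultimately have "(LINT x:A|lborel. f x) = 0"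
    using A
  proof (induction rule: sigma_sets_induct_disjoint)
    case (basic A)
    then show ?case using box by auto
  next
    case empty
    then show ?case by (simp add: set_lebesgue_integral_def)
  next
    case (compl A)
    then have A: "A \<in> sets borel" by (simp add: borel_eq_box)
    have "(LINT x:UNIV|lborel. f x) = (LINT x:A \<union> (UNIV - A)|lborel. f x)" by simp
    also have "\<dots> = (LINT x:A|lborel. f x) + (LINT x:UNIV - A|lborel. f x)"
      using A by (intro set_integral_Un si) auto
    finally show ?case using compl f0 by (simp add: set_lebesgue_integral_def)
  next
    case (union A)
    then have A: "A i \<in> sets borel" for i by (auto simp: borel_eq_box)
    have "(LINT x:(\<Union>i. A i)|lborel. f x) = (\<Sum>i. LINT x:A i|lborel. f x)"
      using A union by (intro lebesgue_integral_countable_add si) (auto simp: disjoint_family_on_def)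
    then show ?case using union by simp
  qed
  then show "(LINT x:A|lborel. f x) = (LINT x:A|lborel. 0)" by simp
qed (use f in auto)

lemma integral_lebesgue_on_eq_lborel:
  fixes f :: "'a::euclidean_space \<Rightarrow> real"
  assumes \<Omega>: "\<Omega> \<in> sets lebesgue" and f: "f \<in> borel_measurable borel" and 0: "\<And>x. x \<notin> \<Omega> \<Longrightarrow> f x = 0"
  shows "(LINT x|lebesgue_on \<Omega>. f x) = (LINT x|lborel. f x)"
    and "integrable (lebesgue_on \<Omega>) f \<longleftrightarrow> integrable lborel f"
proof -
  have eq: "(\<lambda>x. indicator \<Omega> x *\<^sub>R f x) = f" using 0 by (auto simp: indicator_def fun_eq_iff)
  show "(LINT x|lebesgue_on \<Omega>. f x) = (LINT x|lborel. f x)"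
    using \<Omega> f integral_restrict_space[of \<Omega> lebesgue f] unfolding eq by (simp add: integral_completion)
  show "integrable (lebesgue_on \<Omega>) f \<longleftrightarrow> integrable lborel f"
    using \<Omega> f integrable_restrict_space[of \<Omega> lebesgue f] unfolding eq by (simp add: integrable_completion)
qed

lemma test_function_integrable_mult:
  assumes \<phi>: "\<phi> \<in> test_functions \<Omega>" and g: "integrable (lebesgue_on \<Omega>) g"
    and \<Omega>: "\<Omega> \<in> sets lebesgue"
  shows "integrable (lebesgue_on \<Omega>) (\<lambda>x. g x * \<phi> x)"
    "integrable (lebesgue_on \<Omega>) (\<lambda>x. g x * partial_deriv i \<phi> x)"
proof -
  have C1: "C1_compact_support \<phi>" using \<phi> by (rule test_function_C1)
  obtain R where R: "\<And>x. R \<le> norm x \<Longrightarrow> \<phi> x = 0" using C1 unfolding C1_compact_support_def by blast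
  have pd0: "partial_deriv i \<phi> x = 0" if "R + 1 \<le> norm x" for x
    by (rule partial_deriv_outside_support[of "- cball 0 R"]) (use R that in auto)
  have cont: "continuous_on UNIV \<phi>" "continuous_on UNIV (partial_deriv i \<phi>)"
    using C1 C1_compact_support_continuous unfolding C1_compact_support_def by auto
  have *: "integrable (lebesgue_on \<Omega>) (\<lambda>x. g x * h x)"
    if h: "continuous_on UNIV h" "\<And>x. S \<le> norm x \<Longrightarrow> h x = 0" for h :: "real^'a \<Rightarrow> real" and S
  proof -
    obtain B where B: "B \<ge> 0" "\<And>x. \<bar>h x\<bar> \<le> B" using bounded_if_compact_support[OF h] by blast
    have h_meas: "h \<in> borel_measurable (lebesgue_on \<Omega>)"
      using borel_measurable_continuous_onI[OF h(1)] by (intro measurable_restrict_space1 measurable_completion) simp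
    show ?thesis
    proof (rule Bochner_Integration.integrable_bound)
      show "integrable (lebesgue_on \<Omega>) (\<lambda>x. B * g x)" using g by simp
      show "(\<lambda>x. g x * h x) \<in> borel_measurable (lebesgue_on \<Omega>)" using g h_meas by auto
      show "AE x in lebesgue_on \<Omega>. norm (g x * h x) \<le> norm (B * g x)"
        using B mult_right_mono[OF B(2) abs_ge_zero] by (intro AE_I2) (simp add: abs_mult mult.commute)
    qed
  qed
  show "integrable (lebesgue_on \<Omega>) (\<lambda>x. g x * \<phi> x)" by (rule *[OF cont(1) R])
  show "integrable (lebesgue_on \<Omega>) (\<lambda>x. g x * partial_deriv i \<phi> x)" by (rule *[OF cont(2) pd0])
qed

text \<open>The fundamental lemma.  On a box \<open>R\<close> whose closure lies in \<open>\<Omega>\<close>, all boxes \<open>B \<inter> R\<close> have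
  cut-off functions with support in \<open>\<Omega>\<close>, so that the integrals of \<open>g\<close> over them vanish; \<open>\<Omega>\<close> is a
  countable union of such boxes up to a null set.\<close>

theorem fundamental_lemma:
  fixes g :: "real^'n \<Rightarrow> real"
  assumes "open \<Omega>" and g: "integrable (lebesgue_on \<Omega>) g"
    and orth: "\<And>\<phi>. \<phi> \<in> test_functions \<Omega> \<Longrightarrow> (LINT x|lebesgue_on \<Omega>. g x * \<phi> x) = 0"
  shows "AE x in lebesgue_on \<Omega>. g x = 0"
proof -
  have \<Omega>: "\<Omega> \<in> sets lebesgue" using assms(1) by simp
  have g': "integrable lebesgue (\<lambda>x. indicator \<Omega> x * g x)"
    using g \<Omega> by (simp add: integrable_restrict_space)
  have box0: "(LINT x|lebesgue. indicator (box a b) x * g x) = 0" if ab: "cbox a b \<subseteq> \<Omega>" for a b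
  proof -
    have "(\<lambda>n. LINT x|lebesgue_on \<Omega>. g x * box_cutoff a b n x) \<longlonglongrightarrow>
        (LINT x|lebesgue_on \<Omega>. g x * indicator (box a b) x)"
    proof (rule integral_dominated_convergence[where w="\<lambda>x. \<bar>g x\<bar>"])
      show "(\<lambda>x. g x * indicator (box a b) x) \<in> borel_measurable (lebesgue_on \<Omega>)"
      proof (intro borel_measurable_times)
        have "box a b \<subseteq> \<Omega>" using ab box_subset_cbox by blast
        then show "indicator (box a b) \<in> borel_measurable (lebesgue_on \<Omega>)"
          using \<Omega> by (intro borel_measurable_indicator) (auto simp: sets_restrict_space_iff)
      qed (use g in auto)
      show "(\<lambda>x. g x * box_cutoff a b n x) \<in> borel_measurable (lebesgue_on \<Omega>)" for n
        using test_function_integrable_mult(1)[OF box_cutoff_test_function[OF ab] g \<Omega>] by auto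
      show "AE x in lebesgue_on \<Omega>. (\<lambda>n. g x * box_cutoff a b n x) \<longlonglongrightarrow> g x * indicator (box a b) x"
        by (intro AE_I2 tendsto_intros box_cutoff_tendsto)
      show "AE x in lebesgue_on \<Omega>. norm (g x * box_cutoff a b n x) \<le> \<bar>g x\<bar>" for n
        using mult_left_le[OF box_cutoff_bounds abs_ge_zero] by (intro AE_I2) (simp add: abs_mult)
    qed (use g in auto)
    then have "(LINT x|lebesgue_on \<Omega>. g x * indicator (box a b) x) = 0"
      using orth[OF box_cutoff_test_function[OF ab]] by (simp add: LIMSEQ_const_iff)
    moreover have "(LINT x|lebesgue_on \<Omega>. g x * indicator (box a b) x)
        = (LINT x|lebesgue. indicator \<Omega> x *\<^sub>R (g x * indicator (box a b) x))"
      using \<Omega> by (intro integral_restrict_space) auto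
    moreover have "(\<lambda>x. indicator \<Omega> x *\<^sub>R (g x * indicator (box a b) x)) = (\<lambda>x. indicator (box a b) x * g x)"
      using ab box_subset_cbox[of a b] by (auto simp: indicator_def fun_eq_iff)
    ultimately show ?thesis by simp
  qed
  have "AE x in lebesgue. x \<in> cbox a b \<longrightarrow> g x = 0" if ab: "cbox a b \<subseteq> \<Omega>" for a b
  proof -
    have int: "integrable lebesgue (\<lambda>x. indicator (box a b) x * g x)"
    proof -
      have "integrable lebesgue (\<lambda>x. indicator (box a b) x *\<^sub>R (indicator \<Omega> x * g x))"
        using g' by (intro integrable_mult_indicator) auto
      moreover have "(\<lambda>x. indicator (box a b) x *\<^sub>R (indicator \<Omega> x * g x)) = (\<lambda>x. indicator (box a b) x * g x)"
        using ab box_subset_cbox[of a b] by (auto simp: indicator_def fun_eq_iff)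
      ultimately show ?thesis by simp
    qed
    then obtain f where f: "f \<in> borel_measurable lborel" "AE x in lborel. indicator (box a b) x * g x = f x"
      using completion_ex_borel_measurable_real[of "\<lambda>x. indicator (box a b) x * g x" lborel] by auto
    have f_AE: "AE x in lebesgue. indicator (box a b) x * g x = f x" using f(2) by (rule AE_completion)
    have f_meas: "f \<in> borel_measurable lebesgue" using f(1) by (rule measurable_completion)
    have "integrable lebesgue f" using integrable_cong_AE_imp[OF int f_meas] f_AE by auto
    then have fint: "integrable lborel f" using f(1) by (simp add: integrable_completion)
    have f_int: "(LINT x:box c d|lborel. f x) = 0" for c d
    proof -
      have "(LINT x:box c d|lborel. f x) = (LINT x|lebesgue. indicator (box c d) x * f x)"
        unfolding set_lebesgue_integral_def using f(1) by (subst integral_completion) auto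
      also have "\<dots> = (LINT x|lebesgue. indicator (box c d) x * (indicator (box a b) x * g x))"
      proof (rule integral_cong_AE)
        show "(\<lambda>x. indicator (box c d) x * f x) \<in> borel_measurable lebesgue"
          using f_meas by (intro borel_measurable_times borel_measurable_indicator) auto
        show "(\<lambda>x. indicator (box c d) x * (indicator (box a b) x * g x)) \<in> borel_measurable lebesgue"
          by (intro borel_measurable_times[OF borel_measurable_indicator borel_measurable_integrable[OF int]]) simp
        show "AE x in lebesgue. indicator (box c d) x * f x = indicator (box c d) x * (indicator (box a b) x * g x)"
          using f_AE by eventually_elim simp
      qed
      also have "\<dots> = 0"
      proof -
        obtain p q where pq: "box c d \<inter> box a b = box p q" using box_Int_box by blast
        show ?thesis
        proof (cases "box p q = {}")
          case True
          then have "indicator (box c d) x * (indicator (box a b) x * g x) = 0" for x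
            using pq by (auto simp: indicator_def)
          then show ?thesis by (simp only: Bochner_Integration.integral_zero)
        next
          case False
          have "box p q \<subseteq> box a b" using pq by blast
          then have "closure (box p q) \<subseteq> cbox a b"
            using box_subset_cbox[of a b] by (intro closure_minimal closed_cbox) auto
          then have "cbox p q \<subseteq> cbox a b" using False by (simp add: closure_box)
          then have "(LINT x|lebesgue. indicator (box p q) x * g x) = 0" using ab by (intro box0) auto
          moreover have "(\<lambda>x. indicator (box c d) x * (indicator (box a b) x * g x)) = (\<lambda>x. indicator (box p q) x * g x)"
            unfolding pq[symmetric] by (auto simp: indicator_def fun_eq_iff)
          ultimately show ?thesis by (simp only:)
        qed
      qed
      finally show ?thesis .
    qed
    have "(LINT x|lborel. f x) = (LINT x|lebesgue. f x)" using f(1) by (simp add: integral_completion)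
    also have "\<dots> = (LINT x|lebesgue. indicator (box a b) x * g x)"
      using f_AE f_meas borel_measurable_integrable[OF int] by (intro integral_cong_AE) auto
    also have "\<dots> = 0" using ab by (rule box0)
    finally have "AE x in lborel. f x = 0"
      using AE_zero_if_box_integrals_zero[OF fint _ f_int] by blast
    then have "AE x in lebesgue. f x = 0" by (rule AE_completion)
    moreover have "AE x in lebesgue. x \<notin> cbox a b - box a b"
      using negligible_frontier_interval[of a b] by (intro AE_not_in) (simp add: negligible_iff_null_sets)
    ultimately show ?thesis using f_AE
      by eventually_elim (auto simp: indicator_def split: if_splits)
  qed
  note cbox_zero = this
  obtain \<D> where \<D>: "countable \<D>" "\<D> \<subseteq> Pow \<Omega>" "\<And>X. X \<in> \<D> \<Longrightarrow> \<exists>a b. X = cbox a b" "\<Union>\<D> = \<Omega>"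
    by (rule open_countable_Union_open_cbox[OF assms(1)], rule that)
  have "AE x in lebesgue. x \<in> X \<longrightarrow> g x = 0" if X: "X \<in> \<D>" for X
  proof -
    obtain a b where "X = cbox a b" using \<D>(3)[OF X] by blast
    then show ?thesis using cbox_zero[of a b] \<D>(2) X by blast
  qed
  then have "AE x in lebesgue. \<forall>X\<in>\<D>. x \<in> X \<longrightarrow> g x = 0"
    by (subst AE_ball_countable[OF \<D>(1)]) blast
  then have "AE x in lebesgue. x \<in> \<Omega> \<longrightarrow> g x = 0"
    by eventually_elim (use \<D>(4) in blast)
  then show ?thesis using \<Omega> by (simp add: AE_restrict_space_iff)
qed


section \<open>The Sobolev spaces of a bounded open set\<close>

lemma ip_norm_inner: "ip_norm inner = norm"
  by (auto simp: ip_norm_def norm_eq_sqrt_inner fun_eq_iff)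

lemma semi_inner_space_inner: "semi_inner_space (UNIV :: 'a::real_inner set) inner"
proof
  show "x \<bullet> y = y \<bullet> x" for x y :: 'a by (rule inner_commute)
qed (auto simp: inner_add_left)

lemma complete_in_UNIV: "complete_in (UNIV :: 'a::banach set) norm"
  unfolding complete_in_def
proof (intro allI impI)
  fix X :: "nat \<Rightarrow> 'a" assume "\<forall>e>0. \<exists>M. \<forall>m\<ge>M. \<forall>n\<ge>M. norm (X m - X n) < e"
  then have "Cauchy X" by (auto simp: Cauchy_def dist_norm)
  then obtain x where "X \<longlonglongrightarrow> x" using Cauchy_convergent convergent_def by blast
  then have "(\<lambda>n. norm (X n - x)) \<longlonglongrightarrow> 0" by (simp add: LIM_zero tendsto_norm_zero)
  then show "\<exists>x\<in>UNIV. (\<lambda>n. norm (X n - x)) \<longlonglongrightarrow> 0" by blast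
qed

lemma semi_inner_space_square_integrable:
  "semi_inner_space (square_integrable_in (UNIV :: 'a::euclidean_space set) norm M) (\<lambda>f g. LINT x|M. f x \<bullet> g x)"
  using semi_inner_space.semi_inner_space_Lsq[OF semi_inner_space_inner, of M] by (simp add: ip_norm_inner)

lemma complete_in_square_integrable:
  "complete_in (square_integrable_in (UNIV :: 'a::euclidean_space set) norm M) (ip_norm (\<lambda>f g. LINT x|M. f x \<bullet> g x))"
  using semi_inner_space.complete_in_Lsq[OF semi_inner_space_inner, of M] complete_in_UNIV by (simp add: ip_norm_inner)

lemma integrable_inner_square_integrable:
  fixes f g :: "'m \<Rightarrow> 'a::euclidean_space"
  assumes "f \<in> square_integrable_in UNIV norm M" "g \<in> square_integrable_in UNIV norm M"
  shows "integrable M (\<lambda>x. f x \<bullet> g x)"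
  using semi_inner_space.integrable_ip[OF semi_inner_space_inner, of f M g] assms by (simp add: ip_norm_inner)

lemma square_integrable_null_iff:
  fixes f :: "'m \<Rightarrow> 'a::euclidean_space"
  assumes "f \<in> square_integrable_in UNIV norm M"
  shows "(LINT x|M. f x \<bullet> f x) = 0 \<longleftrightarrow> (AE x in M. f x = 0)"
  using integral_nonneg_eq_0_iff_AE[OF integrable_inner_square_integrable[OF assms assms]] by simp

lemma square_integrable_in_UNIV_iff:
  fixes f :: "'m \<Rightarrow> 'a::euclidean_space"
  shows "f \<in> square_integrable_in UNIV norm M \<longleftrightarrow> f \<in> borel_measurable M \<and> integrable M (\<lambda>x. (norm (f x))\<^sup>2)"
  by (simp add: square_integrable_in_def strongly_measurable_in_UNIV_iff)

lemma L2_eq: "L2 \<Omega> = square_integrable_in UNIV norm (lebesgue_on \<Omega>)"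
  by (auto simp: L2_def square_integrable_in_UNIV_iff)

lemma ip_L2_eq: "ip_L2 \<Omega> = (\<lambda>u v. LINT x|lebesgue_on \<Omega>. u x \<bullet> v x)"
  by (auto simp: ip_L2_def fun_eq_iff)

lemma norm_L2_eq: "norm_L2 \<Omega> = ip_norm (ip_L2 \<Omega>)"
  by (auto simp: norm_L2_def ip_norm_def fun_eq_iff)

lemma semi_inner_space_L2: "semi_inner_space (L2 \<Omega>) (ip_L2 \<Omega>)"
  unfolding L2_eq ip_L2_eq by (rule semi_inner_space_square_integrable)

lemma complete_in_L2: "complete_in (L2 \<Omega>) (norm_L2 \<Omega>)"
  unfolding L2_eq norm_L2_eq ip_L2_eq by (rule complete_in_square_integrable)

definition vector_L2 :: "(real^'n) set \<Rightarrow> (real^'n \<Rightarrow> real^'n) set"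
  where "vector_L2 \<Omega> = square_integrable_in UNIV norm (lebesgue_on \<Omega>)"

definition ip_vector_L2 :: "(real^'n) set \<Rightarrow> (real^'n \<Rightarrow> real^'n) \<Rightarrow> (real^'n \<Rightarrow> real^'n) \<Rightarrow> real"
  where "ip_vector_L2 \<Omega> g h = (LINT x|lebesgue_on \<Omega>. g x \<bullet> h x)"

lemma semi_inner_space_vector_L2: "semi_inner_space (vector_L2 \<Omega>) (ip_vector_L2 \<Omega>)"
  unfolding vector_L2_def ip_vector_L2_def[abs_def] by (rule semi_inner_space_square_integrable)

lemma complete_in_vector_L2: "complete_in (vector_L2 \<Omega>) (ip_norm (ip_vector_L2 \<Omega>))"
  unfolding vector_L2_def ip_vector_L2_def[abs_def] by (rule complete_in_square_integrable)

lemma vector_L2_iff: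
  "g \<in> vector_L2 \<Omega> \<longleftrightarrow> g \<in> borel_measurable (lebesgue_on \<Omega>) \<and> integrable (lebesgue_on \<Omega>) (\<lambda>x. (norm (g x))\<^sup>2)"
  unfolding vector_L2_def by (rule square_integrable_in_UNIV_iff)

lemma ip_vector_L2_cong:
  assumes "g \<in> vector_L2 \<Omega>" "g' \<in> vector_L2 \<Omega>" "h \<in> vector_L2 \<Omega>" "h' \<in> vector_L2 \<Omega>"
    and "AE x in lebesgue_on \<Omega>. g x = g' x" "AE x in lebesgue_on \<Omega>. h x = h' x"
  shows "ip_vector_L2 \<Omega> g h = ip_vector_L2 \<Omega> g' h'"
  unfolding ip_vector_L2_def
proof (rule integral_cong_AE)
  show "AE x in lebesgue_on \<Omega>. g x \<bullet> h x = g' x \<bullet> h' x" using assms(5,6) by eventually_elim simp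
qed (use assms in \<open>auto simp: vector_L2_iff\<close>)

definition ip_H1 :: "(real^'n) set \<Rightarrow> (real^'n \<Rightarrow> real) \<Rightarrow> (real^'n \<Rightarrow> real) \<Rightarrow> real"
  where "ip_H1 \<Omega> u v = ip_L2 \<Omega> u v + ip_vector_L2 \<Omega> (grad \<Omega> u) (grad \<Omega> v)"

lemma seminorm_H1_eq: "seminorm_H1 \<Omega> u = ip_norm (ip_vector_L2 \<Omega>) (grad \<Omega> u)"
  by (simp add: seminorm_H1_def ip_norm_def ip_vector_L2_def power2_norm_eq_inner)

lemma seminorm_H1_sq: "(seminorm_H1 \<Omega> u)\<^sup>2 = ip_vector_L2 \<Omega> (grad \<Omega> u) (grad \<Omega> u)"
  by (simp add: seminorm_H1_eq ip_norm_def ip_vector_L2_def)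

lemma norm_L2_sq: "(norm_L2 \<Omega> u)\<^sup>2 = ip_L2 \<Omega> u u"
  by (simp add: norm_L2_def ip_L2_def)

lemma norm_H1_eq: "norm_H1 \<Omega> = ip_norm (ip_H1 \<Omega>)"
  by (auto simp: norm_H1_def ip_norm_def ip_H1_def norm_L2_sq seminorm_H1_sq fun_eq_iff)

locale bounded_open =
  fixes \<Omega> :: "(real^'n) set"
  assumes open_domain: "open \<Omega>" and bounded_domain: "bounded \<Omega>"
begin

sublocale L2: semi_inner_space "L2 \<Omega>" "ip_L2 \<Omega>"
  by (rule semi_inner_space_L2)

sublocale vL2: semi_inner_space "vector_L2 \<Omega>" "ip_vector_L2 \<Omega>"
  by (rule semi_inner_space_vector_L2)

abbreviation "M\<Omega> \<equiv> lebesgue_on \<Omega>"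

lemma domain_sets: "\<Omega> \<in> sets lebesgue"
  using open_domain by simp

lemma finite_measure_domain: "finite_measure M\<Omega>"
proof
  have "emeasure lebesgue \<Omega> < \<infinity>"
    using emeasure_bounded_finite[OF bounded_domain] open_domain by simp
  then show "emeasure M\<Omega> (space M\<Omega>) \<noteq> \<infinity>"
    using domain_sets by (simp add: emeasure_restrict_space)
qed

lemma square_integrable_imp_integrable:
  assumes "u \<in> borel_measurable M\<Omega>" "integrable M\<Omega> (\<lambda>x. (u x)\<^sup>2 :: real)"
  shows "integrable M\<Omega> u"
proof -
  interpret finite_measure M\<Omega> by (rule finite_measure_domain)
  show ?thesis
  proof (rule Bochner_Integration.integrable_bound)
    show "integrable M\<Omega> (\<lambda>x. 1 + (u x)\<^sup>2)" using assms by simp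
    have "\<bar>t\<bar> \<le> 1 + t\<^sup>2" for t :: real
      using zero_le_power2[of "\<bar>t\<bar> - 1"] unfolding power2_diff by simp
    then show "AE x in M\<Omega>. norm (u x) \<le> norm (1 + (u x)\<^sup>2)" by (intro AE_I2) simp
  qed (rule assms)
qed

lemma L2D:
  assumes "u \<in> L2 \<Omega>"
  shows "u \<in> borel_measurable M\<Omega>" "integrable M\<Omega> u" "integrable M\<Omega> (\<lambda>x. (u x)\<^sup>2)"
proof -
  show 1: "u \<in> borel_measurable M\<Omega>" and 2: "integrable M\<Omega> (\<lambda>x. (u x)\<^sup>2)"
    using assms by (auto simp: L2_def)
  from 1 2 show "integrable M\<Omega> u" by (rule square_integrable_imp_integrable)
qed

lemma vector_L2_component:
  assumes "g \<in> vector_L2 \<Omega>"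
  shows "(\<lambda>x. g x $ i) \<in> borel_measurable M\<Omega>" "integrable M\<Omega> (\<lambda>x. g x $ i)"
proof -
  have g: "g \<in> borel_measurable M\<Omega>" "integrable M\<Omega> (\<lambda>x. (norm (g x))\<^sup>2)"
    using assms by (auto simp: vector_L2_iff)
  have "(\<lambda>x. g x \<bullet> axis i 1) \<in> borel_measurable M\<Omega>" using g by simp
  then show 1: "(\<lambda>x. g x $ i) \<in> borel_measurable M\<Omega>" by (simp add: inner_axis)
  have "integrable M\<Omega> (\<lambda>x. (g x $ i)\<^sup>2)"
  proof (rule Bochner_Integration.integrable_bound[OF g(2)])
    show "AE x in M\<Omega>. norm ((g x $ i)\<^sup>2) \<le> norm ((norm (g x))\<^sup>2)"
      by (intro AE_I2) (simp add: component_le_norm_cart flip: abs_le_square_iff)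
  qed (use 1 in simp)
  with 1 show "integrable M\<Omega> (\<lambda>x. g x $ i)" by (rule square_integrable_imp_integrable)
qed

lemma L2_null_iff: "u \<in> L2 \<Omega> \<Longrightarrow> norm_L2 \<Omega> u = 0 \<longleftrightarrow> (AE x in M\<Omega>. u x = 0)"
  using square_integrable_null_iff[of u "M\<Omega>"] unfolding L2_eq norm_L2_def ip_L2_eq by simp

lemma vector_L2_null_iff:
  "g \<in> vector_L2 \<Omega> \<Longrightarrow> ip_norm (ip_vector_L2 \<Omega>) g = 0 \<longleftrightarrow> (AE x in M\<Omega>. g x = 0)"
  using square_integrable_null_iff[of g "M\<Omega>"] unfolding vector_L2_def ip_norm_def ip_vector_L2_def by simp

lemma continuous_compact_support_L2:
  assumes h: "continuous_on UNIV h" "\<And>x. R \<le> norm x \<Longrightarrow> h x = 0"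
  shows "h \<in> L2 \<Omega>"
proof -
  interpret finite_measure M\<Omega> by (rule finite_measure_domain)
  obtain B where B: "B \<ge> 0" "\<And>x. \<bar>h x\<bar> \<le> B" using bounded_if_compact_support[OF h] by blast
  have h_meas: "h \<in> borel_measurable M\<Omega>"
    using borel_measurable_continuous_onI[OF h(1)] by (intro measurable_restrict_space1 measurable_completion) simp
  moreover have "integrable M\<Omega> (\<lambda>x. (h x)\<^sup>2)"
  proof (rule integrable_const_bound[of _ "B\<^sup>2"])
    have "(h x)\<^sup>2 \<le> B\<^sup>2" for x using B abs_le_square_iff[of "h x" B] by simp
    then show "AE x in M\<Omega>. norm ((h x)\<^sup>2) \<le> B\<^sup>2" by simp
  qed (use h_meas in simp)
  ultimately show ?thesis by (simp add: L2_def)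
qed

lemma test_function_L2:
  assumes "\<phi> \<in> test_functions \<Omega>"
  shows "\<phi> \<in> L2 \<Omega>" "partial_deriv i \<phi> \<in> L2 \<Omega>"
proof -
  have C1: "C1_compact_support \<phi>" using assms by (rule test_function_C1)
  obtain R where R: "\<And>x. R \<le> norm x \<Longrightarrow> \<phi> x = 0" using C1 unfolding C1_compact_support_def by blast
  have pd0: "partial_deriv i \<phi> x = 0" if "R + 1 \<le> norm x" for x
    by (rule partial_deriv_outside_support[of "- cball 0 R"]) (use R that in auto)
  show "\<phi> \<in> L2 \<Omega>"
    by (rule continuous_compact_support_L2[OF C1_compact_support_continuous[OF C1] R])
  show "partial_deriv i \<phi> \<in> L2 \<Omega>"
    using C1 unfolding C1_compact_support_def by (intro continuous_compact_support_L2[OF _ pd0]) auto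
qed

lemma test_function_axis_vector_L2:
  assumes "\<phi> \<in> test_functions \<Omega>"
  shows "(\<lambda>x. \<phi> x *\<^sub>R axis i 1) \<in> vector_L2 \<Omega>"
  using L2D[OF test_function_L2(1)[OF assms]] by (simp add: vector_L2_iff norm_axis_1)

text \<open>The density of the test functions in \<open>L2\<close>, in the form in which it identifies elements of \<open>H\<close> as
  functionals on \<open>V\<close>.\<close>

lemma L2_orthogonal_test_functions:
  assumes "h \<in> L2 \<Omega>" "\<And>\<phi>. \<phi> \<in> test_functions \<Omega> \<Longrightarrow> ip_L2 \<Omega> h \<phi> = 0"
  shows "norm_L2 \<Omega> h = 0"
  using fundamental_lemma[OF open_domain L2D(2)[OF assms(1)]] assms
  by (simp add: L2_null_iff ip_L2_def)

subsection \<open>Weak gradients\<close>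

lemma weak_gradientD:
  assumes "weak_gradient \<Omega> u g"
  shows "g \<in> vector_L2 \<Omega>"
    and "\<phi> \<in> test_functions \<Omega> \<Longrightarrow> ip_L2 \<Omega> u (partial_deriv i \<phi>) = - ip_vector_L2 \<Omega> g (\<lambda>x. \<phi> x *\<^sub>R axis i 1)"
  using assms by (auto simp: weak_gradient_def vector_L2_iff ip_L2_def ip_vector_L2_def inner_axis mult.commute)

lemma weak_gradientI:
  assumes "g \<in> vector_L2 \<Omega>"
    "\<And>\<phi> i. \<phi> \<in> test_functions \<Omega> \<Longrightarrow> ip_L2 \<Omega> u (partial_deriv i \<phi>) = - ip_vector_L2 \<Omega> g (\<lambda>x. \<phi> x *\<^sub>R axis i 1)"
  shows "weak_gradient \<Omega> u g"
  using assms by (auto simp: weak_gradient_def vector_L2_iff ip_L2_def ip_vector_L2_def inner_axis mult.commute)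

text \<open>The fundamental lemma, applied to the components of the difference.  Weak gradients are
  therefore additive almost everywhere, although \<open>grad\<close> chooses an arbitrary one for each function.\<close>

lemma weak_gradient_unique:
  assumes "weak_gradient \<Omega> u g" "weak_gradient \<Omega> u h"
  shows "AE x in M\<Omega>. g x = h x"
proof -
  note gh = assms[THEN weak_gradientD(1)]
  have d: "g - h \<in> vector_L2 \<Omega>" using gh by blast
  have "AE x in M\<Omega>. (g - h) x $ i = 0" for i
  proof (rule fundamental_lemma[OF open_domain vector_L2_component(2)[OF d]])
    fix \<phi> assume \<phi>: "\<phi> \<in> test_functions \<Omega>"
    have "(LINT x|M\<Omega>. (g - h) x $ i * \<phi> x) = ip_vector_L2 \<Omega> (g - h) (\<lambda>x. \<phi> x *\<^sub>R axis i 1)"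
      by (simp add: ip_vector_L2_def inner_axis mult.commute)
    also have "\<dots> = 0"
      using weak_gradientD(2)[OF assms(1) \<phi>, of i] weak_gradientD(2)[OF assms(2) \<phi>, of i] gh
        test_function_axis_vector_L2[OF \<phi>, of i]
      by (simp add: vL2.ip_diff_left)
    finally show "(LINT x|M\<Omega>. (g - h) x $ i * \<phi> x) = 0" .
  qed
  then have "AE x in M\<Omega>. \<forall>i\<in>UNIV. (g - h) x $ i = 0" by (intro AE_finite_allI) auto
  then show ?thesis by eventually_elim (simp add: vec_eq_iff)
qed

lemma weak_gradient_add:
  assumes "u \<in> L2 \<Omega>" "v \<in> L2 \<Omega>" "weak_gradient \<Omega> u g" "weak_gradient \<Omega> v h"
  shows "weak_gradient \<Omega> (u + v) (g + h)"
  using assms weak_gradientD[OF assms(3)] weak_gradientD[OF assms(4)] test_function_L2 test_function_axis_vector_L2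
  by (intro weak_gradientI) (auto simp: L2.ip_add_left vL2.ip_add_left)

lemma weak_gradient_scale:
  assumes "u \<in> L2 \<Omega>" "weak_gradient \<Omega> u g"
  shows "weak_gradient \<Omega> (c *\<^sub>R u) (c *\<^sub>R g)"
  using assms weak_gradientD[OF assms(2)] test_function_L2 test_function_axis_vector_L2
  by (intro weak_gradientI) (auto simp: L2.ip_scale_left vL2.ip_scale_left)

lemma weak_gradient_null:
  assumes "u \<in> L2 \<Omega>" "norm_L2 \<Omega> u = 0"
  shows "weak_gradient \<Omega> u 0"
proof (rule weak_gradientI)
  fix \<phi> i assume "\<phi> \<in> test_functions \<Omega>"
  then show "ip_L2 \<Omega> u (partial_deriv i \<phi>) = - ip_vector_L2 \<Omega> 0 (\<lambda>x. \<phi> x *\<^sub>R axis i 1)"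
    using L2.ip_null_left[OF assms(1) test_function_L2(2)] assms(2) test_function_axis_vector_L2
    by (simp add: norm_L2_eq vL2.ip_zero_left)
qed simp

text \<open>Integration by parts on the whole space: both functions vanish outside \<open>\<Omega>\<close>.\<close>

lemma weak_gradient_test_function:
  assumes \<phi>: "\<phi> \<in> test_functions \<Omega>"
  shows "weak_gradient \<Omega> \<phi> (\<lambda>x. \<chi> i. partial_deriv i \<phi> x)"
proof (rule weak_gradientI)
  have eq: "(\<lambda>x. \<chi> i. partial_deriv i \<phi> x) = (\<Sum>i\<in>UNIV. (\<lambda>x. partial_deriv i \<phi> x *\<^sub>R axis i 1))"
  proof
    fix x
    have "(\<Sum>i\<in>I. (\<lambda>x. partial_deriv i \<phi> x *\<^sub>R axis i 1 :: real^'n)) x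
        = (\<Sum>i\<in>I. partial_deriv i \<phi> x *\<^sub>R axis i 1)" if "finite I" for I
      using that by (induction I rule: finite_induct) auto
    then show "(\<chi> i. partial_deriv i \<phi> x) = (\<Sum>i\<in>UNIV. (\<lambda>x. partial_deriv i \<phi> x *\<^sub>R axis i 1)) x"
      by (simp add: vec_eq_iff axis_def if_distrib cong: if_cong)
  qed
  have "(\<lambda>x. partial_deriv i \<phi> x *\<^sub>R axis i 1) \<in> vector_L2 \<Omega>" for i
    using L2D[OF test_function_L2(2)[OF \<phi>]] by (simp add: vector_L2_iff norm_axis_1)
  then show "(\<lambda>x. \<chi> i. partial_deriv i \<phi> x) \<in> vector_L2 \<Omega>"
    unfolding eq by (rule vL2.sum_in)
  fix \<psi> i assume \<psi>: "\<psi> \<in> test_functions \<Omega>"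
  note C1 = test_function_C1[OF \<phi>] test_function_C1[OF \<psi>]
  have [measurable]: "\<phi> \<in> borel_measurable borel" "\<psi> \<in> borel_measurable borel"
      "partial_deriv i \<phi> \<in> borel_measurable borel" "partial_deriv i \<psi> \<in> borel_measurable borel"
    using C1 C1[THEN C1_compact_support_continuous] unfolding C1_compact_support_def
    by (auto intro: borel_measurable_continuous_onI)
  have "ip_L2 \<Omega> \<phi> (partial_deriv i \<psi>) = (LINT x|lborel. \<phi> x * partial_deriv i \<psi> x)"
    unfolding ip_L2_def using test_function_outside[OF \<phi>]
    by (intro integral_lebesgue_on_eq_lborel domain_sets) auto
  also have "\<dots> = - (LINT x|lborel. partial_deriv i \<phi> x * \<psi> x)" by (rule integration_by_parts[OF C1])
  also have "(LINT x|lborel. partial_deriv i \<phi> x * \<psi> x) = (LINT x|M\<Omega>. partial_deriv i \<phi> x * \<psi> x)"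
    using test_function_outside[OF \<phi>] by (intro integral_lebesgue_on_eq_lborel[symmetric] domain_sets) auto
  finally show "ip_L2 \<Omega> \<phi> (partial_deriv i \<psi>)
      = - ip_vector_L2 \<Omega> (\<lambda>x. \<chi> i. partial_deriv i \<phi> x) (\<lambda>x. \<psi> x *\<^sub>R axis i 1)"
    by (simp add: ip_vector_L2_def inner_axis mult.commute)
qed

subsection \<open>The space \<open>H\<^sup>1\<close>\<close>

lemma H1D:
  assumes "u \<in> H1 \<Omega>"
  shows "u \<in> L2 \<Omega>" "weak_gradient \<Omega> u (grad \<Omega> u)" "grad \<Omega> u \<in> vector_L2 \<Omega>"
proof -
  show "u \<in> L2 \<Omega>" using assms unfolding H1_def by blast
  have "\<exists>g. weak_gradient \<Omega> u g" using assms unfolding H1_def by blast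
  then show 1: "weak_gradient \<Omega> u (grad \<Omega> u)" unfolding grad_def by (rule someI_ex)
  show "grad \<Omega> u \<in> vector_L2 \<Omega>" using 1 by (rule weak_gradientD)
qed

lemma H1I: "u \<in> L2 \<Omega> \<Longrightarrow> weak_gradient \<Omega> u g \<Longrightarrow> u \<in> H1 \<Omega>"
  unfolding H1_def by blast

lemma grad_AE_eq:
  assumes "u \<in> L2 \<Omega>" "weak_gradient \<Omega> u g"
  shows "AE x in M\<Omega>. grad \<Omega> u x = g x"
  by (rule weak_gradient_unique[OF H1D(2)[OF H1I[OF assms]] assms(2)])

lemma H1_add: "u \<in> H1 \<Omega> \<Longrightarrow> v \<in> H1 \<Omega> \<Longrightarrow> u + v \<in> H1 \<Omega>"
  and H1_scale: "u \<in> H1 \<Omega> \<Longrightarrow> c *\<^sub>R u \<in> H1 \<Omega>"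
  using weak_gradient_add H1D by (blast intro: H1I L2.add_in, blast intro: H1I L2.scale_in weak_gradient_scale H1D)

lemma grad_add: "u \<in> H1 \<Omega> \<Longrightarrow> v \<in> H1 \<Omega> \<Longrightarrow> AE x in M\<Omega>. grad \<Omega> (u + v) x = (grad \<Omega> u + grad \<Omega> v) x"
  by (intro grad_AE_eq weak_gradient_add H1D L2.add_in)

lemma grad_scale: "u \<in> H1 \<Omega> \<Longrightarrow> AE x in M\<Omega>. grad \<Omega> (c *\<^sub>R u) x = (c *\<^sub>R grad \<Omega> u) x"
  by (intro grad_AE_eq weak_gradient_scale H1D L2.scale_in)

lemma H1_diff: "u \<in> H1 \<Omega> \<Longrightarrow> v \<in> H1 \<Omega> \<Longrightarrow> u - v \<in> H1 \<Omega>"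
  using H1_add[of u "- 1 *\<^sub>R v"] H1_scale[of v "-1"] by simp

lemma grad_diff:
  assumes "u \<in> H1 \<Omega>" "v \<in> H1 \<Omega>"
  shows "AE x in M\<Omega>. grad \<Omega> (u - v) x = (grad \<Omega> u - grad \<Omega> v) x"
proof -
  have "AE x in M\<Omega>. grad \<Omega> (u - v) x = (grad \<Omega> u + grad \<Omega> (- v)) x"
    using grad_add[OF assms(1) H1_scale[OF assms(2), of "-1"]] by simp
  moreover have "AE x in M\<Omega>. grad \<Omega> (- v) x = (- grad \<Omega> v) x"
    using grad_scale[OF assms(2), of "-1"] by simp
  ultimately show ?thesis by eventually_elim simp
qed

lemma ip_vector_L2_grad_add:
  assumes "u \<in> H1 \<Omega>" "v \<in> H1 \<Omega>" "h \<in> vector_L2 \<Omega>"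
  shows "ip_vector_L2 \<Omega> (grad \<Omega> (u + v)) h = ip_vector_L2 \<Omega> (grad \<Omega> u) h + ip_vector_L2 \<Omega> (grad \<Omega> v) h"
proof -
  have "ip_vector_L2 \<Omega> (grad \<Omega> (u + v)) h = ip_vector_L2 \<Omega> (grad \<Omega> u + grad \<Omega> v) h"
    using assms by (intro ip_vector_L2_cong grad_add H1D H1_add vL2.add_in) auto
  then show ?thesis using assms by (simp add: vL2.ip_add_left H1D)
qed

lemma ip_vector_L2_grad_scale:
  assumes "u \<in> H1 \<Omega>" "h \<in> vector_L2 \<Omega>"
  shows "ip_vector_L2 \<Omega> (grad \<Omega> (c *\<^sub>R u)) h = c * ip_vector_L2 \<Omega> (grad \<Omega> u) h"
proof -
  have "ip_vector_L2 \<Omega> (grad \<Omega> (c *\<^sub>R u)) h = ip_vector_L2 \<Omega> (c *\<^sub>R grad \<Omega> u) h"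
    using assms by (intro ip_vector_L2_cong grad_scale H1D H1_scale vL2.scale_in) auto
  then show ?thesis using assms by (simp add: vL2.ip_scale_left H1D)
qed

lemma H1_zero: "0 \<in> H1 \<Omega>"
  by (rule H1I[OF L2.zero_in weak_gradient_null]) (simp_all add: norm_L2_eq)

lemma semi_inner_space_H1: "semi_inner_space (H1 \<Omega>) (ip_H1 \<Omega>)"
proof
  show "subspace (H1 \<Omega>)" unfolding subspace_def using H1_zero H1_add H1_scale by auto
  show "ip_H1 \<Omega> x y = ip_H1 \<Omega> y x" if "x \<in> H1 \<Omega>" "y \<in> H1 \<Omega>" for x y
    using that H1D[of x] H1D[of y] by (simp add: ip_H1_def L2.ip_commute[of x y] vL2.ip_commute[of "grad \<Omega> x"])
  show "0 \<le> ip_H1 \<Omega> x x" if "x \<in> H1 \<Omega>" for x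
    using that by (simp add: ip_H1_def L2.ip_nonneg vL2.ip_nonneg H1D)
qed (auto simp: ip_H1_def L2.ip_add_left L2.ip_scale_left ip_vector_L2_grad_add ip_vector_L2_grad_scale H1D algebra_simps)

sublocale H1: semi_inner_space "H1 \<Omega>" "ip_H1 \<Omega>"
  rewrites "ip_norm (ip_H1 \<Omega>) = norm_H1 \<Omega>"
  by (rule semi_inner_space_H1) (simp add: norm_H1_eq)

lemma norm_L2_le_H1: "norm_L2 \<Omega> u \<le> norm_H1 \<Omega> u"
  unfolding norm_H1_def by (rule real_le_rsqrt) simp

lemma seminorm_le_H1: "seminorm_H1 \<Omega> u \<le> norm_H1 \<Omega> u"
  unfolding norm_H1_def by (rule real_le_rsqrt) simp

lemma norm_L2_nonneg: "0 \<le> norm_L2 \<Omega> u" and seminorm_H1_nonneg: "0 \<le> seminorm_H1 \<Omega> u"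
  by (auto simp: norm_L2_def ip_L2_def seminorm_H1_def)

lemma norm_H1_le: "norm_H1 \<Omega> u \<le> norm_L2 \<Omega> u + seminorm_H1 \<Omega> u"
  unfolding norm_H1_def using norm_L2_nonneg seminorm_H1_nonneg
  by (intro real_le_lsqrt) (auto simp: power2_sum)

lemma seminorm_H1_diff:
  assumes "u \<in> H1 \<Omega>" "v \<in> H1 \<Omega>"
  shows "seminorm_H1 \<Omega> (u - v) = ip_norm (ip_vector_L2 \<Omega>) (grad \<Omega> u - grad \<Omega> v)"
proof -
  have "ip_vector_L2 \<Omega> (grad \<Omega> (u - v)) (grad \<Omega> (u - v))
      = ip_vector_L2 \<Omega> (grad \<Omega> u - grad \<Omega> v) (grad \<Omega> u - grad \<Omega> v)"
    using assms by (intro ip_vector_L2_cong grad_diff H1D H1_diff vL2.diff_in) auto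
  then show ?thesis by (simp add: seminorm_H1_eq ip_norm_def)
qed

text \<open>Two representatives of one class in \<open>L2\<close> have the same weak gradients, so membership in the
  Sobolev spaces and their norms depend only on the class.\<close>

lemma H1_null:
  assumes "u \<in> L2 \<Omega>" "norm_L2 \<Omega> u = 0"
  shows "u \<in> H1 \<Omega>" "norm_H1 \<Omega> u = 0"
proof -
  note w = weak_gradient_null[OF assms]
  show 1: "u \<in> H1 \<Omega>" using assms(1) w by (rule H1I)
  have "AE x in M\<Omega>. grad \<Omega> u x = 0" using grad_AE_eq[OF assms(1) w] by simp
  then have "seminorm_H1 \<Omega> u = 0" using vector_L2_null_iff[OF H1D(3)[OF 1]] by (simp add: seminorm_H1_eq)
  then show "norm_H1 \<Omega> u = 0" using assms by (simp add: norm_H1_def)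
qed

text \<open>The weak gradient is a closed operator: both sides of its defining identity are inner products
  with a fixed square integrable function, hence continuous in the mean square sense.\<close>

lemma complete_in_H1: "complete_in (H1 \<Omega>) (norm_H1 \<Omega>)"
  unfolding complete_in_def
proof (intro allI impI)
  fix X :: "nat \<Rightarrow> real^'n \<Rightarrow> real"
  assume X: "\<forall>n. X n \<in> H1 \<Omega>" and Cauchy: "\<forall>e>0. \<exists>M. \<forall>m\<ge>M. \<forall>n\<ge>M. norm_H1 \<Omega> (X m - X n) < e"
  have X1: "X n \<in> L2 \<Omega>" "grad \<Omega> (X n) \<in> vector_L2 \<Omega>" "weak_gradient \<Omega> (X n) (grad \<Omega> (X n))" for n
    using X H1D by auto
  obtain u where u: "u \<in> L2 \<Omega>" "(\<lambda>n. norm_L2 \<Omega> (X n - u)) \<longlonglongrightarrow> 0"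
  proof (rule complete_inD[OF complete_in_L2 X1(1)])
    fix e :: real assume "e > 0"
    then show "\<exists>M. \<forall>m\<ge>M. \<forall>n\<ge>M. norm_L2 \<Omega> (X m - X n) < e"
      using Cauchy norm_L2_le_H1 order_le_less_trans by meson
  qed
  obtain g where g: "g \<in> vector_L2 \<Omega>" "(\<lambda>n. ip_norm (ip_vector_L2 \<Omega>) (grad \<Omega> (X n) - g)) \<longlonglongrightarrow> 0"
  proof (rule complete_inD[OF complete_in_vector_L2 X1(2)])
    fix e :: real assume "e > 0"
    moreover have "ip_norm (ip_vector_L2 \<Omega>) (grad \<Omega> (X m) - grad \<Omega> (X n)) \<le> norm_H1 \<Omega> (X m - X n)" for m n
      using seminorm_le_H1[of "X m - X n"] X by (simp add: seminorm_H1_diff)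
    ultimately show "\<exists>M. \<forall>m\<ge>M. \<forall>n\<ge>M. ip_norm (ip_vector_L2 \<Omega>) (grad \<Omega> (X m) - grad \<Omega> (X n)) < e"
      using Cauchy order_le_less_trans by meson
  qed
  have wg: "weak_gradient \<Omega> u g"
  proof (rule weak_gradientI[OF g(1)])
    fix \<phi> i assume \<phi>: "\<phi> \<in> test_functions \<Omega>"
    have "(\<lambda>n. ip_L2 \<Omega> (X n) (partial_deriv i \<phi>)) \<longlonglongrightarrow> ip_L2 \<Omega> u (partial_deriv i \<phi>)"
      using X1(1) u test_function_L2(2)[OF \<phi>] unfolding norm_L2_eq by (intro L2.ip_tendsto_left)
    moreover have "(\<lambda>n. ip_vector_L2 \<Omega> (grad \<Omega> (X n)) (\<lambda>x. \<phi> x *\<^sub>R axis i 1))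
        \<longlonglongrightarrow> ip_vector_L2 \<Omega> g (\<lambda>x. \<phi> x *\<^sub>R axis i 1)"
      using X1(2) g test_function_axis_vector_L2[OF \<phi>] by (intro vL2.ip_tendsto_left)
    ultimately show "ip_L2 \<Omega> u (partial_deriv i \<phi>) = - ip_vector_L2 \<Omega> g (\<lambda>x. \<phi> x *\<^sub>R axis i 1)"
      using LIMSEQ_unique[OF _ tendsto_minus] weak_gradientD(2)[OF X1(3) \<phi>] by fastforce
  qed
  have u1: "u \<in> H1 \<Omega>" using u(1) wg by (rule H1I)
  have "AE x in M\<Omega>. grad \<Omega> u x = g x" using u(1) wg by (rule grad_AE_eq)
  then have "seminorm_H1 \<Omega> (X n - u) = ip_norm (ip_vector_L2 \<Omega>) (grad \<Omega> (X n) - g)" for n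
    unfolding seminorm_H1_diff[OF X[rule_format] u1] ip_norm_def using X1(2)[of n] H1D(3)[OF u1] g(1)
    by (intro arg_cong[of _ _ sqrt] ip_vector_L2_cong vL2.diff_in) auto
  then have "(\<lambda>n. norm_L2 \<Omega> (X n - u) + seminorm_H1 \<Omega> (X n - u)) \<longlonglongrightarrow> 0"
    using tendsto_add[OF u(2) g(2)] by simp
  then have "(\<lambda>n. norm_H1 \<Omega> (X n - u)) \<longlonglongrightarrow> 0"
    by (rule Lim_null_comparison[rotated])
      (use norm_H1_le H1.N_nonneg[OF H1_diff[OF X[rule_format] u1]] in auto)
  with u1 show "\<exists>x\<in>H1 \<Omega>. (\<lambda>n. norm_H1 \<Omega> (X n - x)) \<longlonglongrightarrow> 0" by blast
qed

subsection \<open>The space \<open>H\<^sub>0\<^sup>1\<close>\<close>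

lemma H10_H1: "u \<in> H10 \<Omega> \<Longrightarrow> u \<in> H1 \<Omega>"
  unfolding H10_def by blast

lemma H10_L2: "u \<in> H10 \<Omega> \<Longrightarrow> u \<in> L2 \<Omega>"
  using H10_H1 H1D(1) by blast

lemma test_function_H10: "\<phi> \<in> test_functions \<Omega> \<Longrightarrow> \<phi> \<in> H10 \<Omega>"
  unfolding H10_def
  using H1I[OF test_function_L2(1) weak_gradient_test_function, of \<phi>] H1.N_zero
  by (auto intro!: exI[of _ "\<lambda>_. \<phi>"])

text \<open>This form of the definition is convenient for closure arguments.\<close>

lemma H10_iff: "u \<in> H10 \<Omega> \<longleftrightarrow> u \<in> H1 \<Omega> \<and> (\<forall>e>0. \<exists>\<phi>\<in>test_functions \<Omega>. norm_H1 \<Omega> (u - \<phi>) < e)"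
proof
  assume "u \<in> H10 \<Omega>"
  then obtain \<phi> where \<phi>: "\<And>k::nat. \<phi> k \<in> test_functions \<Omega>" "(\<lambda>k. norm_H1 \<Omega> (u - \<phi> k)) \<longlonglongrightarrow> 0"
    unfolding H10_def by blast
  have "\<exists>\<phi>\<in>test_functions \<Omega>. norm_H1 \<Omega> (u - \<phi>) < e" if "e > 0" for e
    using order_tendstoD(2)[OF \<phi>(2) that] \<phi>(1) by (auto simp: eventually_sequentially)
  then show "u \<in> H1 \<Omega> \<and> (\<forall>e>0. \<exists>\<phi>\<in>test_functions \<Omega>. norm_H1 \<Omega> (u - \<phi>) < e)"
    using \<open>u \<in> H10 \<Omega>\<close> H10_H1 by blast
next
  assume u: "u \<in> H1 \<Omega> \<and> (\<forall>e>0. \<exists>\<phi>\<in>test_functions \<Omega>. norm_H1 \<Omega> (u - \<phi>) < e)"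
  have "\<exists>\<phi>\<in>test_functions \<Omega>. norm_H1 \<Omega> (u - \<phi>) < inverse (real (Suc k))" for k
    using u by simp
  then obtain \<phi> where \<phi>: "\<And>k. \<phi> k \<in> test_functions \<Omega>" "\<And>k. norm_H1 \<Omega> (u - \<phi> k) < inverse (real (Suc k))"
    by metis
  have "0 \<le> norm_H1 \<Omega> (u - \<phi> k)" for k
    using u test_function_H10[OF \<phi>(1)] H10_H1 by (intro H1.N_nonneg H1.diff_in) auto
  then have "(\<lambda>k. norm_H1 \<Omega> (u - \<phi> k)) \<longlonglongrightarrow> 0"
    using \<phi>(2) by (intro tendsto_sandwich[OF _ _ tendsto_const LIMSEQ_inverse_real_of_nat])
      (auto intro!: always_eventually less_imp_le)
  then show "u \<in> H10 \<Omega>" unfolding H10_def using u \<phi>(1) by blast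
qed

lemma H10_approx:
  assumes "u \<in> H1 \<Omega>" "\<And>e. e > 0 \<Longrightarrow> \<exists>v\<in>H10 \<Omega>. norm_H1 \<Omega> (u - v) < e"
  shows "u \<in> H10 \<Omega>"
  unfolding H10_iff
proof (intro conjI allI impI assms(1))
  fix e :: real assume e: "e > 0"
  obtain v where v: "v \<in> H10 \<Omega>" "norm_H1 \<Omega> (u - v) < e / 2" using assms(2)[of "e/2"] e by auto
  obtain \<phi> where \<phi>: "\<phi> \<in> test_functions \<Omega>" "norm_H1 \<Omega> (v - \<phi>) < e / 2"
    using v(1) e unfolding H10_iff by (meson half_gt_zero)
  have "norm_H1 \<Omega> (u - \<phi>) \<le> norm_H1 \<Omega> (u - v) + norm_H1 \<Omega> (v - \<phi>)"
    using assms(1) v(1) \<phi>(1) by (intro H1.N_diff_triangle) (auto intro: H10_H1 test_function_H10)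
  then show "\<exists>\<phi>\<in>test_functions \<Omega>. norm_H1 \<Omega> (u - \<phi>) < e" using v \<phi> by (intro bexI[of _ \<phi>]) auto
qed

lemma H10_add: "u \<in> H10 \<Omega> \<Longrightarrow> v \<in> H10 \<Omega> \<Longrightarrow> u + v \<in> H10 \<Omega>"
proof -
  assume u: "u \<in> H10 \<Omega>" and v: "v \<in> H10 \<Omega>"
  show ?thesis unfolding H10_iff
  proof (intro conjI allI impI)
    show "u + v \<in> H1 \<Omega>" using u v by (intro H1_add H10_H1)
    fix e :: real assume e: "e > 0"
    obtain \<phi> where \<phi>: "\<phi> \<in> test_functions \<Omega>" "norm_H1 \<Omega> (u - \<phi>) < e / 2"
      using u e unfolding H10_iff by (meson half_gt_zero)
    obtain \<psi> where \<psi>: "\<psi> \<in> test_functions \<Omega>" "norm_H1 \<Omega> (v - \<psi>) < e / 2"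
      using v e unfolding H10_iff by (meson half_gt_zero)
    have "norm_H1 \<Omega> ((u - \<phi>) + (v - \<psi>)) \<le> norm_H1 \<Omega> (u - \<phi>) + norm_H1 \<Omega> (v - \<psi>)"
      using u v \<phi> \<psi> test_function_H10 H10_H1 by (intro H1.N_triangle H1.diff_in) auto
    moreover have "(u - \<phi>) + (v - \<psi>) = u + v - (\<phi> + \<psi>)" by simp
    ultimately have "norm_H1 \<Omega> (u + v - (\<phi> + \<psi>)) < e" using \<phi> \<psi> by (simp only:)
    then show "\<exists>\<phi>\<in>test_functions \<Omega>. norm_H1 \<Omega> (u + v - \<phi>) < e"
      using test_functions_add[OF \<phi>(1) \<psi>(1)] by blast
  qed
qed

lemma H10_scale: "u \<in> H10 \<Omega> \<Longrightarrow> c *\<^sub>R u \<in> H10 \<Omega>"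
proof -
  assume u: "u \<in> H10 \<Omega>"
  show ?thesis unfolding H10_iff
  proof (intro conjI allI impI)
    show "c *\<^sub>R u \<in> H1 \<Omega>" using u by (intro H1_scale H10_H1)
    fix e :: real assume e: "e > 0"
    then have "e / (\<bar>c\<bar> + 1) > 0" by simp
    then obtain \<phi> where \<phi>: "\<phi> \<in> test_functions \<Omega>" "norm_H1 \<Omega> (u - \<phi>) < e / (\<bar>c\<bar> + 1)"
      using u unfolding H10_iff by blast
    have d: "u - \<phi> \<in> H1 \<Omega>" using u \<phi> test_function_H10 H10_H1 by (intro H1.diff_in) auto
    have "norm_H1 \<Omega> (c *\<^sub>R u - c *\<^sub>R \<phi>) = \<bar>c\<bar> * norm_H1 \<Omega> (u - \<phi>)"
      using H1.N_scale[OF d, of c] by (simp add: scaleR_diff_right)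
    also have "\<dots> \<le> (\<bar>c\<bar> + 1) * norm_H1 \<Omega> (u - \<phi>)" using H1.N_nonneg[OF d] by (intro mult_right_mono) auto
    also have "\<dots> < (\<bar>c\<bar> + 1) * (e / (\<bar>c\<bar> + 1))" using \<phi>(2) by (intro mult_strict_left_mono) auto
    also have "\<dots> = e" by (simp add: add_nonneg_eq_0_iff)
    finally show "\<exists>\<phi>\<in>test_functions \<Omega>. norm_H1 \<Omega> (c *\<^sub>R u - \<phi>) < e"
      using test_functions_scale[OF \<phi>(1)] by blast
  qed
qed

lemma subspace_H10: "subspace (H10 \<Omega>)"
  unfolding subspace_def using H10_add H10_scale test_function_H10[OF test_functions_zero] by auto

sublocale H10: semi_inner_space "H10 \<Omega>" "ip_H1 \<Omega>"
  rewrites "ip_norm (ip_H1 \<Omega>) = norm_H1 \<Omega>"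
proof -
  show "semi_inner_space (H10 \<Omega>) (ip_H1 \<Omega>)"
    by standard (auto intro!: subspace_H10 H1.ip_commute H1.ip_add_left H1.ip_scale_left H1.ip_nonneg H10_H1)
qed (simp add: norm_H1_eq)

lemma complete_in_H10: "complete_in (H10 \<Omega>) (norm_H1 \<Omega>)"
  unfolding complete_in_def
proof (intro allI impI)
  fix X :: "nat \<Rightarrow> real^'n \<Rightarrow> real"
  assume X: "\<forall>n. X n \<in> H10 \<Omega>" and Cauchy: "\<forall>e>0. \<exists>M. \<forall>m\<ge>M. \<forall>n\<ge>M. norm_H1 \<Omega> (X m - X n) < e"
  obtain u where u: "u \<in> H1 \<Omega>" "(\<lambda>n. norm_H1 \<Omega> (X n - u)) \<longlonglongrightarrow> 0"
    using complete_inD[OF complete_in_H1, of X] X H10_H1 Cauchy by blast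
  have "u \<in> H10 \<Omega>"
  proof (rule H10_approx[OF u(1)])
    fix e :: real assume "e > 0"
    then obtain n where "norm_H1 \<Omega> (X n - u) < e"
      using order_tendstoD(2)[OF u(2)] by (auto simp: eventually_sequentially)
    then show "\<exists>v\<in>H10 \<Omega>. norm_H1 \<Omega> (u - v) < e"
      using X H1.N_minus_commute[OF u(1) H10_H1, of "X n"] by (intro bexI[of _ "X n"]) auto
  qed
  with u(2) show "\<exists>x\<in>H10 \<Omega>. (\<lambda>n. norm_H1 \<Omega> (X n - x)) \<longlonglongrightarrow> 0" by blast
qed

lemma H10_null:
  assumes "u \<in> L2 \<Omega>" "norm_L2 \<Omega> u = 0"
  shows "u \<in> H10 \<Omega>"
  using H1_null[OF assms] test_functions_zero unfolding H10_iff by (auto intro!: bexI[of _ 0])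

text \<open>The Poincare inequality.  For a test function, integration by parts of \<open>\<phi> \<cdot> \<partial>\<^sub>i (x\<^sub>i \<phi>)\<close> gives
  \<open>\<integral> \<phi>\<^sup>2 = -2 \<integral> x\<^sub>i \<phi> \<partial>\<^sub>i \<phi>\<close>, where \<open>x\<^sub>i\<close> is bounded on the domain.\<close>

lemma Poincare_test_function:
  assumes R: "R \<ge> 0" "\<And>x. x \<in> \<Omega> \<Longrightarrow> norm x \<le> R" and \<phi>: "\<phi> \<in> test_functions \<Omega>"
  shows "(norm_L2 \<Omega> \<phi>)\<^sup>2 \<le> 4 * R\<^sup>2 * (seminorm_H1 \<Omega> \<phi>)\<^sup>2"
proof -
  fix i :: 'n
  note C1 = test_function_C1[OF \<phi>]
  have d: "\<phi> differentiable (at x)" for x using C1 unfolding C1_compact_support_def by auto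
  have coord: "((\<lambda>x. x $ i) has_derivative (\<lambda>h. h $ i)) (at x)" for x :: "real^'n"
    by (intro bounded_linear_imp_has_derivative bounded_linear_vec_nth)
  have coord_pd: "partial_deriv j (\<lambda>x. x $ i) = (\<lambda>_. axis j 1 $ i)" for j
    using partial_deriv_eq[OF coord] by (auto simp: fun_eq_iff)
  have coord_diff: "(\<lambda>x. x $ i) differentiable (at x)" for x :: "real^'n"
    using coord differentiable_def by blast
  have C1': "C1_compact_support (\<lambda>x. x $ i * \<phi> x)"
    by (rule C1_compact_support_mult[OF coord_diff _ C1]) (simp add: coord_pd)
  have pd: "partial_deriv i (\<lambda>x. x $ i * \<phi> x) x = x $ i * partial_deriv i \<phi> x + \<phi> x" for x
    using partial_deriv_mult[OF coord_diff d, of i x] by (simp add: coord_pd)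
  have parts: "(LINT x|lborel. \<phi> x * (x $ i * partial_deriv i \<phi> x + \<phi> x))
      = - (LINT x|lborel. partial_deriv i \<phi> x * (x $ i * \<phi> x))"
    using integration_by_parts[OF C1 C1', of i] by (simp only: pd)
  have [measurable]: "\<phi> \<in> borel_measurable borel" "partial_deriv i \<phi> \<in> borel_measurable borel"
    using C1 C1_compact_support_continuous[OF C1] unfolding C1_compact_support_def
    by (auto intro: borel_measurable_continuous_onI)
  have [measurable]: "(\<lambda>x::real^'n. x $ i) \<in> borel_measurable borel"
    by (intro borel_measurable_continuous_onI continuous_intros)
  have "(LINT x|M\<Omega>. \<phi> x * (x $ i * partial_deriv i \<phi> x + \<phi> x))
      = (LINT x|lborel. \<phi> x * (x $ i * partial_deriv i \<phi> x + \<phi> x))"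
    using test_function_outside[OF \<phi>] by (intro integral_lebesgue_on_eq_lborel domain_sets) auto
  moreover have "(LINT x|M\<Omega>. partial_deriv i \<phi> x * (x $ i * \<phi> x))
      = (LINT x|lborel. partial_deriv i \<phi> x * (x $ i * \<phi> x))"
    using test_function_outside[OF \<phi>] by (intro integral_lebesgue_on_eq_lborel domain_sets) auto
  ultimately have parts': "(LINT x|M\<Omega>. \<phi> x * (x $ i * partial_deriv i \<phi> x + \<phi> x))
      = - (LINT x|M\<Omega>. partial_deriv i \<phi> x * (x $ i * \<phi> x))" using parts by simp
  have L: "\<phi> \<in> L2 \<Omega>" "partial_deriv i \<phi> \<in> L2 \<Omega>" using test_function_L2[OF \<phi>] by auto
  have wg: "weak_gradient \<Omega> \<phi> (\<lambda>x. \<chi> i. partial_deriv i \<phi> x)" by (rule weak_gradient_test_function[OF \<phi>])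
  have i1: "integrable M\<Omega> (\<lambda>x. partial_deriv i \<phi> x * (x $ i * \<phi> x))"
  proof (rule Bochner_Integration.integrable_bound)
    show "integrable M\<Omega> (\<lambda>x. R * ((partial_deriv i \<phi> x)\<^sup>2 + (\<phi> x)\<^sup>2))"
      using L2D[OF L(1)] L2D[OF L(2)] by simp
    show "AE x in M\<Omega>. norm (partial_deriv i \<phi> x * (x $ i * \<phi> x)) \<le> norm (R * ((partial_deriv i \<phi> x)\<^sup>2 + (\<phi> x)\<^sup>2))"
    proof (rule AE_I2)
      fix x assume "x \<in> space M\<Omega>"
      then have "\<bar>x $ i\<bar> \<le> R" using R(2)[of x] component_le_norm_cart[of x i] by simp
      moreover have "\<bar>partial_deriv i \<phi> x * \<phi> x\<bar> \<le> (partial_deriv i \<phi> x)\<^sup>2 + (\<phi> x)\<^sup>2"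
        using sum_squares_bound[of "\<bar>partial_deriv i \<phi> x\<bar>" "\<bar>\<phi> x\<bar>"]
          mult_nonneg_nonneg[OF abs_ge_zero abs_ge_zero, of "partial_deriv i \<phi> x" "\<phi> x"]
        unfolding abs_mult power2_abs by linarith
      ultimately have "\<bar>x $ i\<bar> * \<bar>partial_deriv i \<phi> x * \<phi> x\<bar> \<le> R * ((partial_deriv i \<phi> x)\<^sup>2 + (\<phi> x)\<^sup>2)"
        by (intro mult_mono) (use R in auto)
      then show "norm (partial_deriv i \<phi> x * (x $ i * \<phi> x)) \<le> norm (R * ((partial_deriv i \<phi> x)\<^sup>2 + (\<phi> x)\<^sup>2))"
        using R(1) by (simp add: abs_mult mult_ac)
    qed
  qed (use L2D[OF L(1)] L2D[OF L(2)] in \<open>simp add: measurable_restrict_space1 measurable_completion\<close>)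
  have "(LINT x|M\<Omega>. (\<phi> x)\<^sup>2) = (LINT x|M\<Omega>. \<phi> x * (x $ i * partial_deriv i \<phi> x + \<phi> x) - partial_deriv i \<phi> x * (x $ i * \<phi> x))"
    by (intro Bochner_Integration.integral_cong refl) (simp add: algebra_simps power2_eq_square)
  also have "\<dots> = (LINT x|M\<Omega>. \<phi> x * (x $ i * partial_deriv i \<phi> x + \<phi> x)) - (LINT x|M\<Omega>. partial_deriv i \<phi> x * (x $ i * \<phi> x))"
  proof (rule Bochner_Integration.integral_diff[OF _ i1])
    have "integrable M\<Omega> (\<lambda>x. partial_deriv i \<phi> x * (x $ i * \<phi> x) + (\<phi> x)\<^sup>2)" using i1 L2D[OF L(1)] by simp
    then show "integrable M\<Omega> (\<lambda>x. \<phi> x * (x $ i * partial_deriv i \<phi> x + \<phi> x))"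
      by (simp add: algebra_simps power2_eq_square)
  qed
  also have "\<dots> = (LINT x|M\<Omega>. - 2 * (partial_deriv i \<phi> x * (x $ i * \<phi> x)))" using parts' by simp
  \<comment> \<open>Young's inequality with the weight that leaves half of the integral of \<open>\<phi>\<^sup>2\<close> to be absorbed.\<close>
  also have "\<dots> \<le> (LINT x|M\<Omega>. (1/2) * (\<phi> x)\<^sup>2 + 2 * R\<^sup>2 * (partial_deriv i \<phi> x)\<^sup>2)"
  proof (rule integral_mono)
    fix x assume "x \<in> space M\<Omega>"
    then have "\<bar>x $ i\<bar> \<le> R" using R(2)[of x] component_le_norm_cart[of x i] by simp
    then have xR: "(x $ i)\<^sup>2 \<le> R\<^sup>2" using R(1) abs_le_square_iff[of "x $ i" R] by simp
    have "- 2 * (partial_deriv i \<phi> x * (x $ i * \<phi> x)) \<le> (1/2) * (\<phi> x)\<^sup>2 + 2 * ((x $ i)\<^sup>2 * (partial_deriv i \<phi> x)\<^sup>2)"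
      using zero_le_power2[of "\<phi> x + 2 * (x $ i * partial_deriv i \<phi> x)"]
      by (simp add: power2_eq_square algebra_simps)
    also have "(x $ i)\<^sup>2 * (partial_deriv i \<phi> x)\<^sup>2 \<le> R\<^sup>2 * (partial_deriv i \<phi> x)\<^sup>2"
      using xR by (rule mult_right_mono) simp
    finally show "- 2 * (partial_deriv i \<phi> x * (x $ i * \<phi> x)) \<le> (1/2) * (\<phi> x)\<^sup>2 + 2 * R\<^sup>2 * (partial_deriv i \<phi> x)\<^sup>2"
      by simp
  qed (use i1 L2D[OF L(1)] L2D[OF L(2)] in auto)
  also have "\<dots> = (1/2) * (LINT x|M\<Omega>. (\<phi> x)\<^sup>2) + 2 * R\<^sup>2 * (LINT x|M\<Omega>. (partial_deriv i \<phi> x)\<^sup>2)"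
    using L2D[OF L(1)] L2D[OF L(2)] by simp
  finally have "(LINT x|M\<Omega>. (\<phi> x)\<^sup>2) \<le> 4 * R\<^sup>2 * (LINT x|M\<Omega>. (partial_deriv i \<phi> x)\<^sup>2)" by simp
  also have "\<dots> \<le> 4 * R\<^sup>2 * (LINT x|M\<Omega>. (norm (grad \<Omega> \<phi> x))\<^sup>2)"
  proof (intro mult_left_mono integral_mono_AE)
    show "AE x in M\<Omega>. (partial_deriv i \<phi> x)\<^sup>2 \<le> (norm (grad \<Omega> \<phi> x))\<^sup>2"
      using grad_AE_eq[OF L(1) wg]
    proof eventually_elim
      case (elim x)
      have "\<bar>(\<chi> i. partial_deriv i \<phi> x) $ i\<bar> \<le> norm (\<chi> i. partial_deriv i \<phi> x)" by (rule component_le_norm_cart)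
      then show ?case unfolding elim by (simp flip: abs_le_square_iff)
    qed
    show "integrable M\<Omega> (\<lambda>x. (norm (grad \<Omega> \<phi> x))\<^sup>2)"
      using H1D(3)[OF H1I[OF L(1) wg]] by (simp add: vector_L2_iff)
  qed (use L2D[OF L(2)] in auto)
  finally show ?thesis by (simp add: norm_L2_sq ip_L2_def power2_eq_square[of "\<phi> _"] seminorm_H1_def)
qed

text \<open>Both sides of the inequality are continuous in the Sobolev norm, so it passes from test functions
  to their closure.\<close>

lemma Poincare:
  obtains P where "P \<ge> 0" "\<And>u. u \<in> H10 \<Omega> \<Longrightarrow> norm_L2 \<Omega> u \<le> P * seminorm_H1 \<Omega> u"
proof -
  obtain R where R: "R \<ge> 0" "\<And>x. x \<in> \<Omega> \<Longrightarrow> norm x \<le> R"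
    using bounded_domain unfolding bounded_pos by (auto intro: less_imp_le)
  have test: "norm_L2 \<Omega> \<phi> \<le> 2 * R * seminorm_H1 \<Omega> \<phi>" if \<phi>: "\<phi> \<in> test_functions \<Omega>" for \<phi>
  proof (rule power2_le_imp_le)
    show "(norm_L2 \<Omega> \<phi>)\<^sup>2 \<le> (2 * R * seminorm_H1 \<Omega> \<phi>)\<^sup>2"
      using Poincare_test_function[OF R \<phi>] by (simp add: power_mult_distrib)
    show "0 \<le> 2 * R * seminorm_H1 \<Omega> \<phi>" using R(1) seminorm_H1_nonneg by simp
  qed
  have "norm_L2 \<Omega> u \<le> 2 * R * seminorm_H1 \<Omega> u" if u: "u \<in> H10 \<Omega>" for u
  proof (rule field_le_epsilon)
    fix e :: real assume e: "e > 0"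
    define d where "d = e / (1 + 2 * R)"
    have d: "d > 0" "(1 + 2 * R) * d = e" using e R(1) unfolding d_def by auto
    obtain \<phi> where \<phi>: "\<phi> \<in> test_functions \<Omega>" "norm_H1 \<Omega> (u - \<phi>) < d"
      using u d(1) unfolding H10_iff by blast
    have H: "u \<in> H1 \<Omega>" "\<phi> \<in> H1 \<Omega>" using u \<phi> by (auto intro: H10_H1 test_function_H10)
    have "norm_L2 \<Omega> u - norm_L2 \<Omega> \<phi> \<le> norm_L2 \<Omega> (u - \<phi>)"
      using L2.N_reverse_triangle[OF H1D(1)[OF H(1)] H1D(1)[OF H(2)]] by (simp add: norm_L2_eq)
    then have 1: "norm_L2 \<Omega> u \<le> norm_L2 \<Omega> \<phi> + d" using norm_L2_le_H1[of "u - \<phi>"] \<phi>(2) by simp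
    have "seminorm_H1 \<Omega> \<phi> - seminorm_H1 \<Omega> u \<le> seminorm_H1 \<Omega> (u - \<phi>)"
      using vL2.N_reverse_triangle[OF H1D(3)[OF H(1)] H1D(3)[OF H(2)]]
      unfolding seminorm_H1_diff[OF H] unfolding seminorm_H1_eq by linarith
    then have 2: "seminorm_H1 \<Omega> \<phi> \<le> seminorm_H1 \<Omega> u + d" using seminorm_le_H1[of "u - \<phi>"] \<phi>(2) by simp
    have "norm_L2 \<Omega> u \<le> 2 * R * seminorm_H1 \<Omega> \<phi> + d" using 1 test[OF \<phi>(1)] by simp
    also have "\<dots> \<le> 2 * R * (seminorm_H1 \<Omega> u + d) + d" using mult_left_mono[OF 2, of "2 * R"] R(1) by simp
    also have "\<dots> = 2 * R * seminorm_H1 \<Omega> u + e" using d(2) by (simp add: algebra_simps)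
    finally show "norm_L2 \<Omega> u \<le> 2 * R * seminorm_H1 \<Omega> u + e" .
  qed
  then show ?thesis using that[of "2 * R"] R(1) by simp
qed

subsection \<open>Forms with bounded coefficients\<close>

lemma matrix_vector_L2:
  assumes A: "Linfty_matrix \<Omega> A" and g: "g \<in> vector_L2 \<Omega>"
  shows "(\<lambda>x. A x *v g x) \<in> vector_L2 \<Omega>"
proof -
  obtain c where A_meas: "A \<in> borel_measurable M\<Omega>" and c: "AE x in M\<Omega>. \<forall>i j. \<bar>A x $ i $ j\<bar> \<le> c"
    using A unfolding Linfty_matrix_def by blast
  have g': "g \<in> borel_measurable M\<Omega>" "integrable M\<Omega> (\<lambda>x. (norm (g x))\<^sup>2)" using g by (auto simp: vector_L2_iff)
  have meas: "(\<lambda>x. A x *v g x) \<in> borel_measurable M\<Omega>"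
  proof (rule borel_measurable_continuous_Pair[OF A_meas g'(1)])
    show "continuous_on UNIV (\<lambda>x. (fst x :: real^'n^'n) *v (snd x :: real^'n))"
      unfolding matrix_vector_mult_def by (intro continuous_intros)
  qed
  define K where "K = real CARD('n) * (real CARD('n) * \<bar>c\<bar>)"
  have "integrable M\<Omega> (\<lambda>x. (norm (A x *v g x))\<^sup>2)"
  proof (rule Bochner_Integration.integrable_bound)
    show "integrable M\<Omega> (\<lambda>x. K\<^sup>2 * (norm (g x))\<^sup>2)" using g' by simp
    show "AE x in M\<Omega>. norm ((norm (A x *v g x))\<^sup>2) \<le> norm (K\<^sup>2 * (norm (g x))\<^sup>2)"
      using c
    proof eventually_elim
      case (elim x)
      have "norm (A x *v g x) \<le> (\<Sum>i\<in>UNIV. \<bar>(A x *v g x) $ i\<bar>)" by (rule norm_le_l1_cart)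
      also have "\<dots> \<le> (\<Sum>i\<in>(UNIV::'n set). \<Sum>j\<in>(UNIV::'n set). \<bar>c\<bar> * norm (g x))"
      proof (rule sum_mono)
        fix i
        have "\<bar>(A x *v g x) $ i\<bar> \<le> (\<Sum>j\<in>UNIV. \<bar>A x $ i $ j * g x $ j\<bar>)"
          unfolding matrix_vector_mult_def by (simp add: sum_abs)
        also have "\<dots> \<le> (\<Sum>j\<in>(UNIV::'n set). \<bar>c\<bar> * norm (g x))"
        proof (rule sum_mono)
          fix j
          have "\<bar>A x $ i $ j\<bar> \<le> \<bar>c\<bar>" using elim abs_ge_self[of c] order_trans by blast
          then show "\<bar>A x $ i $ j * g x $ j\<bar> \<le> \<bar>c\<bar> * norm (g x)"
            unfolding abs_mult by (intro mult_mono component_le_norm_cart) auto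
        qed
        finally show "\<bar>(A x *v g x) $ i\<bar> \<le> (\<Sum>j\<in>(UNIV::'n set). \<bar>c\<bar> * norm (g x))" .
      qed
      also have "\<dots> = K * norm (g x)" by (simp add: K_def mult_ac)
      finally have "(norm (A x *v g x))\<^sup>2 \<le> (K * norm (g x))\<^sup>2" by (rule power_mono) simp
      then show ?case by (simp add: power_mult_distrib)
    qed
  qed (use meas in simp)
  with meas show ?thesis by (simp add: vector_L2_iff)
qed

text \<open>Forms are inner products of a bounded transformation of one gradient with the other, which gives
  their integrability and linearity.\<close>

lemma aform_eq: "aform \<Omega> A w v = ip_vector_L2 \<Omega> (\<lambda>x. A x *v grad \<Omega> w x) (grad \<Omega> v)"
  by (simp add: aform_def ip_vector_L2_def)

lemma aform_commute:
  assumes A: "Linfty_matrix \<Omega> A" "AE x in M\<Omega>. transpose (A x) = A x" and w: "w \<in> H1 \<Omega>" and v: "v \<in> H1 \<Omega>"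
  shows "aform \<Omega> A w v = aform \<Omega> A v w"
  unfolding aform_def
proof (rule integral_cong_AE)
  show "AE x in M\<Omega>. (A x *v grad \<Omega> w x) \<bullet> grad \<Omega> v x = (A x *v grad \<Omega> v x) \<bullet> grad \<Omega> w x"
    using A(2)
  proof eventually_elim
    case (elim x)
    have "(A x *v grad \<Omega> w x) \<bullet> grad \<Omega> v x = (grad \<Omega> v x v* A x) \<bullet> grad \<Omega> w x"
      by (subst dot_lmul_matrix) (rule inner_commute)
    also have "grad \<Omega> v x v* A x = A x *v grad \<Omega> v x"
      using transpose_matrix_vector[of "A x" "grad \<Omega> v x"] elim by simp
    finally show ?case .
  qed
qed (use matrix_vector_L2[OF A(1) H1D(3)[OF w]] matrix_vector_L2[OF A(1) H1D(3)[OF v]] H1D(3)[OF w] H1D(3)[OF v]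
      in \<open>auto simp: vector_L2_iff\<close>)

lemma aform_add_right:
  assumes "Linfty_matrix \<Omega> A" "w \<in> H1 \<Omega>" "v \<in> H1 \<Omega>" "z \<in> H1 \<Omega>"
  shows "aform \<Omega> A w (v + z) = aform \<Omega> A w v + aform \<Omega> A w z"
  unfolding aform_eq using assms matrix_vector_L2[OF assms(1) H1D(3)[OF assms(2)]]
  by (simp add: vL2.ip_commute[of "\<lambda>x. A x *v grad \<Omega> w x"] ip_vector_L2_grad_add H1D H1_add)

lemma aform_scale_right:
  assumes "Linfty_matrix \<Omega> A" "w \<in> H1 \<Omega>" "v \<in> H1 \<Omega>"
  shows "aform \<Omega> A w (c *\<^sub>R v) = c * aform \<Omega> A w v"
  unfolding aform_eq using assms matrix_vector_L2[OF assms(1) H1D(3)[OF assms(2)]]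
  by (simp add: vL2.ip_commute[of "\<lambda>x. A x *v grad \<Omega> w x"] ip_vector_L2_grad_scale H1D H1_scale)

lemma semi_inner_space_aform:
  assumes A: "Linfty_matrix \<Omega> A" "AE x in M\<Omega>. transpose (A x) = A x"
    and nonneg: "\<And>v. v \<in> H10 \<Omega> \<Longrightarrow> 0 \<le> aform \<Omega> A v v"
  shows "semi_inner_space (H10 \<Omega>) (aform \<Omega> A)"
proof
  show comm: "aform \<Omega> A x y = aform \<Omega> A y x" if "x \<in> H10 \<Omega>" "y \<in> H10 \<Omega>" for x y
    using A that[THEN H10_H1] by (rule aform_commute)
  show "aform \<Omega> A (c *\<^sub>R x) y = c * aform \<Omega> A x y" if "x \<in> H10 \<Omega>" "y \<in> H10 \<Omega>" for x y c
    using comm[OF H10_scale[OF that(1)] that(2)] comm[OF that] aform_scale_right[OF A(1) that(2,1)[THEN H10_H1]]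
    by simp
  show "aform \<Omega> A (x + y) z = aform \<Omega> A x z + aform \<Omega> A y z"
    if "x \<in> H10 \<Omega>" "y \<in> H10 \<Omega>" "z \<in> H10 \<Omega>" for x y z
    using comm[OF H10_add[OF that(1,2)] that(3)] comm[OF that(1,3)] comm[OF that(2,3)]
      aform_add_right[OF A(1) that(3,1,2)[THEN H10_H1]]
    by simp
qed (use nonneg subspace_H10 in auto)

end


section \<open>Generation of contraction semigroups\<close>

text \<open>Here the seminorm is a norm and the resolvent equations hold exactly.  The semigroup is
  constructed by the exponential formula \<open>S(t) x = lim (I - (t/n) A)\<^sup>-\<^sup>n x\<close>, whose convergence is a matter
  of algebra with contractions.\<close>

locale m_dissipative_operator = semi_inner_space C ip
  for C :: "'e::real_vector set" and ip +
  fixes D :: "'e set" and A :: "'e \<Rightarrow> 'e"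
  assumes complete: "complete_in C (ip_norm ip)"
    and definite: "\<lbrakk>x \<in> C; ip_norm ip x = 0\<rbrakk> \<Longrightarrow> x = 0"
    and D: "subspace D" "D \<subseteq> C"
    and A_in: "x \<in> D \<Longrightarrow> A x \<in> C"
    and A_add: "\<lbrakk>x \<in> D; y \<in> D\<rbrakk> \<Longrightarrow> A (x + y) = A x + A y"
    and A_scale: "x \<in> D \<Longrightarrow> A (c *\<^sub>R x) = c *\<^sub>R A x"
    and dissipative: "x \<in> D \<Longrightarrow> ip (A x) x \<le> 0"
    and range: "\<lbrakk>\<tau> > 0; y \<in> C\<rbrakk> \<Longrightarrow> \<exists>x\<in>D. x - \<tau> *\<^sub>R A x = y"
begin

lemma D_C [simp]: "x \<in> D \<Longrightarrow> x \<in> C"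
  using D(2) by blast

lemma D_in:
  "0 \<in> D" "x \<in> D \<Longrightarrow> y \<in> D \<Longrightarrow> x + y \<in> D" "x \<in> D \<Longrightarrow> y \<in> D \<Longrightarrow> x - y \<in> D" "x \<in> D \<Longrightarrow> c *\<^sub>R x \<in> D"
  using D(1) by (auto intro: subspace_0 subspace_add subspace_diff subspace_scale)

lemma A_diff: "x \<in> D \<Longrightarrow> y \<in> D \<Longrightarrow> A (x - y) = A x - A y"
  using A_add[of "x - y" y] D_in by (simp add: algebra_simps)

lemma eqI: "x \<in> C \<Longrightarrow> y \<in> C \<Longrightarrow> Nip (x - y) \<le> 0 \<Longrightarrow> x = y"
  using definite[of "x - y"] N_nonneg[of "x - y"] diff_in[of x y] by (simp add: order_antisym)

text \<open>\<open>\<parallel>x\<parallel>\<^sup>2 \<le> \<langle>x - \<tau> A x, x\<rangle>\<close> by dissipativity.  It makes the resolvents single-valued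
  contractions.\<close>

lemma resolvent_estimate:
  assumes x: "x \<in> D" and "\<tau> \<ge> 0"
  shows "Nip x \<le> Nip (x - \<tau> *\<^sub>R A x)"
proof (cases "Nip x = 0")
  case True
  then show ?thesis using x A_in by simp
next
  case False
  then have pos: "Nip x > 0" using N_nonneg[of x] x by (simp add: less_le)
  have "Nip x * Nip x \<le> ip x x - \<tau> * ip (A x) x"
    using Nip_sq[of x] x mult_nonneg_nonpos[OF assms(2) dissipative[OF x]] by (simp add: power2_eq_square)
  also have "\<dots> = ip (x - \<tau> *\<^sub>R A x) x"
    using x A_in[OF x] by (simp add: ip_diff_left ip_scale_left)
  also have "\<dots> \<le> Nip (x - \<tau> *\<^sub>R A x) * Nip x"
    using Cauchy_Schwarz[of "x - \<tau> *\<^sub>R A x" x] x A_in[OF x] by auto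
  finally show ?thesis using pos by simp
qed

text \<open>The resolvent \<open>(I - \<tau> A)\<^sup>-\<^sup>1\<close>.  The case \<open>\<tau> = 0\<close> covers the semigroup at time \<open>0\<close>, and the value \<open>0\<close>
  outside the carrier lets resolvents commute as functions, so that their iterates can be regrouped.\<close>

definition J :: "real \<Rightarrow> 'e \<Rightarrow> 'e"
  where "J \<tau> y = (if y \<in> C then if \<tau> = 0 then y else THE x. x \<in> D \<and> x - \<tau> *\<^sub>R A x = y else 0)"

lemma J_unique:
  assumes "\<tau> > 0" "x \<in> D" "x - \<tau> *\<^sub>R A x = y"
  shows "J \<tau> y = x"
proof -
  have yC: "y \<in> C" using assms A_in by auto
  have unique: "z = x" if z: "z \<in> D" "z - \<tau> *\<^sub>R A z = y" for z
  proof (rule eqI)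
    have "z - x - \<tau> *\<^sub>R A (z - x) = (z - \<tau> *\<^sub>R A z) - (x - \<tau> *\<^sub>R A x)"
      unfolding A_diff[OF z(1) assms(2)] by (simp add: algebra_simps)
    also have "\<dots> = 0" using z assms by simp
    finally show "Nip (z - x) \<le> 0"
      using resolvent_estimate[OF D_in(3)[OF z(1) assms(2)], of \<tau>] assms(1) by simp
  qed (use z assms in auto)
  have "(THE x. x \<in> D \<and> x - \<tau> *\<^sub>R A x = y) = x"
    by (rule the_equality) (use unique assms(2,3) in blast)+
  then show ?thesis using assms(1) yC unfolding J_def by simp
qed

lemma J_pos:
  assumes "\<tau> > 0" "y \<in> C"
  shows "J \<tau> y \<in> D" "J \<tau> y - \<tau> *\<^sub>R A (J \<tau> y) = y"
proof -
  obtain x where "x \<in> D" "x - \<tau> *\<^sub>R A x = y" using range[OF assms] by blast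
  moreover from J_unique[OF assms(1) this] have "J \<tau> y = x" .
  ultimately show "J \<tau> y \<in> D" "J \<tau> y - \<tau> *\<^sub>R A (J \<tau> y) = y" by auto
qed

lemma J_zero: "y \<in> C \<Longrightarrow> J 0 y = y"
  by (simp add: J_def)

lemma J_in: "\<tau> \<ge> 0 \<Longrightarrow> y \<in> C \<Longrightarrow> J \<tau> y \<in> C"
  using J_pos(1)[of \<tau> y] J_zero[of y] by (cases "\<tau> = 0") auto

lemma J_contraction: "\<tau> \<ge> 0 \<Longrightarrow> y \<in> C \<Longrightarrow> Nip (J \<tau> y) \<le> Nip y"
  using J_pos[of \<tau> y] resolvent_estimate[of "J \<tau> y" \<tau>] J_zero[of y] by (cases "\<tau> = 0") auto

lemma J_add:
  assumes "\<tau> \<ge> 0" "x \<in> C" "y \<in> C"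
  shows "J \<tau> (x + y) = J \<tau> x + J \<tau> y"
proof (cases "\<tau> = 0")
  case False
  then have \<tau>: "\<tau> > 0" using assms by simp
  note x = J_pos[OF \<tau> assms(2)] and y = J_pos[OF \<tau> assms(3)]
  have "J \<tau> x + J \<tau> y - \<tau> *\<^sub>R A (J \<tau> x + J \<tau> y)
      = (J \<tau> x - \<tau> *\<^sub>R A (J \<tau> x)) + (J \<tau> y - \<tau> *\<^sub>R A (J \<tau> y))"
    using A_add[OF x(1) y(1)] by (simp add: algebra_simps)
  then show ?thesis using x y by (intro J_unique[OF \<tau>] D_in) simp_all
qed (use assms in \<open>simp add: J_zero\<close>)

lemma J_scale:
  assumes "\<tau> \<ge> 0" "x \<in> C"
  shows "J \<tau> (c *\<^sub>R x) = c *\<^sub>R J \<tau> x"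
proof (cases "\<tau> = 0")
  case False
  then have \<tau>: "\<tau> > 0" using assms by simp
  note x = J_pos[OF \<tau> assms(2)]
  have "c *\<^sub>R J \<tau> x - \<tau> *\<^sub>R A (c *\<^sub>R J \<tau> x) = c *\<^sub>R (J \<tau> x - \<tau> *\<^sub>R A (J \<tau> x))"
    using A_scale[OF x(1), of c] by (simp add: algebra_simps)
  then show ?thesis using x by (intro J_unique[OF \<tau>] D_in) simp_all
qed (use assms in \<open>simp add: J_zero\<close>)

text \<open>If \<open>z - \<tau> A z = x\<close> with \<open>x\<close> in the domain, then \<open>A z\<close> is a combination of \<open>z\<close> and \<open>x\<close> and lies in the
  domain as well, so \<open>A\<close> may be applied to the equation.\<close>

lemma J_D:
  assumes "\<tau> \<ge> 0" "x \<in> D"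
  shows "J \<tau> x \<in> D" "A (J \<tau> x) = J \<tau> (A x)"
proof -
  have "J \<tau> x \<in> D \<and> A (J \<tau> x) = J \<tau> (A x)"
  proof (cases "\<tau> = 0")
    case False
    then have \<tau>: "\<tau> > 0" using assms by simp
    define z where "z = J \<tau> x"
    have z: "z \<in> D" "z - \<tau> *\<^sub>R A z = x" using J_pos[OF \<tau>, of x] assms unfolding z_def by auto
    have "A z = (1 / \<tau>) *\<^sub>R (z - x)" using \<tau> by (simp add: z(2)[symmetric])
    then have Az: "A z \<in> D" using z assms D_in by simp
    have "A (z - \<tau> *\<^sub>R A z) = A z - \<tau> *\<^sub>R A (A z)"
      using z(1) Az by (simp add: A_diff A_scale D_in)
    then have "A z - \<tau> *\<^sub>R A (A z) = A x" unfolding z(2) by (rule sym)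
    then have "J \<tau> (A x) = A z" using Az by (intro J_unique[OF \<tau>])
    then show ?thesis using z unfolding z_def by simp
  qed (use assms A_in in \<open>simp add: J_zero\<close>)
  then show "J \<tau> x \<in> D" "A (J \<tau> x) = J \<tau> (A x)" by auto
qed

lemma J_diff:
  assumes "\<tau> \<ge> 0" "x \<in> C" "y \<in> C"
  shows "J \<tau> (x - y) = J \<tau> x - J \<tau> y"
  using J_add[of \<tau> "x - y" y] assms by (simp add: algebra_simps)

lemma J_commute:
  assumes "\<sigma> \<ge> 0" "\<tau> \<ge> 0"
  shows "J \<sigma> (J \<tau> y) = J \<tau> (J \<sigma> y)"
proof (cases "y \<in> C")
  case y: True
  show ?thesis
  proof (cases "\<sigma> = 0")
    case False
    then have \<sigma>: "\<sigma> > 0" using assms by simp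
    define z where "z = J \<sigma> y"
    have z: "z \<in> D" "z - \<sigma> *\<^sub>R A z = y" using J_pos[OF \<sigma> y] unfolding z_def by auto
    have "J \<tau> z - \<sigma> *\<^sub>R A (J \<tau> z) = J \<tau> (z - \<sigma> *\<^sub>R A z)"
      unfolding J_D(2)[OF assms(2) z(1)]
      by (subst J_diff) (auto simp: assms(2) z(1) A_in J_scale[OF assms(2) A_in[OF z(1)]])
    then show ?thesis using J_D[OF assms(2) z(1)] z(2) unfolding z_def[symmetric]
      by (intro J_unique[OF \<sigma>]) auto
  qed (use y J_in assms in \<open>simp add: J_zero\<close>)
next
  case False
  have "J \<tau> 0 = 0" if "\<tau> \<ge> 0" for \<tau> using J_scale[OF that zero_in, of 0] by simp
  then show ?thesis using False assms unfolding J_def[of _ y] by simp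
qed

text \<open>Operators that behave like the semigroup at time \<open>\<tau>\<close>, up to second order.  The class contains
  the resolvents and is closed under composition, so it also contains all implicit Euler schemes.\<close>

definition consistent :: "real \<Rightarrow> ('e \<Rightarrow> 'e) \<Rightarrow> bool"
  where "consistent \<tau> P \<longleftrightarrow>
    (\<forall>x\<in>C. P x \<in> C \<and> Nip (P x) \<le> Nip x) \<and>
    (\<forall>x\<in>C. \<forall>y\<in>C. P (x + y) = P x + P y) \<and> (\<forall>x\<in>C. \<forall>c. P (c *\<^sub>R x) = c *\<^sub>R P x) \<and>
    (\<forall>x\<in>D. P x \<in> D \<and> A (P x) = P (A x)) \<and>
    (\<forall>x\<in>D. Nip (P x - x) \<le> \<tau> * Nip (A x)) \<and>
    (\<forall>x\<in>D. A x \<in> D \<longrightarrow> Nip (P x - x - \<tau> *\<^sub>R A x) \<le> \<tau>\<^sup>2 * Nip (A (A x)))"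

lemma consistentD:
  assumes "consistent \<tau> P"
  shows "x \<in> C \<Longrightarrow> P x \<in> C" "x \<in> C \<Longrightarrow> Nip (P x) \<le> Nip x"
    "x \<in> C \<Longrightarrow> y \<in> C \<Longrightarrow> P (x + y) = P x + P y" "x \<in> C \<Longrightarrow> P (c *\<^sub>R x) = c *\<^sub>R P x"
    "x \<in> D \<Longrightarrow> P x \<in> D" "x \<in> D \<Longrightarrow> A (P x) = P (A x)"
    "x \<in> D \<Longrightarrow> Nip (P x - x) \<le> \<tau> * Nip (A x)"
    "x \<in> D \<Longrightarrow> A x \<in> D \<Longrightarrow> Nip (P x - x - \<tau> *\<^sub>R A x) \<le> \<tau>\<^sup>2 * Nip (A (A x))"
  using assms unfolding consistent_def by blast+

lemma consistent_diff: "consistent \<tau> P \<Longrightarrow> x \<in> C \<Longrightarrow> y \<in> C \<Longrightarrow> P (x - y) = P x - P y"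
  using consistentD(3)[of \<tau> P "x - y" y] by (simp add: algebra_simps)

text \<open>Everything follows from \<open>J x - x = \<tau> J (A x)\<close> for \<open>x\<close> in the domain; the second-order
  estimate is the first-order one at \<open>A x\<close>.\<close>

lemma consistent_J:
  assumes \<tau>: "\<tau> \<ge> 0"
  shows "consistent \<tau> (J \<tau>)"
proof -
  have step: "J \<tau> x - x = \<tau> *\<^sub>R J \<tau> (A x)" if "x \<in> D" for x
  proof (cases "\<tau> = 0")
    case False
    then show ?thesis using J_pos(2)[of \<tau> x] J_D(2)[OF \<tau> that] that \<tau> by (simp add: algebra_simps)
  qed (use that in \<open>simp add: J_zero\<close>)
  have 1: "Nip (J \<tau> x - x) \<le> \<tau> * Nip (A x)" if "x \<in> D" for x
    unfolding step[OF that] using that \<tau> A_in J_in J_contraction by (simp add: N_scale mult_left_mono)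
  have 2: "Nip (J \<tau> x - x - \<tau> *\<^sub>R A x) \<le> \<tau>\<^sup>2 * Nip (A (A x))" if "x \<in> D" "A x \<in> D" for x
  proof -
    have "J \<tau> x - x - \<tau> *\<^sub>R A x = \<tau> *\<^sub>R (J \<tau> (A x) - A x)"
      unfolding step[OF that(1)] by (simp add: algebra_simps)
    then have "Nip (J \<tau> x - x - \<tau> *\<^sub>R A x) = \<tau> * Nip (J \<tau> (A x) - A x)"
      using that \<tau> J_in[OF \<tau>, of "A x"] by (simp add: N_scale)
    also have "\<dots> \<le> \<tau> * (\<tau> * Nip (A (A x)))" using 1[OF that(2)] \<tau> by (rule mult_left_mono)
    finally show ?thesis by (simp add: power2_eq_square mult.assoc)
  qed
  show ?thesis unfolding consistent_def
    using 1 2 J_in J_contraction J_add J_scale J_D \<tau> by auto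
qed

lemma consistent_id: "consistent 0 (\<lambda>x. x)"
  unfolding consistent_def by auto

text \<open>The error of \<open>P Q\<close> splits into \<open>P\<close> applied to the error of \<open>Q\<close>, the error of \<open>P\<close>, and
  \<open>\<tau> (P (A x) - A x)\<close>; together they are bounded by \<open>(\<tau>\<^sup>2 + \<sigma>\<^sup>2 + \<tau> \<sigma>) \<parallel>A\<^sup>2 x\<parallel>\<close>.\<close>

lemma consistent_comp:
  assumes P: "consistent \<sigma> P" and Q: "consistent \<tau> Q" and "\<sigma> \<ge> 0" "\<tau> \<ge> 0"
  shows "consistent (\<sigma> + \<tau>) (\<lambda>x. P (Q x))"
proof -
  note P' = consistentD[OF P] and Q' = consistentD[OF Q]
  have 1: "Nip (P (Q x) - x) \<le> (\<sigma> + \<tau>) * Nip (A x)" if x: "x \<in> D" for x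
  proof -
    have xC: "x \<in> C" using x by simp
    have eq: "P (Q x) - x = P (Q x - x) + (P x - x)"
      using consistent_diff[OF P Q'(1)[OF xC] xC] by simp
    have "Nip (P (Q x) - x) \<le> Nip (P (Q x - x)) + Nip (P x - x)"
      unfolding eq using xC P'(1) Q'(1) by (intro N_triangle) auto
    also have "Nip (P (Q x - x)) \<le> Nip (Q x - x)" using xC Q'(1) by (intro P'(2)) auto
    finally show ?thesis using P'(7)[OF x] Q'(7)[OF x] by (simp add: distrib_right)
  qed
  have 2: "Nip (P (Q x) - x - (\<sigma> + \<tau>) *\<^sub>R A x) \<le> (\<sigma> + \<tau>)\<^sup>2 * Nip (A (A x))" if x: "x \<in> D" "A x \<in> D" for x
  proof -
    have C: "x \<in> C" "A x \<in> C" "P x \<in> C" "Q x \<in> C" "P (A x) \<in> C" "P (Q x) \<in> C"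
      using x P'(1) Q'(1) by auto
    let ?a = "P (Q x - x - \<tau> *\<^sub>R A x)" and ?b = "P x - x - \<sigma> *\<^sub>R A x" and ?c = "\<tau> *\<^sub>R (P (A x) - A x)"
    have abc: "?a \<in> C" "?b \<in> C" "?c \<in> C" using C P'(1) by auto
    have "?a = P (Q x) - P x - \<tau> *\<^sub>R P (A x)"
      using C by (simp add: consistent_diff[OF P] P'(4))
    then have eq: "P (Q x) - x - (\<sigma> + \<tau>) *\<^sub>R A x = ?a + (?b + ?c)"
      by (simp add: algebra_simps)
    have "Nip (P (Q x) - x - (\<sigma> + \<tau>) *\<^sub>R A x) \<le> Nip ?a + (Nip ?b + Nip ?c)"
      unfolding eq using N_triangle[OF abc(1) add_in[OF abc(2,3)]] N_triangle[OF abc(2,3)] by linarith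
    also have "Nip ?a \<le> Nip (Q x - x - \<tau> *\<^sub>R A x)" using C by (intro P'(2)) auto
    also have "\<dots> \<le> \<tau>\<^sup>2 * Nip (A (A x))" using x by (rule Q'(8))
    also have "Nip ?b \<le> \<sigma>\<^sup>2 * Nip (A (A x))" using x by (rule P'(8))
    also have "Nip ?c = \<tau> * Nip (P (A x) - A x)" using C \<open>\<tau> \<ge> 0\<close> by (simp add: N_scale)
    also have "\<dots> \<le> \<tau> * (\<sigma> * Nip (A (A x)))" using P'(7)[OF x(2)] \<open>\<tau> \<ge> 0\<close> by (rule mult_left_mono)
    finally have "Nip (P (Q x) - x - (\<sigma> + \<tau>) *\<^sub>R A x) \<le> (\<tau>\<^sup>2 + (\<sigma>\<^sup>2 + \<tau> * \<sigma>)) * Nip (A (A x))"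
      by (simp add: algebra_simps)
    also have "\<dots> \<le> (\<sigma> + \<tau>)\<^sup>2 * Nip (A (A x))"
      using assms(3,4) A_in[OF x(2)] by (intro mult_right_mono) (auto simp: power2_sum)
    finally show ?thesis .
  qed
  have 3: "Nip (P (Q x)) \<le> Nip x" if "x \<in> C" for x
    using P'(2)[OF Q'(1)[OF that]] Q'(2)[OF that] by simp
  show ?thesis unfolding consistent_def
    using 1 2 3 P' Q' A_in by auto
qed

lemma consistent_funpow:
  assumes "consistent \<tau> P" "\<tau> \<ge> 0"
  shows "consistent (real n * \<tau>) (P ^^ n)"
proof (induction n)
  case 0
  then show ?case using consistent_id by (simp add: id_def)
next
  case (Suc n)
  then show ?case
    using consistent_comp[OF assms(1) Suc] assms(2) by (simp add: o_def algebra_simps)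
qed

text \<open>Stability turns second-order consistency into convergence: the errors of \<open>n\<close> steps of
  length \<open>\<tau>\<close> add up to a multiple of \<open>n \<tau>\<^sup>2\<close>.\<close>

lemma consistent_funpow_diff:
  assumes P: "consistent \<tau> P" and Q: "consistent \<tau> Q" and "\<tau> \<ge> 0" and x: "x \<in> D" "A x \<in> D"
  shows "Nip ((P ^^ n) x - (Q ^^ n) x) \<le> real n * (2 * \<tau>\<^sup>2 * Nip (A (A x)))"
proof (induction n)
  case (Suc n)
  note Pn = consistentD[OF consistent_funpow[OF P \<open>\<tau> \<ge> 0\<close>, of n]]
  note Qn = consistentD[OF consistent_funpow[OF Q \<open>\<tau> \<ge> 0\<close>, of n]]
  note P' = consistentD[OF P] and Q' = consistentD[OF Q]
  define y where "y = (Q ^^ n) x"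
  have y: "y \<in> D" "A y \<in> D" "A (A y) = (Q ^^ n) (A (A x))"
    using Qn(5,6) x unfolding y_def by auto
  have yC: "y \<in> C" "A y \<in> C" "(P ^^ n) x \<in> C" using y Pn(1) x by auto
  let ?a = "P ((P ^^ n) x - y)" and ?b = "P y - y - \<tau> *\<^sub>R A y" and ?c = "Q y - y - \<tau> *\<^sub>R A y"
  have C: "?a \<in> C" "?b \<in> C" "?c \<in> C" using yC P'(1) Q'(1) by auto
  have "(P ^^ Suc n) x - (Q ^^ Suc n) x = ?a + (?b - ?c)"
    using yC by (simp add: consistent_diff[OF P] y_def)
  then have "Nip ((P ^^ Suc n) x - (Q ^^ Suc n) x) \<le> Nip ?a + (Nip ?b + Nip ?c)"
    using N_triangle[OF C(1) diff_in[OF C(2,3)]] N_diff_le[OF C(2,3)] by simp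
  also have "Nip ?a \<le> Nip ((P ^^ n) x - y)" using yC by (intro P'(2)) auto
  also have "\<dots> \<le> real n * (2 * \<tau>\<^sup>2 * Nip (A (A x)))" using Suc unfolding y_def .
  also have "Nip ?b \<le> \<tau>\<^sup>2 * Nip (A (A y))" using y by (intro P'(8))
  also have "Nip ?c \<le> \<tau>\<^sup>2 * Nip (A (A y))" using y by (intro Q'(8))
  also have "\<tau>\<^sup>2 * Nip (A (A y)) \<le> \<tau>\<^sup>2 * Nip (A (A x))"
    using Qn(2)[OF A_in[OF x(2)]] y(3) by (intro mult_left_mono) auto
  finally show ?case by (simp add: algebra_simps)
qed simp

lemma dense_D: "x \<in> C \<Longrightarrow> e > 0 \<Longrightarrow> \<exists>d\<in>D. Nip (x - d) < e"
proof -
  have "dense_subset_in C Nip D"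
  proof (rule dissipative_range_imp_dense[OF complete D A_in _ dissipative])
    show "Nip (A x) = 0" if "x \<in> D" "Nip x = 0" for x
      using definite[of x] that A_scale[OF D_in(1), of 0] by simp
    show "\<exists>x\<in>D. Nip (x - A x - y) = 0" if "y \<in> C" for y
      using range[OF zero_less_one that] by force
  qed
  then show "x \<in> C \<Longrightarrow> e > 0 \<Longrightarrow> \<exists>d\<in>D. Nip (x - d) < e" unfolding dense_subset_in_def by blast
qed

text \<open>Resolvents map the domain of \<open>A\<close> into the domain of \<open>A\<^sup>2\<close> and are close to the identity for small
  \<open>\<tau>\<close>.\<close>

lemma dense_D2:
  assumes "x \<in> C" "e > 0"
  obtains d where "d \<in> D" "A d \<in> D" "Nip (x - d) < e"
proof -
  obtain y where y: "y \<in> D" "Nip (x - y) < e / 2" using dense_D[of x "e/2"] assms by auto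
  have yC: "y \<in> C" "A y \<in> C" using y A_in by auto
  \<comment> \<open>The summand \<open>1\<close> covers the case \<open>A y = 0\<close>.\<close>
  define \<tau> where "\<tau> = e / 2 / (Nip (A y) + 1)"
  have pos: "Nip (A y) + 1 > 0" using N_nonneg[OF yC(2)] by linarith
  then have \<tau>: "\<tau> > 0" "\<tau> * Nip (A y) < e / 2" using assms(2) unfolding \<tau>_def by (auto simp: field_simps)
  have "Nip (J \<tau> y - y) < e / 2"
    using consistentD(7)[OF consistent_J, of \<tau> y] y \<tau> by simp
  then have "Nip (x - J \<tau> y) < e"
    using N_diff_triangle[of x y "J \<tau> y"] N_minus_commute[of y "J \<tau> y"] y assms J_in[of \<tau> y] \<tau> by simp
  moreover have "J \<tau> y \<in> D" "A (J \<tau> y) \<in> D"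
    using J_D[of \<tau> y] J_pos(1)[of \<tau> "A y"] \<tau> y yC by auto
  ultimately show ?thesis using that by blast
qed

definition Euler :: "nat \<Rightarrow> real \<Rightarrow> 'e \<Rightarrow> 'e"
  where "Euler n t = J (t / real (Suc n)) ^^ Suc n"

lemma consistent_Euler: "t \<ge> 0 \<Longrightarrow> consistent t (Euler n t)"
  using consistent_funpow[OF consistent_J, of "t / real (Suc n)" "Suc n"] unfolding Euler_def by simp

text \<open>The schemes with \<open>m\<close> and \<open>n\<close> steps are both compared with their common refinement into
  \<open>m n\<close> steps: a block of \<open>m\<close> short steps is itself consistent over one long step.\<close>

lemma Euler_diff:
  assumes "t \<ge> 0" and x: "x \<in> D" "A x \<in> D"
  defines "K \<equiv> \<lambda>n. 2 * t\<^sup>2 * Nip (A (A x)) * inverse (real (Suc n))"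
  shows "Nip (Euler m t x - Euler n t x) \<le> K m + K n"
proof -
  have refine: "Nip (Euler n t x - (J (t / real (Suc n * Suc m)) ^^ (Suc m * Suc n)) x) \<le> K n" for m n
  proof -
    define \<tau> where "\<tau> = t / real (Suc n)"
    have \<tau>: "\<tau> \<ge> 0" "real (Suc n) * \<tau> = t" unfolding \<tau>_def using assms by auto
    have "consistent (real (Suc m) * (t / real (Suc n * Suc m))) (J (t / real (Suc n * Suc m)) ^^ Suc m)"
      using assms by (intro consistent_funpow consistent_J) auto
    moreover have "real (Suc m) * (t / real (Suc n * Suc m)) = \<tau>"
      unfolding \<tau>_def of_nat_mult by (simp del: of_nat_Suc)
    ultimately have Q: "consistent \<tau> (J (t / real (Suc n * Suc m)) ^^ Suc m)" by simp
    have "Nip ((J \<tau> ^^ Suc n) x - ((J (t / real (Suc n * Suc m)) ^^ Suc m) ^^ Suc n) x)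
        \<le> real (Suc n) * (2 * \<tau>\<^sup>2 * Nip (A (A x)))"
      using consistent_J[OF \<tau>(1)] Q \<tau>(1) x by (rule consistent_funpow_diff)
    also have "\<dots> = 2 * (real (Suc n) * \<tau>) * \<tau> * Nip (A (A x))"
      by (simp add: power2_eq_square mult_ac)
    also have "\<dots> = K n" unfolding \<tau>(2) K_def unfolding \<tau>_def
      by (simp add: power2_eq_square divide_inverse mult_ac)
    finally show ?thesis unfolding Euler_def \<tau>_def[symmetric] funpow_mult .
  qed
  define z where "z = (J (t / real (Suc n * Suc m)) ^^ (Suc m * Suc n)) x"
  have "consistent (real (Suc m * Suc n) * (t / real (Suc n * Suc m))) (J (t / real (Suc n * Suc m)) ^^ (Suc m * Suc n))"
    using assms by (intro consistent_funpow consistent_J) auto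
  from consistentD(1)[OF this D_C[OF x(1)]] have zC: "z \<in> C" unfolding z_def .
  have C: "Euler m t x \<in> C" "Euler n t x \<in> C"
    using consistentD(1)[OF consistent_Euler[OF assms(1)]] x by auto
  have "Nip (Euler m t x - z) \<le> K m"
    using refine[of m n] unfolding z_def by (simp only: mult.commute[of "Suc m" "Suc n"])
  moreover have "Nip (Euler n t x - z) \<le> K n" using refine[of n m] unfolding z_def .
  ultimately show ?thesis
    using N_diff_triangle[OF C(1) zC C(2)] N_minus_commute[OF zC C(2)] by simp
qed

lemma Euler_in: "t \<ge> 0 \<Longrightarrow> x \<in> C \<Longrightarrow> Euler n t x \<in> C"
  using consistentD(1)[OF consistent_Euler] by blast

text \<open>On the domain of \<open>A\<^sup>2\<close> the explicit bound shows convergence; all Euler schemes are contractions,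
  so it extends to the closure.\<close>

lemma Euler_converges:
  assumes t: "t \<ge> 0" and x: "x \<in> C"
  shows "\<exists>y\<in>C. (\<lambda>n. Nip (Euler n t x - y)) \<longlonglongrightarrow> 0"
proof -
  obtain y where "y \<in> C" "(\<lambda>n. Nip (Euler n t x - y)) \<longlonglongrightarrow> 0"
  proof (rule complete_inD[OF complete])
    show "Euler n t x \<in> C" for n using t x by (rule Euler_in)
    fix e :: real assume e: "e > 0"
    obtain d where d: "d \<in> D" "A d \<in> D" "Nip (x - d) < e / 4" using dense_D2[OF x, of "e/4"] e by auto
    define K where "K = (\<lambda>n. 2 * t\<^sup>2 * Nip (A (A d)) * inverse (real (Suc n)))"
    have "K \<longlonglongrightarrow> 0" unfolding K_def using tendsto_mult_left[OF LIMSEQ_inverse_real_of_nat] by fastforce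
    from order_tendstoD(2)[OF this, of "e/4"] e obtain M where M: "\<And>n. n \<ge> M \<Longrightarrow> K n < e / 4"
      by (auto simp: eventually_sequentially)
    have "Nip (Euler m t x - Euler n t x) < e" if "m \<ge> M" "n \<ge> M" for m n
    proof -
      have dC: "d \<in> C" using d by simp
      have *: "Nip (Euler k t x - Euler k t d) < e / 4" for k
      proof -
        have "Euler k t x - Euler k t d = Euler k t (x - d)"
          using consistent_diff[OF consistent_Euler[OF t] x dC] by simp
        then show ?thesis using consistentD(2)[OF consistent_Euler[OF t] diff_in[OF x dC], of k] d(3) by simp
      qed
      have C: "Euler k t x \<in> C" "Euler k t d \<in> C" for k using t x dC by (auto intro: Euler_in)
      have "Nip (Euler m t d - Euler n t d) \<le> K m + K n"
        unfolding K_def by (rule Euler_diff[OF t d(1,2)])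
      then have "Nip (Euler m t d - Euler n t d) < e / 2" using M[OF that(1)] M[OF that(2)] by simp
      moreover have "Nip (Euler m t x - Euler n t x) \<le> Nip (Euler m t x - Euler m t d)
          + (Nip (Euler m t d - Euler n t d) + Nip (Euler n t d - Euler n t x))"
        using N_diff_triangle[OF C(1)[of m] C(2)[of m] C(1)[of n]]
          N_diff_triangle[OF C(2)[of m] C(2)[of n] C(1)[of n]] by simp
      ultimately show ?thesis using *[of m] *[of n] N_minus_commute[OF C(2)[of n] C(1)[of n]] by simp
    qed
    then show "\<exists>M. \<forall>m\<ge>M. \<forall>n\<ge>M. Nip (Euler m t x - Euler n t x) < e" by blast
  qed (use that in auto)
  then show ?thesis by blast
qed

definition semigroup :: "real \<Rightarrow> 'e \<Rightarrow> 'e"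
  where "semigroup t x = (SOME y. y \<in> C \<and> (\<lambda>n. Nip (Euler n t x - y)) \<longlonglongrightarrow> 0)"

lemma semigroup:
  assumes "t \<ge> 0" "x \<in> C"
  shows "semigroup t x \<in> C" "(\<lambda>n. Nip (Euler n t x - semigroup t x)) \<longlonglongrightarrow> 0"
  using someI_ex[of "\<lambda>y. y \<in> C \<and> (\<lambda>n. Nip (Euler n t x - y)) \<longlonglongrightarrow> 0"] Euler_converges[OF assms]
  unfolding semigroup_def by blast+

lemma semigroup_eqI:
  assumes "t \<ge> 0" "x \<in> C" "y \<in> C" "(\<lambda>n. Nip (Euler n t x - y)) \<longlonglongrightarrow> 0"
  shows "semigroup t x = y"
  using N_limit_unique[OF Euler_in semigroup(1) _ _ semigroup(2), of t x y] assms
  by (intro eqI) (auto intro: semigroup)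

lemma semigroup_contraction:
  assumes "t \<ge> 0" "x \<in> C"
  shows "Nip (semigroup t x) \<le> Nip x"
proof (rule LIMSEQ_le_const2)
  show "(\<lambda>n. Nip (Euler n t x)) \<longlonglongrightarrow> Nip (semigroup t x)"
    using assms by (intro N_tendsto semigroup Euler_in)
  show "\<exists>N. \<forall>n\<ge>N. Nip (Euler n t x) \<le> Nip x"
    using consistentD(2)[OF consistent_Euler[OF assms(1)] assms(2)] by blast
qed

lemma semigroup_add:
  assumes "t \<ge> 0" "x \<in> C" "y \<in> C"
  shows "semigroup t (x + y) = semigroup t x + semigroup t y"
proof (rule semigroup_eqI)
  note S = semigroup[OF assms(1,2)] semigroup[OF assms(1,3)]
  note E = Euler_in[OF assms(1,2)] Euler_in[OF assms(1,3)]
  have eq: "Euler n t (x + y) - (semigroup t x + semigroup t y)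
      = (Euler n t x - semigroup t x) + (Euler n t y - semigroup t y)" for n
    using consistentD(3)[OF consistent_Euler[OF assms(1)] assms(2,3)] by simp
  have "Nip (Euler n t (x + y) - (semigroup t x + semigroup t y))
      \<le> Nip (Euler n t x - semigroup t x) + Nip (Euler n t y - semigroup t y)" for n
    unfolding eq using S E by (intro N_triangle) auto
  moreover have "0 \<le> Nip (Euler n t (x + y) - (semigroup t x + semigroup t y))" for n
    using assms S E Euler_in[OF assms(1) add_in[OF assms(2,3)]] by (intro N_nonneg) auto
  ultimately have "norm (Nip (Euler n t (x + y) - (semigroup t x + semigroup t y)))
      \<le> Nip (Euler n t x - semigroup t x) + Nip (Euler n t y - semigroup t y)" for n by simp
  then show "(\<lambda>n. Nip (Euler n t (x + y) - (semigroup t x + semigroup t y))) \<longlonglongrightarrow> 0"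
    by (rule Lim_null_comparison[OF always_eventually[OF allI]]) (use tendsto_add[OF S(2) S(4)] in simp)
qed (use assms semigroup in auto)

lemma semigroup_scale:
  assumes "t \<ge> 0" "x \<in> C"
  shows "semigroup t (c *\<^sub>R x) = c *\<^sub>R semigroup t x"
proof (rule semigroup_eqI)
  note S = semigroup[OF assms] and E = Euler_in[OF assms]
  have "Nip (Euler n t (c *\<^sub>R x) - c *\<^sub>R semigroup t x) = \<bar>c\<bar> * Nip (Euler n t x - semigroup t x)" for n
    using consistentD(4)[OF consistent_Euler[OF assms(1)] assms(2), of n c] N_scale[OF diff_in[OF E S(1)], of c n]
    by (simp add: scaleR_diff_right)
  then show "(\<lambda>n. Nip (Euler n t (c *\<^sub>R x) - c *\<^sub>R semigroup t x)) \<longlonglongrightarrow> 0"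
    using tendsto_mult_left[OF S(2), of "\<bar>c\<bar>"] by simp
qed (use assms semigroup in auto)

lemma semigroup_diff:
  "t \<ge> 0 \<Longrightarrow> x \<in> C \<Longrightarrow> y \<in> C \<Longrightarrow> semigroup t (x - y) = semigroup t x - semigroup t y"
  using semigroup_add[of t x "- 1 *\<^sub>R y"] semigroup_scale[of t y "-1"] by simp

lemma semigroup_zero: "x \<in> C \<Longrightarrow> semigroup 0 x = x"
proof (rule semigroup_eqI)
  assume x: "x \<in> C"
  have "(J 0 ^^ n) x = x" for n by (induction n) (auto simp: J_zero x)
  then show "(\<lambda>n. Nip (Euler n 0 x - x)) \<longlonglongrightarrow> 0" unfolding Euler_def by (simp del: funpow.simps)
qed auto

lemma semigroup_lipschitz:
  assumes t: "t \<ge> 0" and x: "x \<in> D"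
  shows "Nip (semigroup t x - x) \<le> t * Nip (A x)"
proof (rule LIMSEQ_le_const2)
  have xC: "x \<in> C" using x by simp
  note S = semigroup[OF t xC] and E = Euler_in[OF t xC]
  have "(\<lambda>n. Nip (Euler n t x - x - (semigroup t x - x))) \<longlonglongrightarrow> 0" using S by simp
  then show "(\<lambda>n. Nip (Euler n t x - x)) \<longlonglongrightarrow> Nip (semigroup t x - x)"
    using S E xC by (intro N_tendsto) auto
  show "\<exists>N. \<forall>n\<ge>N. Nip (Euler n t x - x) \<le> t * Nip (A x)"
    using consistentD(7)[OF consistent_Euler[OF t] x] by blast
qed

lemma semigroup_taylor:
  assumes t: "t \<ge> 0" and x: "x \<in> D" "A x \<in> D"
  shows "Nip (semigroup t x - x - t *\<^sub>R A x) \<le> t\<^sup>2 * Nip (A (A x))"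
proof (rule LIMSEQ_le_const2)
  have xC: "x \<in> C" "A x \<in> C" using x by auto
  note S = semigroup[OF t xC(1)] and E = Euler_in[OF t xC(1)]
  have "(\<lambda>n. Nip (Euler n t x - x - t *\<^sub>R A x - (semigroup t x - x - t *\<^sub>R A x))) \<longlonglongrightarrow> 0" using S by simp
  then show "(\<lambda>n. Nip (Euler n t x - x - t *\<^sub>R A x)) \<longlonglongrightarrow> Nip (semigroup t x - x - t *\<^sub>R A x)"
    using S E xC by (intro N_tendsto) auto
  show "\<exists>N. \<forall>n\<ge>N. Nip (Euler n t x - x - t *\<^sub>R A x) \<le> t\<^sup>2 * Nip (A (A x))"
    using consistentD(8)[OF consistent_Euler[OF t] x] by blast
qed

lemma funpow_comp_commute:
  assumes "\<And>x. f (g x) = g (f x)"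
  shows "((\<lambda>x. f (g x)) ^^ n) x = (f ^^ n) ((g ^^ n) x)"
proof (induction n)
  case (Suc n)
  have "(f ^^ n) (g y) = g ((f ^^ n) y)" for y by (induction n) (simp_all add: assms)
  then show ?case using Suc by simp
qed simp

text \<open>For \<open>x\<close> in the domain of \<open>A\<^sup>2\<close>: as resolvents commute, \<open>n\<close> steps of length \<open>t/n\<close> followed by \<open>n\<close> steps
  of length \<open>s/n\<close> are \<open>n\<close> steps of the operator \<open>J(s/n) J(t/n)\<close>, which is consistent over the time
  \<open>(s+t)/n\<close> and can be compared with \<open>J((s+t)/n)\<close>.\<close>

lemma semigroup_law:
  assumes s: "s \<ge> 0" and t: "t \<ge> 0" and x: "x \<in> C"
  shows "semigroup (s + t) x = semigroup s (semigroup t x)"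
proof -
  note S_in = semigroup(1)
  have D2: "Nip (semigroup (s + t) x - semigroup s (semigroup t x)) \<le> 0" if x: "x \<in> D" "A x \<in> D" for x
  proof -
    have xC: "x \<in> C" using x by simp
    have st: "s + t \<ge> 0" using s t by simp
    have C: "semigroup t x \<in> C" "semigroup (s + t) x \<in> C" "semigroup s (semigroup t x) \<in> C"
      "Euler n t x \<in> C" "Euler n (s + t) x \<in> C" "Euler n s (Euler n t x) \<in> C"
      "Euler n s (semigroup t x) \<in> C" for n
      using s t st xC by (auto intro!: S_in Euler_in)
    define K where "K = 2 * (s + t)\<^sup>2 * Nip (A (A x))"
    have euler: "Nip (Euler n (s + t) x - Euler n s (Euler n t x)) \<le> K * inverse (real (Suc n))" for n
    proof -
      define k where "k = real (Suc n)"
      have k: "k > 0" unfolding k_def by simp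
      have "consistent (s / k + t / k) (\<lambda>x. J (s / k) (J (t / k) x))"
        using s t k by (intro consistent_comp consistent_J) auto
      then have 1: "consistent ((s + t) / k) (\<lambda>x. J (s / k) (J (t / k) x))" by (simp add: add_divide_distrib)
      have 2: "consistent ((s + t) / k) (J ((s + t) / k))" using st k by (intro consistent_J) simp
      have "Nip ((J ((s + t) / k) ^^ Suc n) x - ((\<lambda>x. J (s / k) (J (t / k) x)) ^^ Suc n) x)
        \<le> k * (2 * ((s + t) / k)\<^sup>2 * Nip (A (A x)))"
        unfolding k_def using 2 1 st k x by (intro consistent_funpow_diff) (auto simp: k_def)
      also have "((\<lambda>x. J (s / k) (J (t / k) x)) ^^ Suc n) x = Euler n s (Euler n t x)"
        unfolding Euler_def k_def[symmetric] using s t k by (intro funpow_comp_commute J_commute) auto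
      also have "k * (2 * ((s + t) / k)\<^sup>2 * Nip (A (A x))) = K * inverse k"
        using k unfolding K_def by (simp add: power2_eq_square field_simps)
      finally show ?thesis unfolding Euler_def k_def .
    qed
    have "Nip (semigroup (s + t) x - semigroup s (semigroup t x)) \<le>
        Nip (Euler n (s + t) x - semigroup (s + t) x) + K * inverse (real (Suc n))
        + Nip (Euler n t x - semigroup t x) + Nip (Euler n s (semigroup t x) - semigroup s (semigroup t x))" for n
    proof -
      have "Nip (Euler n s (Euler n t x) - Euler n s (semigroup t x)) \<le> Nip (Euler n t x - semigroup t x)"
        using consistentD(2)[OF consistent_Euler[OF s] diff_in[OF C(4,1)]]
          consistent_diff[OF consistent_Euler[OF s] C(4,1)] by simp
      then show ?thesis
        using N_diff_triangle[OF C(2) C(5) C(3), of n] N_minus_commute[OF C(2) C(5), of n]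
          N_diff_triangle[OF C(5) C(6) C(3), of n n] N_diff_triangle[OF C(6) C(7) C(3), of n n] euler[of n]
        by linarith
    qed
    moreover have "(\<lambda>n. Nip (Euler n (s + t) x - semigroup (s + t) x) + K * inverse (real (Suc n))
        + Nip (Euler n t x - semigroup t x) + Nip (Euler n s (semigroup t x) - semigroup s (semigroup t x)))
        \<longlonglongrightarrow> 0 + K * 0 + 0 + 0"
      using xC s t st C by (intro tendsto_add tendsto_mult tendsto_const semigroup LIMSEQ_inverse_real_of_nat)
    ultimately show ?thesis by (intro LIMSEQ_le_const[of _ 0]) auto
  qed
  have "Nip (semigroup (s + t) x - semigroup s (semigroup t x)) \<le> 0"
  proof (rule field_le_epsilon)
    fix e :: real assume e: "e > 0"
    obtain d where d: "d \<in> D" "A d \<in> D" "Nip (x - d) < e / 2" using dense_D2[OF x, of "e/2"] e by auto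
    have dC: "d \<in> C" "x - d \<in> C" using d x by auto
    have C: "semigroup (s + t) (x - d) \<in> C" "semigroup s (semigroup t (x - d)) \<in> C"
        "semigroup (s + t) d \<in> C" "semigroup s (semigroup t d) \<in> C"
      using s t dC by (auto intro!: S_in)
    have "semigroup (s + t) x - semigroup s (semigroup t x)
        = (semigroup (s + t) (x - d) - semigroup s (semigroup t (x - d)))
          + (semigroup (s + t) d - semigroup s (semigroup t d))"
      using s t x dC S_in by (simp add: semigroup_diff)
    then have "Nip (semigroup (s + t) x - semigroup s (semigroup t x))
        \<le> Nip (semigroup (s + t) (x - d)) + Nip (semigroup s (semigroup t (x - d)))
          + Nip (semigroup (s + t) d - semigroup s (semigroup t d))"
      using N_triangle[OF diff_in[OF C(1,2)] diff_in[OF C(3,4)]] N_diff_le[OF C(1,2)] by simp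
    also have "Nip (semigroup (s + t) (x - d)) \<le> Nip (x - d)" using s t dC by (intro semigroup_contraction) auto
    also have "Nip (semigroup s (semigroup t (x - d))) \<le> Nip (x - d)"
      using semigroup_contraction[OF s S_in[OF t dC(2)]] semigroup_contraction[OF t dC(2)] by simp
    finally show "Nip (semigroup (s + t) x - semigroup s (semigroup t x)) \<le> 0 + e"
      using D2[OF d(1,2)] d(3) by simp
  qed
  then show ?thesis using s t x by (intro eqI) (auto intro!: S_in)
qed

lemma semigroup_continuous:
  assumes x: "x \<in> C"
  shows "((\<lambda>t. Nip (semigroup t x - x)) \<longlongrightarrow> 0) (at_right 0)"
proof (rule tendstoI)
  fix e :: real assume e: "e > 0"
  obtain d where d: "d \<in> D" "Nip (x - d) < e / 4" using dense_D[OF x, of "e/4"] e by auto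
  have dC: "d \<in> C" using d by simp
  have pos: "Nip (A d) + 1 > 0" using N_nonneg[OF A_in[OF d(1)]] by linarith
  have "\<forall>\<^sub>F t in at_right 0. t < e / 4 / (Nip (A d) + 1) \<and> 0 < t"
    using e pos by (auto simp: eventually_at_right_field intro!: exI[of _ "e / 4 / (Nip (A d) + 1)"])
  then show "\<forall>\<^sub>F t in at_right 0. dist (Nip (semigroup t x - x)) 0 < e"
  proof eventually_elim
    case (elim t)
    then have t: "t \<ge> 0" "t * Nip (A d) < e / 4"
    proof -
      have "t * (Nip (A d) + 1) < e / 4" using elim pos by (simp add: field_simps)
      then show "t * Nip (A d) < e / 4" using elim by (simp add: distrib_left)
    qed (use elim in auto)
    have C: "semigroup t (x - d) \<in> C" "semigroup t d \<in> C" "semigroup t x \<in> C" using semigroup(1) t x dC by auto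
    have eq: "semigroup t x - x = (semigroup t (x - d) - (x - d)) + (semigroup t d - d)"
      using t x dC by (simp add: semigroup_diff)
    have "Nip (semigroup t x - x) \<le> Nip (semigroup t (x - d) - (x - d)) + Nip (semigroup t d - d)"
      unfolding eq using C x dC by (intro N_triangle) auto
    then have "Nip (semigroup t x - x) \<le> Nip (semigroup t (x - d)) + Nip (x - d) + Nip (semigroup t d - d)"
      using N_diff_le[OF C(1) diff_in[OF x dC]] by simp
    also have "\<dots> \<le> 2 * Nip (x - d) + t * Nip (A d)"
      using semigroup_contraction[OF t(1) diff_in[OF x dC]] semigroup_lipschitz[OF t(1) d(1)] by simp
    finally have "Nip (semigroup t x - x) < e" using d(2) t(2) e by linarith
    then show ?case using C x by simp
  qed
qed

text \<open>On the domain of \<open>A\<^sup>2\<close> this is the second-order estimate.  A general \<open>x\<close> is approximated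
  by \<open>d\<close> in that domain in the graph norm, and the remainder \<open>x - d\<close> is controlled by the Lipschitz bound
  with constant \<open>\<parallel>A (x - d)\<parallel>\<close>.\<close>

lemma semigroup_derivative:
  assumes x: "x \<in> D"
  shows "((\<lambda>h. Nip ((1 / h) *\<^sub>R (semigroup h x - x) - A x)) \<longlongrightarrow> 0) (at_right 0)"
proof (rule tendstoI)
  fix e :: real assume e: "e > 0"
  have xC: "x \<in> C" "A x \<in> C" using x A_in by auto
  obtain d where d: "d \<in> D" "A d \<in> D" "Nip (A x - A d) < e / 4"
  proof -
    obtain y where y: "y \<in> D" "Nip (A x - y) < e / 16" using dense_D[OF xC(2), of "e/16"] e by auto
    have pos: "Nip (A y) + 1 > 0" using N_nonneg[OF A_in[OF y(1)]] by linarith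
    \<comment> \<open>The approximation is \<open>d = J \<tau> x\<close> for small \<open>\<tau>\<close>, because \<open>A (J \<tau> x) = J \<tau> (A x)\<close> is close to \<open>A x\<close>.\<close>
    define \<tau> where "\<tau> = e / 16 / (Nip (A y) + 1)"
    have \<tau>: "\<tau> > 0" "\<tau> * Nip (A y) < e / 16" using e pos unfolding \<tau>_def by (auto simp: field_simps)
    have C: "y \<in> C" "J \<tau> y \<in> C" "J \<tau> (A x) \<in> C" using y xC \<tau> by (auto intro: J_in)
    have "Nip (A x - J \<tau> (A x)) \<le> Nip (A x - y) + (Nip (y - J \<tau> y) + Nip (J \<tau> y - J \<tau> (A x)))"
      using N_diff_triangle[OF xC(2) C(1) C(3)] N_diff_triangle[OF C(1) C(2) C(3)] by simp
    also have "Nip (J \<tau> y - J \<tau> (A x)) \<le> Nip (A x - y)"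
      using J_contraction[of \<tau> "y - A x"] \<tau> C xC N_minus_commute[of y "A x"] by (simp add: J_diff)
    also have "Nip (y - J \<tau> y) \<le> \<tau> * Nip (A y)"
      using consistentD(7)[OF consistent_J, of \<tau> y] \<tau> y C N_minus_commute[of y "J \<tau> y"] by simp
    finally have "Nip (A x - A (J \<tau> x)) < e / 4" using y \<tau> J_D[of \<tau> x] x e by simp
    moreover have "J \<tau> x \<in> D" "A (J \<tau> x) \<in> D"
      using J_D[of \<tau> x] J_pos(1)[of \<tau> "A x"] \<tau> x xC by auto
    ultimately show ?thesis using that by blast
  qed
  have dC: "d \<in> C" "A d \<in> C" "A (A d) \<in> C" using d A_in by auto
  have pos: "Nip (A (A d)) + 1 > 0" using N_nonneg[OF dC(3)] by linarith
  have "\<forall>\<^sub>F h in at_right 0. h < e / 4 / (Nip (A (A d)) + 1) \<and> 0 < h"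
    using e pos by (auto simp: eventually_at_right_field intro!: exI[of _ "e / 4 / (Nip (A (A d)) + 1)"])
  then show "\<forall>\<^sub>F h in at_right 0. dist (Nip ((1 / h) *\<^sub>R (semigroup h x - x) - A x)) 0 < e"
  proof eventually_elim
    case (elim h)
    then have h: "h > 0" "h \<ge> 0" by auto
    have "h * (Nip (A (A d)) + 1) < e / 4" using elim pos by (simp add: field_simps)
    then have hA: "h * Nip (A (A d)) < e / 4" using h by (simp add: distrib_left)
    define a b where "a = semigroup h (x - d) - (x - d)" and "b = semigroup h d - d - h *\<^sub>R A d"
    have C: "a \<in> C" "b \<in> C" unfolding a_def b_def using semigroup(1)[OF h(2)] xC dC by auto
    have xd: "x - d \<in> D" using x d D_in by blast
    have eq: "(1 / h) *\<^sub>R (semigroup h x - x) - A x = (1 / h) *\<^sub>R a + ((1 / h) *\<^sub>R b + (A d - A x))"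
      unfolding a_def b_def using h xC dC by (simp add: semigroup_diff algebra_simps)
    have "Nip ((1 / h) *\<^sub>R (semigroup h x - x) - A x)
        \<le> Nip ((1 / h) *\<^sub>R a) + Nip ((1 / h) *\<^sub>R b + (A d - A x))"
      unfolding eq using C xC dC by (intro N_triangle) auto
    then have "Nip ((1 / h) *\<^sub>R (semigroup h x - x) - A x)
        \<le> Nip ((1 / h) *\<^sub>R a) + (Nip ((1 / h) *\<^sub>R b) + Nip (A d - A x))"
      using N_triangle[of "(1 / h) *\<^sub>R b" "A d - A x"] C xC dC by simp
    also have "Nip ((1 / h) *\<^sub>R a) \<le> Nip (A x - A d)"
      using semigroup_lipschitz[OF h(2) xd] C h x d unfolding a_def[symmetric]
      by (simp add: N_scale A_diff field_simps)
    also have "Nip ((1 / h) *\<^sub>R b) \<le> h * Nip (A (A d))"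
      using semigroup_taylor[OF h(2) d(1,2)] C h unfolding b_def[symmetric]
      by (simp add: N_scale field_simps power2_eq_square)
    finally have "Nip ((1 / h) *\<^sub>R (semigroup h x - x) - A x) < e"
      using d(3) hA N_minus_commute[OF xC(2) dC(2)] e by linarith
    moreover have "0 \<le> Nip ((1 / h) *\<^sub>R (semigroup h x - x) - A x)"
      using semigroup(1)[OF h(2) xC(1)] xC by (intro N_nonneg) auto
    ultimately show ?case by simp
  qed
qed

text \<open>The generator is a dissipative extension of \<open>A\<close>; since \<open>I - A\<close> is already surjective and a
  dissipative extension of it is injective, the extension is not proper.\<close>

lemma derivative_imp_D:
  assumes x: "x \<in> C" and y: "y \<in> C"
    and lim: "((\<lambda>h. Nip ((1 / h) *\<^sub>R (semigroup h x - x) - y)) \<longlongrightarrow> 0) (at_right 0)"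
  shows "x \<in> D"
proof -
  obtain z where z: "z \<in> D" "z - 1 *\<^sub>R A z = x - y" using range[of 1 "x - y"] x y by auto
  have zC: "z \<in> C" "A z \<in> C" using z A_in by auto
  define w where "w = x - z"
  have w: "w \<in> C" "w = y - A z" using x zC z(2) unfolding w_def by (auto simp: algebra_simps)
  define q where "q = (\<lambda>h. (1 / h) *\<^sub>R (semigroup h w - w))"
  have pos: "\<forall>\<^sub>F h::real in at_right 0. h > 0" by (rule eventually_at_right_less)
  have wlim: "((\<lambda>h. Nip (q h - w)) \<longlongrightarrow> 0) (at_right 0)"
  proof (rule Lim_null_comparison)
    show "((\<lambda>h. Nip ((1 / h) *\<^sub>R (semigroup h x - x) - y) + Nip ((1 / h) *\<^sub>R (semigroup h z - z) - A z)) \<longlongrightarrow> 0) (at_right 0)"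
      using tendsto_add[OF lim semigroup_derivative[OF z(1)]] by simp
    show "\<forall>\<^sub>F h in at_right 0. norm (Nip (q h - w)) \<le>
        Nip ((1 / h) *\<^sub>R (semigroup h x - x) - y) + Nip ((1 / h) *\<^sub>R (semigroup h z - z) - A z)"
      using pos
    proof eventually_elim
      case (elim h)
      then have h: "h \<ge> 0" by simp
      have C: "semigroup h x \<in> C" "semigroup h z \<in> C" "semigroup h w \<in> C" using semigroup(1)[OF h] x zC w by auto
      have Sw: "semigroup h w = semigroup h x - semigroup h z"
        unfolding w_def by (rule semigroup_diff[OF h x zC(1)])
      have key: "(1 / h) *\<^sub>R ((a - b) - (x - z)) - (y - c) = ((1 / h) *\<^sub>R (a - x) - y) - ((1 / h) *\<^sub>R (b - z) - c)"
        for a b c by (simp add: algebra_simps)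
      have "q h - w = ((1 / h) *\<^sub>R (semigroup h x - x) - y) - ((1 / h) *\<^sub>R (semigroup h z - z) - A z)"
        unfolding q_def Sw key[symmetric] w_def[symmetric] w(2)[symmetric] by (rule refl)
      moreover have "(1 / h) *\<^sub>R (semigroup h x - x) - y \<in> C" "(1 / h) *\<^sub>R (semigroup h z - z) - A z \<in> C"
        using C x y zC by auto
      ultimately show ?case using N_diff_le[of "(1 / h) *\<^sub>R (semigroup h x - x) - y" "(1 / h) *\<^sub>R (semigroup h z - z) - A z"]
        by (metis N_nonneg abs_of_nonneg diff_in real_norm_def)
    qed
  qed
  have "ip w w - Nip (q h - w) * Nip w \<le> 0" if "h > 0" for h
  proof -
    have h: "h \<ge> 0" using that by simp
    have S: "semigroup h w \<in> C" using semigroup(1)[OF h w(1)] .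
    then have qC: "q h \<in> C" unfolding q_def using w by auto
    have "ip (semigroup h w) w \<le> Nip (semigroup h w) * Nip w" using Cauchy_Schwarz[OF S w(1)] by simp
    also have "\<dots> \<le> Nip w * Nip w" using semigroup_contraction[OF h w(1)] w by (intro mult_right_mono) auto
    also have "\<dots> = ip w w" using Nip_sq[OF w(1)] by (simp add: power2_eq_square)
    finally have le: "ip (semigroup h w) w \<le> ip w w" .
    have "ip (q h) w = (1 / h) * (ip (semigroup h w) w - ip w w)"
      unfolding q_def using S w(1) by (simp add: ip_scale_left ip_diff_left)
    also have "\<dots> \<le> 0" using le that by (intro mult_nonneg_nonpos) auto
    finally have "ip (q h) w \<le> 0" .
    moreover have "ip w w - ip (q h) w \<le> Nip (q h - w) * Nip w"
      using Cauchy_Schwarz[of "q h - w" w] qC w(1) by (simp add: ip_diff_left)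
    ultimately show ?thesis by simp
  qed
  then have "\<forall>\<^sub>F h in at_right 0. ip w w - Nip (q h - w) * Nip w \<le> 0"
    using pos by (auto elim: eventually_mono)
  moreover have "((\<lambda>h. ip w w - Nip (q h - w) * Nip w) \<longlongrightarrow> ip w w - 0 * Nip w) (at_right 0)"
    by (intro tendsto_intros wlim)
  ultimately have "ip w w \<le> 0" by (intro tendsto_upperbound[of _ "ip w w" "at_right 0"]) auto
  then have "Nip w = 0" using ip_nonneg[OF w(1)] by (simp add: ip_norm_def)
  then have "w = 0" using definite w by blast
  then show ?thesis using z unfolding w_def by simp
qed

end

text \<open>The Lumer-Phillips theorem for seminorms.  A linear projection along the null space
  selects one representative of each class; on its range the seminorm is a norm.\<close>

theorem (in semi_inner_space) Lumer_Phillips: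
  assumes complete: "complete_in C Nip"
    and D: "subspace D" "D \<subseteq> C"
    and D_saturated: "\<And>x y. \<lbrakk>x \<in> D; y \<in> C; Nip (x - y) = 0\<rbrakk> \<Longrightarrow> y \<in> D"
    and A_in: "\<And>x. x \<in> D \<Longrightarrow> A x \<in> C"
    and A_linear: "\<And>x y a b. \<lbrakk>x \<in> D; y \<in> D\<rbrakk> \<Longrightarrow> Nip (A (a *\<^sub>R x + b *\<^sub>R y) - (a *\<^sub>R A x + b *\<^sub>R A y)) = 0"
    and A_null: "\<And>x. x \<in> D \<Longrightarrow> Nip x = 0 \<Longrightarrow> Nip (A x) = 0"
    and dissipative: "\<And>x. x \<in> D \<Longrightarrow> ip (A x) x \<le> 0"
    and range: "\<And>\<tau> y. \<lbrakk>\<tau> > 0; y \<in> C\<rbrakk> \<Longrightarrow> \<exists>x\<in>D. Nip ((x - \<tau> *\<^sub>R A x) - y) = 0"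
  shows "\<exists>S. contraction_semigroup_in C Nip S \<and> generates_in C Nip D A S"
proof -
  have DC: "x \<in> C" if "x \<in> D" for x using that D by blast
  have D_in: "x + y \<in> D" "x - y \<in> D" "c *\<^sub>R x \<in> D" if "x \<in> D" "y \<in> D" for x y c
    using D(1) that by (auto intro: subspace_add subspace_diff subspace_scale)
  define Z where "Z = {x \<in> C. Nip x = 0}"
  have Z: "subspace Z"
    unfolding subspace_def Z_def
    using N_triangle N_scale N_nonneg by (auto simp: order_antisym intro!: order_antisym[OF order_trans[OF N_triangle]])
  \<comment> \<open>\<open>g\<close> projects linearly onto the null space, so \<open>p = id - g\<close> annihilates it.\<close>
  obtain g where g: "range g \<subseteq> Z" "linear g" "\<And>v. v \<in> Z \<Longrightarrow> g v = v"
    using linear_exists_left_inverse_on[OF linear_id Z, simplified] by auto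
  define p where "p = (\<lambda>x. x - g x)"
  have gZ: "g x \<in> C" "Nip (g x) = 0" for x using g(1) unfolding Z_def by auto
  have p_lin: "linear p" unfolding p_def using g(2) by (intro linear_compose_sub linear_id[unfolded id_def])
  have p_in: "p x \<in> C" if "x \<in> C" for x using that gZ unfolding p_def by auto
  have p_eq: "Nip (p x - x) = 0" if "x \<in> C" for x using gZ N_minus[of "g x"] unfolding p_def by simp
  have p_null: "p x = 0" if "x \<in> C" "Nip x = 0" for x using g(3)[of x] that unfolding p_def Z_def by simp
  have p_cong: "p x = p y" if "x \<in> C" "y \<in> C" "Nip (x - y) = 0" for x y
    using p_null[of "x - y"] linear_diff[OF p_lin, of x y] that by simp
  have p_idem: "p (p x) = p x" if "x \<in> C" for x using p_cong[OF p_in[OF that] that p_eq[OF that]] .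
  have p_N: "Nip (p x) = Nip x" if "x \<in> C" for x using N_cong[OF p_in[OF that] that p_eq[OF that]] .
  have pC: "x \<in> C" "p x = x" if "x \<in> p ` C" for x using that p_in p_idem by auto
  have pD: "p x \<in> D" if "x \<in> D" for x
    using D_saturated[OF that p_in[OF DC[OF that]]] p_eq[OF DC[OF that]] N_minus_commute p_in DC that by metis
  have pD': "x \<in> D" "p x = x" if "x \<in> p ` D" for x using that pD p_idem DC by auto
  have pA: "Nip (A (p x) - A x) = 0" if x: "x \<in> D" for x
  proof -
    have "Nip (A (1 *\<^sub>R p x + (- 1) *\<^sub>R x) - (1 *\<^sub>R A (p x) + (- 1) *\<^sub>R A x)) = 0"
      using A_linear[OF pD[OF x] x] .
    then have "Nip (A (p x - x) - (A (p x) - A x)) = 0" by simp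
    moreover have "Nip (A (p x - x)) = 0"
      using A_null[of "p x - x"] p_eq[OF DC[OF x]] D_in pD x by blast
    ultimately show ?thesis
      using N_cong[of "A (p x - x)" "A (p x) - A x"] A_in D_in pD x by auto
  qed
  interpret G: m_dissipative_operator "p ` C" ip "p ` D" "\<lambda>x. p (A x)"
  proof
    show "subspace (p ` C)" using p_lin subspace_C by (rule linear_subspace_image)
    show "subspace (p ` D)" using p_lin D(1) by (rule linear_subspace_image)
    show "p ` D \<subseteq> p ` C" using D by blast
    show "x = 0" if "x \<in> p ` C" "Nip x = 0" for x using p_null[of x] pC[OF that(1)] that by simp
    show "p (A x) \<in> p ` C" if "x \<in> p ` D" for x using pD'[OF that] A_in by blast
    show "ip (p (A x)) x \<le> 0" if "x \<in> p ` D" for x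
    proof -
      have "ip (p (A x) - A x) x = 0"
        using pD'[OF that] A_in p_in p_eq DC by (intro ip_null_left) auto
      then show ?thesis using pD'[OF that] A_in p_in DC dissipative[of x] by (simp add: ip_diff_left)
    qed
    show "p (A (x + y)) = p (A x) + p (A y)" if "x \<in> p ` D" "y \<in> p ` D" for x y
    proof -
      have xy: "x \<in> D" "y \<in> D" using pD'(1) that by blast+
      have "p (A (x + y)) = p (A x + A y)"
      proof (rule p_cong)
        show "A (x + y) \<in> C" "A x + A y \<in> C" using A_in[OF D_in(1)[OF xy]] A_in[OF xy(1)] A_in[OF xy(2)] by auto
        show "Nip (A (x + y) - (A x + A y)) = 0" using A_linear[OF xy, of 1 1] by simp
      qed
      then show ?thesis by (simp add: linear_add[OF p_lin])
    qed
    show "p (A (c *\<^sub>R x)) = c *\<^sub>R p (A x)" if "x \<in> p ` D" for x c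
    proof -
      have x: "x \<in> D" using pD'(1) that by blast
      have "p (A (c *\<^sub>R x)) = p (c *\<^sub>R A x)"
      proof (rule p_cong)
        show "A (c *\<^sub>R x) \<in> C" "c *\<^sub>R A x \<in> C" using A_in[OF D_in(3)[OF x x]] A_in[OF x] by auto
        show "Nip (A (c *\<^sub>R x) - c *\<^sub>R A x) = 0" using A_linear[OF x x, of c 0] by simp
      qed
      then show ?thesis by (simp add: linear_scale[OF p_lin])
    qed
    show "\<exists>x\<in>p ` D. x - \<tau> *\<^sub>R p (A x) = y" if ty: "\<tau> > 0" "y \<in> p ` C" for \<tau> y
    proof -
      obtain x where x: "x \<in> D" "Nip ((x - \<tau> *\<^sub>R A x) - y) = 0" using range[OF ty(1)] pC(1)[OF ty(2)] by blast
      have "p (A (p x)) = p (A x)"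
        by (rule p_cong[OF A_in[OF pD[OF x(1)]] A_in[OF x(1)] pA[OF x(1)]])
      then have "p x - \<tau> *\<^sub>R p (A (p x)) = p (x - \<tau> *\<^sub>R A x)"
        by (simp add: linear_diff[OF p_lin] linear_scale[OF p_lin])
      also have "\<dots> = p y"
        by (rule p_cong[OF diff_in[OF DC[OF x(1)] scale_in[OF A_in[OF x(1)]]] pC(1)[OF ty(2)] x(2)])
      also have "\<dots> = y" by (rule pC(2)[OF ty(2)])
      finally show ?thesis using x by blast
    qed
    show "complete_in (p ` C) Nip"
      unfolding complete_in_def
    proof (intro allI impI)
      fix X assume X: "\<forall>n::nat. X n \<in> p ` C" and Cauchy: "\<forall>e>0. \<exists>M. \<forall>m\<ge>M. \<forall>n\<ge>M. Nip (X m - X n) < e"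
      obtain x where x: "x \<in> C" "(\<lambda>n. Nip (X n - x)) \<longlonglongrightarrow> 0"
      proof (rule complete_inD[OF complete, of X])
        show "X n \<in> C" for n using X pC(1) by blast
      qed (use Cauchy in auto)
      have "Nip (X n - p x) = Nip (X n - x)" for n
      proof -
        have "X n \<in> C" using X pC(1) by blast
        then show ?thesis using x(1) p_in p_eq N_minus_commute[OF x(1) p_in[OF x(1)]]
          by (intro N_cong) auto
      qed
      then show "\<exists>x\<in>p ` C. (\<lambda>n. Nip (X n - x)) \<longlonglongrightarrow> 0" using x by (intro bexI[of _ "p x"]) auto
    qed
  qed (auto dest!: pC(1) intro: ip_commute ip_nonneg simp: ip_add_left ip_scale_left)
  define S where "S = (\<lambda>t x. G.semigroup t (p x))"
  have S_in: "S t x \<in> p ` C" if "t \<ge> 0" "x \<in> C" for t x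
    unfolding S_def using that by (intro G.semigroup(1)) auto
  have quot: "Nip ((1 / h) *\<^sub>R (S h x - x) - y) = Nip ((1 / h) *\<^sub>R (G.semigroup h (p x) - p x) - p y)"
    if "h > 0" "x \<in> C" "y \<in> C" for h x y
  proof -
    have S: "S h x \<in> C" using pC(1)[OF S_in[of h x]] that by simp
    have "p ((1 / h) *\<^sub>R (S h x - x) - y) = (1 / h) *\<^sub>R (S h x - p x) - p y"
      using pC(2)[OF S_in[of h x]] that by (simp add: linear_diff[OF p_lin] linear_scale[OF p_lin])
    then show ?thesis using p_N[of "(1 / h) *\<^sub>R (S h x - x) - y"] S that unfolding S_def by simp
  qed
  have deriv: "((\<lambda>h. Nip ((1 / h) *\<^sub>R (S h x - x) - y)) \<longlongrightarrow> 0) (at_right 0) \<longleftrightarrow>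
      ((\<lambda>h. Nip ((1 / h) *\<^sub>R (G.semigroup h (p x) - p x) - p y)) \<longlongrightarrow> 0) (at_right 0)" if "x \<in> C" "y \<in> C" for x y
    using quot that eventually_at_right_less[of "0::real"]
    by (intro tendsto_cong) (auto elim!: eventually_mono)
  have "contraction_semigroup_in C Nip S"
    unfolding contraction_semigroup_in_def
  proof (intro conjI ballI allI impI)
    fix t :: real and x assume t: "t \<ge> 0" and x: "x \<in> C"
    show "S t x \<in> C" by (rule pC(1)[OF S_in[OF t x]])
    show "Nip (S t x) \<le> Nip x" using G.semigroup_contraction[OF t, of "p x"] x p_N unfolding S_def by simp
    fix y a b assume y: "y \<in> C"
    have "S t (a *\<^sub>R x + b *\<^sub>R y) = a *\<^sub>R S t x + b *\<^sub>R S t y"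
      unfolding S_def using t x y
      by (simp add: linear_add[OF p_lin] linear_scale[OF p_lin] G.semigroup_add G.semigroup_scale)
    then show "Nip (S t (a *\<^sub>R x + b *\<^sub>R y) - (a *\<^sub>R S t x + b *\<^sub>R S t y)) = 0" by simp
  next
    fix x assume x: "x \<in> C"
    show "Nip (S 0 x - x) = 0" using x p_eq by (simp add: S_def G.semigroup_zero)
    have "Nip (S t x - x) = Nip (G.semigroup t (p x) - p x)" if "t > 0" for t
    proof -
      have "t \<ge> 0" using that by simp
      note SS = S_in[OF this x]
      have "p (S t x - x) = S t x - p x" using pC(2)[OF SS] by (simp add: linear_diff[OF p_lin])
      then show ?thesis using p_N[of "S t x - x"] pC(1)[OF SS] x unfolding S_def by simp
    qed
    then have "((\<lambda>t. Nip (S t x - x)) \<longlongrightarrow> 0) (at_right 0) \<longleftrightarrow>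
        ((\<lambda>t. Nip (G.semigroup t (p x) - p x)) \<longlongrightarrow> 0) (at_right 0)"
      using eventually_at_right_less[of "0::real"] by (intro tendsto_cong) (auto elim!: eventually_mono)
    then show "((\<lambda>t. Nip (S t x - x)) \<longlongrightarrow> 0) (at_right 0)"
      using G.semigroup_continuous[of "p x"] x by blast
  next
    fix s t :: real and x assume "s \<ge> 0" "t \<ge> 0" "x \<in> C"
    then show "Nip (S (s + t) x - S s (S t x)) = 0"
      using pC(2)[OF S_in[of t x]] G.semigroup_law[of s t "p x"] by (simp add: S_def)
  qed
  moreover have "generates_in C Nip D A S"
    unfolding generates_in_def
  proof (intro conjI ballI)
    show "D = {x \<in> C. \<exists>y\<in>C. ((\<lambda>h. Nip ((1 / h) *\<^sub>R (S h x - x) - y)) \<longlongrightarrow> 0) (at_right 0)}"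
    proof safe
      fix x assume x: "x \<in> D"
      show "x \<in> C" using x DC by blast
      have "((\<lambda>h. Nip ((1 / h) *\<^sub>R (S h x - x) - A (p x))) \<longlongrightarrow> 0) (at_right 0)"
        using G.semigroup_derivative[of "p x"] x DC A_in pD by (subst deriv) auto
      then show "\<exists>y\<in>C. ((\<lambda>h. Nip ((1 / h) *\<^sub>R (S h x - x) - y)) \<longlongrightarrow> 0) (at_right 0)"
        using A_in pD x by blast
    next
      fix x y assume x: "x \<in> C" and y: "y \<in> C" and "((\<lambda>h. Nip ((1 / h) *\<^sub>R (S h x - x) - y)) \<longlongrightarrow> 0) (at_right 0)"
      then have "((\<lambda>h. Nip ((1 / h) *\<^sub>R (G.semigroup h (p x) - p x) - p y)) \<longlongrightarrow> 0) (at_right 0)"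
        by (simp add: deriv)
      then have "p x \<in> p ` D" using x y by (intro G.derivative_imp_D[of "p x" "p y"]) auto
      then have "p x \<in> D" using pD' by blast
      then show "x \<in> D" using D_saturated[of "p x" x] x p_eq by blast
    qed
    fix x assume x: "x \<in> D"
    show "A x \<in> C" using x by (rule A_in)
    have "p (A x) = p (A (p x))" by (rule p_cong[OF A_in[OF pD[OF x]] A_in[OF x] pA[OF x], symmetric])
    then show "((\<lambda>h. Nip ((1 / h) *\<^sub>R (S h x - x) - A x)) \<longlongrightarrow> 0) (at_right 0)"
      using G.semigroup_derivative[of "p x"] x DC A_in by (subst deriv) auto
  qed
  ultimately show ?thesis by blast
qed


section \<open>Mild solutions\<close>

context seminormed_space begin

lemma simple_function_restrict:
  assumes "simple_function M s" "A \<in> sets M"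
  shows "simple_function (restrict_space M A) s"
proof -
  have "s -` {y} \<inter> (A \<inter> space M) \<in> sets (restrict_space M A)" for y
  proof -
    have "s -` {y} \<inter> space M \<in> sets M" using assms(1) by (rule simple_functionD(2))
    then have "s -` {y} \<inter> (A \<inter> space M) \<in> (\<inter>) A ` sets M"
      by (intro image_eqI[of _ _ "s -` {y} \<inter> space M"]) auto
    then show ?thesis by (simp add: sets_restrict_space)
  qed
  moreover have "finite (s ` (A \<inter> space M))"
    using simple_functionD(1)[OF assms(1)] by (rule rev_finite_subset) auto
  ultimately show ?thesis by (auto simp: simple_function_def space_restrict_space)
qed

lemma strongly_measurable_restrict:
  assumes "strongly_measurable_in C N M f" "A \<in> sets M"
  shows "strongly_measurable_in C N (restrict_space M A) f"
proof -
  obtain s where s: "\<And>i::nat. simple_function M (s i)" "\<And>i x. x \<in> space M \<Longrightarrow> s i x \<in> C"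
    "\<And>x. x \<in> space M \<Longrightarrow> (\<lambda>i. N (f x - s i x)) \<longlonglongrightarrow> 0" "\<And>x. x \<in> space M \<Longrightarrow> f x \<in> C"
    using strongly_measurableE[OF assms(1)] by blast
  show ?thesis
    by (rule strongly_measurableI[of _ _ s])
      (use s simple_function_restrict[OF s(1) assms(2)] in \<open>auto simp: space_restrict_space\<close>)
qed

lemma sint_restrict:
  assumes A: "A \<in> sets M" and s: "simple_function M s"
  shows "sint (restrict_space M A) s = sint M (\<lambda>x. indicator A x *\<^sub>R s x)"
proof -
  have A': "A \<inter> space M \<in> sets M" using A by simp
  have "finite ((\<lambda>x. indicator A x *\<^sub>R s x) ` space M)"
  proof (rule finite_subset)
    show "(\<lambda>x. indicator A x *\<^sub>R s x) ` space M \<subseteq> insert 0 (s ` space M)"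
      by (auto simp: indicator_def)
  qed (use simple_functionD(1)[OF s] in simp)
  then show ?thesis
    by (auto simp: space_restrict_space measure_restrict_space[OF A'] le_infI2
                   simple_bochner_integral_def Collect_restrict
             split: split_indicator split_indicator_asm
             intro!: sum.mono_neutral_cong_left arg_cong2[where f=measure])
qed

text \<open>Cutting the approximating simple functions off outside \<open>A\<close> changes their integrals by at most
  the approximation error, because the integrand itself vanishes there.\<close>

lemma has_bochner_integral_in_restrict:
  assumes I: "has_bochner_integral_in C N M f I" and A: "A \<in> sets M" and "finite_measure M"
    and zero: "\<And>x. x \<in> space M \<Longrightarrow> x \<notin> A \<Longrightarrow> f x = 0"
  shows "has_bochner_integral_in C N (restrict_space M A) f I"
proof -
  obtain s where f: "strongly_measurable_in C N M f" and IC: "I \<in> C"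
    and s: "\<And>i::nat. sintegrable M (s i)" "\<And>i x. x \<in> space M \<Longrightarrow> s i x \<in> C"
    and lim: "(\<lambda>i. \<integral>\<^sup>+x. ennreal (N (f x - s i x)) \<partial>M) \<longlonglongrightarrow> 0" "(\<lambda>i. N (sint M (s i) - I)) \<longlonglongrightarrow> 0"
    by (rule has_bochner_integral_inE[OF I], rule that)
  have fC: "f x \<in> C" if "x \<in> space M" for x using f that by (rule strongly_measurable_in_C)
  have A': "A \<inter> space M \<in> sets M" using A by simp
  define r where "r = (\<lambda>i x. indicator A x *\<^sub>R s i x)"
  have rC: "r i x \<in> C" if "x \<in> space M" for i x unfolding r_def using s(2)[OF that] by auto
  have r_simple: "simple_function M (r i)" for i
    unfolding r_def using sintegrableD[OF s(1)] A
    by (intro simple_function_compose2[where h="\<lambda>a b. a *\<^sub>R b"] simple_function_indicator) auto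
  have r_int: "sintegrable M (r i)" for i by (rule sintegrableI_finite[OF assms(3) r_simple])
  show ?thesis
  proof (rule has_bochner_integral_inI[where s=s])
    show "strongly_measurable_in C N (restrict_space M A) f" by (rule strongly_measurable_restrict[OF f A])
    show "sintegrable (restrict_space M A) (s i)" for i
      using finite_measure_restrict_space[OF assms(3) A] simple_function_restrict[OF sintegrableD[OF s(1)] A]
      by (intro sintegrableI_finite)
    show "(\<lambda>i. \<integral>\<^sup>+x. ennreal (N (f x - s i x)) \<partial>restrict_space M A) \<longlonglongrightarrow> 0"
    proof (rule tendsto_sandwich[OF _ _ tendsto_const lim(1)])
      have "(\<integral>\<^sup>+x. ennreal (N (f x - s i x)) \<partial>restrict_space M A) \<le> (\<integral>\<^sup>+x. ennreal (N (f x - s i x)) \<partial>M)" for i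
        unfolding nn_integral_restrict_space[OF A'] by (intro nn_integral_mono) (auto simp: indicator_def)
      then show "\<forall>\<^sub>F i in sequentially. (\<integral>\<^sup>+x. ennreal (N (f x - s i x)) \<partial>restrict_space M A)
          \<le> (\<integral>\<^sup>+x. ennreal (N (f x - s i x)) \<partial>M)" by simp
    qed auto
    have r_lim: "(\<lambda>i. \<integral>\<^sup>+x. ennreal (N (r i x - s i x)) \<partial>M) \<longlonglongrightarrow> 0"
    proof (rule tendsto_sandwich[OF _ _ tendsto_const lim(1)])
      have "(\<integral>\<^sup>+x. ennreal (N (r i x - s i x)) \<partial>M) \<le> (\<integral>\<^sup>+x. ennreal (N (f x - s i x)) \<partial>M)" for i
        using zero fC s(2) by (intro nn_integral_mono ennreal_leI) (auto simp: r_def indicator_def)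
      then show "\<forall>\<^sub>F i in sequentially. (\<integral>\<^sup>+x. ennreal (N (r i x - s i x)) \<partial>M)
          \<le> (\<integral>\<^sup>+x. ennreal (N (f x - s i x)) \<partial>M)" by simp
    qed auto
    have C: "sint M (r i) \<in> C" "sint M (s i) \<in> C" for i using rC s(2) by (auto intro: sint_in_C)
    have "ennreal (N (sint M (r i) - sint M (s i))) \<le> (\<integral>\<^sup>+x. ennreal (N (r i x - s i x)) \<partial>M)" for i
    proof -
      have "ennreal (N (sint M (\<lambda>x. r i x - s i x))) \<le> (\<integral>\<^sup>+x. ennreal (N (r i x - s i x)) \<partial>M)"
        using rC s(2) by (intro N_sint_le simple_bochner_integrable_compose2[where p="(-)", OF _ r_int s(1)]) auto
      then show ?thesis by (simp add: simple_bochner_integral_diff[OF r_int s(1)])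
    qed
    then have "(\<lambda>i. ennreal (N (sint M (r i) - sint M (s i)))) \<longlonglongrightarrow> 0"
      by (intro tendsto_sandwich[OF _ _ tendsto_const r_lim]) auto
    then have "(\<lambda>i. N (sint M (r i) - sint M (s i))) \<longlonglongrightarrow> 0"
      using C by (subst (asm) ennreal_0[symmetric], subst (asm) tendsto_ennreal_iff) auto
    from tendsto_add[OF this lim(2)] have lim': "(\<lambda>i. N (sint M (r i) - sint M (s i)) + N (sint M (s i) - I)) \<longlonglongrightarrow> 0"
      by simp
    have eq: "sint (restrict_space M A) (s i) = sint M (r i)" for i
      unfolding r_def by (rule sint_restrict[OF A sintegrableD[OF s(1)]])
    show "(\<lambda>i. N (sint (restrict_space M A) (s i) - I)) \<longlonglongrightarrow> 0"
      unfolding eq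
      by (rule Lim_null_comparison[OF _ lim']) (use C IC N_diff_triangle[OF C(1) C(2) IC] in auto)
  qed (use s IC in \<open>auto simp: space_restrict_space\<close>)
qed

lemma has_bochner_integral_in_cong:
  assumes "\<And>x. x \<in> space M \<Longrightarrow> f x = g x"
  shows "has_bochner_integral_in C N M f I \<longleftrightarrow> has_bochner_integral_in C N M g I"
proof -
  have "(\<integral>\<^sup>+x. ennreal (N (f x - s x)) \<partial>M) = (\<integral>\<^sup>+x. ennreal (N (g x - s x)) \<partial>M)" for s
    using assms by (intro nn_integral_cong) simp
  moreover have "strongly_measurable_in C N M f \<longleftrightarrow> strongly_measurable_in C N M g"
    by (rule strongly_measurable_cong[OF assms])
  ultimately show ?thesis unfolding has_bochner_integral_in_def by simp
qed

lemma bochner_integrable_in_restrict: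
  assumes "bochner_integrable_in C N M f" "A \<in> sets M"
  shows "bochner_integrable_in C N (restrict_space M A) f"
  using assms strongly_measurable_restrict[of M f A] integrable_mult_indicator[of A M "\<lambda>x. N (f x)"]
  unfolding bochner_integrable_in_def by (auto simp: integrable_restrict_space)

lemma bochner_integrable_in_diff:
  assumes "bochner_integrable_in C N M f" "bochner_integrable_in C N M g"
  shows "bochner_integrable_in C N M (\<lambda>x. f x - g x)"
proof -
  have sm: "strongly_measurable_in C N M f" "strongly_measurable_in C N M g"
    using assms unfolding bochner_integrable_in_def by auto
  have "integrable M (\<lambda>x. N (f x - g x))"
  proof (rule Bochner_Integration.integrable_bound)
    show "integrable M (\<lambda>x. N (f x) + N (g x))" using assms unfolding bochner_integrable_in_def by simp
    show "AE x in M. norm (N (f x - g x)) \<le> norm (N (f x) + N (g x))"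
      using strongly_measurable_in_C[OF sm(1)] strongly_measurable_in_C[OF sm(2)] N_diff_le
      by (intro AE_I2) auto
  qed (rule strongly_measurable_norm[OF strongly_measurable_diff[OF sm]])
  then show ?thesis using strongly_measurable_diff[OF sm] unfolding bochner_integrable_in_def by simp
qed

end

locale contraction_semigroup = seminormed_space C N
  for C :: "'e::real_vector set" and N +
  fixes S :: "real \<Rightarrow> 'e \<Rightarrow> 'e"
  assumes complete: "complete_in C N" and semigroup: "contraction_semigroup_in C N S"
begin

lemma S_in [simp]: "t \<ge> 0 \<Longrightarrow> x \<in> C \<Longrightarrow> S t x \<in> C"
  and S_contraction: "t \<ge> 0 \<Longrightarrow> x \<in> C \<Longrightarrow> N (S t x) \<le> N x"
  and S_law: "s \<ge> 0 \<Longrightarrow> t \<ge> 0 \<Longrightarrow> x \<in> C \<Longrightarrow> N (S (s + t) x - S s (S t x)) = 0"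
  and S_continuous_0: "x \<in> C \<Longrightarrow> ((\<lambda>t. N (S t x - x)) \<longlongrightarrow> 0) (at_right 0)"
  using semigroup unfolding contraction_semigroup_in_def by blast+

lemma S_linear:
  "t \<ge> 0 \<Longrightarrow> x \<in> C \<Longrightarrow> y \<in> C \<Longrightarrow> N (S t (a *\<^sub>R x + b *\<^sub>R y) - (a *\<^sub>R S t x + b *\<^sub>R S t y)) = 0"
  using semigroup unfolding contraction_semigroup_in_def by blast

lemma S_diff_le:
  assumes "t \<ge> 0" "x \<in> C" "y \<in> C"
  shows "N (S t x - S t y) \<le> N (x - y)"
proof -
  have "N (S t (x - y) - (S t x - S t y)) = 0"
    using S_linear[OF assms, of 1 "-1"] by simp
  then have "N (S t (x - y)) = N (S t x - S t y)" using assms by (intro N_cong) auto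
  then show ?thesis using S_contraction[of t "x - y"] assms by simp
qed

text \<open>Strong continuity at \<open>0\<close> yields a modulus of continuity on the whole half-line.\<close>

lemma S_increment:
  assumes "0 \<le> s" "s \<le> t" "x \<in> C"
  shows "N (S t x - S s x) \<le> N (S (t - s) x - x)"
proof -
  have C: "S t x \<in> C" "S s x \<in> C" "S (t - s) x \<in> C" "S s (S (t - s) x) \<in> C" using assms by auto
  have "N (S t x - S s (S (t - s) x)) = 0" using S_law[of s "t - s" x] assms by simp
  then have "N (S t x - S s x) \<le> N (S s (S (t - s) x) - S s x)"
    using N_diff_triangle[OF C(1,4,2)] by simp
  also have "\<dots> \<le> N (S (t - s) x - x)" using assms by (intro S_diff_le) auto
  finally show ?thesis .
qed

lemma S_uniformly_continuous:
  assumes x: "x \<in> C" and e: "e > 0"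
  obtains d where "d > 0" "\<And>s t. 0 \<le> s \<Longrightarrow> 0 \<le> t \<Longrightarrow> \<bar>t - s\<bar> < d \<Longrightarrow> N (S t x - S s x) < e"
proof -
  have "\<forall>\<^sub>F h in at_right 0. N (S h x - x) < e"
    using order_tendstoD(2)[OF S_continuous_0[OF x] e] .
  then obtain d where d: "d > 0" "\<And>h. 0 < h \<Longrightarrow> h < d \<Longrightarrow> N (S h x - x) < e"
    by (auto simp: eventually_at_right_field)
  have *: "N (S t x - S s x) < e" if "0 \<le> s" "s \<le> t" "t - s < d" for s t
  proof (cases "s = t")
    case True
    then show ?thesis using e by simp
  next
    case False
    then show ?thesis using S_increment[OF that(1,2) x] d(2)[of "t - s"] that by simp
  qed
  have "N (S t x - S s x) < e" if "0 \<le> s" "0 \<le> t" "\<bar>t - s\<bar> < d" for s t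
    using *[of s t] *[of t s] that N_minus_commute[of "S t x" "S s x"] x by (cases "s \<le> t") auto
  then show ?thesis using that[OF d(1)] by blast
qed

lemma S_tendsto:
  assumes x: "x \<in> C" and r: "\<And>i. r i \<ge> 0" "t \<ge> 0" "(r \<longlongrightarrow> t) F"
  shows "((\<lambda>i. N (S (r i) x - S t x)) \<longlongrightarrow> 0) F"
proof (rule tendstoI)
  fix e :: real assume e: "e > 0"
  obtain d where d: "d > 0" "\<And>s t. 0 \<le> s \<Longrightarrow> 0 \<le> t \<Longrightarrow> \<bar>t - s\<bar> < d \<Longrightarrow> N (S t x - S s x) < e"
    using S_uniformly_continuous[OF x e] by blast
  have "\<forall>\<^sub>F i in F. dist (r i) t < d" using r(3) d(1) by (rule tendstoD)
  then show "\<forall>\<^sub>F i in F. dist (N (S (r i) x - S t x)) 0 < e"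
  proof eventually_elim
    case (elim i)
    then show ?case using d(2)[of t "r i"] r x by (simp add: dist_real_def)
  qed
qed

text \<open>The integrand of the variation-of-constants formula at time \<open>t\<close>, extended by zero to later
  times so that all times share one measure space.\<close>

definition duhamel :: "(real \<Rightarrow> 'e) \<Rightarrow> real \<Rightarrow> real \<Rightarrow> 'e"
  where "duhamel F t s = (if s \<le> t then S (t - s) (F s) else 0)"

text \<open>It is approximated by rounding the time argument of the semigroup to a grid and
  replacing \<open>F\<close> by simple functions.\<close>

lemma duhamel_measurable:
  assumes F: "strongly_measurable_in C N (lebesgue_on {0..T}) F"
  shows "strongly_measurable_in C N (lebesgue_on {0..T}) (duhamel F t)"
proof -
  let ?M = "lebesgue_on {0..T}"
  obtain f where f: "\<And>i::nat. simple_function ?M (f i)" "\<And>i x. x \<in> space ?M \<Longrightarrow> f i x \<in> C"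
    "\<And>x. x \<in> space ?M \<Longrightarrow> (\<lambda>i. N (F x - f i x)) \<longlonglongrightarrow> 0" "\<And>x. x \<in> space ?M \<Longrightarrow> F x \<in> C"
    using strongly_measurableE[OF F] by blast
  \<comment> \<open>The truncation to natural numbers makes \<open>r i s\<close> non-negative also for \<open>s > t\<close>, outside the domain of the semigroup.\<close>
  define k where "k = (\<lambda>(i::nat) s. nat \<lfloor>real (Suc i) * (t - s)\<rfloor>)"
  define r where "r = (\<lambda>i s. real (k i s) / real (Suc i))"
  have id_meas: "(\<lambda>s. s) \<in> borel_measurable ?M"
    by (intro measurable_restrict_space1 measurable_completion) simp
  have k_simple: "simple_function ?M (k i)" for i
    unfolding simple_function_def
  proof (intro conjI ballI)
    have "k i s \<le> nat \<lfloor>real (Suc i) * \<bar>t\<bar>\<rfloor>" if "s \<in> {0..T}" for s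
      unfolding k_def using that by (intro nat_mono floor_mono mult_left_mono) auto
    then show "finite (k i ` space ?M)"
      by (intro finite_subset[OF _ finite_atMost[of "nat \<lfloor>real (Suc i) * \<bar>t\<bar>\<rfloor>"]]) auto
    have "(\<lambda>s. real (Suc i) * (t - s)) \<in> borel_measurable ?M" using id_meas by simp
    then have "(\<lambda>s. \<lfloor>real (Suc i) * (t - s)\<rfloor>) \<in> measurable ?M (count_space UNIV)"
      by (rule measurable_compose[OF _ measurable_real_floor])
    then have "k i \<in> measurable ?M (count_space UNIV)"
      unfolding k_def by (rule measurable_compose) simp
    then show "k i -` {j} \<inter> space ?M \<in> sets ?M" for j by (rule measurable_sets) auto
  qed
  have r_nonneg: "r i s \<ge> 0" for i s unfolding r_def by simp
  have r_close: "\<bar>r i s - (t - s)\<bar> \<le> inverse (real (Suc i))" if "s \<le> t" for i s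
  proof -
    have "0 \<le> real (Suc i) * (t - s)" using that by simp
    then have k: "real (k i s) = of_int \<lfloor>real (Suc i) * (t - s)\<rfloor>" unfolding k_def by simp
    have "\<bar>real (k i s) - real (Suc i) * (t - s)\<bar> \<le> 1" unfolding k by linarith
    then have "\<bar>(real (k i s) - real (Suc i) * (t - s)) / real (Suc i)\<bar> \<le> 1 / real (Suc i)"
      unfolding abs_divide abs_of_nat by (intro divide_right_mono) simp_all
    then show ?thesis unfolding r_def by (simp add: diff_divide_distrib inverse_eq_divide del: of_nat_Suc)
  qed
  have r_lim: "(\<lambda>i. r i s) \<longlonglongrightarrow> t - s" if "s \<le> t" for s
  proof -
    have "(\<lambda>i. r i s - (t - s)) \<longlonglongrightarrow> 0"
      by (rule Lim_null_comparison[OF _ LIMSEQ_inverse_real_of_nat]) (use r_close[OF that] in auto)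
    then show ?thesis by (simp only: LIM_zero_iff)
  qed
  show ?thesis
  proof (rule strongly_measurableI[where s="\<lambda>i s. if s \<le> t then S (r i s) (f i s) else 0"])
    show "duhamel F t x \<in> C" if "x \<in> space ?M" for x unfolding duhamel_def using f(4)[OF that] by auto
    show "(if x \<le> t then S (r i x) (f i x) else 0) \<in> C" if "x \<in> space ?M" for i x
      using f(2)[OF that] r_nonneg by auto
    show "simple_function ?M (\<lambda>s. if s \<le> t then S (r i s) (f i s) else 0)" for i
    proof (rule simple_function_If)
      show "simple_function ?M (\<lambda>s. S (r i s) (f i s))"
        unfolding r_def using k_simple f(1)
        by (rule simple_function_compose2[where h="\<lambda>j y. S (real j / real (Suc i)) y"])
      have "{s \<in> space ?M. s \<le> t} = (\<lambda>s. s) -` {..t} \<inter> space ?M" by auto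
      then show "{s \<in> space ?M. s \<le> t} \<in> sets ?M" using measurable_sets[OF id_meas, of "{..t}"] by simp
    qed simp
    fix s assume s: "s \<in> space ?M"
    show "(\<lambda>i. N (duhamel F t s - (if s \<le> t then S (r i s) (f i s) else 0))) \<longlonglongrightarrow> 0"
    proof (cases "s \<le> t")
      case True
      then have ts: "t - s \<ge> 0" by simp
      have "(\<lambda>i. N (S (t - s) (F s) - S (r i s) (f i s))) \<longlonglongrightarrow> 0"
      proof (rule Lim_null_comparison[OF always_eventually[OF allI]])
        fix i
        have C: "S (t - s) (F s) \<in> C" "S (r i s) (F s) \<in> C" "S (r i s) (f i s) \<in> C"
          using ts r_nonneg f(2,4)[OF s] by auto
        show "norm (N (S (t - s) (F s) - S (r i s) (f i s))) \<le> N (S (r i s) (F s) - S (t - s) (F s)) + N (F s - f i s)"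
          using N_diff_triangle[OF C] N_minus_commute[OF C(1,2)] S_diff_le[OF r_nonneg f(4)[OF s] f(2)[OF s], of i s i] C
          by auto
      next
        show "(\<lambda>i. N (S (r i s) (F s) - S (t - s) (F s)) + N (F s - f i s)) \<longlonglongrightarrow> 0"
          using tendsto_add[OF S_tendsto[OF f(4)[OF s] r_nonneg ts r_lim[OF True]] f(3)[OF s]] by simp
      qed
      then show ?thesis using True by (simp add: duhamel_def)
    qed (simp add: duhamel_def)
  qed
qed

lemma duhamel_le:
  assumes "F s \<in> C"
  shows "duhamel F t s \<in> C" "N (duhamel F t s) \<le> N (F s)"
  using S_contraction[of "t - s" "F s"] assms unfolding duhamel_def by auto

lemma duhamel_integrable:
  assumes F: "bochner_integrable_in C N (lebesgue_on {0..T}) F"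
  shows "bochner_integrable_in C N (lebesgue_on {0..T}) (duhamel F t)"
proof -
  have sm: "strongly_measurable_in C N (lebesgue_on {0..T}) F" and int: "integrable (lebesgue_on {0..T}) (\<lambda>s. N (F s))"
    using F unfolding bochner_integrable_in_def by auto
  note d = duhamel_measurable[OF sm, of t]
  have "integrable (lebesgue_on {0..T}) (\<lambda>s. N (duhamel F t s))"
  proof (rule Bochner_Integration.integrable_bound[OF int strongly_measurable_norm[OF d]])
    show "AE s in lebesgue_on {0..T}. norm (N (duhamel F t s)) \<le> norm (N (F s))"
      using duhamel_le strongly_measurable_in_C[OF sm] by (intro AE_I2) auto
  qed
  with d show ?thesis unfolding bochner_integrable_in_def by simp
qed

lemma finite_measure_lebesgue_on_interval: "finite_measure (lebesgue_on {a..b::real})"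
  by (rule finite_measure_lebesgue_on) simp

lemma restrict_lebesgue_on: "t \<le> T \<Longrightarrow> restrict_space (lebesgue_on {0..T}) {0..t} = lebesgue_on {0..t::real}"
  by (subst restrict_restrict_space) (auto simp: min_def)

lemma interval_sets: "t \<le> T \<Longrightarrow> {0..t} \<in> sets (lebesgue_on {0..T::real})"
  by (auto simp: sets_restrict_space_iff)

lemma duhamel_integral_exists:
  assumes F: "bochner_integrable_in C N (lebesgue_on {0..T}) F"
  obtains I where "has_bochner_integral_in C N (lebesgue_on {0..T}) (duhamel F t) I"
  using has_bochner_integral_in_exists[OF complete finite_measure_lebesgue_on_interval duhamel_integrable[OF F]]
  by blast

lemma duhamel_integral_restrict:
  assumes "has_bochner_integral_in C N (lebesgue_on {0..T}) (duhamel F t) I" "t \<le> T"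
  shows "has_bochner_integral_in C N (lebesgue_on {0..t}) (\<lambda>s. S (t - s) (F s)) I"
proof -
  have "has_bochner_integral_in C N (lebesgue_on {0..t}) (duhamel F t) I"
    using has_bochner_integral_in_restrict[OF assms(1) interval_sets[OF assms(2)] finite_measure_lebesgue_on_interval]
    by (auto simp: restrict_lebesgue_on[OF assms(2)] duhamel_def)
  then show ?thesis
    by (subst (asm) has_bochner_integral_in_cong[where g="\<lambda>s. S (t - s) (F s)"]) (auto simp: duhamel_def)
qed

text \<open>Replacing the integral over \<open>[0,t]\<close> by one over \<open>[0,T]\<close> makes solutions at different times
  comparable: their integrands live on the same measure space.\<close>

lemma mild_solution_duhamel:
  assumes F: "bochner_integrable_in C N (lebesgue_on {0..T}) F" and x0: "x0 \<in> C"
    and X: "mild_solution_in C N S T x0 F X" and t: "t \<in> {0..T}"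
  obtains I where "has_bochner_integral_in C N (lebesgue_on {0..T}) (duhamel F t) I" "X t \<in> C" "I \<in> C"
    "N (X t - (S t x0 + I)) = 0"
proof -
  obtain I' where I': "has_bochner_integral_in C N (lebesgue_on {0..t}) (\<lambda>s. S (t - s) (F s)) I'"
    "N (X t - (S t x0 + I')) = 0" and XC: "X t \<in> C"
    using X t unfolding mild_solution_in_def by blast
  obtain I where I: "has_bochner_integral_in C N (lebesgue_on {0..T}) (duhamel F t) I"
    using duhamel_integral_exists[OF F] .
  have "N (I' - I) = 0"
    using I'(1) duhamel_integral_restrict[OF I] t by (intro has_bochner_integral_in_unique) auto
  have C: "I \<in> C" "I' \<in> C" "S t x0 \<in> C"
    using I I'(1) x0 t unfolding has_bochner_integral_in_def by auto
  have "N (X t - (S t x0 + I)) \<le> N (X t - (S t x0 + I')) + N ((S t x0 + I') - (S t x0 + I))"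
    using C XC by (intro N_diff_triangle) auto
  also have "\<dots> = 0" using I'(2) \<open>N (I' - I) = 0\<close> by simp
  finally have "N (X t - (S t x0 + I)) = 0" using C XC by (intro order_antisym) auto
  then show ?thesis using that I C XC by blast
qed

theorem mild_solution_exists:
  assumes F: "bochner_integrable_in C N (lebesgue_on {0..T}) F" and x0: "x0 \<in> C"
  shows "\<exists>X. mild_solution_in C N S T x0 F X"
proof -
  have "\<exists>I. has_bochner_integral_in C N (lebesgue_on {0..T}) (duhamel F t) I" for t
    using duhamel_integral_exists[OF F] by blast
  then obtain I where I: "\<And>t. has_bochner_integral_in C N (lebesgue_on {0..T}) (duhamel F t) (I t)"
    by metis
  have "I t \<in> C" for t using I unfolding has_bochner_integral_in_def by blast
  moreover have "\<exists>J. has_bochner_integral_in C N (lebesgue_on {0..t}) (\<lambda>s. S (t - s) (F s)) J \<and>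
      N (S t x0 + I t - (S t x0 + J)) = 0" if "t \<in> {0..T}" for t
    using duhamel_integral_restrict[OF I, of t] that by (intro exI[of _ "I t"]) auto
  ultimately have "mild_solution_in C N S T x0 F (\<lambda>t. S t x0 + I t)"
    unfolding mild_solution_in_def using x0 by auto
  then show ?thesis by blast
qed

text \<open>The formula determines the solution, and integrals are unique up to null elements.\<close>

theorem mild_solution_unique:
  assumes F: "bochner_integrable_in C N (lebesgue_on {0..T}) F" and x0: "x0 \<in> C"
    and X: "mild_solution_in C N S T x0 F X" and Y: "mild_solution_in C N S T x0 F Y" and t: "t \<in> {0..T}"
  shows "N (X t - Y t) = 0"
proof -
  obtain I where I: "has_bochner_integral_in C N (lebesgue_on {0..T}) (duhamel F t) I" "X t \<in> C" "I \<in> C"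
    "N (X t - (S t x0 + I)) = 0" using mild_solution_duhamel[OF F x0 X t] .
  obtain I' where I': "has_bochner_integral_in C N (lebesgue_on {0..T}) (duhamel F t) I'" "Y t \<in> C" "I' \<in> C"
    "N (Y t - (S t x0 + I')) = 0" using mild_solution_duhamel[OF F x0 Y t] .
  have "N (I - I') = 0" using I(1) I'(1) by (rule has_bochner_integral_in_unique)
  have C: "S t x0 + I \<in> C" "S t x0 + I' \<in> C" using x0 t I I' by auto
  have "N (X t - Y t) \<le> N (X t - (S t x0 + I)) + (N ((S t x0 + I) - (S t x0 + I')) + N ((S t x0 + I') - Y t))"
    using N_diff_triangle[OF I(2) C(1) I'(2)] N_diff_triangle[OF C I'(2)] by linarith
  also have "\<dots> = 0" using I I' \<open>N (I - I') = 0\<close> N_minus_commute[OF C(2) I'(2)] by simp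
  finally show ?thesis using I I' by (intro order_antisym) auto
qed

text \<open>The difference of two solutions is governed by the semigroup applied to the differences of
  the data, and the semigroup is contractive.\<close>

theorem mild_solution_lipschitz:
  assumes F: "bochner_integrable_in C N (lebesgue_on {0..T}) F" and x0: "x0 \<in> C"
    and G: "bochner_integrable_in C N (lebesgue_on {0..T}) G" and y0: "y0 \<in> C"
    and X: "mild_solution_in C N S T x0 F X" and Y: "mild_solution_in C N S T y0 G Y" and t: "t \<in> {0..T}"
  shows "N (X t - Y t) \<le> N (x0 - y0) + (LINT s|lebesgue_on {0..t}. N (F s - G s))"
proof -
  obtain I where I: "has_bochner_integral_in C N (lebesgue_on {0..T}) (duhamel F t) I" "X t \<in> C" "I \<in> C"
    "N (X t - (S t x0 + I)) = 0" using mild_solution_duhamel[OF F x0 X t] .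
  obtain I' where I': "has_bochner_integral_in C N (lebesgue_on {0..T}) (duhamel G t) I'" "Y t \<in> C" "I' \<in> C"
    "N (Y t - (S t y0 + I')) = 0" using mild_solution_duhamel[OF G y0 Y t] .
  let ?M = "lebesgue_on {0..t}"
  have tT: "t \<le> T" "t \<ge> 0" using t by auto
  have FG: "bochner_integrable_in C N ?M (\<lambda>s. F s - G s)"
    using bochner_integrable_in_restrict[OF bochner_integrable_in_diff[OF F G] interval_sets[OF tT(1)]]
    by (simp add: restrict_lebesgue_on[OF tT(1)])
  have FC: "F s \<in> C" "G s \<in> C" if "s \<in> {0..t}" for s
    using F G that tT strongly_measurable_in_C[of "lebesgue_on {0..T}" _ s] unfolding bochner_integrable_in_def by auto
  have int: "has_bochner_integral_in C N ?M (\<lambda>s. S (t - s) (F s) - S (t - s) (G s)) (I - I')"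
    using duhamel_integral_restrict[OF I(1) tT(1)] duhamel_integral_restrict[OF I'(1) tT(1)]
    by (rule has_bochner_integral_in_diff)
  have le: "N (S (t - s) (F s) - S (t - s) (G s)) \<le> N (F s - G s)" if "s \<in> {0..t}" for s
    using that FC[OF that] by (intro S_diff_le) auto
  have intN: "integrable ?M (\<lambda>s. N (S (t - s) (F s) - S (t - s) (G s)))"
  proof (rule Bochner_Integration.integrable_bound)
    show "integrable ?M (\<lambda>s. N (F s - G s))" using FG unfolding bochner_integrable_in_def by simp
    show "(\<lambda>s. N (S (t - s) (F s) - S (t - s) (G s))) \<in> borel_measurable ?M"
      using int unfolding has_bochner_integral_in_def by (intro strongly_measurable_norm) auto
    show "AE s in ?M. norm (N (S (t - s) (F s) - S (t - s) (G s))) \<le> norm (N (F s - G s))"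
      using le FC by (intro AE_I2) auto
  qed
  have "N (I - I') \<le> (LINT s|?M. N (S (t - s) (F s) - S (t - s) (G s)))"
    using int intN by (rule has_bochner_integral_in_bound_real)
  also have "\<dots> \<le> (LINT s|?M. N (F s - G s))"
    using FG intN le unfolding bochner_integrable_in_def by (intro integral_mono) auto
  finally have *: "N (I - I') \<le> (LINT s|?M. N (F s - G s))" .
  have C: "S t x0 \<in> C" "S t y0 \<in> C" "S t x0 + I \<in> C" "S t y0 + I' \<in> C" using x0 y0 tT I I' by auto
  have "N (X t - Y t) \<le> N (X t - (S t x0 + I)) + (N ((S t x0 + I) - (S t y0 + I')) + N ((S t y0 + I') - Y t))"
    using N_diff_triangle[OF I(2) C(3) I'(2)] N_diff_triangle[OF C(3,4) I'(2)] by linarith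
  also have "\<dots> = N ((S t x0 - S t y0) + (I - I'))"
    using I I' N_minus_commute[OF C(4) I'(2)] by (simp add: algebra_simps)
  also have "\<dots> \<le> N (S t x0 - S t y0) + N (I - I')" using C I I' by (intro N_triangle) auto
  also have "N (S t x0 - S t y0) \<le> N (x0 - y0)" using tT x0 y0 by (intro S_diff_le) auto
  finally show ?thesis using * by simp
qed

text \<open>Comparison with the solution for zero data, which is null.\<close>

theorem mild_solution_bound:
  assumes F: "bochner_integrable_in C N (lebesgue_on {0..T}) F" and x0: "x0 \<in> C"
    and X: "mild_solution_in C N S T x0 F X" and t: "t \<in> {0..T}"
  shows "N (X t) \<le> N x0 + (LINT s|lebesgue_on {0..t}. N (F s))"
proof -
  have zero: "bochner_integrable_in C N (lebesgue_on {0..T}) (\<lambda>_. 0)"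
    unfolding bochner_integrable_in_def by (auto intro: strongly_measurable_const)
  obtain Y where Y: "mild_solution_in C N S T 0 (\<lambda>_. 0) Y"
    using mild_solution_exists[OF zero zero_in] by blast
  have null: "N (S s 0) = 0" if "s \<ge> 0" for s
    using S_contraction[OF that zero_in] S_in[OF that zero_in] by (intro order_antisym) auto
  obtain I where I: "has_bochner_integral_in C N (lebesgue_on {0..T}) (duhamel (\<lambda>_. 0) t) I" "Y t \<in> C" "I \<in> C"
    "N (Y t - (S t 0 + I)) = 0" using mild_solution_duhamel[OF zero zero_in Y t] .
  have "ennreal (N I) \<le> (\<integral>\<^sup>+s. ennreal (N (duhamel (\<lambda>_. 0) t s)) \<partial>lebesgue_on {0..T})"
    by (rule has_bochner_integral_in_bound[OF I(1)])
  also have "\<dots> = (\<integral>\<^sup>+s. 0 \<partial>lebesgue_on {0..T})"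
    by (intro nn_integral_cong) (auto simp: duhamel_def null)
  finally have NI: "N I \<le> 0" by (simp add: ennreal_eq_0_iff)
  have SC: "S t 0 \<in> C" using t by simp
  have "N (Y t) = N (S t 0 + I)" using N_cong[OF I(2) add_in[OF SC I(3)] I(4)] .
  also have "\<dots> \<le> 0" using N_triangle[OF SC I(3)] null[of t] NI t by simp
  finally have NY: "N (Y t) \<le> 0" .
  have XC: "X t \<in> C" using X t unfolding mild_solution_in_def by blast
  have "N (X t) \<le> N (X t - Y t) + N (Y t)" using N_triangle[of "X t - Y t" "Y t"] XC I(2) by simp
  also have "N (X t - Y t) \<le> N (x0 - 0) + (LINT s|lebesgue_on {0..t}. N (F s - 0))"
    by (rule mild_solution_lipschitz[OF F x0 zero zero_in X Y t])
  finally show ?thesis using NY by simp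
qed

text \<open>As \<open>t'\<close> tends to \<open>t\<close>, the integrands \<open>duhamel F t'\<close> converge at every time other than \<open>t\<close>,
  dominated by \<open>2 N (F s)\<close>.\<close>

theorem mild_solution_continuous:
  assumes F: "bochner_integrable_in C N (lebesgue_on {0..T}) F" and x0: "x0 \<in> C"
    and X: "mild_solution_in C N S T x0 F X"
  shows "continuous_curve_in C N T X"
  unfolding continuous_curve_in_def
proof (intro ballI conjI)
  fix t assume t: "t \<in> {0..T}"
  let ?M = "lebesgue_on {0..T}"
  have sm: "strongly_measurable_in C N ?M F" and Fint: "integrable ?M (\<lambda>s. N (F s))"
    using F unfolding bochner_integrable_in_def by auto
  have FC: "F s \<in> C" if "s \<in> {0..T}" for s using strongly_measurable_in_C[OF sm, of s] that by simp
  have XC: "X s \<in> C" if "s \<in> {0..T}" for s using X that unfolding mild_solution_in_def by blast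
  show "X t \<in> C" using XC[OF t] .
  obtain I where I: "has_bochner_integral_in C N ?M (duhamel F t) I" "X t \<in> C" "I \<in> C"
    "N (X t - (S t x0 + I)) = 0" using mild_solution_duhamel[OF F x0 X t] .
  define \<Delta> where "\<Delta> = (\<lambda>t' s. N (duhamel F t' s - duhamel F t s))"
  have \<Delta>_sm: "strongly_measurable_in C N ?M (\<lambda>s. duhamel F t' s - duhamel F t s)" for t'
    using sm by (intro strongly_measurable_diff duhamel_measurable)
  have \<Delta>_le: "\<bar>\<Delta> t' s\<bar> \<le> 2 * N (F s)" if "s \<in> {0..T}" for t' s
  proof -
    note d = duhamel_le[where F=F and s=s, OF FC[OF that]]
    show ?thesis
      using N_diff_le[OF d(1)[of t'] d(1)[of t]] N_nonneg[OF diff_in[OF d(1)[of t'] d(1)[of t]]] d(2)[of t] d(2)[of t']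
      unfolding \<Delta>_def by linarith
  qed
  have le: "N (X t' - X t) \<le> N (S t' x0 - S t x0) + (LINT s|?M. \<Delta> t' s)" if t': "t' \<in> {0..T}" for t'
  proof -
    obtain I' where I': "has_bochner_integral_in C N ?M (duhamel F t') I'" "X t' \<in> C" "I' \<in> C"
      "N (X t' - (S t' x0 + I')) = 0" using mild_solution_duhamel[OF F x0 X t'] .
    have "integrable ?M (\<lambda>s. \<Delta> t' s)"
    proof (rule Bochner_Integration.integrable_bound)
      show "integrable ?M (\<lambda>s. 2 * N (F s))" using Fint by simp
      show "(\<lambda>s. \<Delta> t' s) \<in> borel_measurable ?M" unfolding \<Delta>_def by (rule strongly_measurable_norm[OF \<Delta>_sm])
      show "AE s in ?M. norm (\<Delta> t' s) \<le> norm (2 * N (F s))" using \<Delta>_le FC by (intro AE_I2) auto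
    qed
    then have *: "N (I' - I) \<le> (LINT s|?M. \<Delta> t' s)"
      using has_bochner_integral_in_bound_real[OF has_bochner_integral_in_diff[OF I'(1) I(1)]] unfolding \<Delta>_def by blast
    have C: "S t x0 \<in> C" "S t' x0 \<in> C" "S t x0 + I \<in> C" "S t' x0 + I' \<in> C" using x0 t t' I I' by auto
    have "N (X t' - X t) \<le> N (X t' - (S t' x0 + I')) + (N ((S t' x0 + I') - (S t x0 + I)) + N ((S t x0 + I) - X t))"
      using N_diff_triangle[OF I'(2) C(4) I(2)] N_diff_triangle[OF C(4,3) I(2)] by linarith
    also have "\<dots> = N ((S t' x0 - S t x0) + (I' - I))"
      using I I' N_minus_commute[OF C(3) I(2)] by (simp add: algebra_simps)
    also have "\<dots> \<le> N (S t' x0 - S t x0) + N (I' - I)" using C I I' by (intro N_triangle) auto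
    finally show ?thesis using * by simp
  qed
  show "((\<lambda>s. N (X s - X t)) \<longlongrightarrow> 0) (at t within {0..T})"
    unfolding tendsto_at_iff_sequentially
  proof (intro allI impI)
    fix \<tau> :: "nat \<Rightarrow> real" assume \<tau>: "\<forall>i. \<tau> i \<in> {0..T} - {t}" "\<tau> \<longlonglongrightarrow> t"
    have \<tau>T: "\<tau> i \<in> {0..T}" "0 \<le> \<tau> i" for i using \<tau>(1) by auto
    have "(\<lambda>i. LINT s|?M. \<Delta> (\<tau> i) s) \<longlonglongrightarrow> (LINT s|?M. 0)"
    proof (rule integral_dominated_convergence[where w="\<lambda>s. 2 * N (F s)"])
      show "\<Delta> (\<tau> i) \<in> borel_measurable ?M" for i unfolding \<Delta>_def by (rule strongly_measurable_norm[OF \<Delta>_sm])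
      show "integrable ?M (\<lambda>s. 2 * N (F s))" using Fint by simp
      show "AE s in ?M. norm (\<Delta> (\<tau> i) s) \<le> 2 * N (F s)" for i using \<Delta>_le by (intro AE_I2) auto
      have "AE s in lebesgue. s \<noteq> t" using AE_lborel_singleton by (rule AE_completion)
      then have "AE s in ?M. s \<noteq> t" by (subst AE_restrict_space_iff) auto
      then show "AE s in ?M. (\<lambda>i. \<Delta> (\<tau> i) s) \<longlonglongrightarrow> 0"
        using AE_space
      proof eventually_elim
        case (elim s)
        have s: "s \<in> {0..T}" using elim(2) by simp
        consider "s < t" | "t < s" using elim(1) by linarith
        then show ?case
        proof cases
          case 1
          have "(\<lambda>i. max 0 (\<tau> i - s)) \<longlonglongrightarrow> max 0 (t - s)" by (intro tendsto_intros \<tau>(2))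
          then have "(\<lambda>i. max 0 (\<tau> i - s)) \<longlonglongrightarrow> t - s" using 1 by simp
          from S_tendsto[OF FC[OF s] _ _ this] 1
          have "(\<lambda>i. N (S (max 0 (\<tau> i - s)) (F s) - S (t - s) (F s))) \<longlonglongrightarrow> 0" by simp
          then show ?thesis
          proof (rule Lim_transform_eventually)
            show "\<forall>\<^sub>F i in sequentially. N (S (max 0 (\<tau> i - s)) (F s) - S (t - s) (F s)) = \<Delta> (\<tau> i) s"
              using order_tendstoD(1)[OF \<tau>(2) 1]
              by eventually_elim (use 1 in \<open>auto simp: \<Delta>_def duhamel_def max_def\<close>)
          qed
        next
          case 2
          show ?thesis
          proof (rule Lim_transform_eventually[OF tendsto_const])
            show "\<forall>\<^sub>F i in sequentially. 0 = \<Delta> (\<tau> i) s"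
              using order_tendstoD(2)[OF \<tau>(2) 2]
              by eventually_elim (use 2 in \<open>auto simp: \<Delta>_def duhamel_def\<close>)
          qed
        qed
      qed
    qed simp
    moreover have "(\<lambda>i. N (S (\<tau> i) x0 - S t x0)) \<longlonglongrightarrow> 0"
      using t by (intro S_tendsto[OF x0 \<tau>T(2) _ \<tau>(2)]) auto
    ultimately have lim: "(\<lambda>i. N (S (\<tau> i) x0 - S t x0) + (LINT s|?M. \<Delta> (\<tau> i) s)) \<longlonglongrightarrow> 0"
      using tendsto_add by fastforce
    have "norm (N (X (\<tau> i) - X t)) \<le> N (S (\<tau> i) x0 - S t x0) + (LINT s|?M. \<Delta> (\<tau> i) s)" for i
      using le[OF \<tau>T(1)] N_nonneg[OF diff_in[OF XC[OF \<tau>T(1)] XC[OF t]]] by simp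
    then show "((\<lambda>s. N (X s - X t)) \<circ> \<tau>) \<longlonglongrightarrow> 0"
      unfolding o_def by (rule Lim_null_comparison[OF always_eventually[OF allI] lim])
  qed
qed

end


section \<open>The extended memory state space\<close>

locale memory_problem = bounded_open \<Omega> for \<Omega> :: "(real^'n) set" +
  fixes A0 A1 :: "real^'n \<Rightarrow> real^'n^'n" and \<nu> :: "real measure" and \<beta> :: real
  assumes A0: "Linfty_matrix \<Omega> A0" "AE x in lebesgue_on \<Omega>. transpose (A0 x) = A0 x"
    and A1: "Linfty_matrix \<Omega> A1" "AE x in lebesgue_on \<Omega>. transpose (A1 x) = A1 x"
    and nu: "sets \<nu> = sets (restrict_space borel {0..})"
      "0 < emeasure \<nu> (space \<nu>)" "emeasure \<nu> (space \<nu>) < \<infinity>"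
    and a0_bounded: "\<exists>c. \<forall>w\<in>H10 \<Omega>. \<forall>v\<in>H10 \<Omega>. \<bar>aform \<Omega> A0 w v\<bar> \<le> c * norm_H1 \<Omega> w * norm_H1 \<Omega> v"
    and a1_bounded: "\<exists>c. \<forall>w\<in>H10 \<Omega>. \<forall>v\<in>H10 \<Omega>. \<bar>aform \<Omega> A1 w v\<bar> \<le> c * norm_H1 \<Omega> w * norm_H1 \<Omega> v"
    and a0_nonneg: "\<forall>v\<in>H10 \<Omega>. 0 \<le> aform \<Omega> A0 v v"
    and a1_coercive: "\<beta> > 0" "\<forall>v\<in>H10 \<Omega>. \<beta> * (seminorm_H1 \<Omega> v)\<^sup>2 \<le> aform \<Omega> A1 v v"
begin

abbreviation "a0 \<equiv> aform \<Omega> A0"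
abbreviation "a1 \<equiv> aform \<Omega> A1"
abbreviation "V \<equiv> H10 \<Omega>"
abbreviation "K \<equiv> K_space \<Omega> A1 \<nu>"
abbreviation "W \<equiv> W_space \<Omega> A1 \<nu>"
abbreviation "ipK \<equiv> (\<lambda>\<zeta> \<xi>. LINT l|\<nu>. a1 (\<zeta> l) (\<xi> l))"

sublocale a0: semi_inner_space V a0
  using A0 a0_nonneg by (intro semi_inner_space_aform) auto

sublocale a1: semi_inner_space V a1
proof (rule semi_inner_space_aform[OF A1])
  fix v assume "v \<in> V"
  then have "\<beta> * (seminorm_H1 \<Omega> v)\<^sup>2 \<le> a1 v v" using a1_coercive(2) by blast
  moreover have "0 \<le> \<beta> * (seminorm_H1 \<Omega> v)\<^sup>2" using a1_coercive(1) by simp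
  ultimately show "0 \<le> a1 v v" by linarith
qed

lemma space_nu: "space \<nu> = {0..}"
  using sets_eq_imp_space_eq[OF nu(1)] by (simp add: space_restrict_space)

sublocale nu: finite_measure \<nu>
  by standard (use nu(3) in auto)

lemma measurable_nu: "f \<in> borel_measurable borel \<Longrightarrow> f \<in> borel_measurable \<nu>"
  using measurable_cong_sets[OF nu(1) refl] measurable_restrict_space1 by blast

text \<open>On \<open>V\<close> the energy norm of \<open>a1\<close> is equivalent to the Sobolev norm, by coercivity and the
  Poincare inequality.\<close>

lemma H1_le_a1:
  obtains c where "c \<ge> 0" "\<And>v. v \<in> V \<Longrightarrow> norm_H1 \<Omega> v \<le> c * a1.Nip v"
proof -
  obtain P where P: "P \<ge> 0" "\<And>u. u \<in> V \<Longrightarrow> norm_L2 \<Omega> u \<le> P * seminorm_H1 \<Omega> u"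
    using Poincare by blast
  have "norm_H1 \<Omega> v \<le> ((P + 1) / sqrt \<beta>) * a1.Nip v" if v: "v \<in> V" for v
  proof -
    have "sqrt (\<beta> * (seminorm_H1 \<Omega> v)\<^sup>2) \<le> a1.Nip v"
      unfolding ip_norm_def using a1_coercive(2) v by (intro real_sqrt_le_mono) auto
    then have "sqrt \<beta> * seminorm_H1 \<Omega> v \<le> a1.Nip v"
      using seminorm_H1_nonneg[of v] by (simp add: real_sqrt_mult)
    then have "seminorm_H1 \<Omega> v \<le> a1.Nip v / sqrt \<beta>" using a1_coercive(1) by (simp add: field_simps)
    moreover have "norm_H1 \<Omega> v \<le> (P + 1) * seminorm_H1 \<Omega> v"
      using norm_H1_le[of v] P(2)[OF v] by (simp add: distrib_right)
    ultimately show ?thesis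
      using mult_left_mono[of "seminorm_H1 \<Omega> v" "a1.Nip v / sqrt \<beta>" "P + 1"] P(1) by simp
  qed
  moreover have "(P + 1) / sqrt \<beta> \<ge> 0" using P a1_coercive(1) by simp
  ultimately show ?thesis using that by blast
qed

lemma a1_le_H1:
  obtains d where "d \<ge> 0" "\<And>v. v \<in> V \<Longrightarrow> a1.Nip v \<le> d * norm_H1 \<Omega> v"
proof -
  obtain c where c: "\<And>v. v \<in> V \<Longrightarrow> \<bar>a1 v v\<bar> \<le> c * norm_H1 \<Omega> v * norm_H1 \<Omega> v"
    using a1_bounded by blast
  have "a1.Nip v \<le> sqrt \<bar>c\<bar> * norm_H1 \<Omega> v" if v: "v \<in> V" for v
  proof -
    have nn: "0 \<le> norm_H1 \<Omega> v" using v by simp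
    have "a1 v v \<le> \<bar>c\<bar> * (norm_H1 \<Omega> v)\<^sup>2"
      using c[OF v] mult_right_mono[OF abs_ge_self[of c], of "(norm_H1 \<Omega> v)\<^sup>2"]
      by (simp add: power2_eq_square mult.assoc)
    from real_sqrt_le_mono[OF this] show ?thesis using nn by (simp add: ip_norm_def real_sqrt_mult)
  qed
  then show ?thesis using that[of "sqrt \<bar>c\<bar>"] by simp
qed

lemma complete_in_a1: "complete_in V a1.Nip"
proof -
  obtain c where c: "\<And>v. v \<in> V \<Longrightarrow> norm_H1 \<Omega> v \<le> c * a1.Nip v" using H1_le_a1 by blast
  obtain d where d: "\<And>v. v \<in> V \<Longrightarrow> a1.Nip v \<le> d * norm_H1 \<Omega> v" using a1_le_H1 by blast
  show ?thesis
    using complete_in_H10 subspace_H10 c d a1.N_nonneg by (rule complete_in_equivalent)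
qed

text \<open>Measurability in \<open>\<K>\<close> refers to the Sobolev norm, integrability to the energy norm; with
  this equivalence \<open>\<K>\<close> is the space of square integrable functions for the energy inner product.\<close>

lemma strongly_measurable_a1_iff:
  "strongly_measurable_in V (norm_H1 \<Omega>) M \<zeta> \<longleftrightarrow> strongly_measurable_in V a1.Nip M \<zeta>"
proof
  obtain d where d: "\<And>v. v \<in> V \<Longrightarrow> a1.Nip v \<le> d * norm_H1 \<Omega> v" using a1_le_H1 by blast
  assume "strongly_measurable_in V (norm_H1 \<Omega>) M \<zeta>"
  then show "strongly_measurable_in V a1.Nip M \<zeta>"
    by (rule H10.strongly_measurable_compose[where L="\<lambda>x. x" and c=d]) (use d in auto)
next
  obtain c where c: "\<And>v. v \<in> V \<Longrightarrow> norm_H1 \<Omega> v \<le> c * a1.Nip v" using H1_le_a1 by blast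
  assume "strongly_measurable_in V a1.Nip M \<zeta>"
  then show "strongly_measurable_in V (norm_H1 \<Omega>) M \<zeta>"
    by (rule a1.strongly_measurable_compose[where L="\<lambda>x. x" and c=c]) (use c in auto)
qed

lemma K_eq: "K = a1.Lsq \<nu>"
proof -
  have "integrable \<nu> (\<lambda>l. a1 (\<zeta> l) (\<zeta> l)) \<longleftrightarrow> integrable \<nu> (\<lambda>l. (a1.Nip (\<zeta> l))\<^sup>2)"
    if "strongly_measurable_in V a1.Nip \<nu> \<zeta>" for \<zeta>
    using a1.strongly_measurable_in_C[OF that]
    by (intro Bochner_Integration.integrable_cong refl) (simp add: a1.Nip_sq)
  then show ?thesis unfolding K_space_def square_integrable_in_def strongly_measurable_a1_iff by blast
qed

sublocale K: semi_inner_space K ipK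
  unfolding K_eq by (rule a1.semi_inner_space_Lsq)

lemma complete_in_K: "complete_in K (ip_norm ipK)"
  unfolding K_eq by (rule a1.complete_in_Lsq[OF complete_in_a1])

lemma ip_W_eq: "ip_W \<Omega> A1 \<nu> = (\<lambda>X Y. ip_L2 \<Omega> (fst X) (fst Y) + ipK (snd X) (snd Y))"
  by (auto simp: ip_W_def fun_eq_iff)

lemma norm_W_eq: "norm_W \<Omega> A1 \<nu> = ip_norm (ip_W \<Omega> A1 \<nu>)"
  by (auto simp: norm_W_def ip_norm_def fun_eq_iff)

sublocale W: semi_inner_space W "ip_W \<Omega> A1 \<nu>"
  rewrites "ip_norm (ip_W \<Omega> A1 \<nu>) = norm_W \<Omega> A1 \<nu>"
  unfolding W_space_def ip_W_eq
  by (rule semi_inner_space_Times[OF semi_inner_space_L2 K.semi_inner_space_axioms])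
     (simp add: norm_W_eq ip_W_eq)

lemma complete_in_W: "complete_in W (norm_W \<Omega> A1 \<nu>)"
  unfolding W_space_def norm_W_eq ip_W_eq
  using complete_in_L2 complete_in_K
  by (intro complete_in_Times semi_inner_space_L2 K.semi_inner_space_axioms) (auto simp: norm_L2_eq)

lemma W_iff: "(u, \<zeta>) \<in> W \<longleftrightarrow> u \<in> L2 \<Omega> \<and> \<zeta> \<in> K"
  by (simp add: W_space_def)

lemma norm_W_null_iff:
  assumes "(u, \<zeta>) \<in> W"
  shows "norm_W \<Omega> A1 \<nu> (u, \<zeta>) = 0 \<longleftrightarrow> norm_L2 \<Omega> u = 0 \<and> ip_norm ipK \<zeta> = 0"
proof -
  have "0 \<le> ip_L2 \<Omega> u u" "0 \<le> ipK \<zeta> \<zeta>" using assms L2.ip_nonneg K.ip_nonneg by (auto simp: W_iff)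
  then show ?thesis by (auto simp: norm_W_def ip_W_def norm_L2_def ip_norm_def)
qed

lemma norm_W_Pair_zero: "norm_W \<Omega> A1 \<nu> (u, 0) = norm_L2 \<Omega> u"
  using K.ip_zero_left[OF K.zero_in] by (simp add: norm_W_def ip_W_def norm_L2_def)

lemma K_cong: "(\<And>l. l \<ge> 0 \<Longrightarrow> \<zeta> l = \<xi> l) \<Longrightarrow> \<zeta> \<in> K \<longleftrightarrow> \<xi> \<in> K"
proof -
  assume eq: "\<And>l. l \<ge> 0 \<Longrightarrow> \<zeta> l = \<xi> l"
  have "strongly_measurable_in V (norm_H1 \<Omega>) \<nu> \<zeta> \<longleftrightarrow> strongly_measurable_in V (norm_H1 \<Omega>) \<nu> \<xi>"
    by (rule H10.strongly_measurable_cong) (simp add: eq space_nu)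
  moreover have "integrable \<nu> (\<lambda>l. a1 (\<zeta> l) (\<zeta> l)) \<longleftrightarrow> integrable \<nu> (\<lambda>l. a1 (\<xi> l) (\<xi> l))"
    by (intro Bochner_Integration.integrable_cong refl) (simp add: eq space_nu)
  ultimately show ?thesis by (simp add: K_space_def)
qed

lemma K_in_V: "\<zeta> \<in> K \<Longrightarrow> l \<ge> 0 \<Longrightarrow> \<zeta> l \<in> V"
  using a1.LsqD(3)[of \<zeta> \<nu> l] by (simp add: K_eq space_nu)

lemma E_in_K: "v \<in> V \<Longrightarrow> E_op v \<in> K"
  unfolding K_space_def E_op_def by (auto intro: H10.strongly_measurable_const)

lemma ipK_E: "ipK (E_op u) (E_op v) = measure \<nu> (space \<nu>) * a1 u v"
  by (simp add: E_op_def)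

text \<open>The operator \<open>J\<close> enters only through the form \<open>a1\<close>, where it is the adjoint of \<open>E\<close>.\<close>

lemma J_adjoint_E:
  assumes \<zeta>: "\<zeta> \<in> K" and v: "v \<in> V"
  shows "a1 (J_op \<Omega> \<nu> \<zeta>) v = ipK \<zeta> (E_op v)"
proof -
  have sm: "strongly_measurable_in V (norm_H1 \<Omega>) \<nu> \<zeta>" using \<zeta> unfolding K_space_def by blast
  obtain c where c: "c \<ge> 0" "\<And>v. v \<in> V \<Longrightarrow> norm_H1 \<Omega> v \<le> c * a1.Nip v" using H1_le_a1 by blast
  have "integrable \<nu> (\<lambda>l. norm_H1 \<Omega> (\<zeta> l))"
  proof (rule Bochner_Integration.integrable_bound)
    show "integrable \<nu> (\<lambda>l. c * (1 + (a1.Nip (\<zeta> l))\<^sup>2))"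
      using a1.LsqD(2)[of \<zeta> \<nu>] \<zeta> by (simp add: K_eq)
    show "(\<lambda>l. norm_H1 \<Omega> (\<zeta> l)) \<in> borel_measurable \<nu>" using sm by (rule H10.strongly_measurable_norm)
    have "norm (norm_H1 \<Omega> (\<zeta> l)) \<le> norm (c * (1 + (a1.Nip (\<zeta> l))\<^sup>2))" if "l \<in> space \<nu>" for l
    proof -
      have V: "\<zeta> l \<in> V" using K_in_V[OF \<zeta>] that by (simp add: space_nu)
      have "a1.Nip (\<zeta> l) \<le> 1 + (a1.Nip (\<zeta> l))\<^sup>2"
        using zero_le_power2[of "a1.Nip (\<zeta> l) - 1"] a1.N_nonneg[OF V] unfolding power2_diff by simp
      then have "c * a1.Nip (\<zeta> l) \<le> c * (1 + (a1.Nip (\<zeta> l))\<^sup>2)" using c(1) by (rule mult_left_mono)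
      then show ?thesis using c(2)[OF V] H10.N_nonneg[OF V] by simp
    qed
    then show "AE l in \<nu>. norm (norm_H1 \<Omega> (\<zeta> l)) \<le> norm (c * (1 + (a1.Nip (\<zeta> l))\<^sup>2))" by (rule AE_I2)
  qed
  then have "bochner_integrable_in V (norm_H1 \<Omega>) \<nu> \<zeta>" using sm unfolding bochner_integrable_in_def by blast
  then have "\<exists>I. has_bochner_integral_in V (norm_H1 \<Omega>) \<nu> \<zeta> I"
    using H10.has_bochner_integral_in_exists[OF complete_in_H10 nu.finite_measure_axioms] by blast
  then have J: "has_bochner_integral_in V (norm_H1 \<Omega>) \<nu> \<zeta> (J_op \<Omega> \<nu> \<zeta>)"
    unfolding J_op_def bochner_integral_in_def by (rule someI_ex)
  obtain d where d: "\<And>w v. w \<in> V \<Longrightarrow> v \<in> V \<Longrightarrow> \<bar>a1 w v\<bar> \<le> d * norm_H1 \<Omega> w * norm_H1 \<Omega> v"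
    using a1_bounded by blast
  have "has_bochner_integral \<nu> (\<lambda>l. a1 (\<zeta> l) v) (a1 (J_op \<Omega> \<nu> \<zeta>) v)"
  proof (rule H10.has_bochner_integral_in_functional[where l="\<lambda>x. a1 x v", OF J])
    show "\<bar>a1 x v\<bar> \<le> (d * norm_H1 \<Omega> v) * norm_H1 \<Omega> x" if "x \<in> V" for x
      using d[OF that v] by (simp add: mult_ac)
  qed (use v in \<open>auto simp: a1.ip_add_left a1.ip_scale_left\<close>)
  then show ?thesis unfolding E_op_def by (simp add: has_bochner_integral_integral_eq)
qed

section \<open>The augmented operator\<close>

abbreviation "DA \<equiv> aug_domain \<Omega> A0 A1 \<nu>"
abbreviation "AA \<equiv> aug_op \<Omega> A0 A1 \<nu>"

text \<open>The functional \<open>\<A>\<^sub>0 u + \<A>\<^sub>1 J \<zeta>\<close> on \<open>V\<close>.\<close>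

definition stress :: "(real^'n \<Rightarrow> real) \<Rightarrow> (real \<Rightarrow> real^'n \<Rightarrow> real) \<Rightarrow> (real^'n \<Rightarrow> real) \<Rightarrow> real"
  where "stress u \<zeta> v = a0 u v + ipK \<zeta> (E_op v)"

lemma stress_add:
  "\<lbrakk>u \<in> V; u' \<in> V; \<zeta> \<in> K; \<zeta>' \<in> K; v \<in> V\<rbrakk> \<Longrightarrow> stress (u + u') (\<zeta> + \<zeta>') v = stress u \<zeta> v + stress u' \<zeta>' v"
  unfolding stress_def by (subst K.ip_add_left) (auto simp: a0.ip_add_left E_in_K)

lemma stress_scale:
  "\<lbrakk>u \<in> V; \<zeta> \<in> K; v \<in> V\<rbrakk> \<Longrightarrow> stress (c *\<^sub>R u) (c *\<^sub>R \<zeta>) v = c * stress u \<zeta> v"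
  unfolding stress_def by (subst K.ip_scale_left) (auto simp: a0.ip_scale_left E_in_K distrib_left)

lemma dual_stress:
  assumes "\<zeta> \<in> K" "v \<in> V"
  shows "(dual_op \<Omega> A0 u + dual_op \<Omega> A1 (J_op \<Omega> \<nu> \<zeta>)) v = stress u \<zeta> v"
    "(- dual_op \<Omega> A0 u - dual_op \<Omega> A1 (J_op \<Omega> \<nu> \<zeta>)) v = - stress u \<zeta> v"
  using J_adjoint_E[OF assms] by (auto simp: dual_op_def stress_def)

lemma DA_iff: "(u, \<zeta>) \<in> DA \<longleftrightarrow> u \<in> V \<and> \<zeta> \<in> K \<and>
    (\<exists>h\<in>L2 \<Omega>. \<forall>v\<in>V. stress u \<zeta> v = ip_L2 \<Omega> h v) \<and> E_op u - Lambda_op \<zeta> \<in> K"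
  unfolding aug_domain_def in_H_def represents_def using dual_stress(1) by auto

lemma DA_I:
  "\<lbrakk>u \<in> V; \<zeta> \<in> K; h \<in> L2 \<Omega>; \<And>v. v \<in> V \<Longrightarrow> stress u \<zeta> v = ip_L2 \<Omega> h v; E_op u - Lambda_op \<zeta> \<in> K\<rbrakk>
    \<Longrightarrow> (u, \<zeta>) \<in> DA"
  unfolding DA_iff by blast

text \<open>The first component of \<open>\<A>(u, \<zeta>)\<close> is an arbitrarily chosen representative; only its inner products
  with elements of \<open>V\<close> are known, and they determine its class.\<close>

lemma AA_spec:
  assumes "(u, \<zeta>) \<in> DA"
  obtains h where "AA (u, \<zeta>) = (h, E_op u - Lambda_op \<zeta>)" "h \<in> L2 \<Omega>"
    "\<And>v. v \<in> V \<Longrightarrow> ip_L2 \<Omega> h v = - stress u \<zeta> v"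
proof -
  have \<zeta>: "\<zeta> \<in> K" using assms by (simp add: DA_iff)
  let ?l = "- dual_op \<Omega> A0 u - dual_op \<Omega> A1 (J_op \<Omega> \<nu> \<zeta>)"
  have "\<exists>h\<in>L2 \<Omega>. \<forall>v\<in>V. stress u \<zeta> v = ip_L2 \<Omega> h v" using assms by (simp add: DA_iff)
  then obtain h where h: "h \<in> L2 \<Omega>" "\<And>v. v \<in> V \<Longrightarrow> stress u \<zeta> v = ip_L2 \<Omega> h v" by blast
  have "represents \<Omega> (- h) ?l"
    unfolding represents_def
  proof (intro conjI ballI)
    show "- h \<in> L2 \<Omega>" using h(1) by simp
    fix v assume v: "v \<in> V"
    have "ip_L2 \<Omega> (- h) v = - ip_L2 \<Omega> h v" using L2.ip_scale_left[OF h(1) H10_L2[OF v], of "-1"] by simp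
    then show "?l v = ip_L2 \<Omega> (- h) v" using dual_stress(2)[OF \<zeta> v] h(2)[OF v] by simp
  qed
  then have "represents \<Omega> (H_rep \<Omega> ?l) ?l" unfolding H_rep_def by (rule someI[where P="\<lambda>h. represents \<Omega> h ?l"])
  then have "H_rep \<Omega> ?l \<in> L2 \<Omega>" "\<And>v. v \<in> V \<Longrightarrow> ip_L2 \<Omega> (H_rep \<Omega> ?l) v = - stress u \<zeta> v"
    using dual_stress(2)[OF \<zeta>] unfolding represents_def by auto
  then show ?thesis using that[of "H_rep \<Omega> ?l"] by (simp add: aug_op_def)
qed

lemma DA_W: "X \<in> DA \<Longrightarrow> X \<in> W"
  by (cases X) (auto simp: DA_iff W_iff H10_L2)

lemma AA_W: "X \<in> DA \<Longrightarrow> AA X \<in> W"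
  by (cases X) (metis AA_spec DA_iff W_iff)

lemma L2_orthogonal_V:
  "h \<in> L2 \<Omega> \<Longrightarrow> (\<And>v. v \<in> V \<Longrightarrow> ip_L2 \<Omega> h v = 0) \<Longrightarrow> norm_L2 \<Omega> h = 0"
  using L2_orthogonal_test_functions test_function_H10 by blast

lemma subspace_DA: "subspace DA"
  unfolding subspace_def
proof (intro conjI ballI allI)
  have "E_op 0 - Lambda_op 0 = (0 :: real \<Rightarrow> real^'n \<Rightarrow> real)"
    by (auto simp: E_op_def Lambda_op_def fun_eq_iff scaleR_fun_def)
  moreover have "stress 0 0 v = ip_L2 \<Omega> 0 v" if "v \<in> V" for v
    using stress_scale[OF H10.zero_in K.zero_in that, of 0] L2.ip_zero_left[OF H10_L2[OF that]] by simp
  ultimately have "(0, 0) \<in> DA" by (intro DA_I[of _ _ 0]) auto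
  then show "0 \<in> DA" by (simp add: zero_prod_def)
next
  fix X Y assume X: "X \<in> DA" and Y: "Y \<in> DA"
  obtain u \<zeta> where Xe: "X = (u, \<zeta>)" by (cases X)
  obtain u' \<zeta>' where Ye: "Y = (u', \<zeta>')" by (cases Y)
  obtain h where h: "u \<in> V" "\<zeta> \<in> K" "h \<in> L2 \<Omega>" "\<And>v. v \<in> V \<Longrightarrow> stress u \<zeta> v = ip_L2 \<Omega> h v" "E_op u - Lambda_op \<zeta> \<in> K"
    using X unfolding Xe DA_iff by blast
  obtain h' where h': "u' \<in> V" "\<zeta>' \<in> K" "h' \<in> L2 \<Omega>" "\<And>v. v \<in> V \<Longrightarrow> stress u' \<zeta>' v = ip_L2 \<Omega> h' v" "E_op u' - Lambda_op \<zeta>' \<in> K"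
    using Y unfolding Ye DA_iff by blast
  have "E_op (u + u') - Lambda_op (\<zeta> + \<zeta>') = (E_op u - Lambda_op \<zeta>) + (E_op u' - Lambda_op \<zeta>')"
    by (auto simp: E_op_def Lambda_op_def fun_eq_iff scaleR_fun_def algebra_simps)
  then have "(u + u', \<zeta> + \<zeta>') \<in> DA"
    using h h' K.add_in[OF h(5) h'(5)]
    by (intro DA_I[of _ _ "h + h'"]) (auto simp: stress_add L2.ip_add_left H10_L2)
  then show "X + Y \<in> DA" unfolding Xe Ye by simp
next
  fix X and c :: real assume X: "X \<in> DA"
  obtain u \<zeta> where Xe: "X = (u, \<zeta>)" by (cases X)
  obtain h where h: "u \<in> V" "\<zeta> \<in> K" "h \<in> L2 \<Omega>" "\<And>v. v \<in> V \<Longrightarrow> stress u \<zeta> v = ip_L2 \<Omega> h v" "E_op u - Lambda_op \<zeta> \<in> K"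
    using X unfolding Xe DA_iff by blast
  have "E_op (c *\<^sub>R u) - Lambda_op (c *\<^sub>R \<zeta>) = c *\<^sub>R (E_op u - Lambda_op \<zeta>)"
    by (auto simp: E_op_def Lambda_op_def fun_eq_iff scaleR_fun_def algebra_simps)
  then have "(c *\<^sub>R u, c *\<^sub>R \<zeta>) \<in> DA"
    using h K.scale_in[OF h(5), of c]
    by (intro DA_I[of _ _ "c *\<^sub>R h"]) (auto simp: stress_scale L2.ip_scale_left H10_L2)
  then show "c *\<^sub>R X \<in> DA" unfolding Xe by simp
qed

lemma AA_linear:
  assumes X: "X \<in> DA" and Y: "Y \<in> DA"
  shows "norm_W \<Omega> A1 \<nu> (AA (a *\<^sub>R X + b *\<^sub>R Y) - (a *\<^sub>R AA X + b *\<^sub>R AA Y)) = 0"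
proof -
  obtain u \<zeta> where Xe: "X = (u, \<zeta>)" by (cases X)
  obtain u' \<zeta>' where Ye: "Y = (u', \<zeta>')" by (cases Y)
  have u: "u \<in> V" "\<zeta> \<in> K" "u' \<in> V" "\<zeta>' \<in> K" using X Y by (auto simp: Xe Ye DA_iff)
  have Z: "(a *\<^sub>R u + b *\<^sub>R u', a *\<^sub>R \<zeta> + b *\<^sub>R \<zeta>') \<in> DA"
    using subspace_add[OF subspace_DA subspace_scale[OF subspace_DA X, of a] subspace_scale[OF subspace_DA Y, of b]]
    by (simp add: Xe Ye)
  obtain h where h: "AA (u, \<zeta>) = (h, E_op u - Lambda_op \<zeta>)" "h \<in> L2 \<Omega>"
    "\<And>v. v \<in> V \<Longrightarrow> ip_L2 \<Omega> h v = - stress u \<zeta> v" using AA_spec X Xe by metis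
  obtain h' where h': "AA (u', \<zeta>') = (h', E_op u' - Lambda_op \<zeta>')" "h' \<in> L2 \<Omega>"
    "\<And>v. v \<in> V \<Longrightarrow> ip_L2 \<Omega> h' v = - stress u' \<zeta>' v" using AA_spec Y Ye by metis
  obtain k where k: "AA (a *\<^sub>R u + b *\<^sub>R u', a *\<^sub>R \<zeta> + b *\<^sub>R \<zeta>') =
      (k, E_op (a *\<^sub>R u + b *\<^sub>R u') - Lambda_op (a *\<^sub>R \<zeta> + b *\<^sub>R \<zeta>'))" "k \<in> L2 \<Omega>"
    "\<And>v. v \<in> V \<Longrightarrow> ip_L2 \<Omega> k v = - stress (a *\<^sub>R u + b *\<^sub>R u') (a *\<^sub>R \<zeta> + b *\<^sub>R \<zeta>') v"
    using AA_spec[OF Z] by metis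
  have "E_op (a *\<^sub>R u + b *\<^sub>R u') - Lambda_op (a *\<^sub>R \<zeta> + b *\<^sub>R \<zeta>')
      = a *\<^sub>R (E_op u - Lambda_op \<zeta>) + b *\<^sub>R (E_op u' - Lambda_op \<zeta>')"
    by (auto simp: E_op_def Lambda_op_def fun_eq_iff scaleR_fun_def algebra_simps)
  then have "AA (a *\<^sub>R X + b *\<^sub>R Y) - (a *\<^sub>R AA X + b *\<^sub>R AA Y) = (k - (a *\<^sub>R h + b *\<^sub>R h'), 0)"
    by (simp add: Xe Ye h h' k)
  moreover have "norm_L2 \<Omega> (k - (a *\<^sub>R h + b *\<^sub>R h')) = 0"
  proof (rule L2_orthogonal_V)
    fix v assume v: "v \<in> V"
    show "ip_L2 \<Omega> (k - (a *\<^sub>R h + b *\<^sub>R h')) v = 0"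
      using h h' k u v by (simp add: L2.ip_simps H10_L2 stress_add stress_scale)
  qed (use h h' k in auto)
  ultimately show ?thesis by (simp add: norm_W_Pair_zero)
qed

text \<open>A null element of \<open>\<K>\<close> vanishes \<open>\<nu>\<close>-almost everywhere, and then so does its product with the
  unbounded factor \<open>\<lambda>\<close>.\<close>

lemma Lambda_null:
  assumes "\<zeta> \<in> K" "ip_norm ipK \<zeta> = 0"
  shows "Lambda_op \<zeta> \<in> K" "ip_norm ipK (Lambda_op \<zeta>) = 0"
proof -
  have \<zeta>: "\<zeta> \<in> a1.Lsq \<nu>" using assms by (simp add: K_eq)
  have "AE l in \<nu>. a1.Nip (\<zeta> l) = 0"
    using a1.Lsq_norm_sq(3)[OF \<zeta>] assms(2) by (simp add: ip_norm_def[of ipK])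
  then have AE: "AE l in \<nu>. a1.Nip (l *\<^sub>R \<zeta> l) = 0"
    using AE_space by eventually_elim (use a1.LsqD(3)[OF \<zeta>] in \<open>simp add: a1.N_scale\<close>)
  have sm: "strongly_measurable_in V a1.Nip \<nu> (\<lambda>l. l *\<^sub>R \<zeta> l)"
    using a1.LsqD(1)[OF \<zeta>] by (intro a1.strongly_measurable_scale_fun measurable_nu) auto
  have "integrable \<nu> (\<lambda>l. (a1.Nip (l *\<^sub>R \<zeta> l))\<^sup>2) \<longleftrightarrow> integrable \<nu> (\<lambda>l. 0 :: real)"
    using a1.strongly_measurable_norm[OF sm] AE by (intro integrable_cong_AE) auto
  then have L: "Lambda_op \<zeta> \<in> a1.Lsq \<nu>" using sm by (simp add: square_integrable_in_def Lambda_op_def)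
  then show "Lambda_op \<zeta> \<in> K" by (simp add: K_eq)
  show "ip_norm ipK (Lambda_op \<zeta>) = 0"
    using a1.Lsq_norm_sq(3)[OF L] AE by (simp add: ip_norm_def[of ipK] Lambda_op_def)
qed

lemma V_null:
  assumes "u \<in> L2 \<Omega>" "norm_L2 \<Omega> u = 0"
  shows "u \<in> V" "v \<in> V \<Longrightarrow> a0 u v = 0" "ip_norm ipK (E_op u) = 0"
proof -
  show u: "u \<in> V" using assms by (rule H10_null)
  have H: "norm_H1 \<Omega> u = 0" using H1_null(2)[OF assms] .
  show "a0 u v = 0" if "v \<in> V" using a0_bounded u that H by fastforce
  have "a1 u u = 0" using a1_bounded u H by fastforce
  then show "ip_norm ipK (E_op u) = 0" by (simp add: ip_norm_def E_op_def)
qed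

text \<open>The operator is defined on representatives; this lemma shows that it induces one on classes:
  its domain is saturated and it maps null elements to null elements.\<close>

lemma null_in_DA:
  assumes X: "X \<in> W" "norm_W \<Omega> A1 \<nu> X = 0"
  shows "X \<in> DA" "norm_W \<Omega> A1 \<nu> (AA X) = 0"
proof -
  obtain u \<zeta> where Xe: "X = (u, \<zeta>)" by (cases X)
  have u: "u \<in> L2 \<Omega>" "norm_L2 \<Omega> u = 0" and \<zeta>: "\<zeta> \<in> K" "ip_norm ipK \<zeta> = 0"
    using X norm_W_null_iff[of u \<zeta>] by (auto simp: Xe W_iff)
  have stress0: "stress u \<zeta> v = 0" if v: "v \<in> V" for v
    using V_null(2)[OF u v] K.ip_null_left[OF \<zeta>(1) E_in_K[OF v] \<zeta>(2)] by (simp add: stress_def)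
  have EK: "E_op u \<in> K" using V_null(1)[OF u] by (rule E_in_K)
  have D: "E_op u - Lambda_op \<zeta> \<in> K" using EK Lambda_null(1)[OF \<zeta>] by (rule K.diff_in)
  have "stress u \<zeta> v = ip_L2 \<Omega> 0 v" if "v \<in> V" for v
    using stress0[OF that] L2.ip_zero_left[OF H10_L2[OF that]] by simp
  then have DA: "(u, \<zeta>) \<in> DA" using V_null(1)[OF u] \<zeta>(1) D by (intro DA_I[of _ _ 0]) auto
  then show "X \<in> DA" by (simp add: Xe)
  obtain h where h: "AA (u, \<zeta>) = (h, E_op u - Lambda_op \<zeta>)" "h \<in> L2 \<Omega>"
    "\<And>v. v \<in> V \<Longrightarrow> ip_L2 \<Omega> h v = - stress u \<zeta> v" using AA_spec[OF DA] by metis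
  have "norm_L2 \<Omega> h = 0" using h stress0 by (intro L2_orthogonal_V) auto
  moreover have "ip_norm ipK (E_op u - Lambda_op \<zeta>) = 0"
    using K.N_diff_le[OF EK Lambda_null(1)[OF \<zeta>]] V_null(3)[OF u] Lambda_null(2)[OF \<zeta>] K.N_nonneg[OF D]
    by simp
  ultimately show "norm_W \<Omega> A1 \<nu> (AA X) = 0"
    using norm_W_null_iff[of h "E_op u - Lambda_op \<zeta>"] h D by (simp add: Xe W_iff)
qed

lemma DA_saturated:
  assumes "X \<in> DA" "Y \<in> W" "norm_W \<Omega> A1 \<nu> (X - Y) = 0"
  shows "Y \<in> DA"
proof -
  have "X - Y \<in> DA" using DA_W[OF assms(1)] assms by (intro null_in_DA(1)) auto
  then have "X - (X - Y) \<in> DA" by (rule subspace_diff[OF subspace_DA assms(1)])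
  then show ?thesis by simp
qed

text \<open>In the energy identity the contributions of \<open>\<A>\<^sub>1 J\<close> and \<open>E\<close> cancel, because \<open>J\<close> is the adjoint
  of \<open>E\<close>.\<close>

lemma energy_identity:
  assumes X: "(u, \<zeta>) \<in> DA"
  shows "integrable \<nu> (\<lambda>l. l * a1 (\<zeta> l) (\<zeta> l))"
    and "ip_W \<Omega> A1 \<nu> (AA (u, \<zeta>)) (u, \<zeta>) = - a0 u u - (LINT l|\<nu>. l * a1 (\<zeta> l) (\<zeta> l))"
    and "- a0 u u - (LINT l|\<nu>. l * a1 (\<zeta> l) (\<zeta> l)) \<le> 0"
proof -
  have u: "u \<in> V" and \<zeta>: "\<zeta> \<in> K" and D: "E_op u - Lambda_op \<zeta> \<in> K" using X by (auto simp: DA_iff)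
  have EK: "E_op u \<in> K" using u by (rule E_in_K)
  have "E_op u - (E_op u - Lambda_op \<zeta>) \<in> K" using EK D by (rule K.diff_in)
  then have LK: "Lambda_op \<zeta> \<in> K" by simp
  have \<zeta>V: "\<zeta> l \<in> V" if "l \<in> space \<nu>" for l using K_in_V[OF \<zeta>] that by (simp add: space_nu)
  have eq: "a1 (Lambda_op \<zeta> l) (\<zeta> l) = l * a1 (\<zeta> l) (\<zeta> l)" if "l \<in> space \<nu>" for l
    unfolding Lambda_op_def using \<zeta>V[OF that] by (simp add: a1.ip_scale_left)
  have "integrable \<nu> (\<lambda>l. a1 (Lambda_op \<zeta> l) (\<zeta> l)) \<longleftrightarrow> integrable \<nu> (\<lambda>l. l * a1 (\<zeta> l) (\<zeta> l))"
    by (rule Bochner_Integration.integrable_cong[OF refl eq])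
  then show "integrable \<nu> (\<lambda>l. l * a1 (\<zeta> l) (\<zeta> l))"
    using a1.integrable_ip[of "Lambda_op \<zeta>" \<nu> \<zeta>] LK \<zeta> by (simp add: K_eq)
  have ipL: "ipK (Lambda_op \<zeta>) \<zeta> = (LINT l|\<nu>. l * a1 (\<zeta> l) (\<zeta> l))"
    by (rule Bochner_Integration.integral_cong[OF refl eq])
  obtain h where h: "AA (u, \<zeta>) = (h, E_op u - Lambda_op \<zeta>)" "h \<in> L2 \<Omega>"
    "\<And>v. v \<in> V \<Longrightarrow> ip_L2 \<Omega> h v = - stress u \<zeta> v" using AA_spec[OF X] by metis
  have "ip_W \<Omega> A1 \<nu> (AA (u, \<zeta>)) (u, \<zeta>) = - stress u \<zeta> u + ipK (E_op u - Lambda_op \<zeta>) \<zeta>"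
    using h u by (simp add: ip_W_def)
  also have "ipK (E_op u - Lambda_op \<zeta>) \<zeta> = ipK (E_op u) \<zeta> - ipK (Lambda_op \<zeta>) \<zeta>"
    using EK LK \<zeta> by (rule K.ip_diff_left)
  also have "ipK (E_op u) \<zeta> = ipK \<zeta> (E_op u)" using EK \<zeta> by (rule K.ip_commute)
  finally show "ip_W \<Omega> A1 \<nu> (AA (u, \<zeta>)) (u, \<zeta>) = - a0 u u - (LINT l|\<nu>. l * a1 (\<zeta> l) (\<zeta> l))"
    unfolding ipL stress_def by simp
  have "0 \<le> (LINT l|\<nu>. l * a1 (\<zeta> l) (\<zeta> l))"
    using \<zeta>V a1.ip_nonneg by (intro Bochner_Integration.integral_nonneg mult_nonneg_nonneg) (auto simp: space_nu)
  then show "- a0 u u - (LINT l|\<nu>. l * a1 (\<zeta> l) (\<zeta> l)) \<le> 0" using a0.ip_nonneg[OF u] by simp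
qed

text \<open>The form is an inner product on \<open>V\<close> whose norm is equivalent to the energy norm of \<open>a1\<close>; the lower
  bound comes from the third summand.\<close>

lemma resolvent_form:
  assumes "\<tau> > 0" "\<kappa> > 0"
  defines "b \<equiv> \<lambda>u v. ip_L2 \<Omega> u v + \<tau> * a0 u v + \<tau>\<^sup>2 * \<kappa> * a1 u v"
  shows "semi_inner_space V b" "complete_in V (ip_norm b)"
    "\<And>v. v \<in> V \<Longrightarrow> a1.Nip v \<le> (1 / sqrt (\<tau>\<^sup>2 * \<kappa>)) * ip_norm b v"
proof -
  have \<tau>\<kappa>: "\<tau>\<^sup>2 * \<kappa> > 0" using assms by simp
  show b: "semi_inner_space V b"
  proof
    show "b x y = b y x" if "x \<in> V" "y \<in> V" for x y
      using that L2.ip_commute[OF H10_L2 H10_L2, of x y] a0.ip_commute[of x y] a1.ip_commute[of x y]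
      by (simp add: b_def)
    show "0 \<le> b x x" if "x \<in> V" for x
      using that assms L2.ip_nonneg[OF H10_L2] a0.ip_nonneg a1.ip_nonneg by (simp add: b_def)
  qed (auto simp: b_def subspace_H10 L2.ip_add_left L2.ip_scale_left H10_L2 a0.ip_add_left a0.ip_scale_left
      a1.ip_add_left a1.ip_scale_left algebra_simps)
  interpret b: semi_inner_space V b by (rule b)
  show lower: "a1.Nip v \<le> (1 / sqrt (\<tau>\<^sup>2 * \<kappa>)) * ip_norm b v" if v: "v \<in> V" for v
  proof -
    have "\<tau>\<^sup>2 * \<kappa> * a1 v v \<le> b v v"
      using v assms L2.ip_nonneg[OF H10_L2[OF v]] a0.ip_nonneg[OF v] by (simp add: b_def)
    then have "sqrt (\<tau>\<^sup>2 * \<kappa> * a1 v v) \<le> ip_norm b v" unfolding ip_norm_def by (rule real_sqrt_le_mono)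
    then have "sqrt (\<tau>\<^sup>2 * \<kappa>) * a1.Nip v \<le> ip_norm b v" by (simp add: ip_norm_def[of a1] real_sqrt_mult)
    then show ?thesis using \<tau>\<kappa> by (simp add: field_simps)
  qed
  obtain c where c: "c \<ge> 0" "\<And>v. v \<in> V \<Longrightarrow> norm_H1 \<Omega> v \<le> c * a1.Nip v" using H1_le_a1 by blast
  obtain c0 where c0: "\<And>v. v \<in> V \<Longrightarrow> \<bar>a0 v v\<bar> \<le> c0 * norm_H1 \<Omega> v * norm_H1 \<Omega> v" using a0_bounded by blast
  define d where "d = c\<^sup>2 + \<tau> * (\<bar>c0\<bar> * c\<^sup>2) + \<tau>\<^sup>2 * \<kappa>"
  have d0: "d \<ge> 0" unfolding d_def using assms by simp
  have upper: "ip_norm b v \<le> sqrt d * a1.Nip v" if v: "v \<in> V" for v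
  proof -
    have H: "(norm_H1 \<Omega> v)\<^sup>2 \<le> c\<^sup>2 * a1 v v"
      using power_mono[OF c(2)[OF v] H10.N_nonneg[OF v], of 2] v by (simp add: power_mult_distrib a1.Nip_sq)
    have "ip_L2 \<Omega> v v \<le> (norm_H1 \<Omega> v)\<^sup>2"
      using power_mono[OF norm_L2_le_H1 norm_L2_nonneg, of v 2] by (simp add: norm_L2_sq)
    then have 1: "ip_L2 \<Omega> v v \<le> c\<^sup>2 * a1 v v" using H by simp
    have "a0 v v \<le> \<bar>c0\<bar> * (norm_H1 \<Omega> v)\<^sup>2"
      using c0[OF v] mult_right_mono[OF abs_ge_self[of c0], of "(norm_H1 \<Omega> v)\<^sup>2"]
      by (simp add: power2_eq_square mult.assoc)
    also have "\<dots> \<le> \<bar>c0\<bar> * (c\<^sup>2 * a1 v v)" using H by (intro mult_left_mono) auto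
    finally have "\<tau> * a0 v v \<le> \<tau> * (\<bar>c0\<bar> * (c\<^sup>2 * a1 v v))" using assms(1) by simp
    then have "b v v \<le> d * a1 v v" using 1 unfolding b_def d_def by (simp add: algebra_simps)
    from real_sqrt_le_mono[OF this] show ?thesis by (simp add: ip_norm_def real_sqrt_mult)
  qed
  show "complete_in V (ip_norm b)"
    using complete_in_a1 subspace_H10 lower upper b.N_nonneg by (rule complete_in_equivalent)
qed

text \<open>The resolvent equation.  Its second component gives \<open>\<zeta>(\<lambda>) = (\<xi>(\<lambda>) + \<tau> u) / (1 + \<tau> \<lambda>)\<close>;
  inserted into the first one, this leaves a variational problem for \<open>u\<close> with the inner product
  \<open>(u, v)\<^sub>H + \<tau> a0(u, v) + \<tau>\<^sup>2 \<kappa> a1(u, v)\<close>, where \<open>\<kappa> = \<integral> (1 + \<tau> \<lambda>)\<^sup>-\<^sup>1 d\<nu> > 0\<close>.\<close>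

lemma range_condition:
  assumes \<tau>: "\<tau> > 0" and Y: "Y \<in> W"
  shows "\<exists>X\<in>DA. norm_W \<Omega> A1 \<nu> ((X - \<tau> *\<^sub>R AA X) - Y) = 0"
proof -
  obtain g \<xi> where Ye: "Y = (g, \<xi>)" by (cases Y)
  have g: "g \<in> L2 \<Omega>" and \<xi>: "\<xi> \<in> K" using Y by (auto simp: Ye W_iff)
  define w :: "real \<Rightarrow> real" where "w = (\<lambda>l. 1 / (1 + \<tau> * l))"
  have w: "0 < w l" "\<bar>w l\<bar> \<le> 1" if "l \<in> space \<nu>" for l
  proof -
    have "1 + \<tau> * l \<ge> 1" using that \<tau> by (simp add: space_nu)
    then show "0 < w l" "\<bar>w l\<bar> \<le> 1" unfolding w_def by (auto simp: field_simps)
  qed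
  have w_meas: "w \<in> borel_measurable \<nu>" unfolding w_def by (intro measurable_nu) measurable
  have w_int: "integrable \<nu> w" using w w_meas by (intro nu.integrable_const_bound[of _ 1]) auto
  define \<kappa> where "\<kappa> = (LINT l|\<nu>. w l)"
  have \<kappa>: "\<kappa> > 0"
  proof -
    have "\<kappa> \<ge> 0" unfolding \<kappa>_def using w by (intro Bochner_Integration.integral_nonneg) (auto intro: less_imp_le)
    moreover have "\<kappa> \<noteq> 0"
    proof
      assume "\<kappa> = 0"
      then have "AE l in \<nu>. w l = 0"
        using integral_nonneg_eq_0_iff_AE[OF w_int] w unfolding \<kappa>_def by (auto intro: less_imp_le)
      then have "AE l in \<nu>. False" using AE_space by eventually_elim (use w in force)
      then show False using nu(2) by (simp add: eventually_False ae_filter_eq_bot_iff)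
    qed
    ultimately show ?thesis by simp
  qed
  define \<eta> where "\<eta> = (\<lambda>l. w l *\<^sub>R \<xi> l)"
  have \<eta>: "\<eta> \<in> K" unfolding \<eta>_def K_eq using \<xi> w w_meas by (intro a1.Lsq_scale_fun) (auto simp: K_eq)
  define b where "b = (\<lambda>u v. ip_L2 \<Omega> u v + \<tau> * a0 u v + \<tau>\<^sup>2 * \<kappa> * a1 u v)"
  note form = resolvent_form[OF \<tau> \<kappa>, folded b_def]
  interpret b: semi_inner_space V b by (rule form(1))
  define l where "l = (\<lambda>v. ip_L2 \<Omega> g v - \<tau> * ipK \<eta> (E_op v))"
  have E_add: "E_op (x + y) = E_op x + E_op y" and E_scale: "E_op (c *\<^sub>R x) = c *\<^sub>R E_op x"
    for x y :: "real^'n \<Rightarrow> real" and c by (auto simp: E_op_def fun_eq_iff scaleR_fun_def)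
  obtain c where c: "c \<ge> 0" "\<And>v. v \<in> V \<Longrightarrow> norm_H1 \<Omega> v \<le> c * a1.Nip v" using H1_le_a1 by blast
  define m where "m = sqrt (measure \<nu> (space \<nu>))"
  define C where "C = (norm_L2 \<Omega> g * c + \<tau> * (ip_norm ipK \<eta> * m)) * (1 / sqrt (\<tau>\<^sup>2 * \<kappa>))"
  have l_bound: "\<bar>l v\<bar> \<le> C * ip_norm b v" if v: "v \<in> V" for v
  proof -
    have "\<bar>ip_L2 \<Omega> g v\<bar> \<le> norm_L2 \<Omega> g * norm_L2 \<Omega> v"
      using L2.Cauchy_Schwarz[OF g H10_L2[OF v]] by (simp add: norm_L2_eq)
    also have "\<dots> \<le> norm_L2 \<Omega> g * (c * a1.Nip v)"
      using norm_L2_le_H1[of v] c(2)[OF v] norm_L2_nonneg by (intro mult_left_mono) auto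
    finally have 1: "\<bar>ip_L2 \<Omega> g v\<bar> \<le> norm_L2 \<Omega> g * c * a1.Nip v" by simp
    have "\<bar>ipK \<eta> (E_op v)\<bar> \<le> ip_norm ipK \<eta> * ip_norm ipK (E_op v)"
      by (rule K.Cauchy_Schwarz[OF \<eta> E_in_K[OF v]])
    also have "ip_norm ipK (E_op v) = m * a1.Nip v"
      unfolding ip_norm_def[of ipK] ipK_E m_def by (simp add: ip_norm_def real_sqrt_mult)
    finally have 2: "\<tau> * \<bar>ipK \<eta> (E_op v)\<bar> \<le> \<tau> * (ip_norm ipK \<eta> * (m * a1.Nip v))"
      using \<tau> by simp
    have "\<bar>l v\<bar> \<le> \<bar>ip_L2 \<Omega> g v\<bar> + \<tau> * \<bar>ipK \<eta> (E_op v)\<bar>"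
      unfolding l_def using abs_triangle_ineq4[of "ip_L2 \<Omega> g v" "\<tau> * ipK \<eta> (E_op v)"] \<tau> by (simp add: abs_mult)
    also have "\<dots> \<le> (norm_L2 \<Omega> g * c + \<tau> * (ip_norm ipK \<eta> * m)) * a1.Nip v"
      using 1 2 by (simp add: algebra_simps)
    also have "\<dots> \<le> (norm_L2 \<Omega> g * c + \<tau> * (ip_norm ipK \<eta> * m)) * ((1 / sqrt (\<tau>\<^sup>2 * \<kappa>)) * ip_norm b v)"
      using form(3)[OF v] c(1) \<tau> norm_L2_nonneg[of g] K.N_nonneg[OF \<eta>]
      by (intro mult_left_mono) (auto simp: m_def)
    finally show ?thesis unfolding C_def by (simp only: mult.assoc)
  qed
  obtain u where u: "u \<in> V" "\<And>v. v \<in> V \<Longrightarrow> b u v = l v"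
  proof (rule b.Riesz_representation[OF form(2)])
    show "l (x + y) = l x + l y" if "x \<in> V" "y \<in> V" for x y
      unfolding l_def E_add using that g \<eta> K.ip_add_right[OF E_in_K E_in_K \<eta>, of x y]
      by (simp add: L2.ip_add_right H10_L2 algebra_simps)
    show "l (a *\<^sub>R x) = a * l x" if "x \<in> V" for x a
      unfolding l_def E_scale using that g \<eta> K.ip_scale_right[OF E_in_K \<eta>, of x a]
      by (simp add: L2.ip_scale_right H10_L2 algebra_simps)
    show "\<bar>l x\<bar> \<le> C * ip_norm b x" if "x \<in> V" for x using that by (rule l_bound)
  qed (use that in blast)
  define \<omega> where "\<omega> = (\<lambda>l. w l *\<^sub>R E_op u l)"
  have \<omega>: "\<omega> \<in> K" unfolding \<omega>_def K_eq using E_in_K[OF u(1)] w w_meas by (intro a1.Lsq_scale_fun) (auto simp: K_eq)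
  define \<zeta> where "\<zeta> = \<eta> + \<tau> *\<^sub>R \<omega>"
  have \<zeta>: "\<zeta> \<in> K" unfolding \<zeta>_def using \<eta> \<omega> by blast
  have ip_\<zeta>: "ipK \<zeta> (E_op v) = ipK \<eta> (E_op v) + \<tau> * (\<kappa> * a1 u v)" if v: "v \<in> V" for v
  proof -
    have "ipK \<omega> (E_op v) = (LINT l|\<nu>. w l * a1 u v)"
      unfolding \<omega>_def E_op_def using u(1) v by (simp add: a1.ip_scale_left)
    also have "\<dots> = \<kappa> * a1 u v" unfolding \<kappa>_def by simp
    finally have "ipK \<omega> (E_op v) = \<kappa> * a1 u v" .
    then show ?thesis unfolding \<zeta>_def
      using K.ip_add_left[OF \<eta> K.scale_in[OF \<omega>] E_in_K[OF v], of \<tau>] K.ip_scale_left[OF \<omega> E_in_K[OF v], of \<tau>] by simp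
  qed
  have \<zeta>_eq: "\<zeta> l = w l *\<^sub>R (\<xi> l + \<tau> *\<^sub>R u)" for l
    unfolding \<zeta>_def \<eta>_def \<omega>_def E_op_def by (auto simp: scaleR_fun_def fun_eq_iff algebra_simps)
  \<comment> \<open>The second component of the resolvent equation holds pointwise on the half-line, hence exactly.\<close>
  have second: "u - l *\<^sub>R \<zeta> l = (1 / \<tau>) *\<^sub>R (\<zeta> l - \<xi> l)" if "l \<ge> 0" for l
  proof -
    have nz: "1 + \<tau> * l \<noteq> 0" using that \<tau> by (simp add: add_nonneg_eq_0_iff)
    have "(1 + \<tau> * l) *\<^sub>R \<zeta> l = \<xi> l + \<tau> *\<^sub>R u" unfolding \<zeta>_eq w_def using nz by simp
    then have "\<zeta> l - \<xi> l = \<tau> *\<^sub>R (u - l *\<^sub>R \<zeta> l)" by (simp add: algebra_simps)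
    then show ?thesis using \<tau> by simp
  qed
  have "(1 / \<tau>) *\<^sub>R (\<zeta> - \<xi>) \<in> K" using \<zeta> \<xi> by blast
  then have D: "E_op u - Lambda_op \<zeta> \<in> K"
    by (rule K_cong[THEN iffD1, rotated]) (simp add: second E_op_def Lambda_op_def scaleR_fun_def[of "1/\<tau>" "\<zeta> - \<xi>"])
  have stress: "ip_L2 \<Omega> u v + \<tau> * stress u \<zeta> v = ip_L2 \<Omega> g v" if v: "v \<in> V" for v
    using u(2)[OF v] unfolding b_def l_def stress_def ip_\<zeta>[OF v] by (simp add: algebra_simps power2_eq_square)
  have DA: "(u, \<zeta>) \<in> DA"
  proof (rule DA_I[OF u(1) \<zeta> _ _ D])
    show "(1 / \<tau>) *\<^sub>R (g - u) \<in> L2 \<Omega>" using g H10_L2[OF u(1)] by blast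
    fix v assume v: "v \<in> V"
    have "ip_L2 \<Omega> ((1 / \<tau>) *\<^sub>R (g - u)) v = (1 / \<tau>) * (ip_L2 \<Omega> g v - ip_L2 \<Omega> u v)"
      using g H10_L2[OF u(1)] H10_L2[OF v] by (simp add: L2.ip_scale_left L2.ip_diff_left)
    also have "\<dots> = stress u \<zeta> v" using stress[OF v] \<tau> by (simp add: field_simps)
    finally show "stress u \<zeta> v = ip_L2 \<Omega> ((1 / \<tau>) *\<^sub>R (g - u)) v" by simp
  qed
  obtain h where h: "AA (u, \<zeta>) = (h, E_op u - Lambda_op \<zeta>)" "h \<in> L2 \<Omega>"
    "\<And>v. v \<in> V \<Longrightarrow> ip_L2 \<Omega> h v = - stress u \<zeta> v" using AA_spec[OF DA] by metis
  define R where "R = \<zeta> - \<tau> *\<^sub>R (E_op u - Lambda_op \<zeta>) - \<xi>"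
  have R: "R \<in> K" unfolding R_def using \<zeta> D \<xi> by blast
  have "R l = 0" if "l \<ge> 0" for l
    using second[OF that] \<tau> unfolding R_def by (simp add: E_op_def Lambda_op_def scaleR_fun_def[of \<tau> "\<lambda>l. u - l *\<^sub>R \<zeta> l"] fun_diff_def[of "\<lambda>l. u"])
  then have "ipK R R = ipK 0 0"
    by (intro Bochner_Integration.integral_cong refl) (simp add: space_nu)
  then have "ip_norm ipK R = 0" using K.ip_zero_left[OF K.zero_in] by (simp add: ip_norm_def)
  moreover have "norm_L2 \<Omega> (u - \<tau> *\<^sub>R h - g) = 0"
  proof (rule L2_orthogonal_V)
    show "u - \<tau> *\<^sub>R h - g \<in> L2 \<Omega>" using H10_L2[OF u(1)] h g by blast
    fix v assume v: "v \<in> V"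
    show "ip_L2 \<Omega> (u - \<tau> *\<^sub>R h - g) v = 0"
      using stress[OF v] h(2) h(3)[OF v] g H10_L2[OF u(1)] H10_L2[OF v] by (simp add: L2.ip_simps)
  qed
  moreover have "((u, \<zeta>) - \<tau> *\<^sub>R AA (u, \<zeta>)) - Y = (u - \<tau> *\<^sub>R h - g, R)"
    by (simp add: h(1) Ye R_def)
  moreover have "(u - \<tau> *\<^sub>R h - g, R) \<in> W"
    using H10_L2[OF u(1)] h(2) g R by (auto simp: W_iff)
  ultimately have "norm_W \<Omega> A1 \<nu> (((u, \<zeta>) - \<tau> *\<^sub>R AA (u, \<zeta>)) - Y) = 0"
    by (simp only: norm_W_null_iff)
  then show ?thesis using DA by (rule bexI)
qed

lemma AA_dissipative: "X \<in> DA \<Longrightarrow> ip_W \<Omega> A1 \<nu> (AA X) X \<le> 0"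
  using energy_identity(2,3) by (cases X) fastforce

lemma range_AA: "range_I_minus W (norm_W \<Omega> A1 \<nu>) DA AA = W"
  using range_condition[of 1] unfolding range_I_minus_def by fastforce

lemma dense_DA: "dense_subset_in W (norm_W \<Omega> A1 \<nu>) DA"
proof (rule W.dissipative_range_imp_dense[OF complete_in_W subspace_DA])
  show "\<exists>x\<in>DA. norm_W \<Omega> A1 \<nu> (x - AA x - y) = 0" if "y \<in> W" for y
    using range_condition[OF zero_less_one that] by simp
qed (use DA_W AA_W null_in_DA AA_dissipative in auto)

lemma m_dissipative_AA: "m_dissipative_in W (ip_W \<Omega> A1 \<nu>) DA AA"
  unfolding m_dissipative_in_def norm_W_def[symmetric, abs_def]
  using range_AA DA_W AA_W AA_dissipative by auto

lemma generation:
  "\<exists>S. contraction_semigroup_in W (norm_W \<Omega> A1 \<nu>) S \<and> generates_in W (norm_W \<Omega> A1 \<nu>) DA AA S"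
proof (rule W.Lumer_Phillips[OF complete_in_W subspace_DA])
  show "y \<in> DA" if "x \<in> DA" "y \<in> W" "norm_W \<Omega> A1 \<nu> (x - y) = 0" for x y
    using that by (rule DA_saturated)
  show "norm_W \<Omega> A1 \<nu> (AA (a *\<^sub>R x + b *\<^sub>R y) - (a *\<^sub>R AA x + b *\<^sub>R AA y)) = 0"
    if "x \<in> DA" "y \<in> DA" for x y a b using that by (rule AA_linear)
  show "\<exists>x\<in>DA. norm_W \<Omega> A1 \<nu> (x - \<tau> *\<^sub>R AA x - y) = 0" if "\<tau> > 0" "y \<in> W" for \<tau> y
    using that by (rule range_condition)
qed (use DA_W AA_W null_in_DA AA_dissipative in auto)

section \<open>The Cauchy problem\<close>

lemma forcing_integrable:
  assumes "f \<in> L1_H \<Omega> T"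
  shows "bochner_integrable_in W (norm_W \<Omega> A1 \<nu>) (lebesgue_on {0..T}) (\<lambda>s. (f s, 0))"
proof -
  have f: "strongly_measurable_in (L2 \<Omega>) (norm_L2 \<Omega>) (lebesgue_on {0..T}) f"
    "integrable (lebesgue_on {0..T}) (\<lambda>s. norm_L2 \<Omega> (f s))"
    using assms unfolding L1_H_def bochner_integrable_in_def by auto
  have "strongly_measurable_in W (norm_W \<Omega> A1 \<nu>) (lebesgue_on {0..T}) (\<lambda>s. (\<lambda>u. (u, 0)) (f s))"
  proof (rule L2.strongly_measurable_compose[where L="\<lambda>u. (u, 0)" and c=1])
    show "strongly_measurable_in (L2 \<Omega>) (ip_norm (ip_L2 \<Omega>)) (lebesgue_on {0..T}) f"
      using f(1) by (simp add: norm_L2_eq)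
  qed (auto simp: W_iff norm_W_Pair_zero norm_L2_nonneg norm_L2_eq)
  then show ?thesis using f(2) unfolding bochner_integrable_in_def by (simp add: norm_W_Pair_zero)
qed

end

theorem theorem3p2:
  fixes \<Omega> :: "(real^'n) set"
    and A0 A1 :: "real^'n \<Rightarrow> real^'n^'n"
    and \<nu> :: "real measure"
    and T \<beta> :: real
  assumes dim: "CARD('n) \<in> {1, 2, 3}"
    and domain: "bounded \<Omega>" "lipschitz_domain \<Omega>"
    and T: "T > 0"
    and A0: "Linfty_matrix \<Omega> A0" "AE x in lebesgue_on \<Omega>. transpose (A0 x) = A0 x"
    and A1: "Linfty_matrix \<Omega> A1" "AE x in lebesgue_on \<Omega>. transpose (A1 x) = A1 x"
      "AE x in lebesgue_on \<Omega>. \<forall>\<xi>. 0 \<le> (A1 x *v \<xi>) \<bullet> \<xi>"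
    and nu: "sets \<nu> = sets (restrict_space borel {0..})"
      "0 < emeasure \<nu> (space \<nu>)" "emeasure \<nu> (space \<nu>) < \<infinity>"
    and a0_bounded: "\<exists>c. \<forall>w\<in>H10 \<Omega>. \<forall>v\<in>H10 \<Omega>. \<bar>aform \<Omega> A0 w v\<bar> \<le> c * norm_H1 \<Omega> w * norm_H1 \<Omega> v"
    and a1_bounded: "\<exists>c. \<forall>w\<in>H10 \<Omega>. \<forall>v\<in>H10 \<Omega>. \<bar>aform \<Omega> A1 w v\<bar> \<le> c * norm_H1 \<Omega> w * norm_H1 \<Omega> v"
    and a0_nonneg: "\<forall>v\<in>H10 \<Omega>. 0 \<le> aform \<Omega> A0 v v"
    and a1_coercive: "\<beta> > 0" "\<forall>v\<in>H10 \<Omega>. \<beta> * (seminorm_H1 \<Omega> v)\<^sup>2 \<le> aform \<Omega> A1 v v"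
  shows
    "dense_subset_in (W_space \<Omega> A1 \<nu>) (norm_W \<Omega> A1 \<nu>) (aug_domain \<Omega> A0 A1 \<nu>) \<and>
     m_dissipative_in (W_space \<Omega> A1 \<nu>) (ip_W \<Omega> A1 \<nu>) (aug_domain \<Omega> A0 A1 \<nu>) (aug_op \<Omega> A0 A1 \<nu>) \<and>
     (\<forall>(u, \<zeta>) \<in> aug_domain \<Omega> A0 A1 \<nu>.
        integrable \<nu> (\<lambda>l. l * aform \<Omega> A1 (\<zeta> l) (\<zeta> l)) \<and>
        ip_W \<Omega> A1 \<nu> (aug_op \<Omega> A0 A1 \<nu> (u, \<zeta>)) (u, \<zeta>) =
          - aform \<Omega> A0 u u - (LINT l|\<nu>. l * aform \<Omega> A1 (\<zeta> l) (\<zeta> l)) \<and>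
        - aform \<Omega> A0 u u - (LINT l|\<nu>. l * aform \<Omega> A1 (\<zeta> l) (\<zeta> l)) \<le> 0) \<and>
     range_I_minus (W_space \<Omega> A1 \<nu>) (norm_W \<Omega> A1 \<nu>)
       (aug_domain \<Omega> A0 A1 \<nu>) (aug_op \<Omega> A0 A1 \<nu>) = W_space \<Omega> A1 \<nu> \<and>
     (\<exists>S. contraction_semigroup_in (W_space \<Omega> A1 \<nu>) (norm_W \<Omega> A1 \<nu>) S \<and>
          generates_in (W_space \<Omega> A1 \<nu>) (norm_W \<Omega> A1 \<nu>)
            (aug_domain \<Omega> A0 A1 \<nu>) (aug_op \<Omega> A0 A1 \<nu>) S) \<and>
     (\<forall>S. contraction_semigroup_in (W_space \<Omega> A1 \<nu>) (norm_W \<Omega> A1 \<nu>) S \<longrightarrow>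
          generates_in (W_space \<Omega> A1 \<nu>) (norm_W \<Omega> A1 \<nu>)
            (aug_domain \<Omega> A0 A1 \<nu>) (aug_op \<Omega> A0 A1 \<nu>) S \<longrightarrow>
        (\<forall>u0 \<in> L2 \<Omega>. \<forall>f \<in> L1_H \<Omega> T.
           (\<exists>X. mild_sol \<Omega> A1 \<nu> T S u0 f X) \<and>
           (\<forall>X Y. mild_sol \<Omega> A1 \<nu> T S u0 f X \<longrightarrow> mild_sol \<Omega> A1 \<nu> T S u0 f Y \<longrightarrow>
              (\<forall>t\<in>{0..T}. norm_W \<Omega> A1 \<nu> (X t - Y t) = 0)) \<and>
           (\<forall>X. mild_sol \<Omega> A1 \<nu> T S u0 f X \<longrightarrow>
              continuous_curve_in (W_space \<Omega> A1 \<nu>) (norm_W \<Omega> A1 \<nu>) T X \<and>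
              (\<forall>t\<in>{0..T}. norm_W \<Omega> A1 \<nu> (X t) \<le>
                 norm_L2 \<Omega> u0 + (LINT s|lebesgue_on {0..t}. norm_L2 \<Omega> (f s))))) \<and>
        (\<exists>L\<ge>0. \<forall>u0\<in>L2 \<Omega>. \<forall>v0\<in>L2 \<Omega>. \<forall>f\<in>L1_H \<Omega> T. \<forall>g\<in>L1_H \<Omega> T. \<forall>X Y.
           mild_sol \<Omega> A1 \<nu> T S u0 f X \<longrightarrow> mild_sol \<Omega> A1 \<nu> T S v0 g Y \<longrightarrow>
           (SUP t\<in>{0..T}. norm_W \<Omega> A1 \<nu> (X t - Y t)) \<le>
             L * (norm_L2 \<Omega> (u0 - v0) + (LINT s|lebesgue_on {0..T}. norm_L2 \<Omega> (f s - g s)))))"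
proof -
  have "open \<Omega>" using domain(2) unfolding lipschitz_domain_def by blast
  interpret memory_problem \<Omega> A0 A1 \<nu> \<beta>
    by unfold_locales (fact \<open>open \<Omega>\<close> domain(1) A0 A1(1,2) nu a0_bounded a1_bounded a0_nonneg a1_coercive)+
  have energy: "\<forall>(u, \<zeta>) \<in> DA. integrable \<nu> (\<lambda>l. l * a1 (\<zeta> l) (\<zeta> l)) \<and>
      ip_W \<Omega> A1 \<nu> (AA (u, \<zeta>)) (u, \<zeta>) = - a0 u u - (LINT l|\<nu>. l * a1 (\<zeta> l) (\<zeta> l)) \<and>
      - a0 u u - (LINT l|\<nu>. l * a1 (\<zeta> l) (\<zeta> l)) \<le> 0"
    using energy_identity by blast
  have Cauchy_problem:
    "(\<forall>u0 \<in> L2 \<Omega>. \<forall>f \<in> L1_H \<Omega> T.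
       (\<exists>X. mild_sol \<Omega> A1 \<nu> T S u0 f X) \<and>
       (\<forall>X Y. mild_sol \<Omega> A1 \<nu> T S u0 f X \<longrightarrow> mild_sol \<Omega> A1 \<nu> T S u0 f Y \<longrightarrow>
          (\<forall>t\<in>{0..T}. norm_W \<Omega> A1 \<nu> (X t - Y t) = 0)) \<and>
       (\<forall>X. mild_sol \<Omega> A1 \<nu> T S u0 f X \<longrightarrow>
          continuous_curve_in W (norm_W \<Omega> A1 \<nu>) T X \<and>
          (\<forall>t\<in>{0..T}. norm_W \<Omega> A1 \<nu> (X t) \<le>
             norm_L2 \<Omega> u0 + (LINT s|lebesgue_on {0..t}. norm_L2 \<Omega> (f s)))))" (is ?wellposed)
    "(\<exists>L\<ge>0. \<forall>u0\<in>L2 \<Omega>. \<forall>v0\<in>L2 \<Omega>. \<forall>f\<in>L1_H \<Omega> T. \<forall>g\<in>L1_H \<Omega> T. \<forall>X Y.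
       mild_sol \<Omega> A1 \<nu> T S u0 f X \<longrightarrow> mild_sol \<Omega> A1 \<nu> T S v0 g Y \<longrightarrow>
       (SUP t\<in>{0..T}. norm_W \<Omega> A1 \<nu> (X t - Y t)) \<le>
         L * (norm_L2 \<Omega> (u0 - v0) + (LINT s|lebesgue_on {0..T}. norm_L2 \<Omega> (f s - g s))))" (is ?lipschitz)
    if S: "contraction_semigroup_in W (norm_W \<Omega> A1 \<nu>) S" for S
  proof -
    interpret S: contraction_semigroup W "norm_W \<Omega> A1 \<nu>" S
      by (intro contraction_semigroup.intro contraction_semigroup_axioms.intro
          W.seminormed_space_axioms complete_in_W S)
    have u0_W: "(u0, 0) \<in> W" if "u0 \<in> L2 \<Omega>" for u0 using that by (simp add: W_iff)
    have diff: "norm_W \<Omega> A1 \<nu> ((u, 0) - (v, 0)) = norm_L2 \<Omega> (u - v)" for u v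
      by (simp add: norm_W_Pair_zero)
    show ?wellposed
    proof (intro ballI conjI allI impI)
      fix u0 f assume u0: "u0 \<in> L2 \<Omega>" and f: "f \<in> L1_H \<Omega> T"
      note F = forcing_integrable[OF f] and x0 = u0_W[OF u0]
      show "\<exists>X. mild_sol \<Omega> A1 \<nu> T S u0 f X"
        unfolding mild_sol_def by (rule S.mild_solution_exists[OF F x0])
      show "norm_W \<Omega> A1 \<nu> (X t - Y t) = 0"
        if "mild_sol \<Omega> A1 \<nu> T S u0 f X" "mild_sol \<Omega> A1 \<nu> T S u0 f Y" "t \<in> {0..T}" for X Y t
        using that unfolding mild_sol_def by (rule S.mild_solution_unique[OF F x0])
      show "continuous_curve_in W (norm_W \<Omega> A1 \<nu>) T X" if "mild_sol \<Omega> A1 \<nu> T S u0 f X" for X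
        using that unfolding mild_sol_def by (rule S.mild_solution_continuous[OF F x0])
      show "norm_W \<Omega> A1 \<nu> (X t) \<le> norm_L2 \<Omega> u0 + (LINT s|lebesgue_on {0..t}. norm_L2 \<Omega> (f s))"
        if "mild_sol \<Omega> A1 \<nu> T S u0 f X" "t \<in> {0..T}" for X t
        using S.mild_solution_bound[OF F x0 that(1)[unfolded mild_sol_def] that(2)] by (simp add: norm_W_Pair_zero)
    qed
    show ?lipschitz
    proof (intro exI[of _ 1] conjI ballI allI impI)
      fix u0 v0 f g X Y
      assume u0: "u0 \<in> L2 \<Omega>" and v0: "v0 \<in> L2 \<Omega>" and f: "f \<in> L1_H \<Omega> T" and g: "g \<in> L1_H \<Omega> T"
        and X: "mild_sol \<Omega> A1 \<nu> T S u0 f X" and Y: "mild_sol \<Omega> A1 \<nu> T S v0 g Y"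
      have int: "integrable (lebesgue_on {0..T}) (\<lambda>s. norm_L2 \<Omega> (f s - g s))"
        using W.bochner_integrable_in_diff[OF forcing_integrable[OF f] forcing_integrable[OF g]]
        unfolding bochner_integrable_in_def diff by blast
      have "norm_W \<Omega> A1 \<nu> (X t - Y t) \<le> norm_L2 \<Omega> (u0 - v0) + (LINT s|lebesgue_on {0..T}. norm_L2 \<Omega> (f s - g s))"
        if t: "t \<in> {0..T}" for t
      proof -
        have upto_t: "norm_W \<Omega> A1 \<nu> (X t - Y t)
            \<le> norm_L2 \<Omega> (u0 - v0) + (LINT s|lebesgue_on {0..t}. norm_L2 \<Omega> (f s - g s))"
          using S.mild_solution_lipschitz[OF forcing_integrable[OF f] u0_W[OF u0] forcing_integrable[OF g]
              u0_W[OF v0] X[unfolded mild_sol_def] Y[unfolded mild_sol_def] t]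
          unfolding diff .
        have "(LINT s|lebesgue_on {0..t}. norm_L2 \<Omega> (f s - g s))
            = (LINT s|lebesgue_on {0..T}. indicator {0..t} s *\<^sub>R norm_L2 \<Omega> (f s - g s))"
        proof (subst S.restrict_lebesgue_on[of t T, symmetric])
          show "t \<le> T" using t by simp
          then show "(LINT s|restrict_space (lebesgue_on {0..T}) {0..t}. norm_L2 \<Omega> (f s - g s))
              = (LINT s|lebesgue_on {0..T}. indicator {0..t} s *\<^sub>R norm_L2 \<Omega> (f s - g s))"
            by (intro integral_restrict_space sets.Int S.interval_sets sets.top)
        qed
        also have "\<dots> \<le> (LINT s|lebesgue_on {0..T}. norm_L2 \<Omega> (f s - g s))"
          using int t S.interval_sets[of t T] norm_L2_nonneg
          by (intro integral_mono integrable_mult_indicator) (auto simp: indicator_def)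
        finally have "(LINT s|lebesgue_on {0..t}. norm_L2 \<Omega> (f s - g s))
            \<le> (LINT s|lebesgue_on {0..T}. norm_L2 \<Omega> (f s - g s))" .
        then show ?thesis by (rule order_trans[OF upto_t add_left_mono])
      qed
      then show "(SUP t\<in>{0..T}. norm_W \<Omega> A1 \<nu> (X t - Y t)) \<le>
          1 * (norm_L2 \<Omega> (u0 - v0) + (LINT s|lebesgue_on {0..T}. norm_L2 \<Omega> (f s - g s)))"
        using T by (intro cSUP_least) auto
    qed simp
  qed
  show ?thesis
    using dense_DA m_dissipative_AA energy range_AA generation Cauchy_problem by (intro conjI allI impI)
qed

end
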